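(* Let $q$ be a prime power and let $\phi$ be a monic polynomial of degree $n$ over $F_{q^2}$ with nonzero constant term which factors into irreducibles as $$\phi=\prod_i\phi_i^{j_i}\prod_{i'}[\phi_{i'}\tilde\phi_{i'}]^{j_{i'}},$$ where $\phi_i=\tilde\phi_i$ and $\phi_{i'}\ne\tilde\phi_{i'}$ (the $\phi_i,\phi_{i'},\tilde\phi_{i'}$ being pairwise distinct monic irreducible polynomials). Then the number of elements of $U(n,q)$ with characteristic polynomial $\phi$ is $$|U(n,q)|\ \prod_i\frac{q^{m_{\phi_i}j_i(j_i-1)}}{|U(j_i,q^{m_{\phi_i}})|}\ \prod_{i'}\frac{q^{2m_{\phi_{i'}}j_{i'}(j_{i'}-1)}}{|GL(j_{i'},q^{2m_{\phi_{i'}}})|}.$$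
   Context: $U(n,q)$ is the subgroup of $GL(n,q^2)$ preserving a non-degenerate skew-linear form, e.g. $\langle\vec x,\vec y\rangle=\sum_{i=1}^nx_iy_i^q$ on $F_{q^2}^n$; $|U(n,q)|=q^{\binom n2}\prod_{i=1}^n(q^i-(-1)^i)$. $m_\phi$ denotes the degree of $\phi$. For a polynomial $\phi$ over $F_{q^2}$ with $\phi(0)\neq0$, $\tilde\phi(z)=z^{m_\phi}\phi^q(1/z)/[\phi(0)]^q$, where $\phi^q$ is obtained from $\phi$ by raising each coefficient to the $q$th power. *)

theory Defs
  imports
    Complex_Main
    "HOL-Library.Cardinality"
    "HOL-Number_Theory.Prime_Powers"
    "HOL-Algebra.Algebraic_Closure_Type"
    "Jordan_Normal_Form.Char_Poly"
begin

text \<open>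
  The groups \<open>GL(n,Q)\<close> and \<open>U(n,q)\<close> are needed over several finite fields at once, namely
  over \<open>F\<^bsub>q^2\<^esub>\<close> and over its extensions of degree \<open>m\<close>. All of them are realised inside an
  ambient field type: if the ambient field contains a field with \<open>Q\<close> elements, then
  that subfield is unique and consists of the solutions of \<open>x^Q = x\<close>. This covers
  a finite field type with \<open>Q\<close> elements (where one gets all of it) as well as the algebraic
  closure of a finite field of characteristic \<open>p\<close> for every \<open>Q = p^k\<close> with \<open>k > 0\<close>.
  For any other \<open>Q\<close> the set below has no meaning.
\<close>

definition GF :: "nat \<Rightarrow> 'a::field set" where
  "GF Q = {x. x ^ Q = x}"

definition vecs :: "nat \<Rightarrow> nat \<Rightarrow> 'a::field vec set" where
  "vecs n Q = {x \<in> carrier_vec n. \<forall>i<n. x $ i \<in> GF Q}"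

definition mats :: "nat \<Rightarrow> nat \<Rightarrow> 'a::field mat set" where
  "mats n Q = {A \<in> carrier_mat n n. elements_mat A \<subseteq> GF Q}"

definition GL_mats :: "nat \<Rightarrow> nat \<Rightarrow> 'a::field mat set" where
  "GL_mats n Q = {A \<in> mats n Q. \<exists>B \<in> mats n Q. inverts_mat A B \<and> inverts_mat B A}"

definition skew_form :: "nat \<Rightarrow> 'a::field vec \<Rightarrow> 'a vec \<Rightarrow> 'a" where
  "skew_form q x y = (\<Sum>i<dim_vec x. x $ i * (y $ i) ^ q)"

text \<open>As usual, \<open>U_mats n q\<close> consists of matrices over the field with \<open>q^2\<close> elements.\<close>

definition U_mats :: "nat \<Rightarrow> nat \<Rightarrow> 'a::field mat set" where
  "U_mats n q = {A \<in> GL_mats n (q^2).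
     \<forall>x \<in> vecs n (q^2). \<forall>y \<in> vecs n (q^2).
       skew_form q (A *\<^sub>v x) (A *\<^sub>v y) = skew_form q x y}"

text \<open>
  \<open>reflect_poly p\<close> is \<open>z^(degree p) p(1/z)\<close>, and raising the coefficients to the \<open>q\<close>-th power
  does not change the degree for \<open>q > 0\<close>. Only meaningful for \<open>coeff \<phi> 0 \<noteq> 0\<close>.
\<close>

definition tilde :: "nat \<Rightarrow> 'a::field poly \<Rightarrow> 'a poly" where
  "tilde q \<phi> = smult (1 / coeff \<phi> 0 ^ q) (reflect_poly (map_poly (\<lambda>c. c ^ q) \<phi>))"

end

theory Submission
  imports Defs "HOL-Number_Theory.Residues"
begin

text \<open>
  Call a polynomial \<^emph>\<open>real\<close> if its coefficients are fixed by \<open>x \<mapsto> x^q\<close>. For \<open>z\<close> of norm one that is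
  no eigenvalue and \<open>c\<close> not real, a Cayley transform turns unitary matrices \<open>A\<close> into Hermitian
  matrices \<open>H\<close>, and the corresponding Moebius substitution turns self-dual polynomials into real
  ones, preserving products and irreducibility. Coprime self-dual factors of the characteristic
  polynomial split the space orthogonally, so it remains to count the number \<open>N j\<close> of Hermitian
  \<open>H\<close> of size \<open>d * j\<close> with characteristic polynomial \<open>F^j\<close>, where \<open>F\<close> is real of degree \<open>d\<close> and
  every monic real divisor of \<open>F^j\<close> is a power of \<open>F\<close>.

  Count the pairs \<open>(H, v)\<close> according to the moments \<open>\<mu> i = \<langle>v, H^i v\<rangle>\<close>, a real sequence annihilated by
  \<open>F^j\<close>, hence with minimal recurrence \<open>F^k\<close> for some \<open>k\<close>. The vectors \<open>H^i v\<close>, \<open>i < d * k\<close>, span a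
  non-degenerate subspace with prescribed Gram matrix; splitting it off shows that the number of
  pairs is \<open>|U(d j)| / |U(d (j - k))|\<close> times the number of pairs of size \<open>d * (j - k)\<close> with zero
  moments. Comparing \<open>\<mu>\<close> with \<open>F\<close> applied to \<open>\<mu>\<close>, over those \<open>\<mu>\<close> with \<open>\<mu> 0 \<noteq> 0\<close>, expresses \<open>N (j + 1)\<close>
  by \<open>N j\<close>. The factors of the theorem satisfy the same recursion in \<open>j\<close>, because \<open>d\<close> is odd for
  irreducible \<open>F\<close> (as the two ways to count \<open>N 1\<close> show) and even for \<open>F\<close> a product of two conjugate
  factors.
\<close>

text \<open>The Gram count alone leaves the number of pairs with zero moments unknown in every size.
  But if \<mu> has order \<open>F^k\<close>, then \<open>F\<close> applied to \<mu> has order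
  \<open>F^(k-1)\<close>, and in sizes \<open>d * (j + 1)\<close> and \<open>d * j\<close> both
  leave the same complement \<open>d * (j + 1 - k)\<close>; the unknown number enters both counts
  alike and is eliminated. The restriction \<open>\<mu> 0 \<noteq> 0\<close> serves twice. It
  excludes the zero sequence, whose order cannot be lowered; and since \<open>\<mu> 0\<close> is the
  norm of \<open>v\<close>, it selects the same vectors for every \<open>H\<close>, so that the
  pairs form a product set. As \<open>\<mu> 0\<close> is one of the \<open>d\<close> free initial
  values, each real sequence annihilated by \<open>F^j\<close> is \<open>F\<close> applied to
  exactly \<open>(q - 1) * q^(d - 1)\<close> such \<mu>. Hermitian matrices are preferred to unitary
  ones because their moments depend on \<open>i + j\<close> alone and form a real linear recurrence.
  The recursion so obtained carries the sign \<open>(-1)^(d * (j + 1))\<close>, the orders of the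
  unitary groups carry \<open>(-1)^(j + 1)\<close>; hence the interest in the parity of
  \<open>d\<close>.\<close>

lemma finite_card_fibers:
  assumes "finite B" and "\<And>b. b \<in> B \<Longrightarrow> finite {a \<in> A. f a = b}" and "f ` A \<subseteq> B"
  shows "card A = (\<Sum>b\<in>B. card {a \<in> A. f a = b})"
proof -
  have "A = (\<Union>b\<in>B. {a \<in> A. f a = b})" using assms(3) by auto
  then have "card A = card (\<Union>b\<in>B. {a \<in> A. f a = b})" by simp
  also have "\<dots> = (\<Sum>b\<in>B. card {a \<in> A. f a = b})"
    by (rule card_UN_disjoint) (use assms in auto)
  finally show ?thesis .
qed

lemma card_constant_fibers:
  assumes "finite B" and "\<And>b. b \<in> B \<Longrightarrow> card {a \<in> A. f a = b} = c" and "f ` A \<subseteq> B"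
    and "finite A"
  shows "card A = c * card B"
  using finite_card_fibers[of B A f] assms by (simp add: mult.commute)

lemma bij_betw_Collect:
  assumes "bij_betw f A B" and "\<And>a. a \<in> A \<Longrightarrow> P a \<longleftrightarrow> Q (f a)"
  shows "bij_betw f {a \<in> A. P a} {b \<in> B. Q b}"
proof (rule bij_betw_imageI)
  show "inj_on f {a \<in> A. P a}" using assms(1) by (auto simp: bij_betw_def inj_on_def)
  show "f ` {a \<in> A. P a} = {b \<in> B. Q b}" using assms unfolding bij_betw_def by auto
qed

lemma card_power_eq_le:
  fixes c :: "'a::field"
  assumes "0 < n"
  shows "finite {x::'a. x ^ n = c}" "card {x::'a. x ^ n = c} \<le> n"
proof -
  let ?p = "monom 1 n - [:c:]"
  have deg: "degree ?p = n" using assms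
    by (intro antisym degree_le le_degree) (auto simp: coeff_pCons split: nat.splits)
  with assms have "?p \<noteq> 0" by auto
  moreover have "{x. x ^ n = c} = {x. poly ?p x = 0}" by (auto simp: poly_monom)
  ultimately show "finite {x::'a. x ^ n = c}" "card {x::'a. x ^ n = c} \<le> n"
    using poly_roots_finite[of ?p] card_poly_roots_bound[of ?p] deg by auto
qed

lemma card_GF_le:
  assumes "1 < n"
  shows "finite (GF n :: 'a::field set)" "card (GF n :: 'a::field set) \<le> n"
proof -
  let ?p = "monom 1 n - [:0, 1:] :: 'a poly"
  have deg: "degree ?p = n" using assms
    by (intro antisym degree_le le_degree) (auto simp: coeff_pCons split: nat.splits)
  with assms have "?p \<noteq> 0" by auto
  moreover have "GF n = {x. poly ?p x = 0}" by (auto simp: poly_monom GF_def)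
  ultimately show "finite (GF n :: 'a::field set)" "card (GF n :: 'a::field set) \<le> n"
    using poly_roots_finite[of ?p] card_poly_roots_bound[of ?p] deg by auto
qed

section \<open>Conjugate transposes and matrices with entries in a finite set\<close>

text \<open>The conjugate transpose. As the ambient field may exceed \<open>GF (q^2)\<close>, this
  is an involution only on matrices with entries in that subfield.\<close>

definition star :: "nat \<Rightarrow> 'a::field mat \<Rightarrow> 'a mat" where
  "star q A = mat (dim_col A) (dim_row A) (\<lambda>(i, j). A $$ (j, i) ^ q)"

lemma star_dim [simp]: "dim_row (star q A) = dim_col A" "dim_col (star q A) = dim_row A"
  by (auto simp: star_def)

lemma star_carrier [simp]: "star q A \<in> carrier_mat n m \<longleftrightarrow> A \<in> carrier_mat m n"
  unfolding carrier_mat_def by auto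

lemma star_index [simp]: "i < dim_col A \<Longrightarrow> j < dim_row A \<Longrightarrow> star q A $$ (i, j) = A $$ (j, i) ^ q"
  by (auto simp: star_def)

lemma star_four_block:
  assumes "A \<in> carrier_mat n1 m1" "B \<in> carrier_mat n1 m2"
    "C \<in> carrier_mat n2 m1" "D \<in> carrier_mat n2 m2"
  shows "star q (four_block_mat A B C D) = four_block_mat (star q A) (star q C) (star q B) (star q D)"
  using assms by (intro eq_matI) auto

lemma star_zero [simp]: "0 < q \<Longrightarrow> star q (0\<^sub>m n m) = 0\<^sub>m m n"
  by (intro eq_matI) auto

lemma star_one [simp]: "0 < q \<Longrightarrow> star q (1\<^sub>m n) = 1\<^sub>m n"
  by (intro eq_matI) (auto simp: power_0_left)

text \<open>Column vectors are \<open>n\<close> by 1 matrices throughout, so that products and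
  adjoints need no separate vector operations.\<close>

definition nrm :: "nat \<Rightarrow> 'a::field mat \<Rightarrow> 'a" where
  "nrm q v = (\<Sum>i<dim_row v. v $$ (i, 0) ^ (q + 1))"

definition mats_on :: "nat \<Rightarrow> nat \<Rightarrow> 'a set \<Rightarrow> 'a mat set" where
  "mats_on r c S = {A \<in> carrier_mat r c. elements_mat A \<subseteq> S}"

lemma mats_onI: "A \<in> carrier_mat r c \<Longrightarrow> (\<And>i j. i < r \<Longrightarrow> j < c \<Longrightarrow> A $$ (i, j) \<in> S) \<Longrightarrow> A \<in> mats_on r c S"
  by (auto simp: mats_on_def elements_mat_def)

lemma mats_onD: "A \<in> mats_on r c S \<Longrightarrow> A \<in> carrier_mat r c"
  "A \<in> mats_on r c S \<Longrightarrow> i < r \<Longrightarrow> j < c \<Longrightarrow> A $$ (i, j) \<in> S"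
proof -
  show "A \<in> mats_on r c S \<Longrightarrow> A \<in> carrier_mat r c" by (simp add: mats_on_def)
  show "A \<in> mats_on r c S \<Longrightarrow> i < r \<Longrightarrow> j < c \<Longrightarrow> A $$ (i, j) \<in> S"
    unfolding mats_on_def by (metis (no_types, lifting) carrier_matD elements_matI mem_Collect_eq subsetD)
qed

lemma bij_betw_mats_on:
  "bij_betw (\<lambda>f. mat r c f) ({..<r} \<times> {..<c} \<rightarrow>\<^sub>E S) (mats_on r c S)"
proof (rule bij_betw_byWitness[where f' = "\<lambda>A. restrict (\<lambda>ij. A $$ ij) ({..<r} \<times> {..<c})"])
  show "\<forall>f\<in>{..<r} \<times> {..<c} \<rightarrow>\<^sub>E S. (\<lambda>ij\<in>{..<r} \<times> {..<c}. mat r c f $$ ij) = f"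
    by (auto simp: fun_eq_iff restrict_def PiE_def extensional_def)
  show "\<forall>A\<in>mats_on r c S. mat r c (\<lambda>ij\<in>{..<r} \<times> {..<c}. A $$ ij) = A"
    by (auto simp: mats_on_def intro!: eq_matI)
  show "(\<lambda>f. mat r c f) ` ({..<r} \<times> {..<c} \<rightarrow>\<^sub>E S) \<subseteq> mats_on r c S"
    by (rule image_subsetI, rule mats_onI) auto
  show "(\<lambda>A. \<lambda>ij\<in>{..<r} \<times> {..<c}. A $$ ij) ` mats_on r c S \<subseteq> {..<r} \<times> {..<c} \<rightarrow>\<^sub>E S"
  proof (rule image_subsetI)
    fix A assume "A \<in> mats_on r c S"
    then have "A $$ ij \<in> S" if "ij \<in> {..<r} \<times> {..<c}" for ij
      using that mats_onD(2)[of A r c S "fst ij" "snd ij"] by auto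
    then show "(\<lambda>ij\<in>{..<r} \<times> {..<c}. A $$ ij) \<in> {..<r} \<times> {..<c} \<rightarrow>\<^sub>E S"
      by (simp add: restrict_PiE_iff)
  qed
qed

lemma finite_mats_on: "finite S \<Longrightarrow> finite (mats_on r c S)"
  using bij_betw_finite[OF bij_betw_mats_on[of r c S]] by (simp add: finite_PiE)

lemma card_mats_on: "finite S \<Longrightarrow> card (mats_on r c S) = card S ^ (r * c)"
  using bij_betw_same_card[OF bij_betw_mats_on[of r c S]] by (simp add: card_PiE)

text \<open>\<open>GF (q^2)\<close> is the field over which Hermitian forms live; the ambient field may be larger.\<close>

locale hermitian_field =
  fixes q :: nat and ty :: "'a::field itself"
  assumes q_gt_1: "1 < q"
    and frob_add: "\<And>x y::'a. (x + y) ^ q = x ^ q + y ^ q"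
    and card_GF: "card (GF (q\<^sup>2) :: 'a set) = q\<^sup>2"
begin

abbreviation K :: "'a set" where "K \<equiv> GF (q\<^sup>2)"

abbreviation adj :: "'a mat \<Rightarrow> 'a mat" ("_\<^sup>\<star>" [999] 999) where "A\<^sup>\<star> \<equiv> star q A"

lemma q_pos [simp]: "0 < q" using q_gt_1 by simp

lemma frob_uminus: "(- x :: 'a) ^ q = - (x ^ q)"
proof -
  have "(x + - x) ^ q = x ^ q + (- x) ^ q" by (rule frob_add)
  then show ?thesis using q_pos by (metis add.right_inverse neg_eq_iff_add_eq_0 zero_power)
qed

lemma frob_diff: "(x - y :: 'a) ^ q = x ^ q - y ^ q"
  using frob_add[of x "- y"] by (simp add: frob_uminus)

lemma frob_sum: "(\<Sum>i\<in>A. f i :: 'a) ^ q = (\<Sum>i\<in>A. f i ^ q)"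
  by (induction A rule: infinite_finite_induct) (auto simp: frob_add)

lemma K_iff: "x \<in> K \<longleftrightarrow> (x ^ q) ^ q = x"
  by (simp add: GF_def power2_eq_square power_mult)

lemma finite_K [simp]: "finite K"
  using card_GF q_gt_1 by (metis card.infinite power_eq_0_iff not_less_zero)

lemma K_0 [simp]: "0 \<in> K" and K_1 [simp]: "1 \<in> K"
  by (auto simp: GF_def)

lemma K_add: "x \<in> K \<Longrightarrow> y \<in> K \<Longrightarrow> x + y \<in> K"
  and K_diff: "x \<in> K \<Longrightarrow> y \<in> K \<Longrightarrow> x - y \<in> K"
  and K_uminus: "x \<in> K \<Longrightarrow> - x \<in> K"
  by (auto simp: K_iff frob_add frob_diff frob_uminus)

lemma K_mult: "x \<in> K \<Longrightarrow> y \<in> K \<Longrightarrow> x * y \<in> K"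
  and K_inverse: "x \<in> K \<Longrightarrow> inverse x \<in> K"
  and K_divide: "x \<in> K \<Longrightarrow> y \<in> K \<Longrightarrow> x / y \<in> K"
  and K_power: "x \<in> K \<Longrightarrow> x ^ n \<in> K"
proof -
  show "x \<in> K \<Longrightarrow> y \<in> K \<Longrightarrow> x * y \<in> K" by (simp add: GF_def power_mult_distrib)
  show "x \<in> K \<Longrightarrow> inverse x \<in> K" by (simp add: GF_def power_inverse)
  show "x \<in> K \<Longrightarrow> y \<in> K \<Longrightarrow> x / y \<in> K" by (simp add: GF_def power_divide)
  show "x \<in> K \<Longrightarrow> x ^ n \<in> K" by (simp add: GF_def power_commuting_commutes flip: power_mult)
     (metis mult.commute power_mult)
qed

lemma K_sum: "(\<And>i. i \<in> A \<Longrightarrow> f i \<in> K) \<Longrightarrow> sum f A \<in> K"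
  by (induction A rule: infinite_finite_induct) (auto simp: K_add)

lemma norm_in_GF: "x \<in> K \<Longrightarrow> x ^ (q + 1) \<in> GF q"
proof -
  assume "x \<in> K"
  then have "(x ^ q) ^ q = x" by (simp add: K_iff)
  then have "(x ^ q * x) ^ q = x * x ^ q" by (simp only: power_mult_distrib)
  then show ?thesis by (simp add: GF_def mult.commute)
qed

text \<open>Double counting: the \<open>q^2 - 1\<close> nonzero elements of \<open>K\<close> lie
  over at most \<open>q - 1\<close> nonzero elements of \<open>GF q\<close>, each with at most
  \<open>q + 1\<close> preimages under the norm. As \<open>(q - 1) * (q + 1) = q^2 - 1\<close>, both
  bounds are attained.\<close>

lemma norm_fiber_aux:
  shows "card (GF q :: 'a set) = q"
    and "b \<in> GF q - {0} \<Longrightarrow> card {c \<in> K. c ^ (q + 1) = b} = q + 1"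
proof -
  let ?k = "GF q - {0} :: 'a set"
  let ?fib = "\<lambda>b. {c \<in> K - {0}. c ^ (q + 1) = b}"
  have fink: "finite (GF q :: 'a set)" "card (GF q :: 'a set) \<le> q" using card_GF_le[OF q_gt_1] by auto
  have cardk: "card ?k = card (GF q :: 'a set) - 1"
    using fink q_gt_1 by (subst card_Diff_singleton) (auto simp: GF_def)
  have le: "card (?fib b) \<le> q + 1" for b
  proof -
    have "card (?fib b) \<le> card {c::'a. c ^ (q + 1) = b}"
      using card_power_eq_le(1)[of "q + 1" b] by (intro card_mono) auto
    also have "\<dots> \<le> q + 1" by (rule card_power_eq_le) simp
    finally show ?thesis .
  qed
  have "card (K - {0}) = (\<Sum>b\<in>?k. card (?fib b))"
    by (rule finite_card_fibers) (use fink norm_in_GF in auto)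
  moreover have "card (K - {0}) = (q - 1) * (q + 1)"
    using card_Diff_singleton[of 0 K] q_gt_1
    by (simp add: card_GF) (simp add: power2_eq_square algebra_simps diff_mult_distrib)
  ultimately have eq: "(q - 1) * (q + 1) = (\<Sum>b\<in>?k. card (?fib b))" by simp
  also have "\<dots> \<le> card ?k * (q + 1)" using sum_bounded_above[of ?k "\<lambda>b. card (?fib b)" "q + 1"] le by auto
  finally have "q - 1 \<le> card ?k" by (simp only: mult_le_cancel2)
  with cardk fink q_gt_1 have ck: "card ?k = q - 1" "card (GF q :: 'a set) = q" by auto
  then show "card (GF q :: 'a set) = q" by simp
  assume b: "b \<in> GF q - {0}"
  have "card (?fib b) = q + 1"
  proof (rule ccontr)
    assume "card (?fib b) \<noteq> q + 1"
    with le[of b] have "card (?fib b) < q + 1" by simp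
    then have "(\<Sum>b\<in>?k. card (?fib b)) < (\<Sum>b\<in>?k. q + 1)"
      using b le fink by (intro sum_strict_mono_ex1) auto
    with eq ck show False by simp
  qed
  moreover have "?fib b = {c \<in> K. c ^ (q + 1) = b}" using b by auto
  ultimately show "card {c \<in> K. c ^ (q + 1) = b} = q + 1" by simp
qed

lemma norm_surj: assumes "b \<in> GF q" obtains c where "c \<in> K" "c ^ (q + 1) = b"
proof (cases "b = 0")
  case True then show thesis using that[of 0] by simp
next
  case False
  then have "{c \<in> K. c ^ (q + 1) = b} \<noteq> {}" using norm_fiber_aux(2)[of b] assms by (metis (no_types, lifting) Diff_iff card.empty insertE emptyE add_is_0 zero_neq_one)
  then show thesis using that by auto
qed

lemma norm_fiber_0: "card {c \<in> K. c ^ (q + 1) = 0} = 1"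
proof -
  have "{c \<in> K. c ^ (q + 1) = 0} = {0}" by auto
  then show ?thesis by simp
qed

lemma ex_nonreal: "\<exists>c\<in>K. c ^ q \<noteq> c"
proof (rule ccontr)
  assume "\<not> ?thesis"
  then have "K \<subseteq> GF q" by (auto simp: GF_def)
  then have "card K \<le> card (GF q :: 'a set)" using card_GF_le(1)[OF q_gt_1] by (rule card_mono[rotated])
  then show False using card_GF norm_fiber_aux(1) q_gt_1 by (simp add: power2_eq_square)
qed

text \<open>With \<open>q + 1\<close> elements of norm one, any single value can be avoided; this is
  used for an entry of a vector and for a root of a polynomial.\<close>

lemma ex_norm_one_neq: "\<exists>z\<in>K. z ^ (q + 1) = 1 \<and> z \<noteq> a"
proof (rule ccontr)
  assume "\<not> ?thesis"
  then have "{c \<in> K. c ^ (q + 1) = 1} \<subseteq> {a}" by auto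
  then have "card {c \<in> K. c ^ (q + 1) = 1} \<le> 1" by (metis card.empty card_insert_disjoint card_mono empty_iff finite.intros One_nat_def)
  then show False using norm_fiber_aux(2)[of 1] q_gt_1 by (simp add: GF_def)
qed

subsection \<open>Counting vectors by their norm\<close>

definition vcons :: "'a \<Rightarrow> 'a mat \<Rightarrow> 'a mat" where
  "vcons c v = mat (Suc (dim_row v)) 1 (\<lambda>(i, j). if i = 0 then c else v $$ (i - 1, 0))"

lemma nrm_vcons: "nrm q (vcons c v) = c ^ (q + 1) + nrm q v"
  unfolding nrm_def vcons_def
  by (subst dim_row_mat, subst lessThan_atLeast0, subst sum.atLeast_Suc_lessThan, simp, subst sum.atLeast_Suc_lessThan_Suc_shift)
     (auto simp: lessThan_atLeast0 intro!: sum.cong)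

lemma bij_betw_vcons:
  "bij_betw (\<lambda>(v, c). vcons c v) (mats_on n 1 K \<times> K) (mats_on (Suc n) 1 K)"
proof (rule bij_betw_byWitness[where f' = "\<lambda>w. (mat n 1 (\<lambda>(i, j). w $$ (Suc i, 0)), w $$ (0, 0))"])
  show "\<forall>a\<in>mats_on n 1 K \<times> K. (mat n 1 (\<lambda>(i, j). (case a of (v, c) \<Rightarrow> vcons c v) $$ (Suc i, 0)),
      (case a of (v, c) \<Rightarrow> vcons c v) $$ (0, 0)) = a"
    by (auto simp: vcons_def dest: mats_onD(1) intro!: eq_matI)
  show "\<forall>a'\<in>mats_on (Suc n) 1 K. (case (mat n 1 (\<lambda>(i, j). a' $$ (Suc i, 0)), a' $$ (0, 0)) of (v, c) \<Rightarrow> vcons c v) = a'"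
    by (auto simp: vcons_def dest: mats_onD(1) intro!: eq_matI)
  show "(\<lambda>(v, c). vcons c v) ` (mats_on n 1 K \<times> K) \<subseteq> mats_on (Suc n) 1 K"
  proof (rule image_subsetI, clarify, rule mats_onI)
    fix v c i j assume v: "v \<in> mats_on n 1 K" and "c \<in> K" "i < Suc n" "j < (1::nat)"
    then show "vcons c v $$ (i, j) \<in> K"
      using mats_onD(1)[OF v] mats_onD(2)[OF v, of "i - 1" 0] by (auto simp: vcons_def)
  qed (auto simp: vcons_def dest: mats_onD(1))
  show "(\<lambda>w. (mat n 1 (\<lambda>(i, j). w $$ (Suc i, 0)), w $$ (0, 0))) ` mats_on (Suc n) 1 K
      \<subseteq> mats_on n 1 K \<times> K"
    using mats_onD(2)[of _ "Suc n" 1 K] by (fastforce intro!: mats_onI)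
qed

definition norm_count :: "nat \<Rightarrow> 'a \<Rightarrow> nat" where
  "norm_count n b = card {v \<in> mats_on n 1 K. nrm q v = b}"

lemma nrm_in_GF: "v \<in> mats_on n 1 K \<Longrightarrow> nrm q v \<in> GF q"
proof -
  assume v: "v \<in> mats_on n 1 K"
  have "(\<Sum>i<dim_row v. v $$ (i, 0) ^ (q + 1)) ^ q = (\<Sum>i<dim_row v. v $$ (i, 0) ^ (q + 1))"
    unfolding frob_sum
  proof (rule sum.cong[OF refl])
    fix i assume "i \<in> {..<dim_row v}"
    then have "v $$ (i, 0) \<in> K" using v mats_onD by (metis carrier_matD(1) lessThan_iff less_one)
    then show "(v $$ (i, 0) ^ (q + 1)) ^ q = v $$ (i, 0) ^ (q + 1)" using norm_in_GF by (simp add: GF_def)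
  qed
  then show ?thesis by (simp add: GF_def nrm_def)
qed

text \<open>Split off the first coordinate \<open>c\<close>: a tail of norm \<open>b\<close> leaves
  one choice for \<open>c\<close>, any other tail leaves \<open>q + 1\<close>. So \<open>q\<close>
  choices are lost for each tail of norm \<open>b\<close>.\<close>

lemma norm_count_Suc:
  assumes b: "b \<in> GF q"
  shows "int (norm_count (Suc n) b) = (int q + 1) * int q ^ (2 * n) - int q * int (norm_count n b)"
proof -
  let ?V = "mats_on n 1 K"
  have fin: "finite ?V" by (simp add: finite_mats_on)
  have "norm_count (Suc n) b = card {p \<in> ?V \<times> K. nrm q (case p of (v, c) \<Rightarrow> vcons c v) = b}"
    unfolding norm_count_def
    by (rule bij_betw_same_card[symmetric, of "\<lambda>(v, c). vcons c v"], rule bij_betw_Collect[OF bij_betw_vcons]) simp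
  also have "{p \<in> ?V \<times> K. nrm q (case p of (v, c) \<Rightarrow> vcons c v) = b}
      = Sigma ?V (\<lambda>v. {c \<in> K. c ^ (q + 1) = b - nrm q v})"
    by (auto simp: nrm_vcons algebra_simps)
  also have "card \<dots> = (\<Sum>v\<in>?V. card {c \<in> K. c ^ (q + 1) = b - nrm q v})"
    by (rule card_SigmaI) (use fin in auto)
  also have "\<dots> = (\<Sum>v\<in>?V. if nrm q v = b then 1 else q + 1)"
  proof (rule sum.cong[OF refl])
    fix v assume v: "v \<in> ?V"
    have "b - nrm q v \<in> GF q" using b nrm_in_GF[OF v] by (auto simp: GF_def frob_diff)
    then show "card {c \<in> K. c ^ (q + 1) = b - nrm q v} = (if nrm q v = b then 1 else q + 1)"
      using norm_fiber_0 norm_fiber_aux(2)[of "b - nrm q v"] by auto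
  qed
  also have "int \<dots> = (\<Sum>v\<in>?V. (int q + 1) - int q * (if nrm q v = b then 1 else 0))"
    unfolding of_nat_sum by (rule sum.cong) auto
  also have "\<dots> = (int q + 1) * int (card ?V) - int q * (\<Sum>v\<in>?V. if nrm q v = b then 1 else 0)"
    by (simp add: sum_subtractf sum_distrib_left)
  also have "(\<Sum>v\<in>?V. if nrm q v = b then 1 else (0::int)) = int (norm_count n b)"
    using fin by (simp add: norm_count_def sum.If_cases Int_def)
  also have "int (card ?V) = int q ^ (2 * n)"
    by (simp add: card_mats_on card_GF power_mult)
  finally show ?thesis .
qed

text \<open>Closed form of the recursion. The factor \<open>q\<close> on the left keeps the exponent
  \<open>n - 1\<close> out of the formula, so that \<open>n = 0\<close> fits as well.\<close>

lemma norm_count_one: "int q * int (norm_count n 1) = int q ^ n * (int q ^ n - (-1) ^ n)"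
proof (induction n)
  case 0
  have "{v \<in> mats_on 0 1 K. nrm q v = 1} = {}" by (auto simp: nrm_def mats_on_def)
  then show ?case unfolding norm_count_def by (simp only: card.empty) simp
next
  case (Suc n)
  have "(1::'a) \<in> GF q" by (simp add: GF_def)
  from norm_count_Suc[OF this, of n] have "int q * int (norm_count (Suc n) 1) =
      int q * ((int q + 1) * int q ^ (2 * n) - int q * int (norm_count n 1))"
    by simp
  also have "\<dots> = int q * ((int q + 1) * int q ^ (2 * n) - int q ^ n * (int q ^ n - (-1) ^ n))"
    by (simp only: Suc)
  also have "\<dots> = int q ^ Suc n * (int q ^ Suc n - (-1) ^ Suc n)"
    by (simp only: mult_2 power_add power_Suc) (simp add: algebra_simps)
  finally show ?case .
qed

lemma norm_count_zero:
  "int q * int (norm_count n 0) = int q ^ (2 * n) + (-1) ^ n * (int q - 1) * int q ^ n"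
proof (induction n)
  case 0
  have "{v \<in> mats_on 0 1 K. nrm q v = 0} = mats_on 0 1 K" by (auto simp: nrm_def mats_on_def)
  then have "norm_count 0 0 = 1" unfolding norm_count_def by (simp only: card_mats_on[OF finite_K]) simp
  then show ?case by simp
next
  case (Suc n)
  have "(0::'a) \<in> GF q" by (simp add: GF_def)
  from norm_count_Suc[OF this, of n] have "int q * int (norm_count (Suc n) 0) =
      int q * ((int q + 1) * int q ^ (2 * n) - int q * int (norm_count n 0))"
    by simp
  also have "\<dots> = int q * ((int q + 1) * int q ^ (2 * n) - (int q ^ (2 * n) + (-1) ^ n * (int q - 1) * int q ^ n))"
    by (simp only: Suc)
  also have "\<dots> = int q ^ (2 * Suc n) + (-1) ^ Suc n * (int q - 1) * int q ^ Suc n"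
    by (simp add: algebra_simps)
  finally show ?case .
qed

text \<open>The zeroth moment of \<open>v\<close> is its norm, so these are the vectors with
  \<open>\<mu> 0 \<noteq> 0\<close> in the moment count, for every Hermitian matrix alike.\<close>

lemma card_nonisotropic:
  "int q * int (card {v \<in> mats_on n 1 K. nrm q v \<noteq> 0})
     = (int q - 1) * int q ^ n * (int q ^ n - (-1) ^ n)"
proof -
  have "{v \<in> mats_on n 1 K. nrm q v \<noteq> 0} = mats_on n 1 K - {v \<in> mats_on n 1 K. nrm q v = 0}" by auto
  then have "int (card {v \<in> mats_on n 1 K. nrm q v \<noteq> 0}) = int (card (mats_on n 1 K)) - int (norm_count n 0)"
    unfolding norm_count_def
    by (simp add: card_Diff_subset finite_mats_on of_nat_diff card_mono)
  also have "int (card (mats_on n 1 K)) = int q ^ (2 * n)"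
    by (simp add: card_mats_on card_GF power_mult)
  finally have "int q * int (card {v \<in> mats_on n 1 K. nrm q v \<noteq> 0})
      = int q * int q ^ (2 * n) - int q * int (norm_count n 0)"
    by (simp only: right_diff_distrib)
  also have "\<dots> = (int q - 1) * int q ^ n * (int q ^ n - (-1) ^ n)"
    unfolding norm_count_zero by (simp only: mult_2 power_add) (simp add: algebra_simps)
  finally show ?thesis .
qed

subsection \<open>Unitary matrices\<close>

lemma mats_eq: "mats n (q\<^sup>2) = mats_on n n K"
  by (simp add: mats_def mats_on_def)

lemma mats_on_mult:
  assumes "A \<in> mats_on r n K" "B \<in> mats_on n c K"
  shows "A * B \<in> mats_on r c K"
proof (rule mats_onI)
  show "A * B \<in> carrier_mat r c" using assms[THEN mats_onD(1)] by auto
  fix i j assume "i < r" "j < c"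
  then show "(A * B) $$ (i, j) \<in> K"
    using assms mats_onD(1)[OF assms(1)] mats_onD(1)[OF assms(2)]
    by (auto simp: scalar_prod_def intro!: K_sum K_mult mats_onD(2)[OF assms(1)] mats_onD(2)[OF assms(2)])
qed

lemma mats_on_star: "A \<in> mats_on r c K \<Longrightarrow> A\<^sup>\<star> \<in> mats_on c r K"
  using mats_onD(1)[of A r c K] mats_onD(2)[of A r c K] by (intro mats_onI) (auto intro!: K_power)

lemma mats_on_one [simp]: "1\<^sub>m n \<in> mats_on n n K" and mats_on_zero [simp]: "0\<^sub>m r c \<in> mats_on r c K"
  by (auto intro!: mats_onI)

lemma mats_on_four_block:
  assumes "A \<in> mats_on n1 m1 K" "B \<in> mats_on n1 m2 K" "C \<in> mats_on n2 m1 K" "D \<in> mats_on n2 m2 K"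
  shows "four_block_mat A B C D \<in> mats_on (n1 + n2) (m1 + m2) K"
  using assms[THEN mats_onD(1)] by (auto intro!: mats_onI mats_onD(2)[OF assms(1)] mats_onD(2)[OF assms(2)]
    mats_onD(2)[OF assms(3)] mats_onD(2)[OF assms(4)])

lemma star_mult:
  assumes "A \<in> carrier_mat r n" "B \<in> carrier_mat n c"
  shows "(A * B)\<^sup>\<star> = B\<^sup>\<star> * A\<^sup>\<star>"
  using assms by (intro eq_matI) (auto simp: scalar_prod_def frob_sum power_mult_distrib mult.commute)

lemma star_add: "A \<in> carrier_mat r c \<Longrightarrow> B \<in> carrier_mat r c \<Longrightarrow> (A + B)\<^sup>\<star> = A\<^sup>\<star> + B\<^sup>\<star>"
  by (intro eq_matI) (auto simp: frob_add)

lemma star_smult: "(c \<cdot>\<^sub>m A)\<^sup>\<star> = c ^ q \<cdot>\<^sub>m A\<^sup>\<star>"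
  by (intro eq_matI) (auto simp: power_mult_distrib)

lemma star_star: assumes "A \<in> mats_on r c K" shows "A\<^sup>\<star>\<^sup>\<star> = A"
  using mats_onD(1)[OF assms] by (intro eq_matI) (auto simp: mats_onD(2)[OF assms, unfolded K_iff])

definition U :: "nat \<Rightarrow> 'a mat set" where
  "U n = {A \<in> mats_on n n K. A\<^sup>\<star> * A = 1\<^sub>m n}"

lemma U_D: assumes "A \<in> U n"
  shows "A \<in> mats_on n n K" "A \<in> carrier_mat n n" "A\<^sup>\<star> * A = 1\<^sub>m n" "A * A\<^sup>\<star> = 1\<^sub>m n"
    "A\<^sup>\<star> \<in> carrier_mat n n"
proof -
  show 1: "A \<in> mats_on n n K" and 2: "A\<^sup>\<star> * A = 1\<^sub>m n" using assms by (auto simp: U_def)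
  show 3: "A \<in> carrier_mat n n" using 1 by (rule mats_onD)
  then show 4: "A\<^sup>\<star> \<in> carrier_mat n n" by simp
  show "A * A\<^sup>\<star> = 1\<^sub>m n" using mat_mult_left_right_inverse[OF 4 3 2] .
qed

lemma finite_U [simp]: "finite (U n)"
  by (rule finite_subset[OF _ finite_mats_on[of K n n]]) (auto simp: U_def)

lemma one_U [simp]: "1\<^sub>m n \<in> U n" by (auto simp: U_def)

lemma card_U_pos: "0 < card (U n)"
  using one_U[of n] finite_U[of n] unfolding card_gt_0_iff by blast

lemma star_U: assumes "A \<in> U n" shows "A\<^sup>\<star> \<in> U n"
proof -
  have "A\<^sup>\<star>\<^sup>\<star> * A\<^sup>\<star> = 1\<^sub>m n" unfolding star_star[OF U_D(1)[OF assms]] by (rule U_D(4)[OF assms])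
  then show ?thesis unfolding U_def using mats_on_star[OF U_D(1)[OF assms]] by blast
qed

lemma mult_U: assumes "A \<in> U n" "B \<in> U n" shows "A * B \<in> U n"
proof -
  note A = U_D[OF assms(1)] and B = U_D[OF assms(2)]
  have "A\<^sup>\<star> * (A * B) = B" using A(2,3,5) B(2) by (simp flip: assoc_mult_mat[of _ n n _ n _ n])
  then have "(A * B)\<^sup>\<star> * (A * B) = 1\<^sub>m n"
    using A(2,5) B(2,3,5) by (simp add: star_mult[of _ n n _ n] assoc_mult_mat[of _ n n _ n _ n])
  then show ?thesis using mats_on_mult[OF A(1) B(1)] by (simp add: U_def)
qed

lemma U_cancel: assumes "g \<in> U n" "A \<in> carrier_mat n m"
  shows "g\<^sup>\<star> * (g * A) = A" "g * (g\<^sup>\<star> * A) = A"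
  using U_D[OF assms(1)] assms(2) by (simp_all flip: assoc_mult_mat[of _ n n _ n _ m])

lemma skew_form_mult_vec:
  assumes "A \<in> carrier_mat n n" "x \<in> carrier_vec n" "y \<in> carrier_vec n"
  shows "skew_form q (A *\<^sub>v x) (A *\<^sub>v y) = (\<Sum>i<n. \<Sum>j<n. x $ i * y $ j ^ q * (A\<^sup>\<star> * A) $$ (j, i))"
proof -
  have "skew_form q (A *\<^sub>v x) (A *\<^sub>v y) = (\<Sum>l<n. (\<Sum>i<n. A $$ (l, i) * x $ i) * (\<Sum>j<n. A $$ (l, j) * y $ j) ^ q)"
    using assms by (auto simp: skew_form_def scalar_prod_def lessThan_atLeast0 intro!: sum.cong)
  also have "\<dots> = (\<Sum>l<n. \<Sum>i<n. \<Sum>j<n. x $ i * y $ j ^ q * (A $$ (l, j) ^ q * A $$ (l, i)))"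
    by (simp add: frob_sum sum_product power_mult_distrib mult_ac)
  also have "\<dots> = (\<Sum>i<n. \<Sum>j<n. \<Sum>l<n. x $ i * y $ j ^ q * (A $$ (l, j) ^ q * A $$ (l, i)))"
  proof -
    have "(\<Sum>l<n. \<Sum>i<n. \<Sum>j<n. F l i j) = (\<Sum>i<n. \<Sum>j<n. \<Sum>l<n. F l i j)" for F :: "nat \<Rightarrow> nat \<Rightarrow> nat \<Rightarrow> 'a"
    proof -
      have "(\<Sum>l<n. \<Sum>i<n. \<Sum>j<n. F l i j) = (\<Sum>i<n. \<Sum>l<n. \<Sum>j<n. F l i j)" by (rule sum.swap)
      also have "\<dots> = (\<Sum>i<n. \<Sum>j<n. \<Sum>l<n. F l i j)" by (rule sum.cong[OF refl], rule sum.swap)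
      finally show ?thesis .
    qed
    then show ?thesis .
  qed
  also have "\<dots> = (\<Sum>i<n. \<Sum>j<n. x $ i * y $ j ^ q * (A\<^sup>\<star> * A) $$ (j, i))"
    using assms by (intro sum.cong refl) (auto simp: scalar_prod_def lessThan_atLeast0 sum_distrib_left)
  finally show ?thesis .
qed

text \<open>Testing the form on pairs of unit vectors reads off the entries of
  \<open>A\<^sup>\<star> * A\<close>; conversely this product determines the transformed
  form.\<close>

lemma U_mats_eq: "U_mats n q = U n"
proof
  show "U_mats n q \<subseteq> U n"
  proof
    fix A :: "'a mat" assume A: "A \<in> U_mats n q"
    then have AK: "A \<in> mats_on n n K" by (auto simp: U_mats_def GL_mats_def mats_eq)
    then have Ac: "A \<in> carrier_mat n n" by (rule mats_onD)
    have "(A\<^sup>\<star> * A) $$ (j, i) = 1\<^sub>m n $$ (j, i)" if "i < n" "j < n" for i j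
    proof -
      have *: "(unit_vec n i :: 'a vec) \<in> vecs n (q\<^sup>2)" for i by (auto simp: vecs_def unit_vec_def)
      have pick: "(\<Sum>k<n. \<Sum>l<n. (unit_vec n i :: 'a vec) $ k * (unit_vec n j :: 'a vec) $ l ^ q * f l k) = f j i" for f
      proof -
        have "(\<Sum>k<n. \<Sum>l<n. (unit_vec n i :: 'a vec) $ k * (unit_vec n j :: 'a vec) $ l ^ q * f l k)
           = (\<Sum>k<n. if k = i then (\<Sum>l<n. if l = j then f l k else 0) else 0)"
        proof (intro sum.cong refl)
          fix k assume "k \<in> {..<n}"
          then have "(\<Sum>l<n. (unit_vec n i :: 'a vec) $ k * (unit_vec n j :: 'a vec) $ l ^ q * f l k)
            = (\<Sum>l<n. if k = i then (if l = j then f l k else 0) else 0)"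
            using that by (intro sum.cong refl) (simp add: unit_vec_def)
          then show "(\<Sum>l<n. (unit_vec n i :: 'a vec) $ k * (unit_vec n j :: 'a vec) $ l ^ q * f l k)
            = (if k = i then (\<Sum>l<n. if l = j then f l k else 0) else 0)" by simp
        qed
        then show ?thesis using that by simp
      qed
      have "skew_form q (A *\<^sub>v unit_vec n i) (A *\<^sub>v unit_vec n j) = skew_form q (unit_vec n i) (unit_vec n j)"
        using A * by (auto simp: U_mats_def)
      also have "skew_form q (unit_vec n i) (unit_vec n j) =
          skew_form q (1\<^sub>m n *\<^sub>v unit_vec n i) (1\<^sub>m n *\<^sub>v (unit_vec n j :: 'a vec))" by simp
      finally show ?thesis using Ac by (simp only: skew_form_mult_vec[of _ n] unit_vec_carrier one_carrier_mat pick) simp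
    qed
    then have "A\<^sup>\<star> * A = 1\<^sub>m n" using Ac by (intro eq_matI) auto
    then show "A \<in> U n" using AK by (simp add: U_def)
  qed
  show "U n \<subseteq> U_mats n q"
  proof
    fix A assume A: "A \<in> U n"
    note AD = U_D[OF A]
    have "A \<in> GL_mats n (q\<^sup>2)"
      unfolding GL_mats_def mats_eq inverts_mat_def
      using AD mats_on_star[OF AD(1)] by (auto intro!: bexI[of _ "A\<^sup>\<star>"])
    moreover have "skew_form q (A *\<^sub>v x) (A *\<^sub>v y) = skew_form q x y"
      if "x \<in> carrier_vec n" "y \<in> carrier_vec n" for x y
      using skew_form_mult_vec[OF AD(2) that] skew_form_mult_vec[of "1\<^sub>m n" n x y] that AD by simp
    ultimately show "A \<in> U_mats n q" by (auto simp: U_mats_def vecs_def)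
  qed
qed

end

text \<open>Counting form of orbit and stabiliser. In its applications \<open>f\<close> conjugates a
  normal form by a unitary matrix, and each fibre is a copy of a smaller unitary group or of a
  product of two.\<close>

lemma card_product_fibers:
  assumes fin: "finite A" "finite B"
    and maps: "\<And>a b. a \<in> A \<Longrightarrow> b \<in> B \<Longrightarrow> f a b \<in> C"
    and surj: "\<And>c. c \<in> C \<Longrightarrow> \<exists>a\<in>A. \<exists>b\<in>B. f a b = c"
    and fib: "\<And>a b. a \<in> A \<Longrightarrow> b \<in> B \<Longrightarrow> card {(a', b'). a' \<in> A \<and> b' \<in> B \<and> f a' b' = f a b} = m"
  shows "card A * card B = m * card C"
proof -
  have C: "C = (\<lambda>(a, b). f a b) ` (A \<times> B)" using maps surj by fastforce
  have "card (A \<times> B) = m * card C"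
  proof (rule card_constant_fibers[where f = "\<lambda>(a, b). f a b"])
    show "finite C" "finite (A \<times> B)" using fin unfolding C by auto
    show "(\<lambda>(a, b). f a b) ` (A \<times> B) \<subseteq> C" using C by simp
    fix c assume "c \<in> C"
    then obtain a b where "a \<in> A" "b \<in> B" "c = f a b" using surj by blast
    moreover have "{p \<in> A \<times> B. (case p of (a, b) \<Rightarrow> f a b) = f a b}
        = {(a', b'). a' \<in> A \<and> b' \<in> B \<and> f a' b' = f a b}" by auto
    ultimately show "card {p \<in> A \<times> B. (case p of (a, b) \<Rightarrow> f a b) = c} = m" using fib by simp
  qed
  then show ?thesis by (simp add: card_cartesian_product)
qed

lemma mat_mult_index:
  assumes "A \<in> carrier_mat r n" "B \<in> carrier_mat n c" "i < r" "j < c"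
  shows "(A * B) $$ (i, j) = (\<Sum>l = 0..<n. A $$ (i, l) * B $$ (l, j))"
  using assms by (auto simp: scalar_prod_def)

section \<open>Block-diagonal matrices\<close>

definition blk :: "'a::zero mat \<Rightarrow> 'a mat \<Rightarrow> 'a mat" where
  "blk A D = four_block_mat A (0\<^sub>m (dim_row A) (dim_col D)) (0\<^sub>m (dim_row D) (dim_col A)) D"

lemma blk_carrier: "A \<in> carrier_mat m m \<Longrightarrow> D \<in> carrier_mat n n \<Longrightarrow> blk A D \<in> carrier_mat (m + n) (m + n)"
  by (simp add: blk_def)

lemma blk_four_block: "A \<in> carrier_mat m m \<Longrightarrow> D \<in> carrier_mat n n \<Longrightarrow>
    blk A D = four_block_mat A (0\<^sub>m m n) (0\<^sub>m n m) D"
  by (simp add: blk_def)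

lemma blk_mult:
  assumes "A \<in> carrier_mat m m" "D \<in> carrier_mat n n" "A' \<in> carrier_mat m m" "D' \<in> carrier_mat n n"
  shows "blk A D * blk A' D' = blk (A * A') (D * D')"
proof -
  have "A * A' \<in> carrier_mat m m" "D * D' \<in> carrier_mat n n" using assms by auto
  then show ?thesis using assms
    by (simp add: blk_four_block[of _ m _ n] mult_four_block_mat[of _ m m _ n _ n _ _ m _ n])
qed

lemma blk_one [simp]: "blk (1\<^sub>m m) (1\<^sub>m n) = 1\<^sub>m (m + n)"
  by (simp add: blk_def)

lemma blk_inj:
  assumes "A \<in> carrier_mat m m" "D \<in> carrier_mat n n" "A' \<in> carrier_mat m m" "D' \<in> carrier_mat n n"
    and eq: "blk A D = blk A' D'"
  shows "A = A'" "D = D'"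
proof -
  have "blk A D $$ (i, j) = A $$ (i, j)" "blk A' D' $$ (i, j) = A' $$ (i, j)" if "i < m" "j < m" for i j
    using that assms(1-4) by (auto simp: blk_def)
  then show "A = A'" using assms eq by (intro eq_matI) auto
  have "blk A D $$ (m + i, m + j) = D $$ (i, j)" "blk A' D' $$ (m + i, m + j) = D' $$ (i, j)" if "i < n" "j < n" for i j
    using that assms(1-4) by (auto simp: blk_def)
  then show "D = D'" using assms eq by (intro eq_matI) auto
qed

context hermitian_field
begin

lemma star_blk: "A \<in> carrier_mat m m \<Longrightarrow> D \<in> carrier_mat n n \<Longrightarrow> (blk A D)\<^sup>\<star> = blk (A\<^sup>\<star>) (D\<^sup>\<star>)"
  by (simp add: blk_def star_four_block[of _ m m _ n _ n])

lemma mats_on_blk: "A \<in> mats_on m m K \<Longrightarrow> D \<in> mats_on n n K \<Longrightarrow> blk A D \<in> mats_on (m + n) (m + n) K"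
  using mats_onD(1)[of A m m K] mats_onD(1)[of D n n K]
  by (auto simp: blk_def intro!: mats_on_four_block)

lemma blk_U_iff:
  assumes "A \<in> mats_on m m K" "D \<in> mats_on n n K"
  shows "blk A D \<in> U (m + n) \<longleftrightarrow> A \<in> U m \<and> D \<in> U n"
proof -
  have c: "A \<in> carrier_mat m m" "D \<in> carrier_mat n n" using assms mats_onD(1) by auto
  have "blk (A\<^sup>\<star> * A) (D\<^sup>\<star> * D) = blk (1\<^sub>m m) (1\<^sub>m n) \<longleftrightarrow> A\<^sup>\<star> * A = 1\<^sub>m m \<and> D\<^sup>\<star> * D = 1\<^sub>m n"
  proof
    assume eq: "blk (A\<^sup>\<star> * A) (D\<^sup>\<star> * D) = blk (1\<^sub>m m) (1\<^sub>m n)"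
    have cc: "A\<^sup>\<star> * A \<in> carrier_mat m m" "D\<^sup>\<star> * D \<in> carrier_mat n n" using c by simp_all
    show "A\<^sup>\<star> * A = 1\<^sub>m m \<and> D\<^sup>\<star> * D = 1\<^sub>m n"
      using blk_inj[OF cc one_carrier_mat one_carrier_mat eq] by blast
  qed simp
  then show ?thesis
    using assms c by (simp add: U_def star_blk[of _ m _ n] blk_mult[of _ m _ n] mats_on_blk)
qed

section \<open>Completing orthonormal columns to unitary matrices\<close>

text \<open>Orthonormality carries the shape of the columns over to the rows: for
  \<open>i < m\<close> column \<open>i\<close> is a unit vector, so entry \<open>(i, j)\<close> of
  \<open>g\<^sup>\<star> * g\<close> is just \<open>g $$ (i, j)\<close>.\<close>

lemma U_first_cols_trivial:
  assumes g: "g \<in> U (m + n)"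
    and cols: "\<And>i j. i < m + n \<Longrightarrow> j < m \<Longrightarrow> g $$ (i, j) = (if i = j then 1 else 0)"
  obtains h where "h \<in> U n" "g = blk (1\<^sub>m m) h"
proof -
  note gD = U_D[OF g]
  let ?h = "mat n n (\<lambda>(i, j). g $$ (m + i, m + j))"
  have rows: "g $$ (i, j) = (if i = j then 1 else 0)" if "i < m" "j < m + n" for i j
  proof -
    have "(g\<^sup>\<star> * g) $$ (i, j) = (\<Sum>l = 0..<m + n. g $$ (l, i) ^ q * g $$ (l, j))"
      using gD(2) that by (simp add: scalar_prod_def)
    also have "\<dots> = (\<Sum>l = 0..<m + n. if l = i then g $$ (l, j) else 0)"
      using that by (intro sum.cong) (auto simp: cols)
    also have "\<dots> = g $$ (i, j)" using that by simp
    finally show ?thesis using that gD(3) by simp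
  qed
  have hK: "?h \<in> mats_on n n K" using mats_onD(2)[OF gD(1)] by (intro mats_onI) auto
  have eq: "g = blk (1\<^sub>m m) ?h"
    using gD(2) cols rows by (intro eq_matI) (auto simp: blk_def)
  then have "?h \<in> U n" using g blk_U_iff[OF mats_on_one hK, of m] by simp
  then show thesis using that eq by blast
qed

lemma nrm_star: "v \<in> carrier_mat n 1 \<Longrightarrow> (v\<^sup>\<star> * v) $$ (0, 0) = nrm q v"
  by (simp add: nrm_def scalar_prod_def lessThan_atLeast0 mult.commute)

text \<open>Transitivity on vectors of norm one by one quasi-reflection
  \<open>1 + a d d\<^sup>\<star>\<close> with \<open>d = w - z e\<close>, where \<open>e\<close> is
  the first unit vector, preceded by a diagonal matrix sending \<open>e\<close> to
  \<open>z e\<close>. Choosing \<open>z\<close> different from the first entry of \<open>w\<close>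
  makes the product of \<open>d\<close> with \<open>z e\<close> nonzero, even when \<open>d\<close>
  is isotropic.\<close>

lemma unitary_first_col:
  assumes w: "w \<in> mats_on (Suc n) 1 K" and nw: "nrm q w = 1"
  shows "\<exists>g\<in>U (Suc n). \<forall>i<Suc n. g $$ (i, 0) = w $$ (i, 0)"
proof -
  let ?N = "Suc n"
  obtain z where z: "z \<in> K" "z ^ (q + 1) = 1" "z \<noteq> w $$ (0, 0)" using ex_norm_one_neq by blast
  have z0: "z \<noteq> 0" using z(2) by auto
  have zq: "z ^ q = 1 / z" using z(2) z0 by (simp add: field_simps)
  have w0: "w $$ (0, 0) \<in> K" using w by (rule mats_onD) auto
  define w0 where "w0 = w $$ (0, 0)"
  define d where "d = mat ?N 1 (\<lambda>(i, j). if i = 0 then w0 - z else w $$ (i, 0))"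
  have dK: "d \<in> mats_on ?N 1 K"
    using z w0 mats_onD(2)[OF w] by (intro mats_onI) (auto simp: d_def w0_def intro!: K_diff)
  have dc: "d \<in> carrier_mat ?N 1" using dK by (rule mats_onD)
  have wc: "w \<in> carrier_mat ?N 1" using w by (rule mats_onD)
  \<comment> \<open>Chosen so that \<open>a\<close> times the product of \<open>d\<close> with
    \<open>z e\<close> is 1; then \<open>1 + a d d\<^sup>\<star>\<close> maps \<open>z e\<close> to
    \<open>z e + d = w\<close>.\<close>
  define a where "a = 1 / ((w0 - z) ^ q * z)"
  have wz: "(w0 - z) ^ q \<noteq> 0" using z(3) by (simp add: w0_def)
  have a0: "a \<noteq> 0" using wz z0 by (simp add: a_def)
  have aK: "a \<in> K" unfolding a_def w0_def using z w0
    by (intro K_divide K_mult K_power K_diff) auto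
  have ia: "1 / a = w0 ^ q * z - 1" using zq z0 by (simp add: a_def frob_diff field_simps)
  have w0q: "(w0 ^ q) ^ q = w0" using w0 by (simp add: K_iff w0_def)
  have iaq: "1 / a ^ q = w0 * z ^ q - 1"
  proof -
    have "1 / a ^ q = (1 / a) ^ q" by (simp add: power_divide)
    then show ?thesis by (simp add: ia frob_diff power_mult_distrib w0q)
  qed
  have nd: "nrm q d = 2 - w0 * z ^ q - w0 ^ q * z"
  proof -
    have "nrm q w = w0 ^ (q + 1) + (\<Sum>i = 0..<n. w $$ (Suc i, 0) ^ (q + 1))"
      using wc by (simp add: nrm_def lessThan_atLeast0 sum.atLeast0_lessThan_Suc_shift w0_def del: sum.op_ivl_Suc)
    moreover have "nrm q d = (w0 - z) ^ (q + 1) + (\<Sum>i = 0..<n. w $$ (Suc i, 0) ^ (q + 1))"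
      using dc by (simp add: nrm_def lessThan_atLeast0 sum.atLeast0_lessThan_Suc_shift d_def del: sum.op_ivl_Suc)
    moreover have "(w0 - z) ^ (q + 1) = w0 ^ (q + 1) - w0 * z ^ q - w0 ^ q * z + 1"
      using z(2) by (simp add: frob_diff algebra_simps)
    ultimately show ?thesis using nw by (simp only:) (simp add: algebra_simps)
  qed
  \<comment> \<open>This is the coefficient of \<open>d d\<^sup>\<star>\<close> in the product of
    \<open>1 + a d d\<^sup>\<star>\<close> with its adjoint; its vanishing is unitarity. The norm of
    \<open>w\<close> enters through \<open>nd\<close>.\<close>
  have key: "a + a ^ q + a * a ^ q * nrm q d = 0"
  proof -
    have "a + a ^ q + a * a ^ q * nrm q d = a * a ^ q * (1 / a + 1 / a ^ q + nrm q d)"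
      using a0 by (simp add: field_simps)
    then show ?thesis unfolding ia iaq nd by simp
  qed
  let ?P = "d * d\<^sup>\<star>"
  have Pc: "?P \<in> carrier_mat ?N ?N" using dc by auto
  have Ps: "?P\<^sup>\<star> = ?P" using dc star_star[OF dK] by (simp add: star_mult[of _ ?N 1])
  have nd': "d\<^sup>\<star> * d = nrm q d \<cdot>\<^sub>m 1\<^sub>m 1"
    using dc nrm_star[OF dc] by (intro eq_matI) auto
  have PP: "?P * ?P = nrm q d \<cdot>\<^sub>m ?P"
  proof -
    have "?P * ?P = d * ((d\<^sup>\<star> * d) * d\<^sup>\<star>)"
      using dc by (simp add: assoc_mult_mat[of _ ?N 1 _ ?N _ ?N] assoc_mult_mat[of _ 1 ?N _ 1 _ ?N])
    also have "\<dots> = nrm q d \<cdot>\<^sub>m ?P" unfolding nd' using dc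
      by (simp add: mult_smult_assoc_mat[of _ 1 1 _ ?N] mult_smult_distrib[of _ ?N 1 _ ?N])
    finally show ?thesis .
  qed
  let ?T = "1\<^sub>m ?N + a \<cdot>\<^sub>m ?P"
  have TK: "?T \<in> mats_on ?N ?N K"
  proof (rule mats_onI)
    fix i j assume ij: "i < ?N" "j < ?N"
    have "?P $$ (i, j) \<in> K" using mats_on_mult[OF dK mats_on_star[OF dK]] ij by (rule mats_onD)
    then show "?T $$ (i, j) \<in> K" using ij dc aK by (auto intro!: K_add K_mult)
  qed (use dc in auto)
  have "?T\<^sup>\<star> = 1\<^sub>m ?N + a ^ q \<cdot>\<^sub>m ?P"
    using Pc by (simp add: star_add[of _ ?N ?N] star_smult Ps)
  then have "?T\<^sup>\<star> * ?T = 1\<^sub>m ?N + (a + a ^ q + a * a ^ q * nrm q d) \<cdot>\<^sub>m ?P"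
    using Pc by (intro eq_matI)
      (simp_all add: add_mult_distrib_mat[of _ ?N ?N] mult_add_distrib_mat[of _ ?N ?N _ ?N] mult_smult_distrib[of _ ?N ?N _ ?N]
         mult_smult_assoc_mat[of _ ?N ?N _ ?N] PP algebra_simps del: index_mult_mat)
  also have "\<dots> = 1\<^sub>m ?N" unfolding key using Pc by (intro eq_matI) auto
  finally have TU: "?T \<in> U ?N" using TK by (simp add: U_def)
  let ?D = "mat ?N ?N (\<lambda>(i, j). if i = j then if i = 0 then z else 1 else 0)"
  have "?D\<^sup>\<star> * ?D = 1\<^sub>m ?N"
  proof (rule eq_matI)
    fix i j assume ij: "i < dim_row (1\<^sub>m ?N :: 'a mat)" "j < dim_col (1\<^sub>m ?N :: 'a mat)"
    have "(?D\<^sup>\<star> * ?D) $$ (i, j) = (\<Sum>l = 0..<?N. ?D $$ (l, i) ^ q * ?D $$ (l, j))"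
      using ij by (simp add: scalar_prod_def del: sum.op_ivl_Suc)
    also have "\<dots> = (\<Sum>l = 0..<?N. if l = i then (if i = j then if i = 0 then z ^ q * z else 1 else 0) else 0)"
      using ij by (intro sum.cong refl) auto
    finally have "(?D\<^sup>\<star> * ?D) $$ (i, j) = \<dots>" .
    then show "(?D\<^sup>\<star> * ?D) $$ (i, j) = 1\<^sub>m ?N $$ (i, j)" using ij z(2) by (auto simp: mult.commute simp del: sum.op_ivl_Suc)
  qed auto
  then have DU: "?D \<in> U ?N" unfolding U_def using z by (auto intro!: mats_onI)
  have "(?T * ?D) $$ (i, 0) = w $$ (i, 0)" if i: "i < ?N" for i
  proof -
    have "(?T * ?D) $$ (i, 0) = (\<Sum>l = 0..<?N. ?T $$ (i, l) * ?D $$ (l, 0))"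
      using i dc by (intro mat_mult_index[of _ ?N ?N _ ?N]) auto
    also have "\<dots> = (\<Sum>l = 0..<?N. if l = 0 then ?T $$ (i, 0) * z else 0)"
      by (intro sum.cong refl) (auto simp del: index_add_mat)
    also have "\<dots> = ?T $$ (i, 0) * z" by (simp del: sum.op_ivl_Suc)
    also have "?T $$ (i, 0) = (if i = 0 then 1 else 0) + a * (d $$ (i, 0) * (w0 - z) ^ q)"
      using i dc by (simp add: scalar_prod_def d_def)
    also have "\<dots> * z = (if i = 0 then z else 0) + d $$ (i, 0)"
      using wz z0 by (simp add: a_def field_simps)
    also have "\<dots> = w $$ (i, 0)" using i by (simp add: d_def w0_def)
    finally show ?thesis .
  qed
  then show ?thesis using mult_U[OF TU DU] by blast
qed

text \<open>Induction on the number of columns: a unitary matrix moves the first column to the first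
  unit vector, orthogonality then clears the rest of the first row, and the remaining block is
  completed in one dimension less.\<close>

lemma unitary_extension:
  assumes "Q \<in> mats_on (m + n) m K" and "Q\<^sup>\<star> * Q = 1\<^sub>m m"
  shows "\<exists>g\<in>U (m + n). \<forall>i<m + n. \<forall>j<m. g $$ (i, j) = Q $$ (i, j)"
  using assms
proof (induction m arbitrary: Q)
  case 0
  show ?case by (intro bexI[of _ "1\<^sub>m n"]) auto
next
  case (Suc m)
  let ?N = "m + n"
  note QK = Suc.prems(1)
  have Qc: "Q \<in> carrier_mat (Suc ?N) (Suc m)" using mats_onD(1)[OF QK] by simp
  let ?w = "mat (Suc ?N) 1 (\<lambda>(i, j). Q $$ (i, 0))"
  have wK: "?w \<in> mats_on (Suc ?N) 1 K" using mats_onD(2)[OF QK] by (intro mats_onI) auto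
  have "nrm q ?w = (Q\<^sup>\<star> * Q) $$ (0, 0)"
    using Qc by (simp add: mat_mult_index[of _ "Suc m" "Suc ?N" _ "Suc m"] nrm_def lessThan_atLeast0 mult.commute
        del: sum.op_ivl_Suc index_mult_mat)
  then have "nrm q ?w = 1" using Suc.prems(2) by simp
  from unitary_first_col[OF wK this] obtain g where
    g: "g \<in> U (Suc ?N)" "\<And>i. i < Suc ?N \<Longrightarrow> g $$ (i, 0) = Q $$ (i, 0)" by auto
  note gD = U_D[OF g(1)]
  let ?Q1 = "g\<^sup>\<star> * Q"
  have Q1c: "?Q1 \<in> carrier_mat (Suc ?N) (Suc m)" using gD Qc by simp
  have Q1K: "?Q1 \<in> mats_on (Suc ?N) (Suc m) K" using mats_on_mult[OF mats_on_star[OF gD(1)]] QK by simp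
  have gQ1: "g * ?Q1 = Q" using U_cancel[OF g(1) Qc] by simp
  have iso1: "?Q1\<^sup>\<star> * ?Q1 = 1\<^sub>m (Suc m)"
  proof -
    have "?Q1\<^sup>\<star> = Q\<^sup>\<star> * g" using star_mult[OF gD(5) Qc] star_star[OF gD(1)] by simp
    then have "?Q1\<^sup>\<star> * ?Q1 = Q\<^sup>\<star> * (g * ?Q1)" using gD(2) Q1c Qc by (simp add: assoc_mult_mat[of _ "Suc m" "Suc ?N" _ "Suc ?N" _ "Suc m"])
    then show ?thesis using gQ1 Suc.prems(2) by simp
  qed
  have col0: "?Q1 $$ (i, 0) = (if i = 0 then 1 else 0)" if "i < Suc ?N" for i
  proof -
    have "?Q1 $$ (i, 0) = (\<Sum>l = 0..<Suc ?N. g\<^sup>\<star> $$ (i, l) * Q $$ (l, 0))"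
      using that gD Qc by (intro mat_mult_index) auto
    also have "\<dots> = (\<Sum>l = 0..<Suc ?N. g\<^sup>\<star> $$ (i, l) * g $$ (l, 0))"
      using g(2) by (intro sum.cong refl) auto
    also have "\<dots> = (g\<^sup>\<star> * g) $$ (i, 0)"
      using that gD by (intro mat_mult_index[symmetric]) auto
    finally show ?thesis using that gD(3) by simp
  qed
  have row0: "?Q1 $$ (0, j) = (if j = 0 then 1 else 0)" if "j < Suc m" for j
  proof -
    have "(?Q1\<^sup>\<star> * ?Q1) $$ (0, j) = (\<Sum>l = 0..<Suc ?N. ?Q1\<^sup>\<star> $$ (0, l) * ?Q1 $$ (l, j))"
      using that Q1c by (intro mat_mult_index) auto
    also have "\<dots> = (\<Sum>l = 0..<Suc ?N. if l = 0 then ?Q1 $$ (l, j) else 0)"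
    proof (intro sum.cong refl)
      fix l assume "l \<in> {0..<Suc ?N}"
      then have "?Q1\<^sup>\<star> $$ (0, l) = (if l = 0 then 1 else 0)" using Qc gD(2) col0[of l] by (auto simp del: index_mult_mat(1))
      then show "?Q1\<^sup>\<star> $$ (0, l) * ?Q1 $$ (l, j) = (if l = 0 then ?Q1 $$ (l, j) else 0)" by simp
    qed
    also have "\<dots> = ?Q1 $$ (0, j)" by (simp del: sum.op_ivl_Suc index_mult_mat)
    finally show ?thesis using that iso1 by simp
  qed
  let ?Q2 = "mat ?N m (\<lambda>(i, j). ?Q1 $$ (Suc i, Suc j))"
  have Q2K: "?Q2 \<in> mats_on ?N m K"
    using mats_onD(2)[OF Q1K] by (intro mats_onI) (auto simp del: index_mult_mat)
  have "?Q2\<^sup>\<star> * ?Q2 = 1\<^sub>m m"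
  proof (rule eq_matI)
    fix i j assume ij: "i < dim_row (1\<^sub>m m :: 'a mat)" "j < dim_col (1\<^sub>m m :: 'a mat)"
    have "(?Q1\<^sup>\<star> * ?Q1) $$ (Suc i, Suc j) = (\<Sum>l = 0..<Suc ?N. ?Q1\<^sup>\<star> $$ (Suc i, l) * ?Q1 $$ (l, Suc j))"
      using ij Q1c by (intro mat_mult_index) auto
    also have "\<dots> = (\<Sum>l = 0..<?N. ?Q1\<^sup>\<star> $$ (Suc i, Suc l) * ?Q1 $$ (Suc l, Suc j))"
      using ij by (subst sum.atLeast0_lessThan_Suc_shift) (simp add: row0 del: index_mult_mat)
    also have "\<dots> = (\<Sum>l = 0..<?N. ?Q2\<^sup>\<star> $$ (i, l) * ?Q2 $$ (l, j))"
      using ij Q1c by (intro sum.cong refl) (auto simp del: index_mult_mat)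
    also have "\<dots> = (?Q2\<^sup>\<star> * ?Q2) $$ (i, j)"
      using ij by (intro mat_mult_index[symmetric]) auto
    finally show "(?Q2\<^sup>\<star> * ?Q2) $$ (i, j) = 1\<^sub>m m $$ (i, j)" using ij iso1 by simp
  qed auto
  from Suc.IH[OF Q2K this] obtain h where
    h: "h \<in> U ?N" "\<And>i j. i < ?N \<Longrightarrow> j < m \<Longrightarrow> h $$ (i, j) = ?Q2 $$ (i, j)" by blast
  note hD = U_D[OF h(1)]
  let ?b = "blk (1\<^sub>m 1) h"
  have bU: "?b \<in> U (Suc ?N)" using blk_U_iff[OF mats_on_one hD(1), of 1] h(1) by simp
  note bD = U_D[OF bU]
  have b: "?b $$ (l, j) = ?Q1 $$ (l, j)" if "l < Suc ?N" "j < Suc m" for l j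
  proof (cases "l = 0 \<or> j = 0")
    case True
    then show ?thesis using that hD(2) col0[of l] row0[of j] by (auto simp: blk_def simp del: index_mult_mat)
  next
    case False
    then show ?thesis using that hD(2) h(2)[of "l - 1" "j - 1"] by (auto simp: blk_def simp del: index_mult_mat)
  qed
  have "(g * ?b) $$ (i, j) = Q $$ (i, j)" if "i < Suc ?N" "j < Suc m" for i j
  proof -
    have "(g * ?b) $$ (i, j) = (\<Sum>l = 0..<Suc ?N. g $$ (i, l) * ?b $$ (l, j))"
      using that gD(2) bD(2) by (intro mat_mult_index[of _ "Suc ?N" "Suc ?N" _ "Suc ?N"]) auto
    also have "\<dots> = (\<Sum>l = 0..<Suc ?N. g $$ (i, l) * ?Q1 $$ (l, j))"
      using that b by (intro sum.cong refl) auto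
    also have "\<dots> = (g * ?Q1) $$ (i, j)"
      using that gD Q1c by (intro mat_mult_index[symmetric]) auto
    finally show ?thesis unfolding gQ1 .
  qed
  then show ?case using mult_U[OF g(1) bU] by auto
qed

text \<open>\<open>U (Suc n)\<close> is transitive on the vectors of norm one, and the stabiliser of
  the first unit vector is a copy of \<open>U n\<close>.\<close>

lemma card_U_Suc: "card (U (Suc n)) = card (U n) * norm_count (Suc n) 1"
proof -
  let ?N = "Suc n"
  let ?c = "\<lambda>g::'a mat. mat ?N 1 (\<lambda>(i, j). g $$ (i, 0))"
  let ?B = "{v \<in> mats_on ?N 1 K. nrm q v = 1}"
  have "card (U ?N) = card (U n) * card ?B"
  proof (rule card_constant_fibers[where f = ?c])
    show "finite ?B" by (simp add: finite_mats_on)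
    show "?c ` U ?N \<subseteq> ?B"
    proof (rule image_subsetI, rule CollectI, rule conjI)
      fix g assume "g \<in> U ?N"
      note gD = U_D[OF this]
      show "?c g \<in> mats_on ?N 1 K" using mats_onD(2)[OF gD(1)] by (intro mats_onI) auto
      have "nrm q (?c g) = (g\<^sup>\<star> * g) $$ (0, 0)"
        using gD(2) by (simp add: mat_mult_index[of _ ?N ?N _ ?N] nrm_def lessThan_atLeast0 mult.commute
            del: sum.op_ivl_Suc index_mult_mat)
      then show "nrm q (?c g) = 1" using gD(3) by simp
    qed
    fix w assume w: "w \<in> ?B"
    then obtain g where g: "g \<in> U ?N" "\<And>i. i < ?N \<Longrightarrow> g $$ (i, 0) = w $$ (i, 0)"
      using unitary_first_col by blast
    note gD = U_D[OF g(1)]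
    have wc: "w \<in> carrier_mat ?N 1" using w mats_onD(1) by blast
    have img: "{a \<in> U ?N. ?c a = w} = (\<lambda>h. g * blk (1\<^sub>m 1) h) ` U n"
    proof (intro equalityI subsetI)
      fix a assume "a \<in> {a \<in> U ?N. ?c a = w}"
      then have a: "a \<in> U ?N" and aw: "?c a = w" by auto
      note aD = U_D[OF a]
      have a0: "a $$ (i, 0) = g $$ (i, 0)" if "i < ?N" for i
        using aw g(2)[OF that] that by (metis (no_types, lifting) index_mat(1) less_one split_conv)
      have b: "g\<^sup>\<star> * a \<in> U (1 + n)" using mult_U[OF star_U[OF g(1)] a] by simp
      have "(g\<^sup>\<star> * a) $$ (i, j) = (if i = j then 1 else 0)" if "i < 1 + n" "j < 1" for i j
      proof -
        have "(g\<^sup>\<star> * a) $$ (i, j) = (\<Sum>l = 0..<?N. g\<^sup>\<star> $$ (i, l) * a $$ (l, j))"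
          using that gD aD by (intro mat_mult_index) auto
        also have "\<dots> = (\<Sum>l = 0..<?N. g\<^sup>\<star> $$ (i, l) * g $$ (l, j))"
          using that a0 by (intro sum.cong refl) auto
        also have "\<dots> = (g\<^sup>\<star> * g) $$ (i, j)"
          using that gD by (intro mat_mult_index[symmetric]) auto
        finally show ?thesis using gD(3) that by simp
      qed
      from U_first_cols_trivial[OF b this] obtain h where "h \<in> U n" "g\<^sup>\<star> * a = blk (1\<^sub>m 1) h" .
      moreover have "a = g * (g\<^sup>\<star> * a)" using U_cancel[OF g(1) aD(2)] by simp
      ultimately show "a \<in> (\<lambda>h. g * blk (1\<^sub>m 1) h) ` U n" by auto
    next
      fix a assume "a \<in> (\<lambda>h. g * blk (1\<^sub>m 1) h) ` U n"
      then obtain h where h: "h \<in> U n" and a: "a = g * blk (1\<^sub>m 1) h" by blast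
      note hD = U_D[OF h]
      have bU: "blk (1\<^sub>m 1) h \<in> U ?N" using blk_U_iff[OF mats_on_one hD(1), of 1] h by simp
      have "a $$ (i, 0) = w $$ (i, 0)" if "i < ?N" for i
      proof -
        have "a $$ (i, 0) = (\<Sum>l = 0..<?N. g $$ (i, l) * blk (1\<^sub>m 1) h $$ (l, 0))"
          unfolding a using that gD U_D[OF bU] by (intro mat_mult_index) auto
        also have "\<dots> = (\<Sum>l = 0..<?N. if l = 0 then g $$ (i, l) else 0)"
          using hD(2) by (intro sum.cong refl) (auto simp: blk_def)
        finally show ?thesis using g(2)[OF that] by (simp del: sum.op_ivl_Suc)
      qed
      then have "?c a = w" using wc by (intro eq_matI) auto
      then show "a \<in> {a \<in> U ?N. ?c a = w}" using mult_U[OF g(1) bU] a by simp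
    qed
    have "inj_on (\<lambda>h. g * blk (1\<^sub>m 1) h) (U n)"
    proof (rule inj_onI)
      fix h h' assume h: "h \<in> U n" "h' \<in> U n" and eq: "g * blk (1\<^sub>m 1) h = g * blk (1\<^sub>m 1) h'"
      have c: "blk (1\<^sub>m 1) h \<in> carrier_mat ?N ?N" "blk (1\<^sub>m 1) h' \<in> carrier_mat ?N ?N"
        using blk_carrier[OF one_carrier_mat[of 1] U_D(2)[OF h(1)]] blk_carrier[OF one_carrier_mat[of 1] U_D(2)[OF h(2)]] by simp_all
      have "blk (1\<^sub>m 1) h = blk (1\<^sub>m 1) h'" using arg_cong[OF eq, of "\<lambda>x. g\<^sup>\<star> * x"] U_cancel(1)[OF g(1)] c by simp
      then show "h = h'" using blk_inj(2)[OF one_carrier_mat U_D(2)[OF h(1)] one_carrier_mat U_D(2)[OF h(2)]] by simp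
    qed
    then show "card {a \<in> U ?N. ?c a = w} = card (U n)" unfolding img by (rule card_image)
  qed simp
  then show ?thesis by (simp add: norm_count_def)
qed

subsection \<open>Orders of the general linear and unitary groups\<close>

definition GL :: "nat \<Rightarrow> 'a mat set" where
  "GL n = {A \<in> mats_on n n K. det A \<noteq> 0}"

lemma GL_D: assumes "A \<in> GL n"
  shows "A \<in> mats_on n n K" "A \<in> carrier_mat n n" "det A \<noteq> 0"
  using assms mats_onD(1) by (auto simp: GL_def)

lemma GL_inverse:
  assumes A: "A \<in> GL n"
  obtains B where "B \<in> GL n" "A * B = 1\<^sub>m n" "B * A = 1\<^sub>m n"
proof -
  note AD = GL_D[OF A]
  from det_non_zero_imp_unit[OF AD(2,3), of "()"] obtain B where
    B: "B \<in> carrier_mat n n" "A * B = 1\<^sub>m n" "B * A = 1\<^sub>m n"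
    by (auto simp: Units_def ring_mat_simps)
  \<comment> \<open>Two stars raise every entry to the power \<open>q^2\<close>. This fixes
    \<open>A\<close>, so \<open>B\<close> with raised entries is again an inverse of
    \<open>A\<close> and must equal \<open>B\<close>; hence the entries of \<open>B\<close> lie in
    \<open>K\<close>.\<close>
  have "A * B\<^sup>\<star>\<^sup>\<star> = (A * B)\<^sup>\<star>\<^sup>\<star>"
    using AD(2) B(1) by (simp add: star_mult[of _ n n _ n] star_star[OF AD(1)])
  then have eq: "A * B\<^sup>\<star>\<^sup>\<star> = 1\<^sub>m n" by (simp add: B(2))
  have "B\<^sup>\<star>\<^sup>\<star> = (B * A) * B\<^sup>\<star>\<^sup>\<star>" using B by simp
  also have "\<dots> = B * (A * B\<^sup>\<star>\<^sup>\<star>)" using AD(2) B(1) by (intro assoc_mult_mat[of _ n n _ n _ n]) auto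
  finally have Bs: "B\<^sup>\<star>\<^sup>\<star> = B" using B(1) by (simp add: eq)
  have "B \<in> mats_on n n K"
  proof (rule mats_onI)
    fix i j assume ij: "i < n" "j < n"
    have "B\<^sup>\<star>\<^sup>\<star> $$ (i, j) = (B $$ (i, j) ^ q) ^ q" using ij B(1) by simp
    then show "B $$ (i, j) \<in> K" by (simp add: Bs K_iff)
  qed (rule B(1))
  moreover have "det B \<noteq> 0" using arg_cong[OF B(2), of det] AD(2) B(1) by (auto simp: det_mult[of _ n])
  ultimately show thesis using that B by (simp add: GL_def)
qed

lemma GL_mats_eq: "GL_mats n (q\<^sup>2) = GL n"
proof
  show "GL_mats n (q\<^sup>2) \<subseteq> GL n"
  proof
    fix A :: "'a mat" assume "A \<in> GL_mats n (q\<^sup>2)"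
    then obtain B where A: "A \<in> mats_on n n K" and B: "B \<in> mats_on n n K" and AB: "A * B = 1\<^sub>m (dim_row A)"
      by (auto simp: GL_mats_def mats_eq inverts_mat_def)
    have "det A * det B = det (1\<^sub>m (dim_row A))" using AB det_mult[OF mats_onD(1)[OF A] mats_onD(1)[OF B]] by simp
    then show "A \<in> GL n" using A by (auto simp: GL_def)
  qed
  show "GL n \<subseteq> GL_mats n (q\<^sup>2)"
  proof
    fix A assume A: "A \<in> GL n"
    then obtain B where "B \<in> GL n" "A * B = 1\<^sub>m n" "B * A = 1\<^sub>m n" using GL_inverse by blast
    then show "A \<in> GL_mats n (q\<^sup>2)"
      using GL_D[of B n] GL_D[OF A] by (auto simp: GL_mats_def mats_eq inverts_mat_def)
  qed
qed

lemma mult_GL: assumes "A \<in> GL n" "B \<in> GL n" shows "A * B \<in> GL n"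
proof -
  have "det (A * B) = det A * det B" using assms[THEN GL_D(2)] by (rule det_mult)
  then have "det (A * B) \<noteq> 0" using assms[THEN GL_D(3)] by simp
  then show ?thesis unfolding GL_def using mats_on_mult[OF assms[THEN GL_D(1)]] by blast
qed

lemma finite_GL [simp]: "finite (GL n)"
  by (rule finite_subset[OF _ finite_mats_on[of K n n]]) (auto simp: GL_def)

lemma one_GL [simp]: "1\<^sub>m n \<in> GL n" by (simp add: GL_def)

lemma GL_first_col:
  assumes w: "w \<in> mats_on (Suc n) 1 K" and "w \<noteq> 0\<^sub>m (Suc n) 1"
  shows "\<exists>g\<in>GL (Suc n). \<forall>i<Suc n. g $$ (i, 0) = w $$ (i, 0)"
proof -
  let ?N = "Suc n"
  have wc: "w \<in> carrier_mat ?N 1" using w by (rule mats_onD)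
  have "\<exists>k<?N. w $$ (k, 0) \<noteq> 0"
  proof (rule ccontr)
    assume "\<not> ?thesis"
    then have "w = 0\<^sub>m ?N 1" using wc by (intro eq_matI) auto
    then show False using assms(2) by simp
  qed
  then obtain k where k: "k < ?N" "w $$ (k, 0) \<noteq> 0" by blast
  \<comment> \<open>Column 0 is \<open>w\<close>; the other columns are the unit vectors with index
    different from \<open>k\<close>, where column \<open>k\<close>, if it is not column 0 itself,
    takes the index 0.\<close>
  let ?g = "mat ?N ?N (\<lambda>(r, c). if c = 0 then w $$ (r, 0) else if r = (if c = k then 0 else c) then 1 else 0)"
  have gK: "?g \<in> mats_on ?N ?N K" using mats_onD(2)[OF w] by (intro mats_onI) auto
  have "det ?g \<noteq> 0"
  proof
    assume "det ?g = 0"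
    then obtain v where v: "v \<in> carrier_vec ?N" "v \<noteq> 0\<^sub>v ?N" "?g *\<^sub>v v = 0\<^sub>v ?N"
      using det_0_iff_vec_prod_zero_field[of ?g ?N] by auto
    have eqn: "(\<Sum>c = 0..<?N. ?g $$ (r, c) * v $ c) = 0" if "r < ?N" for r
    proof -
      have "(?g *\<^sub>v v) $ r = (\<Sum>c = 0..<?N. ?g $$ (r, c) * v $ c)"
        using that v(1) by (simp add: scalar_prod_def del: sum.op_ivl_Suc)
      then show ?thesis using v(3) that by simp
    qed
    \<comment> \<open>Row \<open>r\<close> has its unit entry in column \<open>c\<close>; the
      default \<open>c = 0\<close> marks row \<open>k\<close>, which has none. So row
      \<open>k\<close> forces \<open>v $ 0 = 0\<close>, and the other rows then kill the remaining
      entries.\<close>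
    have ev: "w $$ (r, 0) * v $ 0 + (if c \<noteq> 0 then v $ c else 0) = 0"
      if "r < ?N" and c: "c = (if r = 0 then k else if r = k then 0 else r)" for r c
    proof -
      have "?g $$ (r, j) * v $ j = (if j = 0 then w $$ (r, 0) * v $ 0 else 0) + (if j = c then (if c \<noteq> 0 then v $ c else 0) else 0)"
        if "j \<in> {0..<?N}" for j
        using that \<open>r < ?N\<close> c k by (auto split: if_splits)
      then have "(\<Sum>j = 0..<?N. ?g $$ (r, j) * v $ j) =
          (\<Sum>j = 0..<?N. (if j = 0 then w $$ (r, 0) * v $ 0 else 0) + (if j = c then (if c \<noteq> 0 then v $ c else 0) else 0))"
        by (intro sum.cong refl) blast
      also have "\<dots> = w $$ (r, 0) * v $ 0 + (if c \<noteq> 0 then v $ c else 0)"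
        using that k by (simp add: sum.distrib del: sum.op_ivl_Suc split: if_splits)
      finally show ?thesis using eqn[OF that(1)] by simp
    qed
    have v0: "v $ 0 = 0" using ev[OF k(1) refl] k(2) by (cases "k = 0") auto
    have "v $ r = 0" if "r < ?N" for r
    proof -
      consider "r = 0" | "r = k" "r \<noteq> 0" | "r \<noteq> 0" "r \<noteq> k" by blast
      then show ?thesis
      proof cases
        case 2 then show ?thesis using ev[of 0, OF _ refl] v0 by simp
      next
        case 3 then show ?thesis using ev[of r, OF that refl] v0 by simp
      qed (use v0 in simp)
    qed
    then have "v = 0\<^sub>v ?N" using v(1) by (intro eq_vecI) auto
    then show False using v(2) by simp
  qed
  then have "?g \<in> GL ?N" using gK by (simp add: GL_def)
  then show ?thesis by (intro bexI[of _ ?g]) auto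
qed

text \<open>Let \<open>g\<close> be a fixed invertible matrix with first column \<open>w\<close>.
  The matrices with first column \<open>w\<close> are the products of \<open>g\<close> with block
  triangular matrices, given by a free row \<open>b\<close> and an invertible
  \<open>h\<close>.\<close>

lemma card_GL_Suc: "card (GL (Suc n)) = card (GL n) * (q\<^sup>2) ^ n * ((q\<^sup>2) ^ Suc n - 1)"
proof -
  let ?N = "Suc n"
  let ?c = "\<lambda>g::'a mat. mat ?N 1 (\<lambda>(i, j). g $$ (i, 0))"
  let ?B = "mats_on ?N 1 K - {0\<^sub>m ?N 1}"
  let ?f = "\<lambda>b h::'a mat. four_block_mat (1\<^sub>m 1) b (0\<^sub>m n 1) h"
  have cB: "card ?B = (q\<^sup>2) ^ ?N - 1"
    by (subst card_Diff_singleton) (simp_all add: card_mats_on[of K ?N 1, simplified] card_GF)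
  have "card (GL ?N) = (card (GL n) * (q\<^sup>2) ^ n) * card ?B"
  proof (rule card_constant_fibers[where f = ?c])
    show "finite ?B" by (simp add: finite_mats_on)
    show "?c ` GL ?N \<subseteq> ?B"
    proof (rule image_subsetI, rule DiffI)
      fix g assume "g \<in> GL ?N"
      note gD = GL_D[OF this]
      show "?c g \<in> mats_on ?N 1 K" using mats_onD(2)[OF gD(1)] by (intro mats_onI) auto
      show "?c g \<notin> {0\<^sub>m ?N 1}"
      proof
        assume "?c g \<in> {0\<^sub>m ?N 1}"
        then have 0: "?c g = 0\<^sub>m ?N 1" by simp
        have "g $$ (i, 0) = 0" if "i < ?N" for i using arg_cong[OF 0, of "\<lambda>A. A $$ (i, 0)"] that by simp
        then have "g *\<^sub>v unit_vec ?N 0 = 0\<^sub>v ?N" using gD(2) by (intro eq_vecI) auto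
        then have "det g = 0" using det_0_iff_vec_prod_zero_field[OF gD(2)] by (metis unit_vec_carrier unit_vec_nonzero zero_less_Suc)
        then show False using gD(3) by simp
      qed
    qed
    fix w assume w: "w \<in> ?B"
    then obtain g where g: "g \<in> GL ?N" "\<And>i. i < ?N \<Longrightarrow> g $$ (i, 0) = w $$ (i, 0)"
      using GL_first_col by blast
    note gD = GL_D[OF g(1)]
    obtain gi where gi: "gi \<in> GL ?N" "g * gi = 1\<^sub>m ?N" "gi * g = 1\<^sub>m ?N" using GL_inverse[OF g(1)] .
    note giD = GL_D[OF gi(1)]
    have wc: "w \<in> carrier_mat ?N 1" using w mats_onD(1) by blast
    have fGL: "?f b h \<in> GL ?N" if "b \<in> mats_on 1 n K" "h \<in> GL n" for b h
    proof -
      have "det (?f b h) = det (1\<^sub>m 1) * det h"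
        using mats_onD(1)[OF that(1)] GL_D[OF that(2)] by (intro det_four_block_mat_lower_left_zero) auto
      moreover have "?f b h \<in> mats_on (1 + n) (1 + n) K"
        using GL_D[OF that(2)] that(1) by (intro mats_on_four_block) auto
      ultimately show ?thesis using GL_D[OF that(2)] by (simp add: GL_def)
    qed
    have img: "{a \<in> GL ?N. ?c a = w} = (\<lambda>(b, h). g * ?f b h) ` (mats_on 1 n K \<times> GL n)"
    proof (intro equalityI subsetI)
      fix a assume "a \<in> {a \<in> GL ?N. ?c a = w}"
      then have a: "a \<in> GL ?N" and aw: "?c a = w" by auto
      note aD = GL_D[OF a]
      have a0: "a $$ (i, 0) = g $$ (i, 0)" if "i < ?N" for i
        using aw g(2)[OF that] that by (metis (no_types, lifting) index_mat(1) less_one split_conv)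
      let ?k = "gi * a"
      have k: "?k \<in> GL ?N" using mult_GL[OF gi(1) a] .
      note kD = GL_D[OF k]
      have k0: "?k $$ (i, 0) = (if i = 0 then 1 else 0)" if "i < ?N" for i
      proof -
        have "?k $$ (i, 0) = (\<Sum>l = 0..<?N. gi $$ (i, l) * a $$ (l, 0))"
          using that giD(2) aD(2) by (intro mat_mult_index) auto
        also have "\<dots> = (\<Sum>l = 0..<?N. gi $$ (i, l) * g $$ (l, 0))"
          using that a0 by (intro sum.cong refl) auto
        also have "\<dots> = (gi * g) $$ (i, 0)"
          using that gD(2) giD(2) by (intro mat_mult_index[symmetric]) auto
        finally show ?thesis using gi(3) that by simp
      qed
      let ?b = "mat 1 n (\<lambda>(i, j). ?k $$ (0, Suc j))" and ?h = "mat n n (\<lambda>(i, j). ?k $$ (Suc i, Suc j))"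
      have keq: "?k = ?f ?b ?h"
        using aD(2) giD(2) k0 by (intro eq_matI) (auto simp del: index_mult_mat(1))
      have bK: "?b \<in> mats_on 1 n K" using mats_onD(2)[OF kD(1)] by (intro mats_onI) (auto simp del: index_mult_mat(1))
      have hK: "?h \<in> mats_on n n K" using mats_onD(2)[OF kD(1)] by (intro mats_onI) (auto simp del: index_mult_mat(1))
      have "det ?k = det (1\<^sub>m 1 :: 'a mat) * det ?h"
        by (subst keq, rule det_four_block_mat_lower_left_zero) auto
      then have "?h \<in> GL n" using hK kD(3) by (simp add: GL_def)
      moreover have "a = g * ?k"
        using gD(2) giD(2) aD(2) gi(2) by (simp flip: assoc_mult_mat[of _ ?N ?N _ ?N _ ?N])
      ultimately show "a \<in> (\<lambda>(b, h). g * ?f b h) ` (mats_on 1 n K \<times> GL n)"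
        using bK keq by (intro image_eqI[of _ _ "(?b, ?h)"]) auto
    next
      fix a assume "a \<in> (\<lambda>(b, h). g * ?f b h) ` (mats_on 1 n K \<times> GL n)"
      then obtain b h where b: "b \<in> mats_on 1 n K" and h: "h \<in> GL n" and a: "a = g * ?f b h" by auto
      note f = fGL[OF b h]
      have "a $$ (i, 0) = w $$ (i, 0)" if "i < ?N" for i
      proof -
        have "a $$ (i, 0) = (\<Sum>l = 0..<?N. g $$ (i, l) * ?f b h $$ (l, 0))"
          unfolding a using that gD(2) GL_D(2)[OF f] by (intro mat_mult_index) auto
        also have "\<dots> = (\<Sum>l = 0..<?N. if l = 0 then g $$ (i, l) else 0)"
          using GL_D(2)[OF h] mats_onD(1)[OF b] by (intro sum.cong refl) auto
        finally show ?thesis using g(2)[OF that] by (simp del: sum.op_ivl_Suc)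
      qed
      then have "?c a = w" using wc by (intro eq_matI) auto
      then show "a \<in> {a \<in> GL ?N. ?c a = w}" using mult_GL[OF g(1) f] a by simp
    qed
    have "inj_on (\<lambda>(b, h). g * ?f b h) (mats_on 1 n K \<times> GL n)"
    proof (rule inj_onI, clarify)
      fix b h b' h' assume b: "b \<in> mats_on 1 n K" "b' \<in> mats_on 1 n K" and h: "h \<in> GL n" "h' \<in> GL n"
        and eq: "g * ?f b h = g * ?f b' h'"
      have c: "?f b h \<in> carrier_mat ?N ?N" "?f b' h' \<in> carrier_mat ?N ?N"
        using GL_D(2)[OF fGL] b h by auto
      have "gi * (g * M) = M" if "M \<in> carrier_mat ?N ?N" for M
        using that gD(2) giD(2) gi(3) by (simp flip: assoc_mult_mat[of _ ?N ?N _ ?N _ ?N])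
      with arg_cong[OF eq, of "\<lambda>x. gi * x"] c have eq: "?f b h = ?f b' h'" by simp
      have d: "b \<in> carrier_mat 1 n" "b' \<in> carrier_mat 1 n" "h \<in> carrier_mat n n" "h' \<in> carrier_mat n n"
        using b h mats_onD(1) GL_D(2) by auto
      have "b $$ (0, j) = b' $$ (0, j)" if "j < n" for j
        using arg_cong[OF eq, of "\<lambda>M. M $$ (0, Suc j)"] that d by simp
      moreover have "h $$ (i, j) = h' $$ (i, j)" if "i < n" "j < n" for i j
        using arg_cong[OF eq, of "\<lambda>M. M $$ (Suc i, Suc j)"] that d by simp
      ultimately show "b = b' \<and> h = h'" using d by (auto intro!: eq_matI)
    qed
    from card_image[OF this] show "card {a \<in> GL ?N. ?c a = w} = card (GL n) * (q\<^sup>2) ^ n"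
      unfolding img by (simp add: card_cartesian_product card_mats_on[of K 1 n, simplified] card_GF)
  qed simp
  then show ?thesis unfolding cB .
qed

text \<open>One step in \<open>j\<close> of a factor of the product formula. The multiplier has the
  shape of the one in the Hermitian recursion, with sign 1.\<close>

lemma quotient_GL_Suc:
  "real ((q\<^sup>2) ^ (Suc j * (Suc j - 1))) / real (card (GL (Suc j)))
    = real ((q\<^sup>2) ^ (j * (j - 1))) / real (card (GL j)) * (real (q\<^sup>2) ^ j / (real (q\<^sup>2) ^ Suc j - 1))"
proof -
  let ?Q = "q\<^sup>2"
  have Q: "1 < ?Q" using q_gt_1 by (simp add: power2_eq_square) (metis One_nat_def less_1_mult)
  have "1 \<le> ?Q ^ Suc j" using q_gt_1 by (intro one_le_power) simp
  then have "real (card (GL (Suc j))) = real (card (GL j)) * real ?Q ^ j * (real ?Q ^ Suc j - 1)"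
    unfolding card_GL_Suc by (simp add: of_nat_diff)
  moreover have "Suc j * (Suc j - 1) = j * (j - 1) + 2 * j" by (cases j) auto
  then have "real (?Q ^ (Suc j * (Suc j - 1))) = real (?Q ^ (j * (j - 1))) * real ?Q ^ j * real ?Q ^ j"
    by (simp add: power_add mult_2)
  moreover have "a * r * r / (c * r * d) = a / c * (r / d)" if "r \<noteq> 0" for a r c d :: real
    using that by simp
  ultimately show ?thesis using Q by simp
qed

text \<open>The unitary counterpart, with multiplier carrying the sign
  \<open>(-1) ^ Suc j\<close>.\<close>

lemma quotient_U_Suc:
  "real (q ^ (Suc j * (Suc j - 1))) / real (card (U (Suc j)))
    = real (q ^ (j * (j - 1))) / real (card (U j)) * (real q ^ j / (real q ^ Suc j - (-1) ^ Suc j))"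
proof -
  have "real_of_int (int q * int (norm_count (Suc j) 1)) = real_of_int (int q ^ Suc j * (int q ^ Suc j - (-1) ^ Suc j))"
    by (simp only: norm_count_one)
  then have "real q * real (norm_count (Suc j) 1) = real q * (real q ^ j * (real q ^ Suc j - (-1) ^ Suc j))"
    by (simp add: algebra_simps)
  then have nc: "real (norm_count (Suc j) 1) = real q ^ j * (real q ^ Suc j - (-1) ^ Suc j)"
    using q_gt_1 by (subst (asm) mult_cancel_left) auto
  have "Suc j * (Suc j - 1) = j * (j - 1) + 2 * j" by (cases j) auto
  then have "real (q ^ (Suc j * (Suc j - 1))) = real (q ^ (j * (j - 1))) * real q ^ j * real q ^ j"
    by (simp add: power_add mult_2)
  moreover have "a * r * r / (c * (r * d)) = a / c * (r / d)" if "r \<noteq> 0" for a r c d :: real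
    using that by simp
  ultimately show ?thesis unfolding card_U_Suc of_nat_mult nc using q_gt_1 by simp
qed

lemma card_dim_0: "card (U 0) = 1" "card (GL 0) = 1"
proof -
  have *: "mats_on 0 0 K = {1\<^sub>m 0}" by (auto simp: mats_on_def elements_mat_def)
  have "U 0 = {1\<^sub>m 0}" "GL 0 = {1\<^sub>m 0}"
    using one_U[of 0] one_GL[of 0] unfolding U_def GL_def * by auto
  then show "card (U 0) = 1" "card (GL 0) = 1" by simp_all
qed

end

subsection \<open>Finite subfields of an algebraically closed field\<close>

text \<open>\<open>X^Q - X\<close> splits, and its derivative is -1 because the characteristic
  divides \<open>Q\<close>; so no root is repeated and there are \<open>Q\<close> of them.\<close>

lemma card_GF_alg_closed:
  assumes "Factorial_Ring.prime CHAR('b::alg_closed_field)" "Q = CHAR('b) ^ k" "0 < k"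
  shows "card (GF Q :: 'b set) = Q"
proof -
  let ?p = "monom 1 Q - [:0, 1:] :: 'b poly"
  have Q: "1 < Q" using assms by (metis one_less_power prime_gt_1_nat)
  have deg: "degree ?p = Q" using Q by (intro antisym degree_le le_degree) (auto simp: coeff_pCons split: nat.splits)
  then have p0: "?p \<noteq> 0" using Q by auto
  have lc: "lead_coeff ?p = 1" unfolding deg using Q by (auto simp: coeff_pCons split: nat.splits)
  obtain A where A: "size A = Q" "?p = (\<Prod>x\<in>#A. [:- x, 1:])"
    using alg_closed_imp_factorization[OF p0] unfolding deg lc[unfolded deg] by auto
  have "CHAR('b) dvd Q" using assms by (simp add: dvd_power)
  then have Q0: "of_nat Q = (0::'b)" by (simp add: of_nat_eq_0_iff_char_dvd)
  have der: "pderiv ?p = - 1" by (simp add: pderiv_diff pderiv_monom Q0 pderiv_pCons one_pCons)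
  have "count A x \<le> 1" for x
  proof (rule ccontr)
    assume "\<not> count A x \<le> 1"
    then have "{#x, x#} \<subseteq># A" by (simp add: subseteq_mset_def)
    then obtain B where "A = {#x, x#} + B" by (metis subset_mset.le_iff_add)
    then have "?p = [:- x, 1:] * ([:- x, 1:] * (\<Prod>x\<in>#B. [:- x, 1:]))" using A(2) by simp
    then have "poly (pderiv ?p) x = poly (pderiv ([:- x, 1:] * ([:- x, 1:] * (\<Prod>x\<in>#B. [:- x, 1:])))) x"
      by (simp only:)
    also have "\<dots> = 0" by (simp only: pderiv_mult poly_add poly_mult) simp
    finally show False unfolding der by simp
  qed
  moreover have "count A x \<ge> 1" if "x \<in># A" for x using that by simp
  ultimately have c1: "count A x = 1" if "x \<in># A" for x using that by (meson le_antisym)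
  have "size A = (\<Sum>x\<in>set_mset A. count A x)" by (simp add: size_multiset_overloaded_eq)
  also have "\<dots> = card (set_mset A)" using c1 by simp
  finally have "card (set_mset A) = Q" using A(1) by simp
  moreover have "set_mset A = GF Q"
  proof -
    have "x \<in> GF Q \<longleftrightarrow> poly ?p x = 0" for x by (simp add: GF_def poly_monom)
    then show ?thesis unfolding A(2) by (auto simp: poly_prod_mset prod_mset_zero_iff)
  qed
  ultimately show ?thesis by simp
qed

text \<open>Fermat's argument: multiplication by a nonzero \<open>x\<close> permutes the nonzero
  elements, so their product is unchanged by the factor \<open>x ^ (CARD('a) - 1)\<close>.\<close>

lemma power_card_field:
  fixes x :: "'a::field"
  assumes "finite (UNIV :: 'a set)"
  shows "x ^ CARD('a) = x"
proof (cases "x = 0")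
  case True
  then show ?thesis using assms by (simp add: power_0_left)
next
  case False
  let ?P = "\<Prod>y\<in>UNIV-{0::'a}. y"
  have "(\<Prod>y\<in>UNIV-{0}. x * y) = ?P"
    by (rule prod.reindex_bij_witness[of _ "\<lambda>y. y / x" "\<lambda>y. x * y"]) (use False in auto)
  moreover have "(\<Prod>y\<in>UNIV-{0}. x * y) = x ^ (CARD('a) - 1) * ?P"
    by (simp add: prod.distrib)
  moreover have "?P \<noteq> 0" using assms by simp
  ultimately have "x ^ (CARD('a) - 1) = 1" by simp
  moreover have "x ^ CARD('a) = x * x ^ (CARD('a) - 1)"
    using assms by (metis card_gt_0_iff empty_not_UNIV power_minus_mult mult.commute)
  ultimately show ?thesis by simp
qed

lemma CHAR_of_card_primepow:
  assumes "primepow q" "CARD('a::field) = q\<^sup>2"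
  obtains e where "Factorial_Ring.prime CHAR('a)" "0 < e" "q = CHAR('a) ^ e"
proof -
  obtain p e where p: "Factorial_Ring.prime p" "0 < e" "q = p ^ e" using assms(1) by (auto simp: primepow_def)
  have fin: "finite (UNIV :: 'a set)"
    using assms p by (metis card_ge_0_finite prime_gt_0_nat zero_less_power)
  have pr: "Factorial_Ring.prime CHAR('a)" using finite_imp_CHAR_pos[OF fin] prime_CHAR_semidom by blast
  have "CHAR('a) dvd q\<^sup>2" using CHAR_dvd_CARD[where ?'a='a] assms(2) by simp
  then have "CHAR('a) dvd p" using pr p(3) by (metis prime_dvd_power)
  then have "CHAR('a) = p" using pr p(1) by (metis primes_dvd_imp_eq)
  then show thesis using that p pr by blast
qed

lemma hermitian_field_finite:
  assumes "primepow q" "CARD('a::field) = q\<^sup>2"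
  shows "hermitian_field TYPE('a) q"
proof -
  obtain e where e: "Factorial_Ring.prime CHAR('a)" "0 < e" "q = CHAR('a) ^ e" using CHAR_of_card_primepow[OF assms] .
  have q: "1 < q" using e by (metis one_less_power prime_gt_1_nat)
  have fin: "finite (UNIV :: 'a set)" using assms(2) q by (intro card_ge_0_finite) simp
  have "GF (q\<^sup>2) = (UNIV :: 'a set)"
    using power_card_field[OF fin] assms(2) by (auto simp: GF_def)
  then show ?thesis using q assms(2) freshmans_dream'[OF e(1,3)] by unfold_locales auto
qed

text \<open>Provides the extensions with \<open>q^(2m)\<close> elements inside one algebraic
  closure, over which the group orders of the formula are taken.\<close>

lemma hermitian_field_alg_closure:
  assumes "primepow q" "CARD('a::field) = q\<^sup>2" "0 < m"
  shows "hermitian_field TYPE('a alg_closure) (q ^ m)"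
proof -
  obtain e where e: "Factorial_Ring.prime CHAR('a)" "0 < e" "q = CHAR('a) ^ e" using CHAR_of_card_primepow[OF assms(1,2)] .
  have q: "1 < q" using e by (metis one_less_power prime_gt_1_nat)
  have pr: "Factorial_Ring.prime CHAR('a alg_closure)" using e(1) by simp
  have qm: "q ^ m = CHAR('a alg_closure) ^ (e * m)" using e(3) by (simp add: power_mult)
  have qm2: "(q ^ m)\<^sup>2 = CHAR('a alg_closure) ^ (e * m * 2)" unfolding qm by (simp add: power_mult)
  have "card (GF ((q ^ m)\<^sup>2) :: 'a alg_closure set) = (q ^ m)\<^sup>2"
    by (rule card_GF_alg_closed[OF pr qm2]) (use e(2) assms(3) in simp)
  moreover have "1 < q ^ m" using q assms(3) by (rule one_less_power)
  ultimately show ?thesis using freshmans_dream'[OF pr qm] by unfold_locales auto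
qed

subsection \<open>Polynomials evaluated at a matrix\<close>

definition pm :: "'a::field poly \<Rightarrow> 'a mat \<Rightarrow> 'a mat" where
  "pm p A = fold_coeffs (\<lambda>c M. c \<cdot>\<^sub>m 1\<^sub>m (dim_row A) + A * M) p (0\<^sub>m (dim_row A) (dim_row A))"

lemma pm_0 [simp]: "A \<in> carrier_mat n n \<Longrightarrow> pm 0 A = 0\<^sub>m n n"
  by (simp add: pm_def)

lemma pm_pCons:
  assumes "A \<in> carrier_mat n n"
  shows "pm (pCons a p) A = a \<cdot>\<^sub>m 1\<^sub>m n + A * pm p A"
proof (cases "a = 0 \<and> p = 0")
  case True
  have "(0 :: 'a) \<cdot>\<^sub>m 1\<^sub>m n + A * 0\<^sub>m n n = 0\<^sub>m n n" using assms by (intro eq_matI) auto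
  then show ?thesis using True assms by simp
next
  case False
  then show ?thesis using assms
    by (cases "a = 0") (auto simp: pm_def fold_coeffs_pCons_coeff_not_0_eq fold_coeffs_pCons_not_0_0_eq)
qed

lemma pm_carrier: "A \<in> carrier_mat n n \<Longrightarrow> pm p A \<in> carrier_mat n n"
  by (induction p) (auto simp: pm_pCons)

lemma pm_dim [simp]: "dim_row (pm p A) = dim_row A" "dim_col (pm p A) = dim_row A"
proof -
  have "dim_row (pm p A) = dim_row A \<and> dim_col (pm p A) = dim_row A"
    unfolding pm_def
  proof (induction p)
    case (pCons a p)
    then show ?case
      by (cases "a = 0") (auto simp: fold_coeffs_pCons_coeff_not_0_eq fold_coeffs_pCons_not_0_0_eq)
  qed simp
  then show "dim_row (pm p A) = dim_row A" "dim_col (pm p A) = dim_row A" by auto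
qed

lemma pm_const [simp]: "A \<in> carrier_mat n n \<Longrightarrow> pm [:c:] A = c \<cdot>\<^sub>m 1\<^sub>m n"
  by (simp add: pm_pCons)

lemma pm_one [simp]: "A \<in> carrier_mat n n \<Longrightarrow> pm 1 A = 1\<^sub>m n"
  by (simp add: one_pCons) (intro eq_matI, auto)

lemma pm_X [simp]: "A \<in> carrier_mat n n \<Longrightarrow> pm [:0, 1:] A = A"
  by (simp add: pm_pCons) (intro eq_matI, auto)

lemma pm_add: 
  assumes A: "A \<in> carrier_mat n n"
  shows "pm (p + r) A = pm p A + pm r A"
proof (induction p r rule: poly_induct2)
  case (pCons a p b r)
  have "(a + b) \<cdot>\<^sub>m 1\<^sub>m n + A * (pm p A + pm r A) = (a \<cdot>\<^sub>m 1\<^sub>m n + A * pm p A) + (b \<cdot>\<^sub>m 1\<^sub>m n + A * pm r A)"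
    using A pm_carrier[OF A, of p] pm_carrier[OF A, of r]
    by (subst mult_add_distrib_mat[of _ n n _ n]) (auto simp: algebra_simps intro!: eq_matI)
  then show ?case using A pCons by (simp add: pm_pCons)
qed (use A in simp)

lemma pm_smult:
  assumes A: "A \<in> carrier_mat n n"
  shows "pm (smult c p) A = c \<cdot>\<^sub>m pm p A"
proof (induction p)
  case 0
  then show ?case using A by simp
next
  case (pCons a p)
  have "(c * a) \<cdot>\<^sub>m 1\<^sub>m n + A * (c \<cdot>\<^sub>m pm p A) = c \<cdot>\<^sub>m (a \<cdot>\<^sub>m 1\<^sub>m n + A * pm p A)"
    using A pm_carrier[OF A, of p]
    by (subst mult_smult_distrib[of _ n n _ n]) (auto simp: algebra_simps intro!: eq_matI)
  then show ?case using A pCons by (simp add: pm_pCons)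
qed

lemma pm_uminus: "A \<in> carrier_mat n n \<Longrightarrow> pm (- p) A = - pm p A"
  using pm_smult[of A n "-1" p] by (intro eq_matI) auto

lemma pm_diff:
  assumes "A \<in> carrier_mat n n"
  shows "pm (p - r) A = pm p A - pm r A"
  using pm_add[OF assms, of p "- r"] pm_carrier[OF assms, of p] pm_carrier[OF assms, of r]
  by (simp add: pm_uminus[OF assms]) (intro eq_matI, use assms in auto)

lemma pm_mult:
  assumes A: "A \<in> carrier_mat n n"
  shows "pm (p * r) A = pm p A * pm r A"
proof (induction p)
  case 0
  then show ?case using A pm_carrier[OF A, of r] by simp
next
  case (pCons a p)
  note c = pm_carrier[OF A]
  have "pm (pCons a p * r) A = a \<cdot>\<^sub>m pm r A + A * (pm p A * pm r A)"
    using A pCons c[of "p * r"] c[of p] c[of r]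
    by (simp add: pm_add pm_smult pm_pCons) (intro eq_matI, auto simp del: index_mult_mat(1))
  also have "\<dots> = (a \<cdot>\<^sub>m 1\<^sub>m n + A * pm p A) * pm r A"
    using A c[of p] c[of r] by (simp add: add_mult_distrib_mat[of _ n n _ _ n] mult_smult_assoc_mat[of _ n n _ n] assoc_mult_mat[of _ n n _ n _ n])
  finally show ?case using A by (simp add: pm_pCons)
qed

lemma pm_commute:
  assumes "A \<in> carrier_mat n n"
  shows "pm p A * pm r A = pm r A * pm p A"
  by (simp add: mult.commute flip: pm_mult[OF assms])

lemma pm_power_mat: "A \<in> carrier_mat n n \<Longrightarrow> pm (monom 1 k) A = A ^\<^sub>m k"
proof (induction k)
  case 0
  then show ?case by (simp add: monom_0) (auto intro!: eq_matI)
next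
  case (Suc k)
  have "pm (monom 1 k * [:0, 1:]) A = A ^\<^sub>m k * A" using Suc by (simp only: pm_mult pm_X)
  then show ?case by (simp add: monom_Suc)
qed

lemma pm_similar:
  assumes A: "A \<in> carrier_mat n n" and g: "g \<in> carrier_mat n n" "h \<in> carrier_mat n n" "h * g = 1\<^sub>m n" "g * h = 1\<^sub>m n"
  shows "pm p (g * A * h) = g * pm p A * h"
proof (induction p)
  case 0
  then show ?case using A g(1,2) by (simp add: pm_0[of _ n])
next
  case (pCons a p)
  have c: "g * A * h \<in> carrier_mat n n" using A g by simp
  have P: "pm p A \<in> carrier_mat n n" using A by (rule pm_carrier)
  have "(g * A * h) * (g * pm p A * h) = g * (A * pm p A) * h"
  proof -
    have "h * (g * (pm p A * h)) = (h * g) * (pm p A * h)"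
      using g(1,2) P by (intro assoc_mult_mat[of h n n g n "pm p A * h" n, symmetric]) auto
    then have "h * (g * (pm p A * h)) = pm p A * h" unfolding g(3) using g(2) P left_mult_one_mat[of "pm p A * h" n n] by simp
    moreover have "(g * A * h) * (g * pm p A * h) = g * (A * (h * (g * (pm p A * h))))"
      using A g(1,2) P by (simp add: assoc_mult_mat[of _ n n _ n _ n])
    ultimately show ?thesis using A g(1,2) P by (simp add: assoc_mult_mat[of _ n n _ n _ n])
  qed
  moreover have "g * (a \<cdot>\<^sub>m 1\<^sub>m n + A * pm p A) * h = a \<cdot>\<^sub>m (g * h) + g * (A * pm p A) * h"
    using A g(1,2) P by (simp add: mult_add_distrib_mat[of _ n n _ n] add_mult_distrib_mat[of _ n n _ _ n]
      mult_smult_distrib[of _ n n _ n] mult_smult_assoc_mat[of _ n n _ n])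
  ultimately show ?case using pCons c A by (simp add: pm_pCons g(4))
qed

lemma pm_blk:
  assumes A: "A \<in> carrier_mat m m" and D: "D \<in> carrier_mat n n"
  shows "pm p (blk A D) = blk (pm p A) (pm p D)"
proof (induction p)
  case 0
  show ?case using A D blk_carrier[OF A D] by (simp add: pm_0[of _ "m + n"] blk_def)
next
  case (pCons a p)
  note c = blk_carrier[OF A D] and P = pm_carrier[OF A, of p] pm_carrier[OF D, of p]
  have "blk A D * blk (pm p A) (pm p D) = blk (A * pm p A) (D * pm p D)"
    using blk_mult[OF A D P] .
  moreover have "a \<cdot>\<^sub>m 1\<^sub>m (m + n) + blk (A * pm p A) (D * pm p D) = blk (a \<cdot>\<^sub>m 1\<^sub>m m + A * pm p A) (a \<cdot>\<^sub>m 1\<^sub>m n + D * pm p D)"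
    using A D P by (intro eq_matI) (auto simp: blk_def simp del: index_mult_mat(1))
  ultimately show ?case using pCons c A D by (simp add: pm_pCons)
qed

abbreviation cmat :: "'a::comm_ring_1 mat \<Rightarrow> 'a poly mat" where
  "cmat \<equiv> map_mat (\<lambda>a. [:a:])"

lemma cmat_mult: "A \<in> carrier_mat r n \<Longrightarrow> B \<in> carrier_mat n c \<Longrightarrow> cmat (A * B) = cmat A * cmat B"
  by (rule map_poly_mult(1))

lemma char_poly_matrix_eq: "A \<in> carrier_mat n n \<Longrightarrow> char_poly_matrix A = [:0, 1:] \<cdot>\<^sub>m 1\<^sub>m n - cmat A"
  by (intro eq_matI) (auto simp: char_poly_matrix_def)

text \<open>The quotient \<open>C = (p(x) - p(A)) / (x - A)\<close> is a combination of powers of \<open>A\<close>; the last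
  clause is the only trace of this that is needed.\<close>

lemma char_poly_matrix_quotient:
  assumes A: "A \<in> carrier_mat n n"
  shows "\<exists>C \<in> carrier_mat n n. char_poly_matrix A * C = p \<cdot>\<^sub>m 1\<^sub>m n - cmat (pm p A)
    \<and> (\<forall>u \<in> carrier_mat 1 n. \<forall>v \<in> carrier_mat n 1.
         (\<forall>r. u * pm r A * v = 0\<^sub>m 1 1) \<longrightarrow> cmat u * C * cmat v = 0\<^sub>m 1 1)"
proof (induction p)
  case 0
  have "char_poly_matrix A * 0\<^sub>m n n = 0\<^sub>m n n" using char_poly_matrix_closed[OF A] by simp
  moreover have "0\<^sub>m n n = 0 \<cdot>\<^sub>m 1\<^sub>m n - cmat (pm 0 A)" using A by (intro eq_matI) auto
  moreover have "cmat u * 0\<^sub>m n n * cmat v = 0\<^sub>m 1 1" if "u \<in> carrier_mat 1 n" "v \<in> carrier_mat n 1" for u v :: "'a mat"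
  proof -
    have "cmat u \<in> carrier_mat 1 n" "cmat v \<in> carrier_mat n 1" using that by auto
    then show ?thesis by simp
  qed
  ultimately have "char_poly_matrix A * 0\<^sub>m n n = 0 \<cdot>\<^sub>m 1\<^sub>m n - cmat (pm 0 A)
    \<and> (\<forall>u \<in> carrier_mat 1 n. \<forall>v \<in> carrier_mat n 1.
         (\<forall>r. u * pm r A * v = 0\<^sub>m 1 1) \<longrightarrow> cmat u * 0\<^sub>m n n * cmat v = 0\<^sub>m 1 1)" by metis
  then show ?case by (rule bexI) simp
next
  case (pCons a p)
  let ?M = "char_poly_matrix A" and ?X = "[:0, 1:] :: 'a poly"
  have M: "?M \<in> carrier_mat n n" using A by simp
  from pCons obtain C where C: "C \<in> carrier_mat n n" "?M * C = p \<cdot>\<^sub>m 1\<^sub>m n - cmat (pm p A)"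
    and C0: "\<And>u v. u \<in> carrier_mat 1 n \<Longrightarrow> v \<in> carrier_mat n 1 \<Longrightarrow> (\<And>r. u * pm r A * v = 0\<^sub>m 1 1)
       \<Longrightarrow> cmat u * C * cmat v = 0\<^sub>m 1 1" by blast
  have P: "pm p A \<in> carrier_mat n n" using A by (rule pm_carrier)
  \<comment> \<open>Horner step: \<open>(a + x p) - (a + A p(A))\<close> equals
    \<open>x (p - p(A)) + (x - A) p(A)\<close>, and both summands are multiples of
    \<open>x - A\<close>.\<close>
  let ?C = "?X \<cdot>\<^sub>m C + cmat (pm p A)"
  have "?M * cmat (pm p A) = ?X \<cdot>\<^sub>m cmat (pm p A) - cmat (A * pm p A)"
    unfolding char_poly_matrix_eq[OF A] using A P
    by (simp add: minus_mult_distrib_mat[of _ n n _ _ n] mult_smult_assoc_mat[of _ n n _ n] cmat_mult[OF A P]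
      left_mult_one_mat[of "cmat (pm p A)" n n])
  then have "?M * ?C = ?X \<cdot>\<^sub>m (p \<cdot>\<^sub>m 1\<^sub>m n - cmat (pm p A)) + (?X \<cdot>\<^sub>m cmat (pm p A) - cmat (A * pm p A))"
    using M P C by (simp add: mult_add_distrib_mat[of _ n n _ n] mult_smult_distrib[of _ n n _ n])
  also have "\<dots> = pCons a p \<cdot>\<^sub>m 1\<^sub>m n - cmat (pm (pCons a p) A)"
    using A P by (intro eq_matI) (auto simp: pm_pCons simp del: index_mult_mat(1))
  finally have 1: "?M * ?C = pCons a p \<cdot>\<^sub>m 1\<^sub>m n - cmat (pm (pCons a p) A)" .
  have 2: "cmat u * ?C * cmat v = 0\<^sub>m 1 1"
    if u: "u \<in> carrier_mat 1 n" and v: "v \<in> carrier_mat n 1" and r: "\<And>r. u * pm r A * v = 0\<^sub>m 1 1" for u v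
  proof -
    have cu: "cmat u \<in> carrier_mat 1 n" "cmat v \<in> carrier_mat n 1" "cmat (pm p A) \<in> carrier_mat n n" using u v P by auto
    have "cmat u * ?C * cmat v = ?X \<cdot>\<^sub>m (cmat u * C * cmat v) + cmat u * cmat (pm p A) * cmat v"
      using cu C(1) by (simp add: mult_add_distrib_mat[of _ 1 n _ n] add_mult_distrib_mat[of _ 1 n _ _ 1]
         mult_smult_distrib[of _ 1 n _ n] mult_smult_assoc_mat[of _ 1 n _ 1])
    also have "cmat u * cmat (pm p A) * cmat v = cmat (u * pm p A * v)"
      using u v P by (simp add: cmat_mult[of _ n n _ 1] cmat_mult[of _ 1 n _ 1])
    also have "\<dots> = 0\<^sub>m 1 1" unfolding r by (intro eq_matI) auto
    also have "cmat u * C * cmat v = 0\<^sub>m 1 1" using C0[OF u v r] .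
    finally show ?thesis by (simp) 
  qed
  show ?case using 1 2 C(1) P by (intro bexI[of _ ?C]) auto
qed

text \<open>With the quotient \<open>C\<close> and the adjugate \<open>J\<close> of
  \<open>x - A\<close>, the product \<open>(x - A) (J - C)\<close> is the constant matrix
  \<open>p(A)\<close>. A nonzero \<open>J - C\<close> would make this product have positive degree,
  so both vanish.\<close>

lemma Cayley_Hamilton:
  assumes A: "A \<in> carrier_mat n n"
  shows "pm (char_poly A) A = 0\<^sub>m n n"
proof -
  let ?M = "char_poly_matrix A" and ?p = "char_poly A"
  have M: "?M \<in> carrier_mat n n" using A by simp
  let ?P = "pm ?p A"
  have P: "?P \<in> carrier_mat n n" using A by (rule pm_carrier)
  obtain C where C: "C \<in> carrier_mat n n" "?M * C = ?p \<cdot>\<^sub>m 1\<^sub>m n - cmat ?P"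
    using char_poly_matrix_quotient[OF A] by blast
  let ?J = "adj_mat ?M"
  have J: "?J \<in> carrier_mat n n" "?M * ?J = ?p \<cdot>\<^sub>m 1\<^sub>m n" using adj_mat[OF M] by (auto simp: char_poly_def)
  let ?D = "?J - C"
  have D: "?D \<in> carrier_mat n n" using C J by auto
  have MD: "?M * ?D = cmat ?P"
    using mult_minus_distrib_mat[OF M J(1) C(1)] J C P by (auto intro!: eq_matI)
  have entry: "[:?P $$ (i, j):] = pCons 0 (?D $$ (i, j)) - (\<Sum>l = 0..<n. smult (A $$ (i, l)) (?D $$ (l, j)))"
    if ij: "i < n" "j < n" for i j
  proof -
    have "[:?P $$ (i, j):] = (?M * ?D) $$ (i, j)" unfolding MD using A ij by simp
    also have "\<dots> = (\<Sum>l = 0..<n. ?M $$ (i, l) * ?D $$ (l, j))" using M D ij by (rule mat_mult_index)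
    also have "\<dots> = (\<Sum>l = 0..<n. (if l = i then pCons 0 (?D $$ (l, j)) else 0) - smult (A $$ (i, l)) (?D $$ (l, j)))"
      using A ij by (intro sum.cong refl) (auto simp: char_poly_matrix_eq algebra_simps)
    finally show ?thesis using ij by (simp add: sum_subtractf)
  qed
  have D0: "?D $$ (i, j) = 0" if ij: "i < n" "j < n" for i j
  proof (rule ccontr)
    assume ne: "?D $$ (i, j) \<noteq> 0"
    let ?S = "(\<lambda>(i, j). degree (?D $$ (i, j))) ` {(i, j). i < n \<and> j < n \<and> ?D $$ (i, j) \<noteq> 0}"
    have "finite {(i, j). i < n \<and> j < n \<and> ?D $$ (i, j) \<noteq> 0}"
      by (rule finite_subset[of _ "{..<n} \<times> {..<n}"]) auto
    then have fS: "finite ?S" "?S \<noteq> {}" using ij ne by auto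
    define d where "d = Max ?S"
    have "d \<in> ?S" unfolding d_def using fS by (rule Max_in)
    then obtain k l where kl: "k < n" "l < n" "?D $$ (k, l) \<noteq> 0" "d = degree (?D $$ (k, l))" by auto
    have le: "degree (?D $$ (i, j)) \<le> d" if "i < n" "j < n" for i j
    proof (cases "?D $$ (i, j) = 0")
      case False
      then have "degree (?D $$ (i, j)) \<in> ?S" using that by (intro image_eqI[of _ _ "(i, j)"]) auto
      then show ?thesis unfolding d_def using fS(1) by (intro Max_ge)
    qed simp
    \<comment> \<open>Compare coefficients at \<open>Suc d\<close>: with \<open>d\<close> the
      maximal degree in \<open>?D\<close>, the constant and the terms with entries of
      \<open>A\<close> contribute nothing, so the leading coefficient is zero.\<close>
    have "coeff (?D $$ (k, l)) d = coeff [:?P $$ (k, l):] (Suc d) + (\<Sum>m = 0..<n. A $$ (k, m) * coeff (?D $$ (m, l)) (Suc d))"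
      using arg_cong[OF entry[OF kl(1,2)], of "\<lambda>p. coeff p (Suc d)"] by (simp add: coeff_sum)
    also have "\<dots> = 0" using le[OF _ kl(2)] by (simp add: coeff_eq_0 less_Suc_eq_le)
    finally show False using kl by simp
  qed
  show ?thesis
  proof (rule eq_matI)
    fix i j assume "i < dim_row (0\<^sub>m n n :: 'a mat)" "j < dim_col (0\<^sub>m n n :: 'a mat)"
    then show "?P $$ (i, j) = 0\<^sub>m n n $$ (i, j)" using entry[of i j] D0 by simp
  qed (use P in auto)
qed

text \<open>Determinants in \<open>(x - A) C = p\<close> give
  \<open>char_poly A * det C = p ^ n\<close>.\<close>

lemma char_poly_dvd_power:
  assumes A: "A \<in> carrier_mat n n" and "pm p A = 0\<^sub>m n n"
  shows "char_poly A dvd p ^ n"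
proof -
  obtain C where C: "C \<in> carrier_mat n n" "char_poly_matrix A * C = p \<cdot>\<^sub>m 1\<^sub>m n - cmat (pm p A)"
    using char_poly_matrix_quotient[OF A] by blast
  have "p \<cdot>\<^sub>m 1\<^sub>m n - cmat (pm p A) = p \<cdot>\<^sub>m 1\<^sub>m n" unfolding assms(2) by (intro eq_matI) auto
  then have "det (char_poly_matrix A) * det C = det (p \<cdot>\<^sub>m 1\<^sub>m n)"
    using C det_mult[of "char_poly_matrix A" n C] A by simp
  then have "p ^ n = char_poly A * det C" by (simp add: char_poly_def)
  then show ?thesis by simp
qed

lemma char_poly_blk:
  fixes A D :: "'a::field mat"
  assumes A: "A \<in> carrier_mat m m" and D: "D \<in> carrier_mat n n"
  shows "char_poly (blk A D) = char_poly A * char_poly D"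
proof -
  have eq: "char_poly_matrix (blk A D) = four_block_mat (char_poly_matrix A) (0\<^sub>m m n) (0\<^sub>m n m) (char_poly_matrix D)"
    using A D blk_carrier[OF A D] by (intro eq_matI) (auto simp: char_poly_matrix_def blk_def)
  show ?thesis unfolding char_poly_def eq
    using A D by (intro det_four_block_mat_lower_left_zero) auto
qed

text \<open>Here the ambient field is \<open>GF (q^2)\<close> itself, so that the field of entries
  imposes no side condition. All counting of matrices by characteristic polynomial happens here; the
  extensions enter through group orders.\<close>

locale finite_hermitian_field = hermitian_field where q = q and ty = ty
  for q :: nat and ty :: "'a::field itself" +
  assumes K_UNIV: "(GF (q\<^sup>2) :: 'a set) = UNIV"
begin

declare One_nat_def [simp del]

lemma mats_on_K [simp]: "mats_on r c K = carrier_mat r c"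
  by (auto simp: mats_on_def K_UNIV)

lemma frob_frob [simp]: "((x::'a) ^ q) ^ q = x"
  using K_iff[of x] by (simp add: K_UNIV)

lemma frob_mult: "(x * y :: 'a) ^ q = x ^ q * y ^ q"
  by (rule power_mult_distrib)

lemma finite_carrier_mat [simp]: "finite (carrier_mat r c :: 'a mat set)"
  using finite_mats_on[OF finite_K, of r c] by simp

lemma star_star_id [simp]: "A\<^sup>\<star>\<^sup>\<star> = A"
  by (rule star_star[of A "dim_row A" "dim_col A"]) auto

lemma U_I: "A \<in> carrier_mat n n \<Longrightarrow> A\<^sup>\<star> * A = 1\<^sub>m n \<Longrightarrow> A \<in> U n"
  by (simp add: U_def)

subsection \<open>Linear recurrences\<close>

text \<open>The polynomial acts with the shift operator in place of its variable;
  \<open>act p \<mu> = (\<lambda>_. 0)\<close> is the linear recurrence with characteristic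
  polynomial \<open>p\<close>.\<close>

definition act :: "'a poly \<Rightarrow> (nat \<Rightarrow> 'a) \<Rightarrow> nat \<Rightarrow> 'a" where
  "act p \<mu> = (\<lambda>i. \<Sum>j\<le>degree p. coeff p j * \<mu> (i + j))"

lemma act_bound: "degree p \<le> d \<Longrightarrow> act p \<mu> i = (\<Sum>j\<le>d. coeff p j * \<mu> (i + j))"
  unfolding act_def by (rule sum.mono_neutral_left) (auto simp: coeff_eq_0)

lemma act_0 [simp]: "act 0 \<mu> i = 0"
  by (simp add: act_def)

lemma act_zero [simp]: "act p (\<lambda>_. 0) i = 0"
  by (simp add: act_def)

lemma act_pCons: "act (pCons a p) \<mu> i = a * \<mu> i + act p \<mu> (Suc i)"
proof -
  have "act (pCons a p) \<mu> i = (\<Sum>j\<le>Suc (degree p). coeff (pCons a p) j * \<mu> (i + j))"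
    by (rule act_bound) (simp add: degree_pCons_le)
  also have "\<dots> = a * \<mu> i + act p \<mu> (Suc i)"
    by (subst sum.atMost_Suc_shift) (simp add: act_def)
  finally show ?thesis .
qed

lemma act_add: "act (p + r) \<mu> i = act p \<mu> i + act r \<mu> i"
  by (induction p r arbitrary: i rule: poly_induct2) (auto simp: act_pCons algebra_simps)

lemma act_smult: "act (smult c p) \<mu> i = c * act p \<mu> i"
  by (induction p arbitrary: i) (auto simp: act_pCons algebra_simps)

lemma act_mult: "act (p * r) \<mu> = act p (act r \<mu>)"
proof (rule ext)
  show "act (p * r) \<mu> i = act p (act r \<mu>) i" for i
    by (induction p arbitrary: i) (auto simp: act_pCons act_add act_smult)
qed

lemma act_1 [simp]: "act 1 \<mu> = \<mu>"
  by (auto simp: one_pCons act_pCons)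

text \<open>For monic \<open>p\<close> each later term is determined by the preceding ones. This
  also recognises a sequence as zero or as real, by comparison with the zero sequence or with its
  conjugate.\<close>

lemma recurrence_unique:
  assumes p: "lead_coeff p = 1" and eq: "act p \<mu> = act p \<nu>" and init: "\<And>i. i < degree p \<Longrightarrow> \<mu> i = \<nu> i"
  shows "\<mu> = \<nu>"
proof (rule ext)
  fix i show "\<mu> i = \<nu> i"
  proof (induction i rule: less_induct)
    case (less i)
    show ?case
    proof (cases "i < degree p")
      case False
      then obtain l where l: "i = l + degree p" by (metis add.commute le_Suc_ex not_less)
      have "act p \<kappa> l = (\<Sum>j<degree p. coeff p j * \<kappa> (l + j)) + \<kappa> i" for \<kappa> :: "nat \<Rightarrow> 'a"
        using p by (simp add: act_def l flip: lessThan_Suc_atMost)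
      moreover have "(\<Sum>j<degree p. coeff p j * \<mu> (l + j)) = (\<Sum>j<degree p. coeff p j * \<nu> (l + j))"
        using less l by (intro sum.cong refl) auto
      ultimately show ?thesis using fun_cong[OF eq, of l] by simp
    qed (use init in simp)
  qed
qed

subsection \<open>The standard Hermitian form\<close>

definition ip :: "'a mat \<Rightarrow> 'a mat \<Rightarrow> 'a" where
  "ip u w = (u\<^sup>\<star> * w) $$ (0, 0)"

lemma ip_sum: "u \<in> carrier_mat n 1 \<Longrightarrow> w \<in> carrier_mat n 1 \<Longrightarrow> ip u w = (\<Sum>i = 0..<n. u $$ (i, 0) ^ q * w $$ (i, 0))"
  unfolding ip_def by (subst mat_mult_index[of _ 1 n _ 1]) auto

lemma star_mult_eq_0_iff:
  assumes "u \<in> carrier_mat n 1" "w \<in> carrier_mat n 1"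
  shows "u\<^sup>\<star> * w = 0\<^sub>m 1 1 \<longleftrightarrow> ip u w = 0"
proof
  assume "u\<^sup>\<star> * w = 0\<^sub>m 1 1"
  then show "ip u w = 0" by (simp add: ip_def)
next
  assume "ip u w = 0"
  then show "u\<^sup>\<star> * w = 0\<^sub>m 1 1" using assms by (intro eq_matI) (auto simp: ip_def)
qed

lemma ip_mult_left:
  assumes "A \<in> carrier_mat m n" "u \<in> carrier_mat n 1" "w \<in> carrier_mat m 1"
  shows "ip (A * u) w = ip u (A\<^sup>\<star> * w)"
  unfolding ip_def using assms by (simp add: star_mult[of _ m n _ 1] assoc_mult_mat[of _ 1 n _ m _ 1])

lemma ip_frob:
  assumes "u \<in> carrier_mat n 1" "w \<in> carrier_mat n 1"
  shows "ip u w ^ q = ip w u"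
  using assms by (simp add: ip_sum[of _ n] frob_sum frob_mult mult.commute)

lemma ip_add_right: "u \<in> carrier_mat n 1 \<Longrightarrow> w \<in> carrier_mat n 1 \<Longrightarrow> x \<in> carrier_mat n 1 \<Longrightarrow> ip u (w + x) = ip u w + ip u x"
  by (simp add: ip_sum[of _ n] sum.distrib algebra_simps)

lemma ip_smult_right: "u \<in> carrier_mat n 1 \<Longrightarrow> w \<in> carrier_mat n 1 \<Longrightarrow> ip u (c \<cdot>\<^sub>m w) = c * ip u w"
  by (simp add: ip_sum[of _ n] sum_distrib_left algebra_simps)

lemma ip_add_left: "u \<in> carrier_mat n 1 \<Longrightarrow> w \<in> carrier_mat n 1 \<Longrightarrow> x \<in> carrier_mat n 1 \<Longrightarrow> ip (u + w) x = ip u x + ip w x"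
  by (simp add: ip_sum[of _ n] sum.distrib algebra_simps frob_add)

lemma ip_smult_left: "u \<in> carrier_mat n 1 \<Longrightarrow> w \<in> carrier_mat n 1 \<Longrightarrow> ip (c \<cdot>\<^sub>m u) w = c ^ q * ip u w"
  by (simp add: ip_sum[of _ n] sum_distrib_left algebra_simps frob_mult)

lemma ip_zero_right [simp]: "u \<in> carrier_mat n 1 \<Longrightarrow> ip u (0\<^sub>m n 1) = 0"
  by (simp add: ip_sum[of _ n])

lemma ip_self: "v \<in> carrier_mat n 1 \<Longrightarrow> ip v v = nrm q v"
  unfolding ip_def by (rule nrm_star)

definition Herm :: "nat \<Rightarrow> 'a mat set" where
  "Herm n = {H \<in> carrier_mat n n. H\<^sup>\<star> = H}"

lemma HermD: "H \<in> Herm n \<Longrightarrow> H \<in> carrier_mat n n" "H \<in> Herm n \<Longrightarrow> H\<^sup>\<star> = H"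
  by (auto simp: Herm_def)

lemma finite_Herm [simp]: "finite (Herm n)"
  by (rule finite_subset[of _ "carrier_mat n n"]) (auto simp: Herm_def)

lemma Herm_conj:
  assumes "H \<in> Herm n" "g \<in> carrier_mat n m"
  shows "g\<^sup>\<star> * H * g \<in> Herm m"
  using HermD[OF assms(1)] assms(2)
  by (simp add: Herm_def star_mult[of _ m n _ m] star_mult[of _ n n _ m] assoc_mult_mat[of _ m n _ n _ m])

lemma Herm_index: "H \<in> Herm n \<Longrightarrow> i < n \<Longrightarrow> j < n \<Longrightarrow> H $$ (j, i) = H $$ (i, j) ^ q"
  using HermD[of H n] star_index[where A=H and i=j and j=i and q=q] by auto

text \<open>If all traces vanished, \<open>c = 1\<close> would give characteristic 2, where a
  vanishing trace means \<open>c ^ q = c\<close>; but not all elements are real.\<close>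

lemma trace_nonzero: "\<exists>c::'a. c + c ^ q \<noteq> 0"
proof (rule ccontr)
  assume "\<not> ?thesis"
  then have all: "c + c ^ q = 0" for c :: 'a by auto
  then have "(1::'a) + 1 = 0" using all[of 1] by simp
  then have neg: "- x = x" for x :: 'a by (metis add_eq_0_iff mult.right_neutral distrib_left mult_zero_right)
  have "c ^ q = c" for c :: 'a using all[of c] neg[of c] by (simp add: add_eq_0_iff)
  then show False using ex_nonreal by blast
qed

definition evec :: "nat \<Rightarrow> nat \<Rightarrow> 'a mat" where
  "evec n i = mat n 1 (\<lambda>(l, j). if l = i then 1 else 0)"

lemma evec_carrier [simp]: "evec n i \<in> carrier_mat n 1"
  by (simp add: evec_def)

definition cl :: "'a mat \<Rightarrow> nat \<Rightarrow> 'a mat" where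
  "cl A j = mat (dim_row A) 1 (\<lambda>(i, _). A $$ (i, j))"

lemma cl_carrier [simp]: "A \<in> carrier_mat n m \<Longrightarrow> cl A j \<in> carrier_mat n 1"
  by (simp add: cl_def)

lemma cl_index [simp]: "A \<in> carrier_mat n m \<Longrightarrow> i < n \<Longrightarrow> cl A j $$ (i, 0) = A $$ (i, j)"
  by (simp add: cl_def)

lemma mult_evec: "A \<in> carrier_mat n m \<Longrightarrow> i < m \<Longrightarrow> A * evec m i = cl A i"
proof (rule eq_matI)
  assume A: "A \<in> carrier_mat n m" "i < m"
  fix l j assume "l < dim_row (cl A i)" "j < dim_col (cl A i)"
  then have l: "l < n" "j = 0" using A by (auto simp: cl_def)
  have "(A * evec m i) $$ (l, 0) = (\<Sum>k = 0..<m. A $$ (l, k) * evec m i $$ (k, 0))"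
    using A l by (intro mat_mult_index[of _ n m _ 1]) auto
  also have "\<dots> = (\<Sum>k = 0..<m. if k = i then A $$ (l, k) else 0)"
    by (intro sum.cong refl) (auto simp: evec_def)
  also have "\<dots> = A $$ (l, i)" using A by simp
  finally show "(A * evec m i) $$ (l, j) = cl A i $$ (l, j)" using l A by (simp add: cl_def)
qed (auto simp: cl_def evec_def)

lemma cl_mult: "A \<in> carrier_mat n m \<Longrightarrow> B \<in> carrier_mat m c \<Longrightarrow> j < c \<Longrightarrow> cl (A * B) j = A * cl B j"
  by (simp add: assoc_mult_mat[of _ n m _ c _ 1] flip: mult_evec[of "A * B" n c] mult_evec[of B m c])

lemma mat_eq_cl:
  assumes "A \<in> carrier_mat n m" "B \<in> carrier_mat n m" "\<And>j. j < m \<Longrightarrow> cl A j = cl B j"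
  shows "A = B"
proof (rule eq_matI)
  fix i j assume "i < dim_row B" "j < dim_col B"
  then have ij: "i < n" "j < m" using assms by auto
  have "cl A j $$ (i, 0) = cl B j $$ (i, 0)" using assms(3)[OF ij(2)] by simp
  then show "A $$ (i, j) = B $$ (i, j)" using cl_index assms(1,2) ij by metis
qed (use assms in auto)

lemma ip_evec_left: "w \<in> carrier_mat n 1 \<Longrightarrow> i < n \<Longrightarrow> ip (evec n i) w = w $$ (i, 0)"
proof -
  assume w: "w \<in> carrier_mat n 1" "i < n"
  have "ip (evec n i) w = (\<Sum>l = 0..<n. if l = i then w $$ (l, 0) else 0)"
    unfolding ip_sum[OF evec_carrier w(1)] by (intro sum.cong refl) (auto simp: evec_def)
  then show ?thesis using w by simp
qed

lemma ip_cl: "A \<in> carrier_mat n m \<Longrightarrow> B \<in> carrier_mat n l \<Longrightarrow> i < m \<Longrightarrow> j < l \<Longrightarrow> ip (cl A i) (cl B j) = (A\<^sup>\<star> * B) $$ (i, j)"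
  by (simp add: ip_sum[of _ n] mat_mult_index[of _ m n _ l] del: index_mult_mat(1))

text \<open>Polarisation along two unit vectors: the diagonal terms vanish and the trace of
  \<open>d * H $$ (i, j)\<close> remains, where \<open>d\<close> is chosen to make this trace
  nonzero. Nothing is divided by 2, so characteristic 2 is covered.\<close>

lemma isotropic_imp_zero:
  assumes H: "H \<in> Herm n" and iso: "\<And>v. v \<in> carrier_mat n 1 \<Longrightarrow> ip v (H * v) = 0"
  shows "H = 0\<^sub>m n n"
proof (rule ccontr)
  assume "H \<noteq> 0\<^sub>m n n"
  note XD = HermD[OF H]
  have "\<exists>i<n. \<exists>j<n. H $$ (i, j) \<noteq> 0"
  proof (rule ccontr)
    assume "\<not> ?thesis"
    then have "H = 0\<^sub>m n n" using XD(1) by (intro eq_matI) auto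
    then show False using \<open>H \<noteq> 0\<^sub>m n n\<close> by simp
  qed
  then obtain i j where ij: "i < n" "j < n" "H $$ (i, j) \<noteq> 0" by blast
  obtain c :: 'a where c: "c + c ^ q \<noteq> 0" using trace_nonzero by blast
  define d where "d = c / H $$ (i, j)"
  let ?e = "evec n i" and ?f = "evec n j"
  have entry: "ip (evec n k) (H * evec n l) = H $$ (k, l)" if "k < n" "l < n" for k l
    using that XD(1) by (simp add: mult_evec[of _ n n] ip_evec_left)
  have "ip (?e + d \<cdot>\<^sub>m ?f) (H * (?e + d \<cdot>\<^sub>m ?f)) =
     H $$ (i, i) + d * H $$ (i, j) + (d ^ q * H $$ (j, i) + d ^ q * (d * H $$ (j, j)))"
    using XD(1) ij by (simp add: mult_add_distrib_mat[of _ n n _ 1] mult_smult_distrib[of _ n n _ 1]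
       ip_add_left[of _ n] ip_add_right[of _ n] ip_smult_left[of _ n] ip_smult_right[of _ n] entry algebra_simps)
  moreover have "H $$ (k, k) = 0" if "k < n" for k using iso[of "evec n k"] entry[OF that that] by simp
  moreover have "ip (?e + d \<cdot>\<^sub>m ?f) (H * (?e + d \<cdot>\<^sub>m ?f)) = 0" by (rule iso) simp
  ultimately have "d * H $$ (i, j) + d ^ q * H $$ (j, i) = 0" using ij by simp
  then have "d * H $$ (i, j) + (d * H $$ (i, j)) ^ q = 0" using Herm_index[OF H ij(1,2)] by (simp add: frob_mult)
  then show False using c ij by (simp add: d_def)
qed

lemma ip_Herm_real: assumes "H \<in> Herm n" "v \<in> carrier_mat n 1" shows "ip v (H * v) \<in> GF q"
proof -
  have "H * v \<in> carrier_mat n 1" using HermD[OF assms(1)] assms(2) by simp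
  then have "ip v (H * v) ^ q = ip (H * v) v" using ip_frob assms(2) by blast
  also have "\<dots> = ip v (H * v)" using ip_mult_left[of H n n v v] HermD[OF assms(1)] assms(2) by simp
  finally show ?thesis by (simp add: GF_def)
qed

text \<open>A nonzero value of the form lies in \<open>GF q\<close>, and surjectivity of the norm
  provides the scalar that rescales it to 1.\<close>

lemma ex_unit_vector:
  assumes H: "H \<in> Herm n" and "H \<noteq> 0\<^sub>m n n"
  shows "\<exists>v\<in>carrier_mat n 1. ip v (H * v) = 1"
proof -
  obtain v where v: "v \<in> carrier_mat n 1" "ip v (H * v) \<noteq> 0" using isotropic_imp_zero[OF H] assms(2) by blast
  have "1 / ip v (H * v) \<in> GF q" using ip_Herm_real[OF H v(1)] by (simp add: GF_def power_divide)
  then obtain c where c: "c ^ (q + 1) = 1 / ip v (H * v)" using norm_surj by blast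
  have "ip (c \<cdot>\<^sub>m v) (H * (c \<cdot>\<^sub>m v)) = c ^ (q + 1) * ip v (H * v)"
    using HermD(1)[OF H] v(1) by (simp add: mult_smult_distrib[of _ n n _ 1] ip_smult_left[of _ n] ip_smult_right[of _ n] One_nat_def)
  then show ?thesis using c v by (intro bexI[of _ "c \<cdot>\<^sub>m v"]) auto
qed

lemma inverse_ex:
  assumes "(A :: 'a mat) \<in> carrier_mat n n" "det A \<noteq> 0"
  obtains B where "B \<in> carrier_mat n n" "A * B = 1\<^sub>m n" "B * A = 1\<^sub>m n"
proof -
  have "A \<in> GL n" using assms by (simp add: GL_def)
  then show thesis using that GL_inverse GL_D(2) by blast
qed

lemma det_star: assumes "A \<in> carrier_mat n n" "det A \<noteq> 0" shows "det (A\<^sup>\<star>) \<noteq> 0"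
proof -
  obtain B where B: "B \<in> carrier_mat n n" "A * B = 1\<^sub>m n" using inverse_ex[OF assms] .
  have "B\<^sup>\<star> * A\<^sup>\<star> = 1\<^sub>m n" using arg_cong[OF B(2), of "star q"] assms(1) B(1) by (simp add: star_mult[of _ n n _ n])
  then have "det (B\<^sup>\<star>) * det (A\<^sup>\<star>) = 1" using assms(1) B(1) det_mult[of "B\<^sup>\<star>" n "A\<^sup>\<star>"] by simp
  then show ?thesis by auto
qed

text \<open>A non-degenerate Hermitian form has an orthonormal basis. By induction, a vector of
  value 1 becomes the first basis vector, and the Schur complement of the resulting entry 1 is
  factored in one dimension less.\<close>

lemma Herm_factor:
  assumes "G \<in> Herm k" "det G \<noteq> 0"
  shows "\<exists>S\<in>carrier_mat k k. S\<^sup>\<star> * S = G"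
  using assms
proof (induction k arbitrary: G)
  case 0
  then show ?case using HermD(1)[OF 0(1)] by (intro bexI[of _ "1\<^sub>m 0"]) (auto intro!: eq_matI)
next
  case (Suc m)
  let ?N = "Suc m"
  note GD = HermD[OF Suc.prems(1)]
  have "G \<noteq> 0\<^sub>m ?N ?N" using Suc.prems(2) by auto
  then obtain x where x: "x \<in> carrier_mat ?N 1" "ip x (G * x) = 1" using ex_unit_vector[OF Suc.prems(1)] by blast
  then have "x \<noteq> 0\<^sub>m ?N 1" using GD by auto
  then obtain g where g: "g \<in> GL ?N" "\<And>i. i < ?N \<Longrightarrow> g $$ (i, 0) = x $$ (i, 0)"
    using GL_first_col[of x m] x by auto
  have gc: "g \<in> carrier_mat ?N ?N" "det g \<noteq> 0" using GL_D[OF g(1)] by auto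
  obtain h where h: "h \<in> carrier_mat ?N ?N" "g * h = 1\<^sub>m ?N" "h * g = 1\<^sub>m ?N" using inverse_ex[OF gc] .
  let ?G = "g\<^sup>\<star> * G * g"
  have G': "?G \<in> Herm ?N" using Herm_conj[OF Suc.prems(1) gc(1)] .
  note G'D = HermD[OF G']
  have gx: "cl g 0 = x" using gc(1) x(1) g(2) by (intro eq_matI) (auto simp: cl_def)
  have G00: "?G $$ (0, 0) = 1"
  proof -
    have "?G $$ (0, 0) = ip (cl g 0) (cl (G * g) 0)"
      using gc(1) GD(1) by (subst ip_cl[of _ ?N ?N _ ?N]) (auto simp: assoc_mult_mat[of _ ?N ?N _ ?N _ ?N])
    also have "cl (G * g) 0 = G * x" using cl_mult[of G ?N ?N g ?N 0] GD(1) gc(1) gx by simp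
    finally show ?thesis using x gx by simp
  qed
  define b where "b = mat m 1 (\<lambda>(i, j). ?G $$ (Suc i, 0))"
  define D where "D = mat m m (\<lambda>(i, j). ?G $$ (Suc i, Suc j))"
  have bc: "b \<in> carrier_mat m 1" and Dc: "D \<in> carrier_mat m m" by (auto simp: b_def D_def)
  have Geq: "?G = four_block_mat (1\<^sub>m 1) (b\<^sup>\<star>) b D"
  proof (rule eq_matI)
    fix i j assume "i < dim_row (four_block_mat (1\<^sub>m 1) (b\<^sup>\<star>) b D)" "j < dim_col (four_block_mat (1\<^sub>m 1) (b\<^sup>\<star>) b D)"
    then have ij: "i < ?N" "j < ?N" by (auto simp: b_def D_def)
    show "?G $$ (i, j) = four_block_mat (1\<^sub>m 1) (b\<^sup>\<star>) b D $$ (i, j)"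
      using ij G00 Herm_index[OF G', of j i] by (auto simp: b_def D_def simp del: index_mult_mat)
  qed (use G'D(1) bc Dc in auto)
  \<comment> \<open>The Schur complement of the upper left entry, which is 1.\<close>
  let ?D = "D - b * b\<^sup>\<star>"
  have D'c: "?D \<in> carrier_mat m m" using bc Dc by auto
  have Dh: "?D \<in> Herm m"
  proof -
    have "?D\<^sup>\<star> = ?D"
    proof (rule eq_matI)
      fix i j assume "i < dim_row ?D" "j < dim_col ?D"
      then have ij: "i < m" "j < m" using bc by auto
      have bb: "(b * b\<^sup>\<star>) $$ (k, l) = b $$ (k, 0) * b $$ (l, 0) ^ q" if "k < m" "l < m" for k l
        using that bc by (subst mat_mult_index[of _ m 1 _ m]) (auto simp: One_nat_def)
      have "D $$ (j, i) ^ q = D $$ (i, j)" using ij Herm_index[OF G', of "Suc j" "Suc i"] by (simp add: D_def)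
      then show "?D\<^sup>\<star> $$ (i, j) = ?D $$ (i, j)" using ij bc Dc by (simp add: bb frob_diff frob_mult mult.commute del: index_mult_mat(1))
    qed (use bc in auto)
    then show ?thesis using D'c by (simp add: Herm_def)
  qed
  \<comment> \<open>Congruence by this unitriangular matrix turns
    \<open>blk (1\<^sub>m 1) ?D\<close> back into \<open>?G\<close>.\<close>
  let ?L = "four_block_mat (1\<^sub>m 1) (b\<^sup>\<star>) (0\<^sub>m m 1) (1\<^sub>m m)"
  have Lc: "?L \<in> carrier_mat ?N ?N" using bc four_block_carrier_mat[of "1\<^sub>m 1" 1 1 "1\<^sub>m m" m m] by (simp add: One_nat_def)
  have Ls: "?L\<^sup>\<star> = four_block_mat (1\<^sub>m 1) (0\<^sub>m 1 m) b (1\<^sub>m m)"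
    using bc by (subst star_four_block[of _ 1 1 _ m _ m]) auto
  have LDL: "?L\<^sup>\<star> * blk (1\<^sub>m 1) M * ?L = four_block_mat (1\<^sub>m 1) (b\<^sup>\<star>) b (b * b\<^sup>\<star> + M)" if M: "M \<in> carrier_mat m m" for M
    unfolding Ls blk_four_block[OF one_carrier_mat M] using bc M
    by (simp add: mult_four_block_mat[of _ 1 1 _ m _ m _ _ 1 _ m])
  have "b * b\<^sup>\<star> + ?D = D" using bc Dc by (intro eq_matI) auto
  with LDL[OF D'c] have G'L: "?L\<^sup>\<star> * blk (1\<^sub>m 1) ?D * ?L = ?G" using Geq by simp
  have bkc: "blk (1\<^sub>m 1) M \<in> carrier_mat ?N ?N" if "M \<in> carrier_mat m m" for M
    using blk_carrier[OF one_carrier_mat that, of 1] by (simp add: One_nat_def)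
  have "det ?G \<noteq> 0"
    using gc GD(1) det_star[OF gc] Suc.prems(2) by (simp add: det_mult[of _ ?N])
  then have "det (blk (1\<^sub>m 1) ?D) \<noteq> 0"
    unfolding G'L[symmetric] using Lc bkc[OF D'c] by (auto simp: det_mult[of _ ?N])
  then have "det ?D \<noteq> 0"
    unfolding blk_four_block[OF one_carrier_mat D'c] using D'c
    by (subst (asm) det_four_block_mat_lower_left_zero[of _ 1 _ m]) auto
  from Suc.IH[OF Dh this] obtain S' where S': "S' \<in> carrier_mat m m" "S'\<^sup>\<star> * S' = ?D" by blast
  let ?B = "blk (1\<^sub>m 1) S'"
  have BB: "?B\<^sup>\<star> * ?B = blk (1\<^sub>m 1) ?D"
    using S' by (simp add: star_blk[of _ 1 _ m] blk_mult[of _ 1 _ m])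
  \<comment> \<open>The last factor \<open>h\<close> undoes the change of basis
    \<open>g\<close>.\<close>
  let ?S = "?B * ?L * h"
  have Bc: "?B \<in> carrier_mat ?N ?N" using bkc[OF S'(1)] .
  have Sc: "?S \<in> carrier_mat ?N ?N" using Bc Lc h(1) by simp
  have "?S\<^sup>\<star> * ?S = h\<^sup>\<star> * (?L\<^sup>\<star> * (?B\<^sup>\<star> * ?B) * ?L) * h"
    using Bc Lc h(1) by (simp add: star_mult[of _ ?N ?N _ ?N] assoc_mult_mat[of _ ?N ?N _ ?N _ ?N])
  also have "\<dots> = h\<^sup>\<star> * (g\<^sup>\<star> * G * g) * h" unfolding BB G'L ..
  also have "\<dots> = (g * h)\<^sup>\<star> * G * (g * h)"
    using h(1) gc(1) GD(1) by (simp add: star_mult[of _ ?N ?N _ ?N] assoc_mult_mat[of _ ?N ?N _ ?N _ ?N])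
  also have "\<dots> = G" unfolding h(2) using GD(1) by simp
  finally show ?case using Sc by blast
qed

subsection \<open>Krylov sequences and moments\<close>

primrec kry :: "'a mat \<Rightarrow> 'a mat \<Rightarrow> nat \<Rightarrow> 'a mat" where
  "kry H v 0 = v"
| "kry H v (Suc i) = H * kry H v i"

lemma kry_carrier [simp]: "H \<in> carrier_mat n n \<Longrightarrow> v \<in> carrier_mat n c \<Longrightarrow> kry H v i \<in> carrier_mat n c"
  by (induction i) auto

lemma kry_shift: "kry H (H * v) i = kry H v (Suc i)"
  by (induction i) auto

lemma kry_lin:
  assumes "H \<in> carrier_mat n n" "v \<in> carrier_mat n 1" "w \<in> carrier_mat n 1"
  shows "kry H (c \<cdot>\<^sub>m v + w) i = c \<cdot>\<^sub>m kry H v i + kry H w i"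
  using assms by (induction i) (simp_all add: mult_add_distrib_mat[of _ n n _ 1] mult_smult_distrib[of _ n n _ 1])

text \<open>The link between matrix polynomials and recurrences: one more factor \<open>H\<close> on
  the start vector is one shift of the index.\<close>

lemma ip_kry_pm:
  assumes H: "H \<in> carrier_mat n n" and v: "v \<in> carrier_mat n 1" and w: "w \<in> carrier_mat n 1"
  shows "ip w (kry H (pm p H * v) i) = act p (\<lambda>j. ip w (kry H v j)) i"
proof (induction p arbitrary: i)
  case 0
  have "kry H (0\<^sub>m n 1) i = 0\<^sub>m n 1" using H by (induction i) auto
  then show ?case using H v w by simp
next
  case (pCons a p)
  have P: "pm p H \<in> carrier_mat n n" using H by (rule pm_carrier)
  then have "pm (pCons a p) H * v = a \<cdot>\<^sub>m v + H * (pm p H * v)"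
    using H v by (simp add: pm_pCons add_mult_distrib_mat[of _ n n _ _ 1] mult_smult_assoc_mat[of _ n n _ 1])
  then have "kry H (pm (pCons a p) H * v) i = a \<cdot>\<^sub>m kry H v i + kry H (pm p H * v) (Suc i)"
    using H v P by (simp only: kry_shift[symmetric] kry_lin[of _ n] mult_carrier_mat)
  then show ?case using H v w P pCons
    by (simp add: ip_add_right[of _ n] ip_smult_right[of _ n] act_pCons del: kry.simps)
qed

lemma pm_mult_index:
  assumes "H \<in> carrier_mat n n" "v \<in> carrier_mat n 1" "i < n"
  shows "(pm p H * v) $$ (i, 0) = act p (\<lambda>j. kry H v j $$ (i, 0)) 0"
proof -
  have c: "pm p H * v \<in> carrier_mat n 1" using assms pm_carrier[of H n p] by simp
  have "ip (evec n i) (kry H (pm p H * v) 0) = act p (\<lambda>j. ip (evec n i) (kry H v j)) 0"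
    using assms by (intro ip_kry_pm) auto
  then show ?thesis using assms c by (simp add: ip_evec_left[of _ n] del: index_mult_mat(1))
qed

text \<open>As \<open>H\<close> is its own adjoint, its powers move across the form and the pairing
  depends on \<open>i + j\<close> alone. Hence Gram matrices of Krylov vectors are Hankel matrices
  of moments.\<close>

lemma ip_kry:
  assumes "H \<in> Herm n" "v \<in> carrier_mat n 1" "w \<in> carrier_mat n 1"
  shows "ip (kry H v i) (kry H w j) = ip v (kry H w (i + j))"
proof (induction i arbitrary: j)
  case (Suc i)
  have "ip (H * kry H v i) (kry H w j) = ip (kry H v i) (H\<^sup>\<star> * kry H w j)"
    using HermD[OF assms(1)] assms by (intro ip_mult_left[of _ n n]) auto
  then show ?case using Suc[of "Suc j"] HermD[OF assms(1)] by simp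
qed simp

definition mom :: "'a mat \<Rightarrow> 'a mat \<Rightarrow> nat \<Rightarrow> 'a" where
  "mom H v i = ip v (kry H v i)"

lemma act_mom:
  assumes "H \<in> carrier_mat n n" "v \<in> carrier_mat n 1"
  shows "act p (mom H v) i = ip v (kry H (pm p H * v) i)"
  using ip_kry_pm[OF assms(1,2,2)] by (simp add: mom_def[abs_def])

lemma mom_real:
  assumes "H \<in> Herm n" "v \<in> carrier_mat n 1"
  shows "mom H v i \<in> GF q"
proof -
  have "ip v (kry H v i) ^ q = ip (kry H v i) (kry H v 0)"
    using assms HermD[OF assms(1)] ip_frob[of v n "kry H v i"] by simp
  then show ?thesis using ip_kry[OF assms(1,2,2), of i 0] by (simp add: GF_def mom_def)
qed

lemma kry_conj:
  assumes g: "g \<in> U n" and H: "H \<in> carrier_mat n n" and v: "v \<in> carrier_mat n 1"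
  shows "kry (g * H * g\<^sup>\<star>) (g * v) i = g * kry H v i"
proof (induction i)
  case (Suc i)
  have "g * H * g\<^sup>\<star> * (g * kry H v i) = g * (H * (g\<^sup>\<star> * (g * kry H v i)))"
    using U_D(2,5)[OF g] H v by (simp add: assoc_mult_mat[of _ n n _ n _ n] assoc_mult_mat[of _ n n _ n _ 1])
  also have "g\<^sup>\<star> * (g * kry H v i) = kry H v i" by (rule U_cancel(1)[OF g kry_carrier[OF H v]])
  finally show ?case using Suc by simp
qed simp

lemma mom_conj:
  assumes g: "g \<in> U n" and H: "H \<in> carrier_mat n n" and v: "v \<in> carrier_mat n 1"
  shows "mom (g * H * g\<^sup>\<star>) (g * v) = mom H v"
proof (rule ext)
  fix i
  have "ip (g * v) (g * kry H v i) = ip v (g\<^sup>\<star> * (g * kry H v i))"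
    using U_D(2)[OF g] H v by (intro ip_mult_left) auto
  also have "g\<^sup>\<star> * (g * kry H v i) = kry H v i" by (rule U_cancel(1)[OF g kry_carrier[OF H v]])
  finally show "mom (g * H * g\<^sup>\<star>) (g * v) i = mom H v i" by (simp add: mom_def kry_conj[OF assms])
qed

lemma Herm_conj_U:
  assumes "g \<in> U n" "H \<in> Herm n" shows "g * H * g\<^sup>\<star> \<in> Herm n"
  using Herm_conj[OF assms(2), of "g\<^sup>\<star>" n] U_D(5)[OF assms(1)] by simp

lemma char_poly_conj_U:
  assumes "g \<in> U n" "A \<in> carrier_mat n n" shows "char_poly (g * A * g\<^sup>\<star>) = char_poly A"
proof (rule char_poly_similar, rule similar_matI)
  show "{g * A * g\<^sup>\<star>, A, g, g\<^sup>\<star>} \<subseteq> carrier_mat n n" using U_D(2,5)[OF assms(1)] assms(2) by auto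
qed (use U_D[OF assms(1)] in auto)

lemma conj_U_cancel:
  assumes "g \<in> U n" "A \<in> carrier_mat n n"
  shows "g\<^sup>\<star> * (g * A * g\<^sup>\<star>) * g = A" "g * (g\<^sup>\<star> * A * g) * g\<^sup>\<star> = A"
proof -
  note gD = U_D[OF assms(1)]
  have "g\<^sup>\<star> * (g * A * g\<^sup>\<star>) * g = (g\<^sup>\<star> * (g * A)) * (g\<^sup>\<star> * g)"
    using gD(2,5) assms(2) by (simp add: assoc_mult_mat[of _ n n _ n _ n])
  then show "g\<^sup>\<star> * (g * A * g\<^sup>\<star>) * g = A" unfolding U_cancel(1)[OF assms] gD(3) using assms(2) by simp
  have "g * (g\<^sup>\<star> * A * g) * g\<^sup>\<star> = (g * (g\<^sup>\<star> * A)) * (g * g\<^sup>\<star>)"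
    using gD(2,5) assms(2) by (simp add: assoc_mult_mat[of _ n n _ n _ n])
  then show "g * (g\<^sup>\<star> * A * g) * g\<^sup>\<star> = A" unfolding U_cancel(2)[OF assms] gD(4) using assms(2) by simp
qed

subsection \<open>Stacked columns\<close>

definition stk :: "'a mat \<Rightarrow> 'a mat \<Rightarrow> 'a mat" where
  "stk a b = mat (dim_row a + dim_row b) 1 (\<lambda>(i, j). if i < dim_row a then a $$ (i, 0) else b $$ (i - dim_row a, 0))"

lemma stk_carrier [simp]: "a \<in> carrier_mat k 1 \<Longrightarrow> b \<in> carrier_mat m 1 \<Longrightarrow> stk a b \<in> carrier_mat (k + m) 1"
  by (simp add: stk_def)

lemma stk_index:
  assumes "a \<in> carrier_mat k 1" "b \<in> carrier_mat m 1"
  shows "i < k \<Longrightarrow> stk a b $$ (i, 0) = a $$ (i, 0)" "i < m \<Longrightarrow> stk a b $$ (k + i, 0) = b $$ (i, 0)"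
  using assms by (auto simp: stk_def)

lemma stk_inj:
  assumes "a \<in> carrier_mat k 1" "b \<in> carrier_mat m 1" "c \<in> carrier_mat k 1" "d \<in> carrier_mat m 1" and eq: "stk a b = stk c d"
  shows "a = c" "b = d"
proof -
  have "a $$ (i, 0) = c $$ (i, 0)" if "i < k" for i
    using stk_index(1)[OF assms(1,2) that] stk_index(1)[OF assms(3,4) that] eq by simp
  then show "a = c" using assms by (intro eq_matI) auto
  have "b $$ (i, 0) = d $$ (i, 0)" if "i < m" for i
    using stk_index(2)[OF assms(1,2) that] stk_index(2)[OF assms(3,4) that] eq by simp
  then show "b = d" using assms by (intro eq_matI) auto
qed

lemma sum_split:
  fixes f :: "nat \<Rightarrow> 'a"
  shows "(\<Sum>l = 0..<k + m. f l) = (\<Sum>l = 0..<k. f l) + (\<Sum>l = 0..<m. f (k + l))"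
  by (induction m) (auto simp: algebra_simps)

lemma ip_stk:
  assumes "a \<in> carrier_mat k 1" "b \<in> carrier_mat m 1" "c \<in> carrier_mat k 1" "d \<in> carrier_mat m 1"
  shows "ip (stk a b) (stk c d) = ip a c + ip b d"
  using assms by (simp add: ip_sum[of _ "k + m"] ip_sum[of _ k] ip_sum[of _ m] sum_split stk_index)

lemma block_mult_stk:
  assumes A: "A \<in> carrier_mat k k" and B: "B \<in> carrier_mat k m" and C: "C \<in> carrier_mat m k" and D: "D \<in> carrier_mat m m"
    and a: "a \<in> carrier_mat k 1" and b: "b \<in> carrier_mat m 1"
  shows "four_block_mat A B C D * stk a b = stk (A * a + B * b) (C * a + D * b)"
proof (rule eq_matI)
  let ?F = "four_block_mat A B C D"
  have F: "?F \<in> carrier_mat (k + m) (k + m)" using A D by simp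
  have s: "stk a b \<in> carrier_mat (k + m) 1" using a b by simp
  have c1: "A * a + B * b \<in> carrier_mat k 1" "C * a + D * b \<in> carrier_mat m 1" using assms by auto
  fix i j assume "i < dim_row (stk (A * a + B * b) (C * a + D * b))" "j < dim_col (stk (A * a + B * b) (C * a + D * b))"
  then have i: "i < k + m" "j = 0" using carrier_matD[OF stk_carrier[OF c1]] by auto
  have eq: "(?F * stk a b) $$ (i, 0) = (\<Sum>l = 0..<k. ?F $$ (i, l) * a $$ (l, 0)) + (\<Sum>l = 0..<m. ?F $$ (i, k + l) * b $$ (l, 0))"
    using F s i a b by (subst mat_mult_index[of _ "k + m" "k + m" _ 1]) (auto simp: sum_split stk_index)
  show "(?F * stk a b) $$ (i, j) = stk (A * a + B * b) (C * a + D * b) $$ (i, j)"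
  proof (cases "i < k")
    case True
    have "stk (A * a + B * b) (C * a + D * b) $$ (i, 0) = (A * a) $$ (i, 0) + (B * b) $$ (i, 0)"
      using stk_index(1)[OF c1 True] assms True by simp
    also have "\<dots> = (\<Sum>l = 0..<k. A $$ (i, l) * a $$ (l, 0)) + (\<Sum>l = 0..<m. B $$ (i, l) * b $$ (l, 0))"
      using mat_mult_index[OF A a True] mat_mult_index[OF B b True] by simp
    finally show ?thesis unfolding i(2) eq using True assms by simp
  next
    case False
    then obtain l where l: "i = k + l" "l < m" using i(1) by (metis add_less_cancel_left le_Suc_ex not_less)
    have "stk (A * a + B * b) (C * a + D * b) $$ (i, 0) = (C * a) $$ (l, 0) + (D * b) $$ (l, 0)"
      using stk_index(2)[OF c1 l(2)] assms l by simp
    also have "\<dots> = (\<Sum>j = 0..<k. C $$ (l, j) * a $$ (j, 0)) + (\<Sum>j = 0..<m. D $$ (l, j) * b $$ (j, 0))"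
      using mat_mult_index[OF C a l(2)] mat_mult_index[OF D b l(2)] by simp
    finally show ?thesis unfolding i(2) eq using l assms by simp
  qed
qed (use assms in \<open>auto simp: stk_def\<close>)

lemma outer_mult:
  assumes "u \<in> carrier_mat n 1" "w \<in> carrier_mat m 1" "x \<in> carrier_mat m 1"
  shows "u * w\<^sup>\<star> * x = ip w x \<cdot>\<^sub>m u"
proof -
  have "w\<^sup>\<star> * x = ip w x \<cdot>\<^sub>m 1\<^sub>m 1" using assms by (intro eq_matI) (auto simp: ip_def)
  moreover have "u * w\<^sup>\<star> * x = u * (w\<^sup>\<star> * x)" using assms by (intro assoc_mult_mat[of _ n 1 _ m _ 1]) auto
  ultimately show ?thesis using assms by (simp add: mult_smult_distrib[of _ n 1 _ 1])
qed

lemma add_smult_0: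
  fixes A B :: "'a mat"
  assumes "A \<in> carrier_mat n c" "B \<in> carrier_mat n c"
  shows "A + 0 \<cdot>\<^sub>m B = A" "0 \<cdot>\<^sub>m B + A = A"
  using assms by (auto intro!: eq_matI)

lemma one_smult_mat [simp]: "(1 :: 'a) \<cdot>\<^sub>m A = A"
  by (auto intro!: eq_matI)

lemma ip_zero_left [simp]: "u \<in> carrier_mat n 1 \<Longrightarrow> ip (0\<^sub>m n 1) u = 0"
  by (simp add: ip_sum[of _ n] zero_power)

end

subsection \<open>Splitting off a non-degenerate Krylov space\<close>

text \<open>The columns of \<open>S\<close> model the vectors \<open>H^i v\<close> for
  \<open>i < k\<close>: their Gram matrix is the Hankel matrix of \<mu>, which is non-singular since
  \<open>S\<close> has the inverse \<open>R\<close>. Pairs with moments \<mu> are brought into a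
  normal form relative to this model.\<close>

locale gram_factor = finite_hermitian_field where q = q and ty = ty
  for q :: nat and ty :: "'a::field itself" +
  fixes \<mu> :: "nat \<Rightarrow> 'a" and \<tau> :: "'a poly" and k :: nat and S R :: "'a mat"
  assumes k_pos: "0 < k"
    and tau_monic: "lead_coeff \<tau> = 1" and tau_deg: "degree \<tau> = k"
    and tau_mu: "act \<tau> \<mu> = (\<lambda>_. 0)"
    and mu_real: "\<And>i. \<mu> i \<in> GF q"
    and S_carrier: "S \<in> carrier_mat k k" and R_carrier: "R \<in> carrier_mat k k"
    and SR: "S * R = 1\<^sub>m k" and RS: "R * S = 1\<^sub>m k"
    and gram: "\<And>i j. i < k \<Longrightarrow> j < k \<Longrightarrow> ip (cl S i) (cl S j) = \<mu> (i + j)"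
begin

lemma coeff_tau_k: "coeff \<tau> k = 1"
  using tau_monic tau_deg by simp

lemma S_cl: "cl S i \<in> carrier_mat k 1"
  using S_carrier by (rule cl_carrier)

text \<open>Dual vector of the last column of \<open>S\<close>: it pairs to 1 with that column and
  to 0 with the others.\<close>

definition r :: "'a mat" where "r = R\<^sup>\<star> * evec k (k - 1)"

lemma r_carrier: "r \<in> carrier_mat k 1"
  using R_carrier by (simp add: r_def)

lemma ip_r: assumes "w \<in> carrier_mat k 1" shows "ip r w = (R * w) $$ (k - 1, 0)"
  unfolding r_def using R_carrier assms k_pos
  by (subst ip_mult_left[of _ k k]) (auto simp: ip_evec_left[of _ k] simp del: index_mult_mat(1))

lemma R_cl_S: "i < k \<Longrightarrow> R * cl S i = evec k i"
  by (simp add: RS flip: cl_mult[OF R_carrier S_carrier, of i]) (auto simp: evec_def cl_def intro!: eq_matI)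

lemma ip_r_S: "i < k \<Longrightarrow> ip r (cl S i) = (if i = k - 1 then 1 else 0)"
  using k_pos by (simp add: ip_r S_cl R_cl_S) (auto simp: evec_def)

lemma S_span: assumes "w \<in> carrier_mat k 1" and "\<And>j. j < k \<Longrightarrow> ip (cl S j) w = 0" shows "w = 0\<^sub>m k 1"
proof -
  have Sw: "S\<^sup>\<star> * w = 0\<^sub>m k 1"
  proof (rule eq_matI)
    fix i j assume "i < dim_row (0\<^sub>m k 1 :: 'a mat)" "j < dim_col (0\<^sub>m k 1 :: 'a mat)"
    then have ij: "i < k" "j = 0" by auto
    have "cl w 0 = w" using assms(1) by (intro eq_matI) (auto simp: cl_def)
    then have "(S\<^sup>\<star> * w) $$ (i, 0) = ip (cl S i) w" using ip_cl[OF S_carrier assms(1) ij(1), of 0] by simp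
    then show "(S\<^sup>\<star> * w) $$ (i, j) = 0\<^sub>m k 1 $$ (i, j)" using assms(2)[OF ij(1)] ij by simp
  qed (use S_carrier assms(1) in auto)
  have "w = (S * R)\<^sup>\<star> * w" using assms(1) by (simp add: SR)
  also have "\<dots> = R\<^sup>\<star> * (S\<^sup>\<star> * w)"
    using S_carrier R_carrier assms(1) by (simp add: star_mult[of _ k k _ k] assoc_mult_mat[of _ k k _ k _ 1])
  also have "\<dots> = 0\<^sub>m k 1" unfolding Sw using R_carrier by simp
  finally show ?thesis .
qed

text \<open>The compression of \<open>H\<close> to the Krylov space, in model coordinates. Its
  pairings with the columns of \<open>S\<close> must be \<open>\<mu> (i + j + 1)\<close>; defining
  it through them makes it visibly Hermitian.\<close>

definition E :: "'a mat" where "E = R\<^sup>\<star> * mat k k (\<lambda>(i, j). \<mu> (Suc (i + j))) * R"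

lemma E_Herm: "E \<in> Herm k"
proof -
  have "mat k k (\<lambda>(i, j). \<mu> (Suc (i + j))) \<in> Herm k"
    using mu_real unfolding Herm_def by (auto simp: GF_def add.commute intro!: eq_matI)
  from Herm_conj[OF this R_carrier] show ?thesis by (simp add: E_def)
qed

lemma E_carrier: "E \<in> carrier_mat k k"
  using HermD(1)[OF E_Herm] .

lemma ip_S_E: assumes "i < k" "j < k" shows "ip (cl S i) (E * cl S j) = \<mu> (Suc (i + j))"
proof -
  let ?G = "mat k k (\<lambda>(i, j). \<mu> (Suc (i + j)))"
  have G: "?G \<in> carrier_mat k k" by simp
  have Rj: "R * cl S j \<in> carrier_mat k 1" using mult_carrier_mat[OF R_carrier S_cl] .
  have GR: "?G * (R * cl S j) \<in> carrier_mat k 1" using mult_carrier_mat[OF G Rj] .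
  have "E * cl S j = R\<^sup>\<star> * (?G * (R * cl S j))"
  proof -
    have "E * cl S j = R\<^sup>\<star> * (?G * R) * cl S j" unfolding E_def using R_carrier by (simp add: assoc_mult_mat[of _ k k _ k _ k])
    also have "\<dots> = R\<^sup>\<star> * (?G * R * cl S j)" using R_carrier S_cl[of j] by (intro assoc_mult_mat[of _ k k _ k _ 1]) auto
    also have "?G * R * cl S j = ?G * (R * cl S j)" using R_carrier S_cl[of j] by (intro assoc_mult_mat[of _ k k _ k _ 1]) auto
    finally show ?thesis .
  qed
  then have "ip (cl S i) (E * cl S j) = ip (R * cl S i) (?G * (R * cl S j))"
    using ip_mult_left[OF R_carrier S_cl GR] by simp
  also have "\<dots> = ip (evec k i) (cl ?G j)"
    using assms by (simp add: R_cl_S mult_evec[OF G])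
  also have "\<dots> = \<mu> (Suc (i + j))"
    using assms ip_evec_left[OF cl_carrier[OF G] assms(1)] cl_index[OF G assms(1)] by simp
  finally show ?thesis .
qed

text \<open>Coordinates, in the columns of \<open>S\<close>, of the part of \<open>H^k v\<close>
  inside the Krylov space, as dictated by the recurrence \<tau>.\<close>

definition t :: "'a mat" where "t = mat k 1 (\<lambda>(i, j). - coeff \<tau> i)"

lemma t_carrier: "t \<in> carrier_mat k 1"
  by (simp add: t_def)

lemma St_index: "i < k \<Longrightarrow> (S * t) $$ (i, 0) = - (\<Sum>j = 0..<k. coeff \<tau> j * S $$ (i, j))"
  using mat_mult_index[OF S_carrier t_carrier, of i 0] by (simp add: t_def sum_negf mult.commute)

lemma ip_S_St: assumes "i < k" shows "ip (cl S i) (S * t) = \<mu> (i + k)"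
proof -
  have "ip (cl S i) (S * t) = ip (evec k i) (S\<^sup>\<star> * (S * t))"
    using S_carrier t_carrier assms by (subst ip_mult_left[of S k k, symmetric]) (auto simp: mult_evec[of S k k])
  also have "S\<^sup>\<star> * (S * t) = (S\<^sup>\<star> * S) * t" using S_carrier t_carrier by (simp add: assoc_mult_mat[of _ k k _ k _ 1])
  also have "ip (evec k i) ((S\<^sup>\<star> * S) * t) = ((S\<^sup>\<star> * S) * t) $$ (i, 0)"
    using S_carrier t_carrier assms by (intro ip_evec_left mult_carrier_mat[of _ k k]) auto
  also have "\<dots> = (\<Sum>j = 0..<k. (S\<^sup>\<star> * S) $$ (i, j) * t $$ (j, 0))"
    using S_carrier t_carrier assms by (intro mat_mult_index[of _ k k _ 1]) auto
  also have "\<dots> = - (\<Sum>j = 0..<k. coeff \<tau> j * \<mu> (i + j))"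
    unfolding sum_negf[symmetric] using assms S_carrier
    by (intro sum.cong refl) (simp add: ip_cl[of _ k k _ k, symmetric] gram t_def del: index_mult_mat(1))
  also have "(\<Sum>j = 0..<k. coeff \<tau> j * \<mu> (i + j)) + \<mu> (i + k) = act \<tau> \<mu> i"
    by (simp add: act_def tau_deg coeff_tau_k atLeast0LessThan flip: lessThan_Suc_atMost)
  then have "- (\<Sum>j = 0..<k. coeff \<tau> j * \<mu> (i + j)) = \<mu> (i + k)"
    unfolding tau_mu by (simp add: add_eq_0_iff)
  finally show ?thesis .
qed

text \<open>Both sides have the same products with the spanning columns of \<open>S\<close>. So
  \<open>E\<close> acts on these columns as a companion matrix.\<close>

lemma E_S: assumes "i < k" shows "E * cl S i = (if Suc i < k then cl S (Suc i) else S * t)"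
proof -
  let ?u = "if Suc i < k then cl S (Suc i) else S * t"
  have u: "?u \<in> carrier_mat k 1" "E * cl S i \<in> carrier_mat k 1"
    using S_cl mult_carrier_mat[OF E_carrier S_cl] mult_carrier_mat[OF S_carrier t_carrier] by auto
  have "E * cl S i + (- 1) \<cdot>\<^sub>m ?u = 0\<^sub>m k 1"
  proof (rule S_span)
    show "E * cl S i + (- 1) \<cdot>\<^sub>m ?u \<in> carrier_mat k 1" using u by simp
    fix j assume j: "j < k"
    have "ip (cl S j) ?u = \<mu> (Suc (j + i))"
    proof (cases "Suc i < k")
      case False
      then have "j + k = Suc (j + i)" using assms by simp
      then show ?thesis using False ip_S_St[OF j] by simp
    qed (use j gram in auto)
    then have "ip (cl S j) (E * cl S i) + (- 1) * ip (cl S j) ?u = 0" using ip_S_E[OF j assms] by simp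
    then show "ip (cl S j) (E * cl S i + (- 1) \<cdot>\<^sub>m ?u) = 0"
      using u j ip_add_right[OF S_cl u(2), of "(- 1) \<cdot>\<^sub>m ?u" j] ip_smult_right[OF S_cl u(1), of j "- 1"] by simp
  qed
  then have z: "(E * cl S i + (- 1) \<cdot>\<^sub>m ?u) $$ (l, 0) = 0" if "l < k" for l using that by simp
  show ?thesis
  proof (rule eq_matI)
    fix l j assume "l < dim_row ?u" "j < dim_col ?u"
    then have "l < k" "j = 0" using carrier_matD[OF u(1)] by auto
    then show "(E * cl S i) $$ (l, j) = ?u $$ (l, j)" using z[of l] u by (simp del: index_mult_mat(1) split: if_splits)
  qed (use carrier_matD[OF u(1)] carrier_matD[OF u(2)] in simp_all)
qed

lemma kry_E: "i < k \<Longrightarrow> kry E (cl S 0) i = cl S i"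
  by (induction i) (simp_all add: E_S)

lemma kry_E_k: "kry E (cl S 0) k = S * t"
proof -
  have "kry E (cl S 0) (Suc (k - 1)) = S * t"
    unfolding kry.simps using kry_E[of "k - 1"] E_S[of "k - 1"] k_pos by simp
  moreover have "Suc (k - 1) = k" using k_pos by simp
  ultimately show ?thesis by (simp only:)
qed

text \<open>Both \<tau> and the characteristic polynomial, evaluated at \<open>E\<close>, kill the
  first column of \<open>S\<close>. Their difference has degree below \<open>k\<close>, so it is a
  linear relation between the independent columns of \<open>S\<close> and must be zero.\<close>

lemma char_poly_E: "char_poly E = \<tau>"
proof -
  let ?d = "\<tau> - char_poly E"
  have cd: "degree (char_poly E) = k" "coeff (char_poly E) k = 1" using degree_monic_char_poly[OF E_carrier] by auto
  have small: "coeff ?d i = 0" if "k \<le> i" for i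
    using that cd coeff_tau_k tau_deg by (cases "i = k") (auto simp: coeff_eq_0)
  have v: "cl S 0 \<in> carrier_mat k 1" by (rule S_cl)
  have tau0: "(pm \<tau> E * cl S 0) $$ (i, 0) = 0" if i: "i < k" for i
  proof -
    have "(pm \<tau> E * cl S 0) $$ (i, 0) = (\<Sum>j<k. coeff \<tau> j * kry E (cl S 0) j $$ (i, 0)) + (S * t) $$ (i, 0)"
      using i by (simp add: pm_mult_index[OF E_carrier v] act_def tau_deg coeff_tau_k kry_E_k del: index_mult_mat(1) flip: lessThan_Suc_atMost)
    also have "(\<Sum>j<k. coeff \<tau> j * kry E (cl S 0) j $$ (i, 0)) = (\<Sum>j = 0..<k. coeff \<tau> j * S $$ (i, j))"
      using i S_carrier by (intro sum.cong) (auto simp: kry_E)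
    finally show ?thesis using i by (simp add: St_index del: index_mult_mat(1))
  qed
  define d where "d = mat k 1 (\<lambda>(i, j). coeff ?d i)"
  have dc: "d \<in> carrier_mat k 1" by (simp add: d_def)
  have "S * d = 0\<^sub>m k 1"
  proof (rule eq_matI)
    fix i j assume "i < dim_row (0\<^sub>m k 1 :: 'a mat)" "j < dim_col (0\<^sub>m k 1 :: 'a mat)"
    then have i: "i < k" "j = 0" by auto
    have "pm ?d E * cl S 0 = pm \<tau> E * cl S 0 - pm (char_poly E) E * cl S 0"
      using pm_carrier[OF E_carrier] v by (simp add: pm_diff[OF E_carrier] minus_mult_distrib_mat[of _ k k _ _ 1])
    then have "(pm ?d E * cl S 0) $$ (i, 0) = 0"
      using tau0[OF i(1)] i pm_carrier[OF E_carrier, of \<tau>] v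
      by (simp add: Cayley_Hamilton[OF E_carrier] left_mult_zero_mat[OF v] del: index_mult_mat(1))
    moreover have "(pm ?d E * cl S 0) $$ (i, 0) = (\<Sum>j\<le>degree ?d. coeff ?d j * kry E (cl S 0) j $$ (i, 0))"
      using i by (simp add: pm_mult_index[OF E_carrier v] act_def)
    moreover have "\<dots> = (\<Sum>j = 0..<k. coeff ?d j * S $$ (i, j))"
    proof -
      have "(\<Sum>j\<le>degree ?d. coeff ?d j * kry E (cl S 0) j $$ (i, 0)) = (\<Sum>j\<in>{0..<k} \<inter> {..degree ?d}. coeff ?d j * kry E (cl S 0) j $$ (i, 0))"
        using small by (intro sum.mono_neutral_right) (auto simp del: coeff_diff, metis not_le)
      also have "\<dots> = (\<Sum>j\<in>{0..<k} \<inter> {..degree ?d}. coeff ?d j * S $$ (i, j))"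
        using i S_carrier by (intro sum.cong refl) (auto simp: kry_E)
      also have "\<dots> = (\<Sum>j = 0..<k. coeff ?d j * S $$ (i, j))"
        by (intro sum.mono_neutral_left) (auto simp del: coeff_diff dest: le_degree)
      finally show ?thesis .
    qed
    moreover have "(S * d) $$ (i, 0) = (\<Sum>j = 0..<k. coeff ?d j * S $$ (i, j))"
      using mat_mult_index[OF S_carrier dc, of i 0] i by (simp add: d_def mult.commute del: coeff_diff)
    ultimately show "(S * d) $$ (i, j) = 0\<^sub>m k 1 $$ (i, j)" using i by (simp del: index_mult_mat(1))
  qed (use S_carrier dc in auto)
  then have "R * (S * d) = 0\<^sub>m k 1" using R_carrier by simp
  moreover have "R * (S * d) = (R * S) * d" using R_carrier S_carrier dc by (simp add: assoc_mult_mat[of _ k k _ k _ 1])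
  ultimately have "d = 0\<^sub>m k 1" unfolding RS using dc by simp
  then have "d $$ (i, 0) = 0" if "i < k" for i using that by simp
  then have "coeff ?d i = 0" if "i < k" for i using that by (simp add: d_def del: coeff_diff)
  then have "?d = 0" using small by (intro poly_eqI) (metis coeff_0 not_less)
  then show ?thesis by simp
qed

text \<open>The normal form: \<open>E\<close> on the model space, \<open>D\<close> on the complement
  and a coupling of rank one. Among the columns of \<open>S\<close> only the last is mapped out of
  the model space, with component \<open>y\<close>; hence the factor \<open>r\<^sup>\<star>\<close>,
  and by symmetry the adjoint in the other corner.\<close>

definition glue :: "'a mat \<Rightarrow> 'a mat \<Rightarrow> 'a mat" where
  "glue D y = four_block_mat E (r * y\<^sup>\<star>) (y * r\<^sup>\<star>) D"

definition s0 :: "nat \<Rightarrow> 'a mat" where "s0 m = stk (cl S 0) (0\<^sub>m m 1)"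

context
  fixes m :: nat and y :: "'a mat" and D :: "'a mat"
  assumes y: "y \<in> carrier_mat m 1" and D: "D \<in> Herm m"
begin

private lemma Dc: "D \<in> carrier_mat m m" and Ds: "D\<^sup>\<star> = D"
  using HermD[OF D] by auto

private lemma off: "r * y\<^sup>\<star> \<in> carrier_mat k m" "y * r\<^sup>\<star> \<in> carrier_mat m k"
  using y carrier_matD[OF r_carrier] by auto

lemma glue_carrier: "glue D y \<in> carrier_mat (k + m) (k + m)"
  unfolding glue_def using Dc E_carrier by simp

lemma s0_carrier: "s0 m \<in> carrier_mat (k + m) 1"
  using S_cl by (simp add: s0_def)

lemma glue_Herm: "glue D y \<in> Herm (k + m)"
proof -
  have "(glue D y)\<^sup>\<star> = glue D y"
    unfolding glue_def using y Dc Ds HermD[OF E_Herm] off r_carrier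
    by (subst star_four_block[of _ k k _ m _ m]) (auto simp: star_mult[of _ k 1 _ m] star_mult[of _ m 1 _ k])
  then show ?thesis using glue_carrier by (simp add: Herm_def)
qed

lemma glue_mult_stk:
  assumes a: "a \<in> carrier_mat k 1" and b: "b \<in> carrier_mat m 1"
  shows "glue D y * stk a b = stk (E * a + ip y b \<cdot>\<^sub>m r) (ip r a \<cdot>\<^sub>m y + D * b)"
  unfolding glue_def block_mult_stk[OF E_carrier off Dc a b]
  using outer_mult[OF r_carrier y b] outer_mult[OF y r_carrier a] by simp

lemma kry_glue: "i < k \<Longrightarrow> kry (glue D y) (s0 m) i = stk (cl S i) (0\<^sub>m m 1)"
proof (induction i)
  case (Suc i)
  then have "kry (glue D y) (s0 m) (Suc i) = stk (E * cl S i + ip y (0\<^sub>m m 1) \<cdot>\<^sub>m r) (ip r (cl S i) \<cdot>\<^sub>m y + D * 0\<^sub>m m 1)"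
    by (simp add: glue_mult_stk[OF S_cl zero_carrier_mat])
  moreover have "ip y (0\<^sub>m m 1) = 0" "ip r (cl S i) = 0" "E * cl S i = cl S (Suc i)" "D * 0\<^sub>m m 1 = 0\<^sub>m m 1"
    using y Dc E_S[of i] ip_r_S[of i] Suc(2) by auto
  moreover have "0 \<cdot>\<^sub>m y = 0\<^sub>m m 1" using y by (intro eq_matI) auto
  ultimately show ?case using y by (simp add: add_smult_0[OF S_cl r_carrier])
qed (simp add: s0_def)

lemma kry_glue_k: "kry (glue D y) (s0 m) k = stk (S * t) y"
proof -
  have St: "S * t \<in> carrier_mat k 1" using mult_carrier_mat[OF S_carrier t_carrier] .
  have "kry (glue D y) (s0 m) (Suc (k - 1)) = stk (E * cl S (k - 1) + ip y (0\<^sub>m m 1) \<cdot>\<^sub>m r) (ip r (cl S (k - 1)) \<cdot>\<^sub>m y + D * 0\<^sub>m m 1)"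
    using k_pos by (simp only: kry.simps kry_glue[of "k - 1"] glue_mult_stk[OF S_cl zero_carrier_mat] diff_less zero_less_one)
  moreover have "ip y (0\<^sub>m m 1) = 0" "ip r (cl S (k - 1)) = 1" "E * cl S (k - 1) = S * t" "D * 0\<^sub>m m 1 = 0\<^sub>m m 1"
    using y Dc E_S[of "k - 1"] ip_r_S[of "k - 1"] k_pos by auto
  ultimately have "kry (glue D y) (s0 m) (Suc (k - 1)) = stk (S * t) y"
    using y by (simp add: add_smult_0[OF St r_carrier] del: kry.simps)
  moreover have "Suc (k - 1) = k" using k_pos by simp
  ultimately show ?thesis by (simp only:)
qed

text \<open>Inside the model space \<tau> kills the start vector; what survives is the component
  that escapes at step \<open>k\<close>.\<close>

lemma pm_tau_glue: "pm \<tau> (glue D y) * s0 m = stk (0\<^sub>m k 1) y"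
proof (rule eq_matI)
  let ?H = "glue D y" and ?z = "stk (0\<^sub>m k 1) y"
  have zc: "?z \<in> carrier_mat (k + m) 1" using y by simp
  have St: "S * t \<in> carrier_mat k 1" using mult_carrier_mat[OF S_carrier t_carrier] .
  fix i j assume "i < dim_row ?z" "j < dim_col ?z"
  then have i: "i < k + m" "j = 0" using carrier_matD[OF zc] by auto
  have "(pm \<tau> ?H * s0 m) $$ (i, 0) = (\<Sum>j<k. coeff \<tau> j * kry ?H (s0 m) j $$ (i, 0)) + stk (S * t) y $$ (i, 0)"
    using i by (simp add: pm_mult_index[OF glue_carrier s0_carrier] act_def tau_deg coeff_tau_k kry_glue_k flip: lessThan_Suc_atMost)
  also have "(\<Sum>j<k. coeff \<tau> j * kry ?H (s0 m) j $$ (i, 0)) = (\<Sum>j = 0..<k. coeff \<tau> j * stk (cl S j) (0\<^sub>m m 1) $$ (i, 0))"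
    by (intro sum.cong) (auto simp: kry_glue)
  finally have eq: "(pm \<tau> ?H * s0 m) $$ (i, 0) = \<dots> + stk (S * t) y $$ (i, 0)" .
  show "(pm \<tau> ?H * s0 m) $$ (i, j) = ?z $$ (i, j)"
  proof (cases "i < k")
    case True
    then show ?thesis unfolding i(2) eq using S_carrier
      by (simp add: stk_index(1)[OF S_cl zero_carrier_mat] stk_index(1)[OF St y] stk_index(1)[OF zero_carrier_mat y] St_index del: index_mult_mat(1))
  next
    case False
    then obtain l where l: "i = k + l" "l < m" using i(1) by (metis add_less_cancel_left le_Suc_ex not_less)
    then show ?thesis unfolding i(2) eq
      by (simp add: stk_index(2)[OF S_cl zero_carrier_mat] stk_index(2)[OF St y] stk_index(2)[OF zero_carrier_mat y])
  qed
qed (use y glue_carrier s0_carrier carrier_matD[OF stk_carrier[OF zero_carrier_mat y, of k]] in auto)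

context
  assumes iso: "mom D y = (\<lambda>_. 0)"
begin

text \<open>A step re-enters the model space with coefficient \<open>ip y (kry D y i)\<close>, a
  moment of \<open>y\<close>, and these moments are zero.\<close>

lemma kry_glue_bottom: "kry (glue D y) (stk (0\<^sub>m k 1) y) i = stk (0\<^sub>m k 1) (kry D y i)"
proof (induction i)
  case (Suc i)
  have b: "kry D y i \<in> carrier_mat m 1" using y Dc by simp
  have "ip y (kry D y i) = 0" using fun_cong[OF iso, of i] by (simp add: mom_def)
  moreover have "ip r (0\<^sub>m k 1) = 0" "E * 0\<^sub>m k 1 = 0\<^sub>m k 1" "D * kry D y i \<in> carrier_mat m 1"
    using r_carrier E_carrier Dc b by auto
  ultimately show ?case using Suc y
    by (simp add: glue_mult_stk[OF zero_carrier_mat b] add_smult_0[OF zero_carrier_mat r_carrier] add_smult_0[of _ m 1])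
qed simp

text \<open>The action of \<tau> on the moments produces pairings of the start vector with vectors
  of the complement, which are zero. So both sequences satisfy \<tau>, and they agree initially by
  the Gram condition.\<close>

lemma mom_glue: "mom (glue D y) (s0 m) = \<mu>"
proof (rule recurrence_unique[OF tau_monic])
  have "act \<tau> (mom (glue D y) (s0 m)) i = 0" for i
  proof -
    have b: "kry D y i \<in> carrier_mat m 1" using y Dc by simp
    have "act \<tau> (mom (glue D y) (s0 m)) i = ip (s0 m) (stk (0\<^sub>m k 1) (kry D y i))"
      unfolding act_mom[OF glue_carrier s0_carrier] pm_tau_glue kry_glue_bottom ..
    also have "\<dots> = 0" using b by (simp add: s0_def ip_stk[OF S_cl _ zero_carrier_mat b] S_cl)
    finally show ?thesis .
  qed
  then show "act \<tau> (mom (glue D y) (s0 m)) = act \<tau> \<mu>" using tau_mu by auto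
  fix i assume "i < degree \<tau>"
  then have i: "i < k" by (simp add: tau_deg)
  have "mom (glue D y) (s0 m) i = ip (stk (cl S 0) (0\<^sub>m m 1)) (stk (cl S i) (0\<^sub>m m 1))"
    unfolding mom_def kry_glue[OF i] by (simp add: s0_def)
  also have "\<dots> = \<mu> i" using gram[OF k_pos i] by (simp add: ip_stk[OF S_cl zero_carrier_mat S_cl zero_carrier_mat])
  finally show "mom (glue D y) (s0 m) i = \<mu> i" .
qed

text \<open>The coupling drops out because the Schur complement correction contains
  \<open>y\<^sup>\<star> (x - D)^(-1) y\<close>, whose coefficients are moments of \<open>y\<close>.
  To stay with polynomials, the inverse is replaced by \<open>C\<close>, which is
  \<open>char_poly D\<close> times it.\<close>

lemma char_poly_glue: "char_poly (glue D y) = \<tau> * char_poly D"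
proof -
  let ?c = "char_poly D"
  let ?M = "char_poly_matrix D" and ?ME = "char_poly_matrix E"
  have Mc: "?M \<in> carrier_mat m m" "?ME \<in> carrier_mat k k" using Dc E_carrier by auto
  obtain C where C: "C \<in> carrier_mat m m" "?M * C = ?c \<cdot>\<^sub>m 1\<^sub>m m - cmat (pm ?c D)"
    and C0: "\<And>u v. u \<in> carrier_mat 1 m \<Longrightarrow> v \<in> carrier_mat m 1 \<Longrightarrow> (\<And>r. u * pm r D * v = 0\<^sub>m 1 1) \<Longrightarrow> cmat u * C * cmat v = 0\<^sub>m 1 1"
    using char_poly_matrix_quotient[OF Dc, of ?c] by blast
  have MC: "?M * C = ?c \<cdot>\<^sub>m 1\<^sub>m m" unfolding C(2) Cayley_Hamilton[OF Dc] by (intro eq_matI) auto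
  have ysc: "y\<^sup>\<star> \<in> carrier_mat 1 m" using y by simp
  have "y\<^sup>\<star> * pm p D * y = 0\<^sub>m 1 1" for p
  proof -
    have P: "pm p D * y \<in> carrier_mat m 1" by (rule mult_carrier_mat[OF pm_carrier[OF Dc] y])
    have "ip y (kry D (pm p D * y) 0) = act p (mom D y) 0" by (rule act_mom[OF Dc y, symmetric])
    then have "ip y (pm p D * y) = 0" unfolding iso by simp
    then show ?thesis using star_mult_eq_0_iff[OF y P] y pm_carrier[OF Dc, of p]
      by (simp add: assoc_mult_mat[of _ 1 m _ m _ 1])
  qed
  from C0[OF ysc y this] have yCy: "cmat (y\<^sup>\<star>) * C * cmat y = 0\<^sub>m 1 1" .
  \<comment> \<open>Factors of the two rank-one corners of \<open>x - H\<close>, with their signs;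
    \<open>w'\<close> is the negative of \<open>w\<close>.\<close>
  define u where "u = cmat (- r)"
  define w where "w = cmat (- (r\<^sup>\<star>))"
  define w' where "w' = cmat (r\<^sup>\<star>)"
  define z where "z = cmat y"
  define zs where "zs = cmat (y\<^sup>\<star>)"
  have c: "u \<in> carrier_mat k 1" "w \<in> carrier_mat 1 k" "w' \<in> carrier_mat 1 k" "z \<in> carrier_mat m 1" "zs \<in> carrier_mat 1 m"
    using y r_carrier by (auto simp: u_def w_def w'_def z_def zs_def)
  have uz: "u * zs \<in> carrier_mat k m" "z * w \<in> carrier_mat m k" "z * w' \<in> carrier_mat m k" using c by auto
  have rc: "- r \<in> carrier_mat k 1" "- (r\<^sup>\<star>) \<in> carrier_mat 1 k" using r_carrier by auto
  have r1: "u * zs = cmat (- r * y\<^sup>\<star>)" "z * w = cmat (y * - (r\<^sup>\<star>))"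
    unfolding u_def w_def z_def zs_def using cmat_mult[OF rc(1) ysc] cmat_mult[OF y rc(2)] by simp_all
  have r2: "- r * y\<^sup>\<star> = - (r * y\<^sup>\<star>)" "y * - (r\<^sup>\<star>) = - (y * r\<^sup>\<star>)"
    using r_carrier y ysc by (auto intro!: eq_matI simp: mat_mult_index[of _ k 1 _ m] mat_mult_index[of _ m 1 _ k] simp del: index_mult_mat(1))
  have blocks: "char_poly_matrix (glue D y) = four_block_mat ?ME (u * zs) (z * w) ?M"
    unfolding r1 r2 using off Dc glue_carrier E_carrier y r_carrier
    by (intro eq_matI) (auto simp: char_poly_matrix_def glue_def simp del: index_mult_mat(1))
  \<comment> \<open>Right multiplication by \<open>?N\<close> clears the lower left corner, because
    \<open>(x - D) C\<close> is the scalar \<open>char_poly D\<close>. The price is the factor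
    \<open>char_poly D ^ k\<close>, which is cancelled at the end.\<close>
  let ?N = "four_block_mat (?c \<cdot>\<^sub>m 1\<^sub>m k) (0\<^sub>m k m) (C * (z * w')) (1\<^sub>m m)"
  have cz: "C * (z * w') \<in> carrier_mat m k" using mult_carrier_mat[OF C(1) uz(3)] .
  have ck: "?c \<cdot>\<^sub>m 1\<^sub>m k \<in> carrier_mat k k" by simp
  have prod: "four_block_mat ?ME (u * zs) (z * w) ?M * ?N = four_block_mat (?c \<cdot>\<^sub>m ?ME) (u * zs) (0\<^sub>m m k) ?M"
  proof -
    have "zs * C * z = 0\<^sub>m 1 1" using yCy by (simp add: zs_def z_def)
    moreover have "zs * (C * (z * w')) = zs * C * z * w'"
    proof -
      have "zs * (C * (z * w')) = zs * C * (z * w')" using c C(1) uz by (intro assoc_mult_mat[symmetric, of _ 1 m _ m _ k]) auto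
      also have "\<dots> = zs * C * z * w'" using c C(1) by (intro assoc_mult_mat[symmetric, of _ 1 m _ 1 _ k]) auto
      finally show ?thesis .
    qed
    ultimately have "zs * (C * (z * w')) = 0\<^sub>m 1 k" using c by simp
    moreover have "u * zs * (C * (z * w')) = u * (zs * (C * (z * w')))"
      using c cz by (intro assoc_mult_mat[of _ k 1 _ m _ k]) auto
    ultimately have b11: "u * zs * (C * (z * w')) = 0\<^sub>m k k" using c by simp
    have "?M * (C * (z * w')) = (?M * C) * (z * w')"
      using Mc C(1) uz by (intro assoc_mult_mat[symmetric, of _ m m _ m _ k]) auto
    also have "\<dots> = ?c \<cdot>\<^sub>m (z * w')"
      unfolding MC using mult_smult_assoc_mat[of "1\<^sub>m m" m m "z * w'" k ?c] uz(3) left_mult_one_mat[OF uz(3)] by simp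
    finally have b21: "?M * (C * (z * w')) = ?c \<cdot>\<^sub>m (z * w')" .
    have "w + w' = 0\<^sub>m 1 k" using r_carrier unfolding w_def w'_def by (intro eq_matI) auto
    then have zw: "z * w + z * w' = 0\<^sub>m m k" using mult_add_distrib_mat[OF c(4,2,3)] c by simp
    have "(z * w) * (?c \<cdot>\<^sub>m 1\<^sub>m k) = ?c \<cdot>\<^sub>m (z * w)"
      using mult_smult_distrib[OF uz(2) one_carrier_mat[of k], of ?c] right_mult_one_mat[OF uz(2)] by simp
    then have 2: "(z * w) * (?c \<cdot>\<^sub>m 1\<^sub>m k) + ?M * (C * (z * w')) = 0\<^sub>m m k"
      unfolding b21 using zw add_smult_distrib_left_mat[OF uz(2,3), of ?c] by simp
    have 1: "?ME * (?c \<cdot>\<^sub>m 1\<^sub>m k) + u * zs * (C * (z * w')) = ?c \<cdot>\<^sub>m ?ME"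
      unfolding b11 using mult_smult_distrib[OF Mc(2) one_carrier_mat[of k], of ?c] right_mult_one_mat[OF Mc(2)] Mc(2) by simp
    have 3: "?ME * 0\<^sub>m k m + u * zs * 1\<^sub>m m = u * zs"
      using right_mult_zero_mat[OF Mc(2), of m] right_mult_one_mat[OF uz(1)] uz(1) by simp
    have 4: "z * w * 0\<^sub>m k m + ?M * 1\<^sub>m m = ?M"
      using right_mult_zero_mat[OF uz(2), of m] right_mult_one_mat[OF Mc(1)] Mc(1) by simp
    show ?thesis
      using mult_four_block_mat[OF Mc(2) uz(1,2) Mc(1) ck zero_carrier_mat cz one_carrier_mat]
      unfolding 1 2 3 4 .
  qed
  have "char_poly (glue D y) * ?c ^ k = det (four_block_mat ?ME (u * zs) (z * w) ?M) * det ?N"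
    unfolding char_poly_def[of "glue D y"] blocks using cz
    by (subst det_four_block_mat_upper_right_zero[of _ k _ m]) auto
  also have "\<dots> = det (four_block_mat ?ME (u * zs) (z * w) ?M * ?N)"
    using four_block_carrier_mat[OF Mc(2,1)] four_block_carrier_mat[OF ck one_carrier_mat[of m]] by (intro det_mult[symmetric, of _ "k + m"]) auto
  also have "\<dots> = det (?c \<cdot>\<^sub>m ?ME) * det ?M"
    unfolding prod using Mc uz by (intro det_four_block_mat_lower_left_zero) auto
  also have "\<dots> = ?c ^ k * (\<tau> * ?c)" using Mc char_poly_E by (simp add: char_poly_def)
  finally have "?c ^ k * char_poly (glue D y) = ?c ^ k * (\<tau> * ?c)" by (simp add: mult.commute)
  moreover have "?c \<noteq> 0" using degree_monic_char_poly[OF Dc] by auto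
  ultimately show ?thesis by simp
qed

end

end

end

lemma four_block_inj:
  assumes "A \<in> carrier_mat k k" "B \<in> carrier_mat k m" "C \<in> carrier_mat m k" "D \<in> carrier_mat m m"
    "A' \<in> carrier_mat k k" "B' \<in> carrier_mat k m" "C' \<in> carrier_mat m k" "D' \<in> carrier_mat m m"
    and eq: "four_block_mat A B C D = four_block_mat A' B' C' D'"
  shows "C = C'" "D = D'"
proof -
  have "C $$ (i, j) = C' $$ (i, j)" if "i < m" "j < k" for i j
    using arg_cong[OF eq, of "\<lambda>M. M $$ (k + i, j)"] that assms(1-8) by simp
  then show "C = C'" using assms by (intro eq_matI) auto
  have "D $$ (i, j) = D' $$ (i, j)" if "i < m" "j < m" for i j
    using arg_cong[OF eq, of "\<lambda>M. M $$ (k + i, k + j)"] that assms(1-8) by simp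
  then show "D = D'" using assms by (intro eq_matI) auto
qed

context finite_hermitian_field
begin

lemma mult_stk_zero:
  assumes g: "g \<in> carrier_mat (k + m) (k + m)" and Q: "Q \<in> carrier_mat (k + m) k"
    and eq: "\<And>i j. i < k + m \<Longrightarrow> j < k \<Longrightarrow> g $$ (i, j) = Q $$ (i, j)" and a: "a \<in> carrier_mat k 1"
  shows "g * stk a (0\<^sub>m m 1) = Q * a"
proof (rule eq_matI)
  have s: "stk a (0\<^sub>m m 1) \<in> carrier_mat (k + m) 1" using a by simp
  fix i j assume "i < dim_row (Q * a)" "j < dim_col (Q * a)"
  then have i: "i < k + m" "j = 0" using Q a by auto
  have "(g * stk a (0\<^sub>m m 1)) $$ (i, 0) = (\<Sum>l = 0..<k. g $$ (i, l) * a $$ (l, 0))"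
    using g s i by (simp add: mat_mult_index[of _ "k + m" "k + m" _ 1] sum_split stk_index[OF a zero_carrier_mat] del: index_mult_mat(1))
  also have "\<dots> = (Q * a) $$ (i, 0)"
    using Q a i eq by (simp add: mat_mult_index[of _ "k + m" k _ 1] del: index_mult_mat(1))
  finally show "(g * stk a (0\<^sub>m m 1)) $$ (i, j) = (Q * a) $$ (i, j)" using i by (simp only:)
qed (use g Q a carrier_matD[OF stk_carrier[OF a zero_carrier_mat, of m]] in auto)

definition Z :: "nat \<Rightarrow> 'a poly \<Rightarrow> (nat \<Rightarrow> 'a) \<Rightarrow> ('a mat \<times> 'a mat) set" where
  "Z n P \<mu> = {(H, v). H \<in> Herm n \<and> v \<in> carrier_mat n 1 \<and> char_poly H = P \<and> mom H v = \<mu>}"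

lemma finite_Z [simp]: "finite (Z n P \<mu>)"
  by (rule finite_subset[of _ "Herm n \<times> carrier_mat n 1"]) (auto simp: Z_def)

end

context gram_factor
begin

text \<open>The moments fix the upper left block, and the Krylov condition makes the lower left
  corner vanish on all columns of \<open>S\<close> but the last. Orthogonality to the Krylov space
  then forces the moments of the remaining vector \<open>y\<close> to vanish.\<close>

lemma glue_surj:
  assumes H: "H \<in> Herm (k + m)" and kry: "\<And>i. i < k \<Longrightarrow> kry H (s0 m) i = stk (cl S i) (0\<^sub>m m 1)"
    and mom: "mom H (s0 m) = \<mu>"
  shows "\<exists>D\<in>Herm m. \<exists>y\<in>carrier_mat m 1. H = glue D y \<and> mom D y = (\<lambda>_. 0)"
proof -
  let ?n = "k + m"
  have Hc: "H \<in> carrier_mat ?n ?n" using HermD[OF H] by auto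
  define A where "A = mat k k (\<lambda>(i, j). H $$ (i, j))"
  define B where "B = mat k m (\<lambda>(i, j). H $$ (i, k + j))"
  define C where "C = mat m k (\<lambda>(i, j). H $$ (k + i, j))"
  define D where "D = mat m m (\<lambda>(i, j). H $$ (k + i, k + j))"
  have c: "A \<in> carrier_mat k k" "B \<in> carrier_mat k m" "C \<in> carrier_mat m k" "D \<in> carrier_mat m m"
    by (auto simp: A_def B_def C_def D_def)
  have Heq: "H = four_block_mat A B C D"
    using Hc by (intro eq_matI) (auto simp: A_def B_def C_def D_def)
  have DH: "D \<in> Herm m"
    unfolding Herm_def using c Herm_index[OF H, symmetric] by (auto simp: D_def intro!: eq_matI)
  have BC: "B = C\<^sup>\<star>" using Herm_index[OF H, symmetric] by (auto simp: B_def C_def intro!: eq_matI)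
  have Hs: "H * stk (cl S i) (0\<^sub>m m 1) = stk (A * cl S i) (C * cl S i)" for i
    unfolding Heq block_mult_stk[OF c S_cl zero_carrier_mat]
    using c mult_carrier_mat[OF c(1) S_cl, of i] mult_carrier_mat[OF c(3) S_cl, of i] by simp
  define y where "y = C * cl S (k - 1)"
  have yc: "y \<in> carrier_mat m 1" using mult_carrier_mat[OF c(3) S_cl] by (simp add: y_def)
  have C0: "C * cl S i = (if i = k - 1 then y else 0\<^sub>m m 1)" if "i < k" for i
  proof (cases "i = k - 1")
    case False
    then have "Suc i < k" using that by simp
    then have "H * stk (cl S i) (0\<^sub>m m 1) = stk (cl S (Suc i)) (0\<^sub>m m 1)"
      using kry[of i] kry[of "Suc i"] by simp
    then show ?thesis using False Hs[of i] stk_inj(2)[OF mult_carrier_mat[OF c(1) S_cl] mult_carrier_mat[OF c(3) S_cl] S_cl zero_carrier_mat]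
      by simp
  qed (simp add: y_def)
  have s0c: "s0 m \<in> carrier_mat ?n 1" using S_cl by (simp add: s0_def)
  \<comment> \<open>\<open>A\<close> and \<open>E\<close> have the same pairings with the spanning
    columns of \<open>S\<close>, namely the moments of \<open>H\<close>.\<close>
  have AE: "A * cl S j = E * cl S j" if j: "j < k" for j
  proof -
    have AC: "A * cl S j \<in> carrier_mat k 1" "E * cl S j \<in> carrier_mat k 1"
      using mult_carrier_mat[OF c(1) S_cl] mult_carrier_mat[OF E_carrier S_cl] by auto
    have "A * cl S j + (- 1) \<cdot>\<^sub>m (E * cl S j) = 0\<^sub>m k 1"
    proof (rule S_span)
      show "A * cl S j + (- 1) \<cdot>\<^sub>m (E * cl S j) \<in> carrier_mat k 1" using AC by simp
      fix i assume i: "i < k"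
      have "ip (cl S i) (A * cl S j) = ip (stk (cl S i) (0\<^sub>m m 1)) (stk (A * cl S j) (C * cl S j))"
        using ip_stk[OF S_cl zero_carrier_mat AC(1) mult_carrier_mat[OF c(3) S_cl]] mult_carrier_mat[OF c(3) S_cl] by simp
      also have "\<dots> = ip (kry H (s0 m) i) (kry H (s0 m) (Suc j))"
        using kry[OF i] kry[OF j] Hs[of j] by simp
      also have "\<dots> = \<mu> (i + Suc j)" unfolding ip_kry[OF H s0c s0c] using fun_cong[OF mom, of "i + Suc j"] by (simp add: mom_def)
      finally have "ip (cl S i) (A * cl S j) + (- 1) * ip (cl S i) (E * cl S j) = 0" using ip_S_E[OF i j] by simp
      then show "ip (cl S i) (A * cl S j + (- 1) \<cdot>\<^sub>m (E * cl S j)) = 0"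
        using AC ip_add_right[OF S_cl AC(1), of "(- 1) \<cdot>\<^sub>m (E * cl S j)" i] ip_smult_right[OF S_cl AC(2), of i "- 1"] by simp
    qed
    then have z: "(A * cl S j + (- 1) \<cdot>\<^sub>m (E * cl S j)) $$ (l, 0) = 0" if "l < k" for l using that by simp
    show ?thesis
    proof (rule eq_matI)
      fix l j' assume "l < dim_row (E * cl S j)" "j' < dim_col (E * cl S j)"
      then have "l < k" "j' = 0" using carrier_matD[OF AC(2)] by auto
      then show "(A * cl S j) $$ (l, j') = (E * cl S j) $$ (l, j')" using z[of l] AC E_carrier S_cl[of j] by (simp del: index_mult_mat(1))
    qed (use carrier_matD[OF AC(1)] carrier_matD[OF AC(2)] in simp_all)
  qed
  have cancel_S: "M = N" if MN: "M \<in> carrier_mat l k" "N \<in> carrier_mat l k" and eq: "\<And>j. j < k \<Longrightarrow> M * cl S j = N * cl S j" for M N l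
  proof -
    have "M * S = N * S"
      by (rule mat_eq_cl[of _ l k]) (use MN S_carrier eq in \<open>auto simp: cl_mult[of _ l k _ k]\<close>)
    then have "M * (S * R) = N * (S * R)"
      by (simp only: assoc_mult_mat[OF MN(1) S_carrier R_carrier, symmetric] assoc_mult_mat[OF MN(2) S_carrier R_carrier, symmetric])
    then show ?thesis unfolding SR using MN by simp
  qed
  have A: "A = E" by (rule cancel_S[OF c(1) E_carrier AE])
  have yr: "y * r\<^sup>\<star> \<in> carrier_mat m k" using yc carrier_matD[OF r_carrier] by auto
  have C: "C = y * r\<^sup>\<star>"
  proof (rule cancel_S[OF c(3) yr])
    fix j assume j: "j < k"
    show "C * cl S j = y * r\<^sup>\<star> * cl S j"
      unfolding outer_mult[OF yc r_carrier S_cl] using C0[OF j] ip_r_S[OF j] yc by (auto intro!: eq_matI)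
  qed
  have B: "B = r * y\<^sup>\<star>" unfolding BC C using star_mult[OF yc, of "r\<^sup>\<star>" k] r_carrier by simp
  have HD: "H = glue D y" unfolding glue_def Heq A B C ..
  have Dc: "D \<in> carrier_mat m m" by (rule c)
  let ?z = "stk (0\<^sub>m k 1) y"
  have zc: "?z \<in> carrier_mat ?n 1" using yc by simp
  have pz: "pm \<tau> H * s0 m = ?z" unfolding HD by (rule pm_tau_glue[OF yc DH])
  \<comment> \<open>\<tau> annihilates \<mu>, so the value of \<tau> at \<open>H\<close>, applied to
    the start vector, is orthogonal to the whole Krylov space.\<close>
  have orth: "ip (kry H (s0 m) j) (kry H ?z l) = 0" for j l
  proof -
    have "ip (kry H (s0 m) j) (kry H ?z l) = ip (s0 m) (kry H ?z (j + l))"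
      by (rule ip_kry[OF H s0c zc])
    also have "\<dots> = act \<tau> (mom H (s0 m)) (j + l)" unfolding act_mom[OF Hc s0c] pz ..
    also have "\<dots> = 0" unfolding mom tau_mu ..
    finally show ?thesis .
  qed
  have "kry H ?z i = stk (0\<^sub>m k 1) (kry D y i) \<and> ip y (kry D y i) = 0" for i
  proof (induction i)
    \<comment> \<open>A nonzero \<open>ip y b\<close> would give the next vector a component along
      \<open>r\<close>, which pairs to 1 with the last model column, contrary to
      \<open>orth\<close>.\<close>
    have step: "ip y b = 0" if "kry H ?z i = stk (0\<^sub>m k 1) b" and b: "b \<in> carrier_mat m 1" for i b
    proof -
      have Db: "ip r (0\<^sub>m k 1) \<cdot>\<^sub>m y + D * b \<in> carrier_mat m 1" and Er: "E * 0\<^sub>m k 1 + ip y b \<cdot>\<^sub>m r \<in> carrier_mat k 1"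
        using mult_carrier_mat[OF Dc b] r_carrier mult_carrier_mat[OF E_carrier zero_carrier_mat, of 1] by auto
      have E0: "E * 0\<^sub>m k 1 + ip y b \<cdot>\<^sub>m r = ip y b \<cdot>\<^sub>m r" using r_carrier right_mult_zero_mat[OF E_carrier, of 1] by simp
      have "kry H ?z (Suc i) = stk (E * 0\<^sub>m k 1 + ip y b \<cdot>\<^sub>m r) (ip r (0\<^sub>m k 1) \<cdot>\<^sub>m y + D * b)"
        using that(1) glue_mult_stk[OF yc DH zero_carrier_mat b] by (simp add: HD)
      then have "0 = ip (stk (cl S (k - 1)) (0\<^sub>m m 1)) (stk (E * 0\<^sub>m k 1 + ip y b \<cdot>\<^sub>m r) (ip r (0\<^sub>m k 1) \<cdot>\<^sub>m y + D * b))"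
        using orth[of "k - 1" "Suc i"] kry[of "k - 1"] k_pos by simp
      also have "\<dots> = ip (cl S (k - 1)) (ip y b \<cdot>\<^sub>m r)"
        unfolding ip_stk[OF S_cl zero_carrier_mat Er Db] unfolding E0 using Db by simp
      also have "\<dots> = ip y b * ip (cl S (k - 1)) r" by (rule ip_smult_right[OF S_cl r_carrier])
      also have "ip (cl S (k - 1)) r = ip r (cl S (k - 1)) ^ q" using ip_frob[OF r_carrier S_cl] by simp
      also have "\<dots> = 1" using ip_r_S[of "k - 1"] k_pos by simp
      finally show ?thesis by simp
    qed
    {
      case 0
      show ?case using step[of 0 y] yc by simp
    next
      case (Suc i)
      have b: "kry D y i \<in> carrier_mat m 1" using Dc yc by simp
      have "kry H ?z (Suc i) = stk (E * 0\<^sub>m k 1 + ip y (kry D y i) \<cdot>\<^sub>m r) (ip r (0\<^sub>m k 1) \<cdot>\<^sub>m y + D * kry D y i)"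
        using Suc glue_mult_stk[OF yc DH zero_carrier_mat b] by (simp add: HD)
      moreover have "E * 0\<^sub>m k 1 = 0\<^sub>m k 1" "ip r (0\<^sub>m k 1) = 0" using E_carrier r_carrier by auto
      ultimately have "kry H ?z (Suc i) = stk (0\<^sub>m k 1) (kry D y (Suc i))"
        using Suc add_smult_0[OF zero_carrier_mat r_carrier] add_smult_0(2)[OF mult_carrier_mat[OF Dc b] yc] by simp
      then show ?case using step[of "Suc i" "kry D y (Suc i)"] mult_carrier_mat[OF Dc b] by simp
    }
  qed
  then have "mom D y = (\<lambda>_. 0)" by (auto simp: mom_def)
  then show ?thesis using DH yc HD by blast
qed

lemma blk_one_s0: assumes "h \<in> carrier_mat m m" shows "blk (1\<^sub>m k) h * s0 m = s0 m"
  unfolding blk_four_block[OF one_carrier_mat assms] s0_def block_mult_stk[OF one_carrier_mat zero_carrier_mat zero_carrier_mat assms S_cl zero_carrier_mat]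
  using left_mult_one_mat[OF S_cl] left_mult_zero_mat[OF S_cl] S_cl assms by simp

text \<open>A unitary matrix of the complement leaves the model space and \<open>r\<close> alone and
  transforms only \<open>D\<close> and \<open>y\<close>.\<close>

lemma glue_blk_conj:
  assumes h: "h \<in> U m" and D: "D \<in> Herm m" and y: "y \<in> carrier_mat m 1"
  shows "blk (1\<^sub>m k) h * glue (h\<^sup>\<star> * D * h) (h\<^sup>\<star> * y) * (blk (1\<^sub>m k) h)\<^sup>\<star> = glue D y"
proof -
  note hD = U_D[OF h]
  have Dc: "D \<in> carrier_mat m m" using HermD[OF D] by auto
  let ?D = "h\<^sup>\<star> * D * h" and ?y = "h\<^sup>\<star> * y"
  have c: "?D \<in> carrier_mat m m" "?y \<in> carrier_mat m 1" using hD Dc y by auto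
  have ys: "?y\<^sup>\<star> = y\<^sup>\<star> * h" using star_mult[OF hD(5) y] by simp
  have o: "r * ?y\<^sup>\<star> \<in> carrier_mat k m" "?y * r\<^sup>\<star> \<in> carrier_mat m k" using r_carrier c by auto
  have 1: "h * (?y * r\<^sup>\<star>) = y * r\<^sup>\<star>"
  proof -
    have "h * (?y * r\<^sup>\<star>) = h * ?y * r\<^sup>\<star>" using hD(2) c r_carrier by (intro assoc_mult_mat[symmetric, of _ m m _ 1 _ k]) auto
    then show ?thesis using U_cancel(2)[OF h y] by simp
  qed
  have 2: "r * ?y\<^sup>\<star> * h\<^sup>\<star> = r * y\<^sup>\<star>"
  proof -
    have "r * ?y\<^sup>\<star> * h\<^sup>\<star> = r * (y\<^sup>\<star> * h * h\<^sup>\<star>)"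
      unfolding ys using hD(2,5) y r_carrier by (intro assoc_mult_mat[of _ k 1 _ m _ m]) auto
    also have "y\<^sup>\<star> * h * h\<^sup>\<star> = y\<^sup>\<star> * (h * h\<^sup>\<star>)" using hD(2,5) y by (intro assoc_mult_mat[of _ 1 m _ m _ m]) auto
    finally show ?thesis unfolding hD(4) using y by simp
  qed
  have 3: "h * ?D * h\<^sup>\<star> = D" using conj_U_cancel(2)[OF h Dc] .
  have b: "blk (1\<^sub>m k) h = four_block_mat (1\<^sub>m k) (0\<^sub>m k m) (0\<^sub>m m k) h" using hD(2) by (rule blk_four_block[OF one_carrier_mat])
  have bs: "(blk (1\<^sub>m k) h)\<^sup>\<star> = four_block_mat (1\<^sub>m k) (0\<^sub>m k m) (0\<^sub>m m k) (h\<^sup>\<star>)"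
    unfolding star_blk[OF one_carrier_mat hD(2)] using blk_four_block[OF one_carrier_mat hD(5)] by simp
  have hyr: "h * (?y * r\<^sup>\<star>) \<in> carrier_mat m k" "h * ?D \<in> carrier_mat m m"
    using mult_carrier_mat[OF hD(2) o(2)] mult_carrier_mat[OF hD(2) c(1)] by auto
  have s1: "blk (1\<^sub>m k) h * glue ?D ?y = four_block_mat E (r * ?y\<^sup>\<star>) (h * (?y * r\<^sup>\<star>)) (h * ?D)"
    unfolding b glue_def mult_four_block_mat[OF one_carrier_mat zero_carrier_mat zero_carrier_mat hD(2) E_carrier o c(1)]
    using left_mult_one_mat[OF E_carrier] left_mult_one_mat[OF o(1)] left_mult_zero_mat[OF o(2), of k] left_mult_zero_mat[OF c(1), of k]
      left_mult_zero_mat[OF E_carrier, of m] left_mult_zero_mat[OF o(1), of m] hyr o E_carrier by simp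
  show ?thesis
    unfolding s1 bs mult_four_block_mat[OF E_carrier o(1) hyr one_carrier_mat zero_carrier_mat zero_carrier_mat hD(5)]
    using 1 2 3 o E_carrier hyr hD(5) y r_carrier mult_carrier_mat[OF hyr(2) hD(5)] Dc by (simp add: glue_def)
qed

text \<open>Orbit count: every pair with moments \<mu> arises from a unitary \<open>g\<close> and a
  pair \<open>(D, y)\<close> with zero moments, and the freedom in this representation is exactly
  \<open>U m\<close>, acting on the complement.\<close>

lemma card_Z_glue:
  "card (Z (k + m) (\<tau> * \<gamma>) \<mu>) * card (U m) = card (U (k + m)) * card (Z m \<gamma> (\<lambda>_. 0))"
proof -
  let ?n = "k + m"
  let ?f = "\<lambda>g b. (g * glue (fst b) (snd b) * g\<^sup>\<star>, g * s0 m)"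
  have ZD: "fst b \<in> Herm m" "snd b \<in> carrier_mat m 1" "mom (fst b) (snd b) = (\<lambda>_. 0)" "char_poly (fst b) = \<gamma>"
    if "b \<in> Z m \<gamma> (\<lambda>_. 0)" for b
    using that by (auto simp: Z_def)
  have s0c: "s0 m \<in> carrier_mat ?n 1" using S_cl by (simp add: s0_def)
  have "card (U ?n) * card (Z m \<gamma> (\<lambda>_. 0)) = card (U m) * card (Z ?n (\<tau> * \<gamma>) \<mu>)"
  proof (rule card_product_fibers[where f = ?f])
    fix g b assume g: "g \<in> U ?n" and b: "b \<in> Z m \<gamma> (\<lambda>_. 0)"
    note bD = ZD[OF b] and gD = U_D[OF g]
    note gl = glue_carrier[OF bD(2,1)]
    show "?f g b \<in> Z ?n (\<tau> * \<gamma>) \<mu>"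
      unfolding Z_def using Herm_conj_U[OF g glue_Herm[OF bD(2,1)]] mult_carrier_mat[OF gD(2) s0c]
        char_poly_conj_U[OF g gl] char_poly_glue[OF bD(2,1,3)] bD(4) mom_conj[OF g gl s0c] mom_glue[OF bD(2,1,3)]
      by auto
    obtain D y where Dy: "b = (D, y)" by (cases b)
    have D: "D \<in> Herm m" and y: "y \<in> carrier_mat m 1" using bD Dy by auto
    have Dc: "D \<in> carrier_mat m m" using HermD[OF D] by auto
    let ?F = "{(a', b'). a' \<in> U ?n \<and> b' \<in> Z m \<gamma> (\<lambda>_. 0) \<and> ?f a' b' = ?f g b}"
    let ?h = "\<lambda>h. (g * blk (1\<^sub>m k) h, (h\<^sup>\<star> * D * h, h\<^sup>\<star> * y))"
    have bU: "blk (1\<^sub>m k) h \<in> U ?n" if "h \<in> U m" for h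
      using blk_U_iff[OF mats_on_one U_D(1)[OF that], of k] that by simp
    have conj_g: "(g * w) * M * (g * w)\<^sup>\<star> = g * (w * M * w\<^sup>\<star>) * g\<^sup>\<star>" if "w \<in> U ?n" "M \<in> carrier_mat ?n ?n" for w M
      using gD(2,5) U_D(2,5)[OF that(1)] that(2)
      by (simp add: star_mult[of _ ?n ?n _ ?n] assoc_mult_mat[of _ ?n ?n _ ?n _ ?n])
    have img: "?F = ?h ` U m"
    proof (intro equalityI subsetI)
      fix p assume "p \<in> ?h ` U m"
      then obtain h where h: "h \<in> U m" and p: "p = ?h h" by blast
      let ?D = "h\<^sup>\<star> * D * h" and ?y = "h\<^sup>\<star> * y"
      have hs: "h\<^sup>\<star> \<in> U m" by (rule star_U[OF h])
      have DH: "?D \<in> Herm m" using Herm_conj_U[OF hs D] by simp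
      have yc: "?y \<in> carrier_mat m 1" using U_D(5)[OF h] y by simp
      have b': "(?D, ?y) \<in> Z m \<gamma> (\<lambda>_. 0)"
        using DH yc char_poly_conj_U[OF hs Dc] mom_conj[OF hs Dc y] bD Dy by (simp add: Z_def)
      have "g * blk (1\<^sub>m k) h * s0 m = g * s0 m"
        using assoc_mult_mat[OF gD(2) U_D(2)[OF bU[OF h]] s0c] blk_one_s0[OF U_D(2)[OF h]] by simp
      moreover have "(g * blk (1\<^sub>m k) h) * glue ?D ?y * (g * blk (1\<^sub>m k) h)\<^sup>\<star> = g * glue D y * g\<^sup>\<star>"
        unfolding conj_g[OF bU[OF h] glue_carrier[OF yc DH]] glue_blk_conj[OF h D y] ..
      ultimately show "p \<in> ?F" unfolding p using mult_U[OF g bU[OF h]] b' Dy by simp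
    next
      fix p assume "p \<in> ?F"
      then obtain g' D' y' where p: "p = (g', (D', y'))" and g': "g' \<in> U ?n" and b': "(D', y') \<in> Z m \<gamma> (\<lambda>_. 0)"
        and e1: "g' * glue D' y' * g'\<^sup>\<star> = g * glue D y * g\<^sup>\<star>" and e2: "g' * s0 m = g * s0 m"
        by (cases p) (auto simp: Dy)
      have D': "D' \<in> Herm m" and y': "y' \<in> carrier_mat m 1" using ZD[OF b'] by auto
      note gl = glue_carrier[OF y D] and gl' = glue_carrier[OF y' D']
      \<comment> \<open>\<open>w\<close> compares two representations of one pair. It fixes all
        padded columns of \<open>S\<close>, hence the first \<open>k\<close> coordinate vectors, so
        it comes from the complement.\<close>
      define w where "w = g\<^sup>\<star> * g'"
      have w: "w \<in> U ?n" unfolding w_def by (rule mult_U[OF star_U[OF g] g'])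
      have g'w: "g' = g * w" unfolding w_def using U_cancel(2)[OF g U_D(2)[OF g']] by simp
      have ws: "w * s0 m = s0 m"
      proof -
        have "g\<^sup>\<star> * (g' * s0 m) = w * s0 m" unfolding w_def using assoc_mult_mat[OF gD(5) U_D(2)[OF g'] s0c] by simp
        then show ?thesis unfolding e2 using U_cancel(1)[OF g s0c] by simp
      qed
      have wg: "w * glue D' y' * w\<^sup>\<star> = glue D y"
      proof -
        have wc: "w * glue D' y' * w\<^sup>\<star> \<in> carrier_mat ?n ?n" using U_D(2,5)[OF w] gl' by simp
        have eq: "g * (w * glue D' y' * w\<^sup>\<star>) * g\<^sup>\<star> = g * glue D y * g\<^sup>\<star>"
          using e1 unfolding g'w conj_g[OF w gl'] .
        have "w * glue D' y' * w\<^sup>\<star> = g\<^sup>\<star> * (g * (w * glue D' y' * w\<^sup>\<star>) * g\<^sup>\<star>) * g"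
          by (rule conj_U_cancel(1)[OF g wc, symmetric])
        also have "\<dots> = glue D y" unfolding eq by (rule conj_U_cancel(1)[OF g gl])
        finally show ?thesis .
      qed
      have wS: "w * stk (cl S i) (0\<^sub>m m 1) = stk (cl S i) (0\<^sub>m m 1)" if "i < k" for i
        using kry_conj[OF w gl' s0c, of i] unfolding wg ws kry_glue[OF y D that] kry_glue[OF y' D' that] by simp
      define Q where "Q = mat ?n k (\<lambda>(i, j). w $$ (i, j))"
      define J where "J = mat ?n k (\<lambda>(i, j). if i = j then 1 else 0 :: 'a)"
      have QJ: "Q \<in> carrier_mat ?n k" "J \<in> carrier_mat ?n k" by (auto simp: Q_def J_def)
      have "Q * S = J * S"
      proof (rule mat_eq_cl[of _ ?n k])
        fix j assume j: "j < k"
        have "w * stk (cl S j) (0\<^sub>m m 1) = Q * cl S j"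
          using U_D(2)[OF w] by (intro mult_stk_zero[OF _ QJ(1) _ S_cl]) (auto simp: Q_def)
        moreover have "1\<^sub>m ?n * stk (cl S j) (0\<^sub>m m 1) = J * cl S j"
          by (intro mult_stk_zero[OF _ QJ(2) _ S_cl]) (auto simp: J_def)
        ultimately show "cl (Q * S) j = cl (J * S) j"
          using wS[OF j] left_mult_one_mat[OF stk_carrier[OF S_cl zero_carrier_mat, of j m]] cl_mult[OF QJ(1) S_carrier j] cl_mult[OF QJ(2) S_carrier j] by simp
      qed (use QJ S_carrier in auto)
      then have "Q * (S * R) = J * (S * R)"
        by (simp only: assoc_mult_mat[OF QJ(1) S_carrier R_carrier, symmetric] assoc_mult_mat[OF QJ(2) S_carrier R_carrier, symmetric])
      then have QJ': "Q = J" unfolding SR using QJ by simp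
      have "w $$ (i, j) = (if i = j then 1 else 0)" if "i < ?n" "j < k" for i j
        using arg_cong[OF QJ', of "\<lambda>M. M $$ (i, j)"] that by (simp add: Q_def J_def)
      from U_first_cols_trivial[OF w this] obtain h where h: "h \<in> U m" and wh: "w = blk (1\<^sub>m k) h" by blast
      let ?D = "h\<^sup>\<star> * D * h" and ?y = "h\<^sup>\<star> * y"
      have DH: "?D \<in> Herm m" using Herm_conj_U[OF star_U[OF h] D] by simp
      have yc: "?y \<in> carrier_mat m 1" using U_D(5)[OF h] y by simp
      have wg2: "w * glue ?D ?y * w\<^sup>\<star> = glue D y" unfolding wh by (rule glue_blk_conj[OF h D y])
      have "glue D' y' = w\<^sup>\<star> * (w * glue D' y' * w\<^sup>\<star>) * w" by (rule conj_U_cancel(1)[OF w gl', symmetric])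
      also have "\<dots> = w\<^sup>\<star> * (w * glue ?D ?y * w\<^sup>\<star>) * w" unfolding wg wg2 ..
      also have "\<dots> = glue ?D ?y" by (rule conj_U_cancel(1)[OF w glue_carrier[OF yc DH]])
      finally have geq: "glue D' y' = glue ?D ?y" .
      have o: "r * y'\<^sup>\<star> \<in> carrier_mat k m" "y' * r\<^sup>\<star> \<in> carrier_mat m k" "r * ?y\<^sup>\<star> \<in> carrier_mat k m" "?y * r\<^sup>\<star> \<in> carrier_mat m k"
        using r_carrier y' yc by auto
      note inj = four_block_inj[OF E_carrier o(1,2) HermD(1)[OF D'] E_carrier o(3,4) HermD(1)[OF DH] geq[unfolded glue_def]]
      \<comment> \<open>The vector is recovered from the rank-one corner by applying that corner to
        the last column of \<open>S\<close>, which pairs to 1 with \<open>r\<close>.\<close>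
      moreover have "y' * r\<^sup>\<star> * cl S (k - 1) = y'" "?y * r\<^sup>\<star> * cl S (k - 1) = ?y"
        unfolding outer_mult[OF y' r_carrier S_cl] outer_mult[OF yc r_carrier S_cl] using ip_r_S[of "k - 1"] k_pos by auto
      ultimately have "y' = ?y" "D' = ?D" using inj by (metis, metis)
      then show "p \<in> ?h ` U m" using h p g'w wh by auto
    qed
    have "inj_on ?h (U m)"
    proof (rule inj_onI)
      fix h h' assume h: "h \<in> U m" "h' \<in> U m" and "?h h = ?h h'"
      then have "g * blk (1\<^sub>m k) h = g * blk (1\<^sub>m k) h'" by simp
      then have "blk (1\<^sub>m k) h = blk (1\<^sub>m k) h'"
        using U_cancel(1)[OF g U_D(2)[OF bU[OF h(1)]]] U_cancel(1)[OF g U_D(2)[OF bU[OF h(2)]]] by metis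
      then show "h = h'" using blk_inj(2)[OF one_carrier_mat U_D(2)[OF h(1)] one_carrier_mat U_D(2)[OF h(2)]] by simp
    qed
    from card_image[OF this] show "card ?F = card (U m)" unfolding img .
  next
    fix c assume "c \<in> Z ?n (\<tau> * \<gamma>) \<mu>"
    then obtain H v where c: "c = (H, v)" and H: "H \<in> Herm ?n" and v: "v \<in> carrier_mat ?n 1"
      and chi: "char_poly H = \<tau> * \<gamma>" and mom: "mom H v = \<mu>" by (auto simp: Z_def)
    have Hc: "H \<in> carrier_mat ?n ?n" using HermD[OF H] by auto
    \<comment> \<open>The Krylov vectors of \<open>(H, v)\<close>. Having the Gram matrix of the
      columns of \<open>S\<close>, they make \<open>B * R\<close> a matrix with orthonormal columns;
      a unitary extension of it carries the model to them.\<close>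
    define B where "B = mat ?n k (\<lambda>(i, j). kry H v j $$ (i, 0))"
    have Bc: "B \<in> carrier_mat ?n k" by (simp add: B_def)
    have kc: "kry H v j \<in> carrier_mat ?n 1" for j using Hc v by simp
    have clB: "cl B j = kry H v j" if "j < k" for j
      using that carrier_matD[OF kc, of j] by (auto simp: cl_def B_def intro!: eq_matI)
    have BB: "B\<^sup>\<star> * B = S\<^sup>\<star> * S"
    proof (rule eq_matI)
      fix i j assume "i < dim_row (S\<^sup>\<star> * S)" "j < dim_col (S\<^sup>\<star> * S)"
      then have ij: "i < k" "j < k" using S_carrier by auto
      have "(B\<^sup>\<star> * B) $$ (i, j) = ip (kry H v i) (kry H v j)" using ip_cl[OF Bc Bc ij] clB ij by simp
      also have "\<dots> = \<mu> (i + j)" unfolding ip_kry[OF H v v] using fun_cong[OF mom, of "i + j"] by (simp add: mom_def)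
      also have "\<dots> = (S\<^sup>\<star> * S) $$ (i, j)" using ip_cl[OF S_carrier S_carrier ij] gram[OF ij] by simp
      finally show "(B\<^sup>\<star> * B) $$ (i, j) = (S\<^sup>\<star> * S) $$ (i, j)" .
    qed (use Bc S_carrier in auto)
    have Qc: "B * R \<in> carrier_mat ?n k" using Bc R_carrier by simp
    have "(B * R)\<^sup>\<star> * (B * R) = R\<^sup>\<star> * (B\<^sup>\<star> * B) * R"
      using Bc R_carrier by (simp add: star_mult[of _ ?n k _ k] assoc_mult_mat[of _ k k _ ?n _ k] assoc_mult_mat[of _ k ?n _ k _ k] assoc_mult_mat[of _ k k _ k _ k])
    also have "\<dots> = (S * R)\<^sup>\<star> * (S * R)"
      unfolding BB using S_carrier R_carrier by (simp add: star_mult[of _ k k _ k] assoc_mult_mat[of _ k k _ k _ k])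
    also have "\<dots> = 1\<^sub>m k" unfolding SR by simp
    finally obtain g where g: "g \<in> U ?n" and gQ: "\<And>i j. i < ?n \<Longrightarrow> j < k \<Longrightarrow> g $$ (i, j) = (B * R) $$ (i, j)"
      using unitary_extension[of "B * R" k m] Qc by auto
    note gD = U_D[OF g]
    have gS: "g * stk (cl S j) (0\<^sub>m m 1) = kry H v j" if j: "j < k" for j
    proof -
      have "g * stk (cl S j) (0\<^sub>m m 1) = B * R * cl S j" by (rule mult_stk_zero[OF gD(2) Qc gQ S_cl])
      also have "\<dots> = B * (R * cl S j)" by (rule assoc_mult_mat[OF Bc R_carrier S_cl])
      also have "\<dots> = cl B j" unfolding R_cl_S[OF j] by (rule mult_evec[OF Bc j])
      finally show ?thesis using clB[OF j] by simp
    qed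
    let ?H = "g\<^sup>\<star> * H * g"
    have gs: "g\<^sup>\<star> \<in> U ?n" by (rule star_U[OF g])
    have HH: "?H \<in> Herm ?n" using Herm_conj_U[OF gs H] by simp
    have sv: "g\<^sup>\<star> * v = s0 m"
      using gS[OF k_pos] U_cancel(1)[OF g stk_carrier[OF S_cl zero_carrier_mat, of 0]] by (simp add: s0_def)
    have kH: "kry ?H (s0 m) i = stk (cl S i) (0\<^sub>m m 1)" if "i < k" for i
    proof -
      have "kry ?H (s0 m) i = g\<^sup>\<star> * kry H v i" using kry_conj[OF gs Hc v, of i] sv by simp
      then show ?thesis using gS[OF that] U_cancel(1)[OF g stk_carrier[OF S_cl zero_carrier_mat, of i]] by simp
    qed
    have mH: "mom ?H (s0 m) = \<mu>" using mom_conj[OF gs Hc v] sv mom by simp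
    obtain D y where D: "D \<in> Herm m" and y: "y \<in> carrier_mat m 1" and eq: "?H = glue D y" and iso: "mom D y = (\<lambda>_. 0)"
      using glue_surj[OF HH kH mH] by blast
    have "\<tau> * char_poly D = \<tau> * \<gamma>"
      using char_poly_glue[OF y D iso] char_poly_conj_U[OF gs Hc] chi eq by simp
    moreover have "\<tau> \<noteq> 0" using tau_monic by auto
    ultimately have "(D, y) \<in> Z m \<gamma> (\<lambda>_. 0)" using D y iso by (simp add: Z_def)
    moreover have "?f g (D, y) = c"
      using conj_U_cancel(2)[OF g Hc] eq U_cancel(2)[OF g v] sv c by simp
    ultimately show "\<exists>g\<in>U ?n. \<exists>b\<in>Z m \<gamma> (\<lambda>_. 0). ?f g b = c" using g by blast
  qed auto
  then show ?thesis by (simp add: mult.commute)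
qed

end

context finite_hermitian_field
begin

text \<open>The hypothesis on \<open>p\<close> says that the Hankel matrix of the moments is non-singular, that is,
  \<open>\<tau>\<close> is the minimal recurrence of the sequence \<open>\<mu>\<close>.\<close>

lemma card_Z_reduce:
  assumes monic: "lead_coeff \<tau> = 1" and rec: "act \<tau> \<mu> = (\<lambda>_. 0)"
    and real: "\<And>i. \<mu> i \<in> GF q"
    and min: "\<And>p. degree p < degree \<tau> \<Longrightarrow> act p \<mu> = (\<lambda>_. 0) \<Longrightarrow> p = 0"
  shows "card (Z (degree \<tau> + m) (\<tau> * \<gamma>) \<mu>) * card (U m) = card (U (degree \<tau> + m)) * card (Z m \<gamma> (\<lambda>_. 0))"
proof (cases "degree \<tau> = 0")
  case True
  \<comment> \<open>For \<tau> = 1 the sequence is zero, and both sides are the same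
    product.\<close>
  then have "\<tau> = 1" using monic by (metis degree_0_id one_pCons lead_coeff_pCons(2) pCons_one)
  then show ?thesis using rec by (simp add: mult.commute)
next
  case False
  let ?k = "degree \<tau>"
  define G where "G = mat ?k ?k (\<lambda>(i, j). \<mu> (i + j))"
  have G: "G \<in> Herm ?k" using real unfolding Herm_def G_def by (auto simp: GF_def add.commute intro!: eq_matI)
  have Gc: "G \<in> carrier_mat ?k ?k" using HermD[OF G] by auto
  have "det G \<noteq> 0"
  proof
    assume "det G = 0"
    then obtain v where v: "v \<in> carrier_vec ?k" "v \<noteq> 0\<^sub>v ?k" "G *\<^sub>v v = 0\<^sub>v ?k"
      using det_0_iff_vec_prod_zero_field[OF Gc] by blast
    \<comment> \<open>A kernel vector of the Hankel matrix is a polynomial of degree below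
      \<open>?k\<close> whose action on \<mu> vanishes at the first \<open>?k\<close> places. The
      result still satisfies \<tau>, so it vanishes everywhere, contrary to minimality.\<close>
    define p where "p = (\<Sum>i<?k. monom (v $ i) i)"
    have cp: "coeff p i = (if i < ?k then v $ i else 0)" for i
      unfolding p_def coeff_sum coeff_monom by simp
    have dp: "degree p \<le> ?k - 1" using False by (intro degree_le) (auto simp: cp)
    have "act p \<mu> = (\<lambda>_. 0)"
    proof (rule recurrence_unique[OF monic])
      have "act \<tau> (act p \<mu>) = act p (act \<tau> \<mu>)" by (metis act_mult mult.commute)
      then show "act \<tau> (act p \<mu>) = act \<tau> (\<lambda>_. 0)" unfolding rec by auto
      fix i assume i: "i < ?k"
      have "act p \<mu> i = (\<Sum>j\<le>?k - 1. coeff p j * \<mu> (i + j))" by (rule act_bound[OF dp])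
      also have "{..?k - 1} = {0..<?k}" using False by auto
      also have "(\<Sum>j\<in>{0..<?k}. coeff p j * \<mu> (i + j)) = (G *\<^sub>v v) $ i"
        using i v(1) by (simp add: G_def scalar_prod_def cp mult.commute)
      finally show "act p \<mu> i = 0" using v(3) i by simp
    qed
    moreover have "degree p < ?k" using dp False by linarith
    ultimately have "p = 0" using min by blast
    then have "v $ i = 0" if "i < ?k" for i using cp[of i] that by simp
    then have "v = 0\<^sub>v ?k" using v(1) by (intro eq_vecI) auto
    then show False using v(2) by simp
  qed
  from Herm_factor[OF G this] obtain S where S: "S \<in> carrier_mat ?k ?k" "S\<^sup>\<star> * S = G" by blast
  have "det (S\<^sup>\<star>) * det S = det G" using S det_mult[of "S\<^sup>\<star>" ?k S] by simp
  then have "det S \<noteq> 0" using \<open>det G \<noteq> 0\<close> by auto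
  from inverse_ex[OF S(1) this] obtain R where R: "R \<in> carrier_mat ?k ?k" "S * R = 1\<^sub>m ?k" "R * S = 1\<^sub>m ?k" .
  have "ip (cl S i) (cl S j) = \<mu> (i + j)" if "i < ?k" "j < ?k" for i j
    using ip_cl[OF S(1) S(1) that] that unfolding S(2) by (simp add: G_def)
  then interpret gram_factor q ty \<mu> \<tau> ?k S R
    by unfold_locales (use monic rec real S R False in auto)
  show ?thesis by (rule card_Z_glue)
qed

subsection \<open>Real polynomials and real recurrent sequences\<close>

definition bar :: "'a poly \<Rightarrow> 'a poly" where
  "bar p = map_poly (\<lambda>c. c ^ q) p"

lemma coeff_bar [simp]: "coeff (bar p) i = coeff p i ^ q"
  by (simp add: bar_def coeff_map_poly)

lemma degree_bar [simp]: "degree (bar p) = degree p"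
  unfolding bar_def by (rule degree_map_poly) simp

lemma bar_bar [simp]: "bar (bar p) = p"
  by (rule poly_eqI) simp

lemma bar_mult: "bar (p * r) = bar p * bar r"
  by (rule poly_eqI) (simp add: coeff_mult frob_sum frob_mult)

lemma bar_1 [simp]: "bar 1 = 1"
  by (rule poly_eqI) (auto simp: coeff_1)

lemma bar_power: "bar (p ^ n) = bar p ^ n"
  by (induction n) (simp_all add: bar_mult)

lemma act_bar: "act (bar p) (\<lambda>i. \<mu> i ^ q) i = act p \<mu> i ^ q"
  by (simp add: act_def frob_sum frob_mult)

definition real_seqs :: "(nat \<Rightarrow> 'a) set" where
  "real_seqs = {\<mu>. \<forall>i. \<mu> i ^ q = \<mu> i}"

lemma act_bar_real: "\<mu> \<in> real_seqs \<Longrightarrow> act (bar p) \<mu> i = act p \<mu> i ^ q"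
  using act_bar[of p \<mu> i] by (simp add: real_seqs_def)

lemma act_real: "\<mu> \<in> real_seqs \<Longrightarrow> bar p = p \<Longrightarrow> act p \<mu> \<in> real_seqs"
  using act_bar_real[of \<mu> p] by (simp add: real_seqs_def)

lemma mom_real_seqs: "H \<in> Herm n \<Longrightarrow> v \<in> carrier_mat n 1 \<Longrightarrow> mom H v \<in> real_seqs"
  using mom_real by (simp add: real_seqs_def GF_def)

end

text \<open>For monic \<open>F\<close>, the unique solution \<mu> of
  \<open>act F \<mu> = \<nu>\<close> whose first \<open>degree F\<close> values are those of
  \<open>f\<close>.\<close>

function extend :: "'a::field poly \<Rightarrow> (nat \<Rightarrow> 'a) \<Rightarrow> (nat \<Rightarrow> 'a) \<Rightarrow> nat \<Rightarrow> 'a" where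
  "extend F \<nu> f n = (if n < degree F then f n else
     \<nu> (n - degree F) - (\<Sum>l\<in>{..<degree F}. coeff F l * extend F \<nu> f (n - degree F + l)))"
  by auto
termination
  by (relation "measure (\<lambda>(F, \<nu>, f, n). n)") auto

declare extend.simps [simp del]

context finite_hermitian_field
begin

lemma act_extend: "lead_coeff F = 1 \<Longrightarrow> act F (extend F \<nu> f) = \<nu>"
proof (rule ext)
  fix i assume lc: "lead_coeff F = 1"
  have "act F (extend F \<nu> f) i = (\<Sum>l<degree F. coeff F l * extend F \<nu> f (i + l)) + extend F \<nu> f (i + degree F)"
    using lc by (simp add: act_def flip: lessThan_Suc_atMost)
  also have "extend F \<nu> f (i + degree F) = \<nu> i - (\<Sum>l<degree F. coeff F l * extend F \<nu> f (i + l))"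
    by (subst extend.simps) simp
  finally show "act F (extend F \<nu> f) i = \<nu> i" by simp
qed

lemma extend_init: "i < degree F \<Longrightarrow> extend F \<nu> f i = f i"
  by (subst extend.simps) simp

text \<open>The conjugate sequence solves the same recurrence with the same initial values.\<close>

lemma extend_real:
  assumes F: "lead_coeff F = 1" "bar F = F" and \<nu>: "\<nu> \<in> real_seqs" and f: "\<And>i. i < degree F \<Longrightarrow> f i ^ q = f i"
  shows "extend F \<nu> f \<in> real_seqs"
proof -
  let ?e = "extend F \<nu> f"
  have "(\<lambda>i. ?e i ^ q) = ?e"
  proof (rule recurrence_unique[OF F(1)])
    have "act F (\<lambda>i. ?e i ^ q) i = \<nu> i" for i
      using act_bar[of F ?e i] act_extend[OF F(1), of \<nu> f] \<nu> F(2) by (simp add: real_seqs_def)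
    then show "act F (\<lambda>i. ?e i ^ q) = act F ?e" using act_extend[OF F(1), of \<nu> f] by auto
    show "?e i ^ q = ?e i" if "i < degree F" for i using that f by (simp add: extend_init)
  qed
  then show ?thesis by (auto simp: real_seqs_def fun_eq_iff)
qed

lemma bij_betw_init:
  assumes F: "lead_coeff F = 1" "bar F = F" and \<nu>: "\<nu> \<in> real_seqs"
  shows "bij_betw (\<lambda>\<mu>. restrict \<mu> {..<degree F}) {\<mu> \<in> real_seqs. act F \<mu> = \<nu>} ({..<degree F} \<rightarrow>\<^sub>E GF q)"
proof (rule bij_betw_byWitness[where f' = "extend F \<nu>"])
  show "\<forall>\<mu>\<in>{\<mu> \<in> real_seqs. act F \<mu> = \<nu>}. extend F \<nu> (restrict \<mu> {..<degree F}) = \<mu>"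
  proof
    fix \<mu> assume \<mu>: "\<mu> \<in> {\<mu> \<in> real_seqs. act F \<mu> = \<nu>}"
    show "extend F \<nu> (restrict \<mu> {..<degree F}) = \<mu>"
      by (rule recurrence_unique[OF F(1)]) (use \<mu> in \<open>simp_all add: act_extend[OF F(1)] extend_init\<close>)
  qed
  show "\<forall>f\<in>{..<degree F} \<rightarrow>\<^sub>E GF q. restrict (extend F \<nu> f) {..<degree F} = f"
  proof
    fix f assume f: "f \<in> {..<degree F} \<rightarrow>\<^sub>E (GF q :: 'a set)"
    show "restrict (extend F \<nu> f) {..<degree F} = f"
    proof (rule ext)
      fix i show "restrict (extend F \<nu> f) {..<degree F} i = f i"
        using PiE_arb[OF f, of i] by (simp add: extend_init)
    qed
  qed
  show "(\<lambda>\<mu>. restrict \<mu> {..<degree F}) ` {\<mu> \<in> real_seqs. act F \<mu> = \<nu>} \<subseteq> {..<degree F} \<rightarrow>\<^sub>E GF q"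
    by (rule image_subsetI) (simp add: restrict_PiE_iff real_seqs_def GF_def)
  show "extend F \<nu> ` ({..<degree F} \<rightarrow>\<^sub>E GF q) \<subseteq> {\<mu> \<in> real_seqs. act F \<mu> = \<nu>}"
  proof (rule image_subsetI)
    fix f assume f: "f \<in> {..<degree F} \<rightarrow>\<^sub>E (GF q :: 'a set)"
    have "f i ^ q = f i" if "i < degree F" for i using PiE_mem[OF f, of i] that by (simp add: GF_def)
    then show "extend F \<nu> f \<in> {\<mu> \<in> real_seqs. act F \<mu> = \<nu>}"
      using extend_real[OF F \<nu>] act_extend[OF F(1)] by simp
  qed
qed

lemma finite_GF_q [simp]: "finite (GF q :: 'a set)"
  using card_GF_le(1)[OF q_gt_1] .

lemma card_GF_q: "card (GF q :: 'a set) = q"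
  by (rule norm_fiber_aux(1))

lemma recurrent_fiber:
  assumes F: "lead_coeff F = 1" "bar F = F" and \<nu>: "\<nu> \<in> real_seqs"
  shows "finite {\<mu> \<in> real_seqs. act F \<mu> = \<nu>}" "card {\<mu> \<in> real_seqs. act F \<mu> = \<nu>} = q ^ degree F"
proof -
  note b = bij_betw_init[OF assms]
  show "finite {\<mu> \<in> real_seqs. act F \<mu> = \<nu>}"
    using bij_betw_finite[OF b] by (simp add: finite_PiE)
  show "card {\<mu> \<in> real_seqs. act F \<mu> = \<nu>} = q ^ degree F"
    using bij_betw_same_card[OF b] by (simp add: card_PiE card_GF_q)
qed

text \<open>\<open>\<mu> 0\<close> is itself a free initial value, with \<open>q - 1\<close> nonzero
  choices. That the number does not depend on \<nu> is what lets the recursion close.\<close>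

lemma card_recurrent_fiber_nonzero:
  assumes F: "lead_coeff F = 1" "bar F = F" and \<nu>: "\<nu> \<in> real_seqs" and d: "0 < degree F"
  shows "card {\<mu> \<in> real_seqs. act F \<mu> = \<nu> \<and> \<mu> 0 \<noteq> 0} = (q - 1) * q ^ (degree F - 1)"
proof -
  let ?X = "\<lambda>i::nat. if i = 0 then GF q - {0} else GF q :: 'a set"
  have "bij_betw (\<lambda>\<mu>. restrict \<mu> {..<degree F}) {\<mu> \<in> {\<mu> \<in> real_seqs. act F \<mu> = \<nu>}. \<mu> 0 \<noteq> 0}
      {f \<in> {..<degree F} \<rightarrow>\<^sub>E GF q. f 0 \<noteq> 0}"
    by (rule bij_betw_Collect[OF bij_betw_init[OF F \<nu>]]) (use d in auto)
  then have "card {\<mu> \<in> {\<mu> \<in> real_seqs. act F \<mu> = \<nu>}. \<mu> 0 \<noteq> 0}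
      = card {f \<in> {..<degree F} \<rightarrow>\<^sub>E (GF q :: 'a set). f 0 \<noteq> 0}" by (rule bij_betw_same_card)
  also have "{f \<in> {..<degree F} \<rightarrow>\<^sub>E (GF q :: 'a set). f 0 \<noteq> 0} = Pi\<^sub>E {..<degree F} ?X"
  proof (intro Set.set_eqI iffI)
    fix f assume "f \<in> {f \<in> {..<degree F} \<rightarrow>\<^sub>E (GF q :: 'a set). f 0 \<noteq> 0}"
    then show "f \<in> Pi\<^sub>E {..<degree F} ?X" by (simp add: PiE_iff)
  next
    fix f assume f: "f \<in> Pi\<^sub>E {..<degree F} ?X"
    have "f 0 \<noteq> 0" using PiE_mem[OF f, of 0] d by simp
    moreover have "f i \<in> GF q" if "i < degree F" for i using PiE_mem[OF f, of i] that by (simp split: if_splits)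
    ultimately show "f \<in> {f \<in> {..<degree F} \<rightarrow>\<^sub>E (GF q :: 'a set). f 0 \<noteq> 0}" using f by (simp add: PiE_iff)
  qed
  also have "card (Pi\<^sub>E {..<degree F} ?X) = (\<Prod>i<degree F. card (?X i))" by (simp add: card_PiE)
  also have "\<dots> = card (?X 0) * (\<Prod>i\<in>{..<degree F} - {0}. card (?X i))"
    using d by (intro prod.remove) auto
  also have "(\<Prod>i\<in>{..<degree F} - {0}. card (?X i)) = q ^ (degree F - 1)"
    using d by (simp add: card_GF_q)
  also have "card (?X 0) = q - 1"
    using card_GF_q by (simp add: GF_def)
  finally show ?thesis by (simp add: conj_assoc)
qed

text \<open>Only real divisors are tested, so that a product of two distinct conjugate irreducible
  polynomials qualifies just as a real irreducible polynomial does.\<close>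

definition prime_power_real :: "'a poly \<Rightarrow> bool" where
  "prime_power_real F \<longleftrightarrow> lead_coeff F = 1 \<and> bar F = F \<and> 0 < degree F \<and>
     (\<forall>\<gamma> j. lead_coeff \<gamma> = 1 \<and> bar \<gamma> = \<gamma> \<and> \<gamma> dvd F ^ j \<longrightarrow> (\<exists>i\<le>j. \<gamma> = F ^ i))"

text \<open>The annihilator of a real sequence is generated by a real polynomial, which here has to be a
  power of \<open>F\<close>.\<close>

lemma recurrence_order:
  assumes F: "prime_power_real F" and \<mu>: "\<mu> \<in> real_seqs" and rec: "act (F ^ j) \<mu> = (\<lambda>_. 0)"
  obtains k where "k \<le> j" "act (F ^ k) \<mu> = (\<lambda>_. 0)"
    "\<And>p. degree p < degree (F ^ k) \<Longrightarrow> act p \<mu> = (\<lambda>_. 0) \<Longrightarrow> p = 0"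
proof -
  let ?I = "{p. act p \<mu> = (\<lambda>_. 0)}"
  let ?P = "\<lambda>p. lead_coeff p = 1 \<and> p \<in> ?I"
  have lF: "lead_coeff (F ^ j) = 1" using F by (simp add: prime_power_real_def lead_coeff_power)
  then have ex: "?P (F ^ j)" using rec by simp
  \<comment> \<open>A monic annihilator of least degree generates the annihilator of \<mu>.\<close>
  define g where "g = arg_min degree ?P"
  have g: "?P g" unfolding g_def by (rule arg_min_natI[of ?P, OF ex])
  have le: "degree g \<le> degree p" if "?P p" for p
    unfolding g_def using arg_min_nat_le[of ?P, OF that] .
  have I_smult: "smult c p \<in> ?I" if "p \<in> ?I" for c p using that by (auto simp: fun_eq_iff act_smult)
  have I_add: "p + r \<in> ?I" if "p \<in> ?I" "r \<in> ?I" for p r using that by (auto simp: fun_eq_iff act_add)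
  have I_mult: "r * p \<in> ?I" if "p \<in> ?I" for p r using that by (auto simp: act_mult)
  have I_diff: "p - r \<in> ?I" if "p \<in> ?I" "r \<in> ?I" for p r
    using I_add[OF that(1) I_smult[OF that(2), of "- 1"]] by simp
  have min: "p = 0" if "degree p < degree g" "p \<in> ?I" for p
  proof (rule ccontr)
    assume "p \<noteq> 0"
    then have "?P (smult (inverse (lead_coeff p)) p)" using I_smult[OF that(2)] by simp
    from le[OF this] show False using that(1) \<open>p \<noteq> 0\<close> by simp
  qed
  have "bar g = g"
  proof (rule ccontr)
    assume ne: "bar g \<noteq> g"
    \<comment> \<open>On a real sequence \<open>bar g\<close> acts as the conjugate of
      \<open>g\<close>. It is therefore a second monic annihilator of the same degree, and the
      difference of the two has smaller degree.\<close>
    have "bar g \<in> ?I" using g \<mu> by (auto simp: fun_eq_iff act_bar_real)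
    then have I: "g - bar g \<in> ?I" using g I_diff by blast
    have "degree (g - bar g) < degree g \<or> g - bar g = 0"
    proof (cases "degree g = 0")
      case True
      then have "g = 1" using g by (metis degree_0_id one_pCons lead_coeff_pCons(2) pCons_one)
      then show ?thesis by simp
    next
      case False
      have "degree (g - bar g) \<le> degree g" by (rule degree_diff_le) auto
      moreover have "coeff (g - bar g) (degree g) = 0" using g by simp
      ultimately show ?thesis using False by (metis degree_0 eq_zero_or_degree_less gr0I)
    qed
    then show False using min I ne by (metis eq_iff_diff_eq_0)
  qed
  moreover have "g dvd F ^ j"
  proof -
    have "F ^ j mod g = F ^ j - (F ^ j div g) * g" by (simp add: minus_div_mult_eq_mod)
    then have "F ^ j mod g \<in> ?I" using I_diff[OF _ I_mult] ex g by simp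
    moreover have "F ^ j mod g = 0 \<or> degree (F ^ j mod g) < degree g" using g by (intro degree_mod_less) auto
    ultimately show ?thesis using min by (auto simp: mod_eq_0_iff_dvd)
  qed
  ultimately obtain k where "k \<le> j" "g = F ^ k" using F g unfolding prime_power_real_def by blast
  then show thesis using that[of k] g min by simp
qed

subsection \<open>Hermitian matrices whose characteristic polynomial is a real prime power\<close>

definition herm_with_char :: "nat \<Rightarrow> 'a poly \<Rightarrow> 'a mat set" where
  "herm_with_char n P = {H \<in> Herm n. char_poly H = P}"

lemma finite_herm_with_char [simp]: "finite (herm_with_char n P)"
  by (simp add: herm_with_char_def)

lemma act_char_poly_mom:
  assumes "H \<in> Herm n" "v \<in> carrier_mat n 1"
  shows "act (char_poly H) (mom H v) = (\<lambda>_. 0)"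
proof (rule ext)
  fix i
  note HD = HermD[OF assms(1)]
  have "pm (char_poly H) H * v = 0\<^sub>m n 1" unfolding Cayley_Hamilton[OF HD(1)] using assms(2) by simp
  moreover have "kry H (0\<^sub>m n 1) i = 0\<^sub>m n 1" using HD(1) by (induction i) auto
  ultimately show "act (char_poly H) (mom H v) i = 0"
    unfolding act_mom[OF HD(1) assms(2)] using assms(2) by simp
qed

text \<open>By the Cayley-Hamilton theorem the moments of every pair lie in the finite set of real
  sequences annihilated by \<open>P\<close>. The parameter \<open>R\<close> is used for
  \<open>\<mu> 0 \<noteq> 0\<close> and for no restriction.\<close>

lemma card_pairs_by_moments:
  assumes Q: "finite {\<mu> \<in> real_seqs. act P \<mu> = (\<lambda>_. 0)}"
  shows "card {(H, v). H \<in> herm_with_char n P \<and> v \<in> carrier_mat n 1 \<and> R (mom H v)}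
    = (\<Sum>\<mu> | \<mu> \<in> real_seqs \<and> act P \<mu> = (\<lambda>_. 0) \<and> R \<mu>. card (Z n P \<mu>))"
proof -
  let ?A = "{(H, v). H \<in> herm_with_char n P \<and> v \<in> carrier_mat n 1 \<and> R (mom H v)}"
  let ?B = "{\<mu>. \<mu> \<in> real_seqs \<and> act P \<mu> = (\<lambda>_. 0) \<and> R \<mu>}"
  have "card ?A = (\<Sum>\<mu>\<in>?B. card {a \<in> ?A. (case a of (H, v) \<Rightarrow> mom H v) = \<mu>})"
  proof (rule finite_card_fibers)
    show "finite ?B" by (rule finite_subset[OF _ Q]) auto
    have "finite ?A" by (rule finite_subset[of _ "herm_with_char n P \<times> carrier_mat n 1"]) auto
    then show "finite {a \<in> ?A. (case a of (H, v) \<Rightarrow> mom H v) = \<mu>}" for \<mu> by simp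
    show "(\<lambda>(H, v). mom H v) ` ?A \<subseteq> ?B"
      using mom_real_seqs act_char_poly_mom by (auto simp: herm_with_char_def)
  qed
  also have "\<dots> = (\<Sum>\<mu>\<in>?B. card (Z n P \<mu>))"
  proof (rule sum.cong[OF refl])
    fix \<mu> assume "\<mu> \<in> ?B"
    then have "{a \<in> ?A. (case a of (H, v) \<Rightarrow> mom H v) = \<mu>} = Z n P \<mu>"
      by (auto simp: Z_def herm_with_char_def)
    then show "card {a \<in> ?A. (case a of (H, v) \<Rightarrow> mom H v) = \<mu>} = card (Z n P \<mu>)" by simp
  qed
  finally show ?thesis .
qed

section \<open>The recursion in the exponent of a real prime power\<close>

context
  fixes F :: "'a poly" and d :: nat
  assumes F: "prime_power_real F" and d: "degree F = d"
begin

private lemma F_monic: "lead_coeff F = 1" and F_bar: "bar F = F" and d_pos: "0 < d"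
  using F d by (auto simp: prime_power_real_def)

private lemma F_pow: "lead_coeff (F ^ j) = 1" "bar (F ^ j) = F ^ j" "degree (F ^ j) = d * j"
proof -
  have "F \<noteq> 0" using F_monic by auto
  then show "degree (F ^ j) = d * j" using d by (simp add: degree_power_eq mult.commute)
qed (use F_monic F_bar in \<open>simp_all add: lead_coeff_power bar_power\<close>)

private lemma seqs_finite: "finite {\<mu> \<in> real_seqs. act (F ^ j) \<mu> = (\<lambda>_. 0)}"
  by (rule recurrent_fiber(1)[OF F_pow(1,2)]) (simp add: real_seqs_def zero_power)

lemma card_Z_level:
  assumes \<mu>: "\<mu> \<in> real_seqs" and k: "k \<le> j" and rec: "act (F ^ k) \<mu> = (\<lambda>_. 0)"
    and min: "\<And>p. degree p < degree (F ^ k) \<Longrightarrow> act p \<mu> = (\<lambda>_. 0) \<Longrightarrow> p = 0"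
  shows "card (Z (d * j) (F ^ j) \<mu>) * card (U (d * (j - k)))
    = card (U (d * j)) * card (Z (d * (j - k)) (F ^ (j - k)) (\<lambda>_. 0))"
proof -
  have 1: "degree (F ^ k) + d * (j - k) = d * j" using k F_pow(3) by (simp add: add_mult_distrib2[symmetric])
  have 2: "F ^ k * F ^ (j - k) = F ^ j" using k by (simp flip: power_add)
  have 3: "\<mu> i \<in> GF q" for i using \<mu> by (simp add: real_seqs_def GF_def)
  show ?thesis using card_Z_reduce[OF F_pow(1) rec 3 min, of "d * (j - k)" "F ^ (j - k)"] unfolding 1 2 .
qed

text \<open>If \<mu> has order \<open>F^(k'+1)\<close>, then \<open>act F \<mu>\<close> has order
  \<open>F^k'\<close>. Both counts are expressed by the same number of pairs of size
  \<open>d * (j - k')\<close> with zero moments, which is thereby eliminated.\<close>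

lemma card_Z_act:
  assumes \<mu>: "\<mu> \<in> real_seqs" and rec: "act (F ^ Suc j) \<mu> = (\<lambda>_. 0)" and nz: "\<mu> 0 \<noteq> 0"
  shows "card (Z (d * Suc j) (F ^ Suc j) \<mu>) * card (U (d * j)) = card (U (d * Suc j)) * card (Z (d * j) (F ^ j) (act F \<mu>))"
proof -
  obtain k where k: "k \<le> Suc j" "act (F ^ k) \<mu> = (\<lambda>_. 0)"
    and min: "\<And>p. degree p < degree (F ^ k) \<Longrightarrow> act p \<mu> = (\<lambda>_. 0) \<Longrightarrow> p = 0"
    using recurrence_order[OF F \<mu> rec] by blast
  have "k \<noteq> 0"
  \<comment> \<open>Here \<open>\<mu> 0 \<noteq> 0\<close> is used: order \<open>F^0\<close> would
    mean the zero sequence, whose order \<open>F\<close> cannot lower.\<close>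
  proof
    assume "k = 0"
    then have "\<mu> = (\<lambda>_. 0)" using k(2) by simp
    then show False using nz by simp
  qed
  then obtain k' where k': "k = Suc k'" by (cases k) auto
  let ?\<nu> = "act F \<mu>"
  have \<nu>: "?\<nu> \<in> real_seqs" by (rule act_real[OF \<mu> F_bar])
  have rec': "act (F ^ k') ?\<nu> = (\<lambda>_. 0)"
    using k(2) unfolding k' power_Suc2 act_mult .
  \<comment> \<open>A recurrence \<open>p\<close> of \<open>act F \<mu>\<close> is a recurrence
    \<open>p * F\<close> of \<mu>, so minimality passes down.\<close>
  have min': "p = 0" if "degree p < degree (F ^ k')" "act p ?\<nu> = (\<lambda>_. 0)" for p
  proof (rule ccontr)
    assume "p \<noteq> 0"
    have F0: "F \<noteq> 0" using F_monic by auto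
    have "degree (p * F) = degree p + d" using \<open>p \<noteq> 0\<close> F0 d by (simp add: degree_mult_eq)
    then have "degree (p * F) < degree (F ^ k)" using that(1) unfolding F_pow(3) k' by simp
    moreover have "act (p * F) \<mu> = (\<lambda>_. 0)" using that(2) by (simp add: act_mult)
    ultimately have "p * F = 0" by (rule min)
    then show False using \<open>p \<noteq> 0\<close> F0 by simp
  qed
  have k'j: "k' \<le> j" using k(1) k' by simp
  have 1: "card (Z (d * Suc j) (F ^ Suc j) \<mu>) * card (U (d * (j - k'))) = card (U (d * Suc j)) * card (Z (d * (j - k')) (F ^ (j - k')) (\<lambda>_. 0))"
    using card_Z_level[OF \<mu> k min] by (simp add: k')
  have 2: "card (Z (d * j) (F ^ j) ?\<nu>) * card (U (d * (j - k'))) = card (U (d * j)) * card (Z (d * (j - k')) (F ^ (j - k')) (\<lambda>_. 0))"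
    using card_Z_level[OF \<nu> k'j rec' min'] .
  let ?z = "card (Z (d * (j - k')) (F ^ (j - k')) (\<lambda>_. 0))" and ?u = "card (U (d * (j - k')))"
  have "card (Z (d * Suc j) (F ^ Suc j) \<mu>) * card (U (d * j)) * ?u = card (U (d * Suc j)) * ?z * card (U (d * j))"
    unfolding 1[symmetric] by (simp only: mult_ac)
  also have "\<dots> = card (U (d * Suc j)) * (card (Z (d * j) (F ^ j) ?\<nu>) * ?u)" unfolding 2 by (simp only: mult_ac)
  finally have "(card (Z (d * Suc j) (F ^ Suc j) \<mu>) * card (U (d * j))) * ?u
      = (card (U (d * Suc j)) * card (Z (d * j) (F ^ j) ?\<nu>)) * ?u" by (simp only: mult.assoc)
  moreover have "?u \<noteq> 0" by (rule less_imp_neq[OF card_U_pos, symmetric])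
  ultimately show ?thesis by (simp only: mult_cancel2 simp_thms)
qed

text \<open>Counts the pairs of size \<open>d * Suc j\<close> with non-isotropic \<open>v\<close>.
  Grouped by \<open>\<nu> = act F \<mu>\<close>, each \<nu> occurs
  \<open>(q - 1) * q ^ (d - 1)\<close> times, and the remaining sum over \<nu> counts all pairs of
  size \<open>d * j\<close>, isotropic vectors included.\<close>

lemma herm_recursion:
  "card (herm_with_char (d * Suc j) (F ^ Suc j)) * card {v \<in> carrier_mat (d * Suc j) 1. nrm q v \<noteq> (0::'a)} * card (U (d * j))
    = card (U (d * Suc j)) * ((q - 1) * q ^ (d - 1)) * (card (herm_with_char (d * j) (F ^ j)) * (q\<^sup>2) ^ (d * j))"
proof -
  let ?n = "d * Suc j" and ?n' = "d * j"
  let ?A = "{\<mu>. \<mu> \<in> real_seqs \<and> act (F ^ Suc j) \<mu> = (\<lambda>_. 0) \<and> \<mu> 0 \<noteq> 0}"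
  let ?B = "{\<nu>. \<nu> \<in> real_seqs \<and> act (F ^ j) \<nu> = (\<lambda>_. 0) \<and> True}"
  let ?z = "\<lambda>\<nu>. card (Z ?n' (F ^ j) \<nu>)"
  have finA: "finite ?A" by (rule finite_subset[OF _ seqs_finite[of "Suc j"]]) auto
  have finB: "finite ?B" using seqs_finite[of j] by simp
  \<comment> \<open>The zeroth moment is the norm of \<open>v\<close> for every \<open>H\<close>, so
    these pairs form a product set.\<close>
  have "{(H, v). H \<in> herm_with_char ?n (F ^ Suc j) \<and> v \<in> carrier_mat ?n 1 \<and> mom H v 0 \<noteq> 0}
      = herm_with_char ?n (F ^ Suc j) \<times> {v \<in> carrier_mat ?n 1. nrm q v \<noteq> (0::'a)}"
    by (auto simp: mom_def ip_self)
  then have "card (herm_with_char ?n (F ^ Suc j)) * card {v \<in> carrier_mat ?n 1. nrm q v \<noteq> (0::'a)} * card (U ?n')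
      = (\<Sum>\<mu>\<in>?A. card (Z ?n (F ^ Suc j) \<mu>)) * card (U ?n')"
    using card_pairs_by_moments[OF seqs_finite[of "Suc j"], of ?n "\<lambda>\<mu>. \<mu> 0 \<noteq> 0"] by (simp add: card_cartesian_product)
  also have "\<dots> = (\<Sum>\<mu>\<in>?A. card (U ?n) * ?z (act F \<mu>))"
    unfolding sum_distrib_right by (rule sum.cong[OF refl], rule card_Z_act) auto
  also have "\<dots> = card (U ?n) * (\<Sum>\<mu>\<in>?A. ?z (act F \<mu>))" by (simp add: sum_distrib_left)
  also have "(\<Sum>\<mu>\<in>?A. ?z (act F \<mu>)) = (\<Sum>\<nu>\<in>?B. \<Sum>\<mu>\<in>{\<mu> \<in> ?A. act F \<mu> = \<nu>}. ?z (act F \<mu>))"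
  proof (rule sum.group[symmetric, OF finA finB])
    have "act (F ^ j) (act F \<mu>) = (\<lambda>_. 0)" if "act (F ^ Suc j) \<mu> = (\<lambda>_. 0)" for \<mu>
      using that unfolding power_Suc2 act_mult .
    then show "act F ` ?A \<subseteq> ?B" using act_real[OF _ F_bar] by auto
  qed
  also have "\<dots> = (\<Sum>\<nu>\<in>?B. (q - 1) * q ^ (d - 1) * ?z \<nu>)"
  proof (rule sum.cong[OF refl])
    fix \<nu> assume \<nu>: "\<nu> \<in> ?B"
    have "{\<mu> \<in> ?A. act F \<mu> = \<nu>} = {\<mu> \<in> real_seqs. act F \<mu> = \<nu> \<and> \<mu> 0 \<noteq> 0}"
      using \<nu> unfolding power_Suc2 act_mult by auto
    then have "card {\<mu> \<in> ?A. act F \<mu> = \<nu>} = (q - 1) * q ^ (d - 1)"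
      using card_recurrent_fiber_nonzero[OF F_monic F_bar, of \<nu>] \<nu> d d_pos by simp
    then show "(\<Sum>\<mu>\<in>{\<mu> \<in> ?A. act F \<mu> = \<nu>}. ?z (act F \<mu>)) = (q - 1) * q ^ (d - 1) * ?z \<nu>" by simp
  qed
  also have "\<dots> = (q - 1) * q ^ (d - 1) * (\<Sum>\<nu>\<in>?B. ?z \<nu>)" by (simp add: sum_distrib_left)
  also have "(\<Sum>\<nu>\<in>?B. ?z \<nu>) = card (herm_with_char ?n' (F ^ j) \<times> (carrier_mat ?n' 1 :: 'a mat set))"
  proof -
    have "herm_with_char ?n' (F ^ j) \<times> (carrier_mat ?n' 1 :: 'a mat set) = {(H, v). H \<in> herm_with_char ?n' (F ^ j) \<and> v \<in> carrier_mat ?n' 1 \<and> True}" by auto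
    then show ?thesis using card_pairs_by_moments[OF seqs_finite[of j], of ?n' "\<lambda>_. True"] by simp
  qed
  also have "\<dots> = card (herm_with_char ?n' (F ^ j)) * (q\<^sup>2) ^ ?n'"
    using card_mats_on[OF finite_K, of ?n' 1] by (simp add: card_cartesian_product card_GF)
  finally show ?thesis by (simp only: mult.assoc)
qed

text \<open>Inserts the number of non-isotropic vectors into the recursion. The sign
  \<open>(-1) ^ (d * Suc j)\<close> stems from that number alone.\<close>

lemma herm_ratio:
  "real (card (herm_with_char (d * Suc j) (F ^ Suc j))) / real (card (U (d * Suc j)))
    = real (card (herm_with_char (d * j) (F ^ j))) / real (card (U (d * j)))
       * (real (q ^ d) ^ j / (real (q ^ d) ^ Suc j - (-1) ^ (d * Suc j)))"
proof -
  let ?N = "real (card (herm_with_char (d * Suc j) (F ^ Suc j)))" and ?N' = "real (card (herm_with_char (d * j) (F ^ j)))"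
  let ?U = "real (card (U (d * Suc j)))" and ?U' = "real (card (U (d * j)))"
  let ?J = "real (card {v \<in> carrier_mat (d * Suc j) 1. nrm q v \<noteq> (0::'a)})"
  let ?R = "real (q ^ d)" and ?s = "(-1) ^ (d * Suc j) :: real"
  have "real_of_int (int q * int (card {v \<in> mats_on (d * Suc j) 1 K. nrm q v \<noteq> 0}))
     = real_of_int ((int q - 1) * int q ^ (d * Suc j) * (int q ^ (d * Suc j) - (-1) ^ (d * Suc j)))"
    by (simp only: card_nonisotropic)
  moreover have "?R ^ Suc j = real q ^ (d * Suc j)" by (simp only: of_nat_power power_mult)
  ultimately have J: "real q * ?J = (real q - 1) * (?R ^ Suc j * (?R ^ Suc j - ?s))"
    by (simp only: of_int_mult of_int_diff of_int_power of_int_of_nat_eq of_int_1 of_int_minus mult.assoc mats_on_K)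
  have rec: "?N * ?J * ?U' = ?U * ((real q - 1) * real q ^ (d - 1)) * (?N' * (?R ^ j * ?R ^ j))"
  proof -
    have "real ((q\<^sup>2) ^ (d * j)) = ?R ^ j * ?R ^ j" by (simp add: power2_eq_square power_mult_distrib power_mult)
    moreover have "real (q - 1) = real q - 1" using q_gt_1 by simp
    ultimately show ?thesis
      using arg_cong[OF herm_recursion[of j], of real] by (simp only: of_nat_mult of_nat_power)
  qed
  have Rd: "?R = real q * real q ^ (d - 1)" using d_pos by (cases d) auto
  have "(real q - 1) * (?N * (?R ^ Suc j * (?R ^ Suc j - ?s)) * ?U') = ?N * (real q * ?J) * ?U'"
    unfolding J by simp
  also have "\<dots> = real q * (?N * ?J * ?U')" by simp
  also have "\<dots> = (real q - 1) * (?U * ?N' * (?R ^ Suc j * ?R ^ j))" unfolding rec by (simp only: Rd mult_ac power_Suc)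
  finally have "?N * (?R ^ Suc j * (?R ^ Suc j - ?s)) * ?U' = ?U * ?N' * (?R ^ Suc j * ?R ^ j)"
    using q_gt_1 by (subst (asm) mult_cancel_left) auto
  then have "?R ^ Suc j * (?N * (?R ^ Suc j - ?s) * ?U') = ?R ^ Suc j * (?U * ?N' * ?R ^ j)"
    by (simp only: mult_ac)
  then have eq: "?N * (?R ^ Suc j - ?s) * ?U' = ?U * ?N' * ?R ^ j"
    using q_gt_1 by (subst (asm) mult_cancel_left) auto
  have "1 < q ^ d" using q_gt_1 d_pos by (rule one_less_power)
  then have "1 < (q ^ d) ^ Suc j" by (rule one_less_power) simp
  then have "1 < ?R ^ Suc j" by (metis of_nat_1 of_nat_less_iff of_nat_power)
  moreover have "?s \<le> 1" by (cases "even (d * Suc j)") auto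
  ultimately have "?R ^ Suc j - ?s \<noteq> 0" by linarith
  moreover have "?U \<noteq> 0" "?U' \<noteq> 0" using card_U_pos[of "d * Suc j"] card_U_pos[of "d * j"] by auto
  ultimately show ?thesis using eq by (simp add: frac_eq_eq mult_ac)
qed

end

end

subsection \<open>Comaximal polynomials\<close>

text \<open>Coprimality in Bezout form, because the identity \<open>a * p + b * r = 1\<close> is
  what gets evaluated at a matrix.\<close>

definition comaximal :: "'a::field poly \<Rightarrow> 'a poly \<Rightarrow> bool" where
  "comaximal p r \<longleftrightarrow> (\<exists>a b. a * p + b * r = 1)"

lemma comaximal_sym: "comaximal p r \<Longrightarrow> comaximal r p"
  unfolding comaximal_def by (subst add.commute) blast

lemma comaximal_mult:
  assumes "comaximal p r" "comaximal p' r"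
  shows "comaximal (p * p') r"
proof -
  obtain a b a' b' where "a * p + b * r = 1" "a' * p' + b' * r = 1" using assms by (auto simp: comaximal_def)
  then have "1 = (a * p + b * r) * (a' * p' + b' * r)" by simp
  also have "\<dots> = (a * a') * (p * p') + (b * a' * p' + (a * p + b * r) * b') * r" by (simp add: algebra_simps)
  finally show ?thesis unfolding comaximal_def by (intro exI) (rule sym)
qed

lemma comaximal_1 [simp]: "comaximal 1 r"
  unfolding comaximal_def by (rule exI[of _ 1], rule exI[of _ 0]) simp

lemma comaximal_power: "comaximal p r \<Longrightarrow> comaximal (p ^ n) r"
  by (induction n) (auto intro: comaximal_mult)

lemma comaximal_power2: "comaximal p r \<Longrightarrow> comaximal (p ^ n) (r ^ m)"
  by (rule comaximal_power, rule comaximal_sym, rule comaximal_power, rule comaximal_sym)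

lemma comaximal_prod: "(\<And>i. i \<in> I \<Longrightarrow> comaximal (f i) r) \<Longrightarrow> comaximal (\<Prod>i\<in>I. f i) r"
  by (induction I rule: infinite_finite_induct) (auto intro: comaximal_mult)

lemma comaximal_dvd: "comaximal p r \<Longrightarrow> p dvd r * x \<Longrightarrow> p dvd x"
proof -
  assume "comaximal p r" and d: "p dvd r * x"
  then obtain a b where "a * p + b * r = 1" by (auto simp: comaximal_def)
  then have "x = (a * p + b * r) * x" by simp
  also have "\<dots> = p * (a * x) + b * (r * x)" by (simp add: algebra_simps)
  also have "p dvd \<dots>" using d by (intro dvd_add) auto
  finally show ?thesis .
qed

text \<open>A nonzero combination of \<open>p\<close> and \<open>r\<close> of least degree divides
  both. As \<open>p\<close> is irreducible and does not divide \<open>r\<close>, this combination is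
  a unit.\<close>

lemma irreducible_comaximal:
  fixes p r :: "'a::field poly"
  assumes irr: "Factorial_Ring.irreducible p" and nd: "\<not> p dvd r"
  shows "comaximal p r"
proof -
  let ?P = "\<lambda>g. g \<noteq> 0 \<and> (\<exists>a b. g = a * p + b * r)"
  have p0: "p \<noteq> 0" using irr by (simp add: Factorial_Ring.irreducible_def)
  have "p = 1 * p + 0 * r" by simp
  then have ex: "?P p" using p0 by blast
  define g where "g = arg_min degree ?P"
  have g: "?P g" unfolding g_def by (rule arg_min_natI[of ?P, OF ex])
  have le: "degree g \<le> degree x" if "?P x" for x
    unfolding g_def using arg_min_nat_le[of ?P, OF that] .
  obtain a b where ab: "g = a * p + b * r" using g by blast
  have dvd: "g dvd x" if x: "x = u * p + v * r" for x u v
  proof (rule ccontr)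
    assume "\<not> g dvd x"
    then have ne: "x mod g \<noteq> 0" by (simp add: dvd_eq_mod_eq_0)
    have "x mod g = x - (x div g) * g" by (simp add: minus_div_mult_eq_mod)
    also have "\<dots> = (u - (x div g) * a) * p + (v - (x div g) * b) * r" unfolding x ab by (simp add: algebra_simps)
    finally have "?P (x mod g)" using ne by blast
    then show False using le[of "x mod g"] degree_mod_less[of g x] g ne by (meson not_less)
  qed
  have gp: "g dvd p" by (rule dvd[of p 1 0]) simp
  have gr: "g dvd r" by (rule dvd[of r 0 1]) simp
  have "is_unit g"
  proof (rule ccontr)
    assume ng: "\<not> is_unit g"
    obtain e where e: "p = g * e" using gp by (rule dvdE)
    have "is_unit e" using Factorial_Ring.irreducibleD[OF irr e] ng by blast
    then have "p dvd g" unfolding e by (simp add: mult_unit_dvd_iff)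
    then show False using gr nd dvd_trans by blast
  qed
  then obtain h where "1 = g * h" by (rule dvdE)
  then have "(h * a) * p + (h * b) * r = 1" unfolding ab by (simp add: algebra_simps)
  then show ?thesis unfolding comaximal_def by blast
qed

subsection \<open>Homogeneous substitution into polynomials\<close>

text \<open>The homogenised polynomial \<open>a^n p(b / a)\<close>; for linear \<open>a\<close> and
  \<open>b\<close> it describes the effect of a Moebius map on the roots. The parameter
  \<open>n\<close> allows for polynomials of smaller degree.\<close>

definition hsubst :: "nat \<Rightarrow> 'a::field poly \<Rightarrow> 'a poly \<Rightarrow> 'a poly \<Rightarrow> 'a poly" where
  "hsubst n p b a = (\<Sum>i\<le>n. smult (coeff p i) (b ^ i * a ^ (n - i)))"

lemma hsubst_0 [simp]: "hsubst n 0 b a = 0"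
  by (simp add: hsubst_def)

lemma hsubst_add: "hsubst n (p + r) b a = hsubst n p b a + hsubst n r b a"
  by (simp add: hsubst_def smult_add_left sum.distrib)

lemma hsubst_smult: "hsubst n (smult c p) b a = smult c (hsubst n p b a)"
  by (simp add: hsubst_def smult_sum2)

lemma hsubst_sum: "hsubst n (\<Sum>i\<in>I. f i) b a = (\<Sum>i\<in>I. hsubst n (f i) b a)"
  by (induction I rule: infinite_finite_induct) (auto simp: hsubst_add)

lemma hsubst_pCons: "hsubst (Suc n) (pCons k p) b a = smult k (a ^ Suc n) + b * hsubst n p b a"
  unfolding hsubst_def
  by (subst sum.atMost_Suc_shift) (simp add: sum_distrib_left mult.assoc)

lemma hsubst_lift: "degree p \<le> n \<Longrightarrow> hsubst (k + n) p b a = a ^ k * hsubst n p b a"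
proof -
  assume d: "degree p \<le> n"
  have "hsubst (k + n) p b a = (\<Sum>i\<le>n. smult (coeff p i) (b ^ i * a ^ (k + n - i)))"
    unfolding hsubst_def using d by (intro sum.mono_neutral_right) (auto simp: coeff_eq_0)
  also have "\<dots> = (\<Sum>i\<le>n. a ^ k * smult (coeff p i) (b ^ i * a ^ (n - i)))"
  proof (intro sum.cong refl)
    fix i assume "i \<in> {..n}"
    then have "k + n - i = k + (n - i)" by simp
    then show "smult (coeff p i) (b ^ i * a ^ (k + n - i)) = a ^ k * smult (coeff p i) (b ^ i * a ^ (n - i))"
      by (simp add: power_add mult.left_commute)
  qed
  finally show ?thesis by (simp add: hsubst_def sum_distrib_left)
qed

lemma hsubst_mult:
  assumes "degree p \<le> m" "degree r \<le> n"
  shows "hsubst (m + n) (p * r) b a = hsubst m p b a * hsubst n r b a"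
  using assms(1)
proof (induction p arbitrary: m)
  case 0
  then show ?case by simp
next
  case (pCons k p)
  have eq: "pCons k p * r = smult k r + pCons 0 (p * r)" by simp
  show ?case
  proof (cases m)
    case 0
    then have "p = 0" using pCons.prems by (simp split: if_splits)
    then show ?thesis using 0 by (simp add: hsubst_smult) (simp add: hsubst_def)
  next
    case (Suc m')
    then have "degree p \<le> m'" using pCons.prems by (cases "p = 0") auto
    from pCons.IH[OF this] show ?thesis
      unfolding eq Suc hsubst_add hsubst_smult
      using hsubst_lift[OF assms(2), of "Suc m'" b a]
      by (simp add: hsubst_pCons algebra_simps)
  qed
qed

lemma hsubst_power: "degree p \<le> m \<Longrightarrow> hsubst (k * m) (p ^ k) b a = hsubst m p b a ^ k"
proof (induction k)
  case 0
  then show ?case by (simp add: hsubst_def)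
next
  case (Suc k)
  have "degree (p ^ k) \<le> k * m"
    using degree_power_le[of p k] Suc.prems by (metis le_trans mult.commute mult_le_mono1)
  then show ?case using hsubst_mult[of p m "p ^ k" "k * m" b a] Suc by simp
qed

lemma hsubst_linear: "hsubst 1 [:b0, b1:] b' a' = smult b0 a' + smult b1 b'"
  by (simp add: hsubst_def)

text \<open>Substitutions of linear forms compose like 2 by 2 matrices.\<close>

lemma hsubst_hsubst:
  "hsubst n (hsubst n p [:b0, b1:] [:a0, a1:]) b' a'
    = hsubst n p (smult b0 a' + smult b1 b') (smult a0 a' + smult a1 b')"
proof -
  have deg: "degree [:x, y:] \<le> 1" for x y :: 'a by simp
  have "hsubst n ([:b0, b1:] ^ i * [:a0, a1:] ^ (n - i)) b' a'
      = (smult b0 a' + smult b1 b') ^ i * (smult a0 a' + smult a1 b') ^ (n - i)" if "i \<le> n" for i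
  proof -
    have d: "degree ([:x, y:] ^ k) \<le> k * 1" for x y :: 'a and k
      using degree_power_le[of "[:x, y:]" k] deg[of x y] by (metis le_trans mult.commute mult_le_mono1)
    have "i * 1 + (n - i) * 1 = n" using that by simp
    then show ?thesis
      using hsubst_mult[OF d[of b0 b1 i] d[of a0 a1 "n - i"], of b' a']
      unfolding hsubst_power[OF deg] hsubst_linear by simp
  qed
  then show ?thesis
    unfolding hsubst_def[of n p] hsubst_sum hsubst_smult by (intro sum.cong refl) simp
qed

lemma hsubst_reflect: "degree p = n \<Longrightarrow> hsubst n (reflect_poly p) b a = hsubst n p a b"
proof -
  assume d: "degree p = n"
  have "hsubst n (reflect_poly p) b a = (\<Sum>i\<le>n. smult (coeff p (n - i)) (b ^ i * a ^ (n - i)))"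
    unfolding hsubst_def using d by (intro sum.cong refl) (simp add: coeff_reflect_poly)
  also have "\<dots> = (\<Sum>i\<le>n. smult (coeff p i) (b ^ (n - i) * a ^ i))"
    by (rule sum.reindex_bij_witness[of _ "\<lambda>i. n - i" "\<lambda>i. n - i"]) auto
  finally show ?thesis by (simp add: hsubst_def mult.commute)
qed

lemma hsubst_scale: "degree p \<le> n \<Longrightarrow> hsubst n p [:0, \<delta>:] [:\<delta>:] = smult (\<delta> ^ n) p"
proof -
  assume d: "degree p \<le> n"
  have "[:0, \<delta>:] ^ i * [:\<delta>:] ^ (n - i) = monom (\<delta> ^ n) i" if "i \<le> n" for i
  proof -
    have "[:0, \<delta>:] = monom \<delta> 1" by (simp add: monom_altdef)
    then show ?thesis using that
      by (simp add: monom_power poly_const_pow smult_monom mult.commute flip: power_add)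
  qed
  then have "hsubst n p [:0, \<delta>:] [:\<delta>:] = (\<Sum>i\<le>n. smult (coeff p i) (monom (\<delta> ^ n) i))"
    unfolding hsubst_def by (intro sum.cong refl) simp
  also have "\<dots> = (\<Sum>i\<le>n. smult (\<delta> ^ n) (monom (coeff p i) i))"
    by (simp add: smult_monom mult.commute)
  also have "\<dots> = smult (\<delta> ^ n) (\<Sum>i\<le>n. monom (coeff p i) i)" by (simp add: smult_sum2)
  also have "(\<Sum>i\<le>n. monom (coeff p i) i) = p"
    using poly_as_sum_of_monoms'[OF d] .
  finally show ?thesis .
qed

lemma degree_hsubst: "degree a \<le> 1 \<Longrightarrow> degree b \<le> 1 \<Longrightarrow> degree (hsubst n p b a) \<le> n"
proof -
  assume ab: "degree a \<le> 1" "degree b \<le> 1"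
  show ?thesis unfolding hsubst_def
  proof (rule degree_sum_le)
    fix i assume "i \<in> {..n}"
    then have i: "i \<le> n" by simp
    have "degree (b ^ i * a ^ (n - i)) \<le> degree b * i + degree a * (n - i)"
      by (rule order_trans[OF degree_mult_le add_mono]) (rule degree_power_le)+
    also have "\<dots> \<le> 1 * i + 1 * (n - i)" using ab by (intro add_mono mult_le_mono1)
    finally show "degree (smult (coeff p i) (b ^ i * a ^ (n - i))) \<le> n"
      using i degree_smult_le[of "coeff p i" "b ^ i * a ^ (n - i)"] by simp
  qed simp
qed

lemma coeff_mult_top:
  fixes p r :: "'a::comm_semiring_0 poly"
  assumes "degree p \<le> i" "degree r \<le> m"
  shows "coeff (p * r) (i + m) = coeff p i * coeff r m"
proof -
  have "coeff (p * r) (i + m) = (\<Sum>k\<in>{i}. coeff p k * coeff r (i + m - k))"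
    unfolding coeff_mult
  proof (intro sum.mono_neutral_right ballI)
    fix k assume "k \<in> {..i + m} - {i}"
    then consider "k < i" | "i < k" by force
    then show "coeff p k * coeff r (i + m - k) = 0"
      using assms by cases (simp_all add: coeff_eq_0)
  qed auto
  then show ?thesis by simp
qed

text \<open>The leading coefficient is the value of \<open>p\<close> at the image of infinity under
  the Moebius map, here \<open>b1\<close>. The degree drops exactly when this image is a
  root.\<close>

lemma coeff_hsubst:
  assumes "degree p \<le> n"
  shows "coeff (hsubst n p [:b0, b1:] [:a0, 1:]) n = poly p b1"
proof -
  have c: "coeff ([:b0, b1:] ^ i * [:a0, 1:] ^ m) (i + m) = b1 ^ i" for i m
  proof -
    have "coeff ([:x, y:] ^ k) k = y ^ k \<and> degree ([:x, y:] ^ k) \<le> k" for x y :: 'a and k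
    proof (induction k)
      case (Suc k)
      have "coeff ([:x, y:] ^ k) (Suc k) = 0" using Suc by (intro coeff_eq_0) auto
      moreover have "degree ([:x, y:] ^ Suc k) \<le> degree [:x, y:] * Suc k" by (rule degree_power_le)
      ultimately show ?case using Suc by (auto split: if_splits)
    qed simp
    note c = this
    have "coeff ([:b0, b1:] ^ i * [:a0, 1:] ^ m) (i + m) = b1 ^ i * 1 ^ m"
      using c[of b0 b1 i] c[of a0 1 m] by (subst coeff_mult_top) auto
    then show ?thesis by simp
  qed
  have "coeff (hsubst n p [:b0, b1:] [:a0, 1:]) n = (\<Sum>i\<le>n. coeff p i * b1 ^ i)"
    unfolding hsubst_def coeff_sum coeff_smult
  proof (intro sum.cong refl)
    fix i assume "i \<in> {..n}"
    then show "coeff p i * coeff ([:b0, b1:] ^ i * [:a0, 1:] ^ (n - i)) n = coeff p i * b1 ^ i"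
      using c[of i "n - i"] by simp
  qed
  also have "\<dots> = poly p b1" unfolding poly_altdef using assms
    by (intro sum.mono_neutral_right) (auto simp: coeff_eq_0)
  finally show ?thesis .
qed

lemma poly_hsubst: "poly (hsubst n p b a) x = (\<Sum>i\<le>n. coeff p i * (poly b x ^ i * poly a x ^ (n - i)))"
  by (simp add: hsubst_def poly_sum)

lemma poly_hsubst_pole: "poly a x = 0 \<Longrightarrow> poly (hsubst n p b a) x = coeff p n * poly b x ^ n"
proof -
  assume a: "poly a x = 0"
  have "poly (hsubst n p b a) x = (\<Sum>i\<in>{n}. coeff p i * (poly b x ^ i * poly a x ^ (n - i)))"
    unfolding poly_hsubst using a by (intro sum.mono_neutral_right) auto
  then show ?thesis by simp
qed

text \<open>The characteristic polynomial of \<alpha> times \<open>M\<close> is evaluated at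
  \<beta>; substituting \<alpha> times the variable shows its coefficients to be those of
  \<open>char_poly M\<close> times powers of \<alpha>. Over an integral domain, \<alpha> and \<beta>
  may themselves be polynomials.\<close>

lemma det_linear_pencil:
  fixes M :: "'r::idom mat"
  assumes M: "M \<in> carrier_mat n n" and \<alpha>: "\<alpha> \<noteq> 0"
  shows "det (\<beta> \<cdot>\<^sub>m 1\<^sub>m n - \<alpha> \<cdot>\<^sub>m M) = (\<Sum>i\<le>n. coeff (char_poly M) i * (\<beta> ^ i * \<alpha> ^ (n - i)))"
proof -
  let ?S = "char_poly (\<alpha> \<cdot>\<^sub>m M)"
  have ev: "comm_ring_hom (\<lambda>p. poly p \<beta>)" by unfold_locales auto
  have co: "comm_ring_hom (\<lambda>p. p \<circ>\<^sub>p [:0, \<alpha>:])"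
    by unfold_locales (simp_all add: pcompose_add pcompose_mult pcompose_1)
  have aM: "\<alpha> \<cdot>\<^sub>m M \<in> carrier_mat n n" using M by simp
  have "map_mat (\<lambda>p. poly p \<beta>) (char_poly_matrix (\<alpha> \<cdot>\<^sub>m M)) = \<beta> \<cdot>\<^sub>m 1\<^sub>m n - \<alpha> \<cdot>\<^sub>m M"
    using M by (intro eq_matI) (auto simp: char_poly_matrix_def)
  then have 1: "det (\<beta> \<cdot>\<^sub>m 1\<^sub>m n - \<alpha> \<cdot>\<^sub>m M) = poly ?S \<beta>"
    unfolding char_poly_def using comm_ring_hom.hom_det[OF ev, of "char_poly_matrix (\<alpha> \<cdot>\<^sub>m M)"] by simp
  have "map_mat (\<lambda>p. p \<circ>\<^sub>p [:0, \<alpha>:]) (char_poly_matrix (\<alpha> \<cdot>\<^sub>m M)) = [:\<alpha>:] \<cdot>\<^sub>m char_poly_matrix M"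
    using M by (intro eq_matI) (auto simp: char_poly_matrix_def pcompose_pCons)
  then have "?S \<circ>\<^sub>p [:0, \<alpha>:] = [:\<alpha>:] ^ n * char_poly M"
    unfolding char_poly_def using comm_ring_hom.hom_det[OF co, of "char_poly_matrix (\<alpha> \<cdot>\<^sub>m M)"] char_poly_matrix_closed[OF M]
    by simp
  then have 2: "coeff ?S i * \<alpha> ^ i = \<alpha> ^ n * coeff (char_poly M) i" for i
    using coeff_pcompose_linear[of ?S \<alpha> i] by (simp add: poly_const_pow mult.commute)
  have 3: "coeff ?S i = coeff (char_poly M) i * \<alpha> ^ (n - i)" if "i \<le> n" for i
  proof -
    have "\<alpha> ^ i * coeff ?S i = \<alpha> ^ i * (coeff (char_poly M) i * \<alpha> ^ (n - i))"
      using 2[of i] that by (simp add: mult_ac flip: power_add)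
    then show ?thesis using \<alpha> by simp
  qed
  have "poly ?S \<beta> = (\<Sum>i\<le>n. coeff ?S i * \<beta> ^ i)"
    unfolding poly_altdef using degree_monic_char_poly[OF aM] by simp
  also have "\<dots> = (\<Sum>i\<le>n. coeff (char_poly M) i * (\<beta> ^ i * \<alpha> ^ (n - i)))"
    by (intro sum.cong refl) (simp add: 3 mult_ac)
  finally show ?thesis using 1 by simp
qed

lemma det_pencil_hsubst:
  fixes H :: "'a::field mat"
  assumes H: "H \<in> carrier_mat n n" and a: "a \<noteq> 0"
  shows "det (b \<cdot>\<^sub>m 1\<^sub>m n - a \<cdot>\<^sub>m cmat H) = hsubst n (char_poly H) b a"
proof -
  interpret h: comm_ring_hom "\<lambda>x::'a. [:x:]" by unfold_locales (auto simp: one_pCons)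
  have "char_poly (cmat H) = map_poly (\<lambda>x. [:x:]) (char_poly H)" by (rule h.char_poly_hom[OF H])
  then show ?thesis
    unfolding hsubst_def using det_linear_pencil[of "cmat H" n a b] H a by (simp add: coeff_map_poly)
qed

lemma poly_char_poly: "(H :: 'a::field mat) \<in> carrier_mat n n \<Longrightarrow> poly (char_poly H) c = det (c \<cdot>\<^sub>m 1\<^sub>m n - H)"
proof -
  assume H: "H \<in> carrier_mat n n"
  have "1 \<cdot>\<^sub>m H = H" by (intro eq_matI) auto
  then show ?thesis
    using det_linear_pencil[OF H, of 1 c] degree_monic_char_poly[OF H] by (simp add: poly_altdef)
qed

context finite_hermitian_field
begin

subsection \<open>The degree of a real irreducible polynomial\<close>

text \<open>For an irreducible characteristic polynomial a nonzero \<open>v\<close> is cyclic, so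
  its Krylov vectors form a basis. Zero moments make \<open>v\<close> orthogonal to all of
  them.\<close>

lemma cyclic_moments_zero:
  assumes H: "H \<in> Herm d" and v: "v \<in> carrier_mat d 1" and irr: "Factorial_Ring.irreducible (char_poly H)"
    and mom: "mom H v = (\<lambda>_. 0)"
  shows "v = 0\<^sub>m d 1"
proof (rule ccontr)
  assume v0: "v \<noteq> 0\<^sub>m d 1"
  note HD = HermD[OF H]
  define M where "M = mat d d (\<lambda>(i, j). kry H v j $$ (i, 0))"
  have M: "M \<in> carrier_mat d d" by (simp add: M_def)
  have deg: "degree (char_poly H) = d" using degree_monic_char_poly[OF HD(1)] by simp
  have clM: "cl M j = kry H v j" if "j < d" for j
    using kry_carrier[OF HD(1) v, of j] that by (intro eq_matI) (auto simp: cl_def M_def)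
  have "det M \<noteq> 0"
  proof
    assume "det M = 0"
    then obtain a where a: "a \<in> carrier_vec d" "a \<noteq> 0\<^sub>v d" "M *\<^sub>v a = 0\<^sub>v d"
      using det_0_iff_vec_prod_zero_field[OF M] by blast
    \<comment> \<open>A relation between the Krylov vectors is a polynomial \<open>p\<close> of
      degree below \<open>d\<close> with \<open>p(H) v = 0\<close>; a Bezout identity with the
      irreducible \<open>char_poly H\<close> would then give \<open>v = 0\<close>.\<close>
    define p where "p = (\<Sum>i<d. monom (a $ i) i)"
    have cp: "coeff p i = (if i < d then a $ i else 0)" for i
      unfolding p_def coeff_sum coeff_monom by simp
    have p0: "p \<noteq> 0"
    proof
      assume "p = 0"
      then have "a $ i = 0" if "i < d" for i using cp[of i] that by simp
      then have "a = 0\<^sub>v d" using a(1) by (intro eq_vecI) auto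
      then show False using a(2) by simp
    qed
    have d0: "d \<noteq> 0"
    proof
      assume "d = 0"
      then have "a = 0\<^sub>v d" using a(1) by (intro eq_vecI) auto
      then show False using a(2) by simp
    qed
    have dp: "degree p \<le> d - 1" using d0 by (intro degree_le) (auto simp: cp)
    have pv: "pm p H * v = 0\<^sub>m d 1"
    proof (rule eq_matI)
      fix i l assume "i < dim_row (0\<^sub>m d 1 :: 'a mat)" "l < dim_col (0\<^sub>m d 1 :: 'a mat)"
      then have il: "i < d" "l = 0" by auto
      have "(pm p H * v) $$ (i, 0) = act p (\<lambda>j. kry H v j $$ (i, 0)) 0"
        by (rule pm_mult_index[OF HD(1) v il(1)])
      also have "\<dots> = (\<Sum>j\<le>d - 1. coeff p j * kry H v (0 + j) $$ (i, 0))"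
        by (rule act_bound[OF dp])
      also have "{..d - 1} = {0..<d}" using d0 by auto
      also have "(\<Sum>j\<in>{0..<d}. coeff p j * kry H v (0 + j) $$ (i, 0)) = (M *\<^sub>v a) $ i"
        using il a(1) by (simp add: M_def scalar_prod_def cp mult.commute)
      finally show "(pm p H * v) $$ (i, l) = (0\<^sub>m d 1 :: 'a mat) $$ (i, l)" using a(3) il by simp
    qed (use HD(1) v in auto)
    have "\<not> char_poly H dvd p"
    proof
      assume "char_poly H dvd p"
      then have "degree (char_poly H) \<le> degree p" using p0 by (rule dvd_imp_degree_le)
      then show False using dp deg d0 by linarith
    qed
    from irreducible_comaximal[OF irr this] obtain r s where rs: "r * char_poly H + s * p = 1"
      by (auto simp: comaximal_def)
    note c = pm_carrier[OF HD(1)]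
    have "v = pm 1 H * v" using HD(1) v by simp
    also have "pm 1 H = pm r H * pm (char_poly H) H + pm s H * pm p H"
      unfolding rs[symmetric] pm_add[OF HD(1)] pm_mult[OF HD(1)] ..
    also have "\<dots> * v = pm r H * pm (char_poly H) H * v + pm s H * pm p H * v"
      by (rule add_mult_distrib_mat[of _ d d]) (use c v in \<open>auto intro: mult_carrier_mat[OF c c]\<close>)
    also have "pm s H * pm p H * v = pm s H * (pm p H * v)" by (rule assoc_mult_mat[OF c c v])
    also have "pm r H * pm (char_poly H) H * v = 0\<^sub>m d 1"
      unfolding Cayley_Hamilton[OF HD(1)] right_mult_zero_mat[OF c] using v by simp
    also have "pm s H * (pm p H * v) = 0\<^sub>m d 1" unfolding pv by (rule right_mult_zero_mat[OF c])
    finally show False using v0 by simp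
  qed
  from det_star[OF M this] have "det (M\<^sup>\<star>) \<noteq> 0" .
  moreover have "M\<^sup>\<star> \<in> carrier_mat d d" using M by simp
  ultimately obtain R where R: "R \<in> carrier_mat d d" "R * M\<^sup>\<star> = 1\<^sub>m d" using inverse_ex by metis
  have "M\<^sup>\<star> * v = 0\<^sub>m d 1"
  proof (rule eq_matI)
    fix i l assume "i < dim_row (0\<^sub>m d 1 :: 'a mat)" "l < dim_col (0\<^sub>m d 1 :: 'a mat)"
    then have il: "i < d" "l = 0" by auto
    have "cl v 0 = v" using v by (intro eq_matI) (auto simp: cl_def)
    then have "(M\<^sup>\<star> * v) $$ (i, 0) = ip (kry H v i) (kry H v 0)"
      using ip_cl[OF M v il(1), of 0] clM[OF il(1)] by simp
    also have "\<dots> = ip v (kry H v (i + 0))" by (rule ip_kry[OF H v v])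
    also have "\<dots> = mom H v i" by (simp add: mom_def)
    finally show "(M\<^sup>\<star> * v) $$ (i, l) = (0\<^sub>m d 1 :: 'a mat) $$ (i, l)" using mom il by simp
  qed (use M v in auto)
  then have "R * (M\<^sup>\<star> * v) = 0\<^sub>m d 1" using R by simp
  then have "v = 0\<^sub>m d 1" using R v M assoc_mult_mat[of R d d "M\<^sup>\<star>" d v 1] by simp
  then show False using v0 by simp
qed

text \<open>Sum over all moment sequences: the zero sequence comes from \<open>v = 0\<close> alone,
  and each of the other \<open>q^d - 1\<close> has order \<open>F\<close> and belongs to
  \<open>|U d|\<close> pairs. So \<open>N (q^(2d) - 1) = (q^d - 1) |U d|\<close>, that is
  \<open>N = |U d| / (q^d + 1)\<close>, while the recursion from \<open>j = 0\<close> has the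
  denominator \<open>q^d - (-1)^d\<close>.\<close>

lemma irreducible_real_odd:
  assumes F: "prime_power_real F" and irr: "Factorial_Ring.irreducible F"
  shows "odd (degree F)"
proof -
  let ?d = "degree F"
  let ?N = "card (herm_with_char ?d F)" and ?u = "card (U ?d)"
  have FD: "lead_coeff F = 1" "bar F = F" "0 < ?d" using F by (auto simp: prime_power_real_def)
  have zr: "(\<lambda>_. 0) \<in> real_seqs" by (simp add: real_seqs_def)
  let ?B = "{\<mu> \<in> real_seqs. act F \<mu> = (\<lambda>_. 0)}"
  have fB: "finite ?B" and cB: "card ?B = q ^ ?d" using recurrent_fiber[OF FD(1,2) zr] by auto
  have Z0: "card (Z ?d F (\<lambda>_. 0)) = ?N"
  proof -
    have "kry H (0\<^sub>m ?d 1) i = 0\<^sub>m ?d 1" if "H \<in> Herm ?d" for H i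
      using HermD(1)[OF that] by (induction i) auto
    then have "mom H (0\<^sub>m ?d 1) = (\<lambda>_. 0)" if "H \<in> Herm ?d" for H
      using that by (simp add: mom_def fun_eq_iff)
    then have "Z ?d F (\<lambda>_. 0) = herm_with_char ?d F \<times> {0\<^sub>m ?d 1}"
      using cyclic_moments_zero irr by (auto simp: Z_def herm_with_char_def)
    then show ?thesis by (simp add: card_cartesian_product)
  qed
  have U0: "card (U 0) = 1" and Z00: "card (Z 0 1 (\<lambda>_. 0)) = 1"
  proof -
    have e: "A = 1\<^sub>m 0" if "A \<in> carrier_mat 0 0" for A :: "'a mat" using that by (intro eq_matI) auto
    then have "U 0 = {1\<^sub>m 0}" using one_U U_D(2) by blast
    then show "card (U 0) = 1" by simp
    have e1: "v = 0\<^sub>m 0 1" if "v \<in> carrier_mat 0 1" for v :: "'a mat" using that by (intro eq_matI) auto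
    have "char_poly (1\<^sub>m 0 :: 'a mat) = 1" by (simp add: char_poly_def det_dim_zero char_poly_matrix_def)
    moreover have "mom (1\<^sub>m 0) (0\<^sub>m 0 1) = (\<lambda>_. 0)"
      using ip_sum[of _ 0] kry_carrier[of "1\<^sub>m 0" 0 "0\<^sub>m 0 1" 1] by (auto simp: mom_def fun_eq_iff)
    moreover have "1\<^sub>m 0 \<in> Herm 0" by (simp add: Herm_def)
    ultimately have "Z 0 1 (\<lambda>_. 0) = {(1\<^sub>m 0, 0\<^sub>m 0 1)}"
      using HermD(1) e e1 by (auto simp: Z_def)
    then show "card (Z 0 1 (\<lambda>_. 0)) = 1" by simp
  qed
  have Z1: "card (Z ?d F \<mu>) = ?u" if \<mu>: "\<mu> \<in> ?B - {\<lambda>_. 0}" for \<mu>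
  proof -
    have "act (F ^ 1) \<mu> = (\<lambda>_. 0)" using \<mu> by simp
    from recurrence_order[OF F _ this] obtain k where k: "k \<le> 1" "act (F ^ k) \<mu> = (\<lambda>_. 0)"
      and min: "\<And>p. degree p < degree (F ^ k) \<Longrightarrow> act p \<mu> = (\<lambda>_. 0) \<Longrightarrow> p = 0"
      using \<mu> by blast
    have "k \<noteq> 0" using k(2) \<mu> by (intro notI) simp
    then have k1: "k = 1" using k(1) by simp
    show ?thesis
      using card_Z_level[OF F refl _ k min] \<mu> U0 Z00 unfolding k1 by simp
  qed
  have "?N * (q\<^sup>2) ^ ?d = card (herm_with_char ?d F \<times> (carrier_mat ?d 1 :: 'a mat set))"
    using card_mats_on[OF finite_K, of ?d 1] by (simp add: card_cartesian_product card_GF)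
  also have "herm_with_char ?d F \<times> (carrier_mat ?d 1 :: 'a mat set)
      = {(H, v). H \<in> herm_with_char ?d F \<and> v \<in> carrier_mat ?d 1 \<and> True}" by auto
  also have "card \<dots> = (\<Sum>\<mu>\<in>?B. card (Z ?d F \<mu>))"
    using card_pairs_by_moments[OF fB, of ?d "\<lambda>_. True"] by simp
  also have "\<dots> = card (Z ?d F (\<lambda>_. 0)) + (\<Sum>\<mu>\<in>?B - {\<lambda>_. 0}. card (Z ?d F \<mu>))"
    by (rule sum.remove[OF fB]) (simp add: zr fun_eq_iff)
  also have "\<dots> = ?N + (q ^ ?d - 1) * ?u"
    using Z0 Z1 cB fB zr by (simp add: fun_eq_iff)
  finally have eq: "?N * (q\<^sup>2) ^ ?d = ?N + (q ^ ?d - 1) * ?u" .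
  let ?R = "real (q ^ ?d)"
  have R1: "1 < ?R" using one_less_power[OF q_gt_1 FD(3)] by (metis of_nat_1 of_nat_less_iff)
  have "real ((q\<^sup>2) ^ ?d) = ?R * ?R" by (simp add: power2_eq_square power_mult_distrib)
  moreover have "real (q ^ ?d - 1) = ?R - 1"
    by (subst of_nat_diff) (simp_all add: Suc_leI One_nat_def)
  ultimately have "real ?N * (?R * ?R) = real ?N + (?R - 1) * real ?u"
    using arg_cong[OF eq, of real] by (simp only: of_nat_mult of_nat_add)
  then have "(?R - 1) * (real ?N * (?R + 1)) = (?R - 1) * real ?u" by (simp add: algebra_simps)
  then have 1: "real ?N * (?R + 1) = real ?u" using R1 by simp
  have H0: "card (herm_with_char 0 1) = 1"
  proof -
    have e: "A = 1\<^sub>m 0" if "A \<in> carrier_mat 0 0" for A :: "'a mat" using that by (intro eq_matI) auto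
    have "char_poly (1\<^sub>m 0 :: 'a mat) = 1" by (simp add: char_poly_def det_dim_zero char_poly_matrix_def)
    moreover have "1\<^sub>m 0 \<in> Herm 0" by (simp add: Herm_def)
    ultimately have "herm_with_char 0 1 = {1\<^sub>m 0}"
      using HermD(1) e by (auto simp: herm_with_char_def)
    then show ?thesis by simp
  qed
  have u0: "real ?u \<noteq> 0" using card_U_pos[of ?d] by (metis less_numeral_extra(3) of_nat_eq_0_iff)
  have "real ?N / real ?u = 1 / (?R - (-1) ^ ?d)"
    using herm_ratio[OF F refl, of 0] U0 H0 by simp
  moreover have "real ?N / real ?u = 1 / (?R + 1)"
  proof -
    have "?R + 1 \<noteq> 0" using R1 by linarith
    then show ?thesis using 1 u0 by (simp add: field_simps)
  qed
  ultimately have "inverse (?R - (-1) ^ ?d) = inverse (?R + 1)" by (simp add: inverse_eq_divide)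
  then have "?R - (-1) ^ ?d = ?R + 1" by (rule inverse_eq_imp_eq)
  then have "(-1::real) ^ ?d = - 1" by linarith
  then show ?thesis by (cases "even ?d") auto
qed

subsection \<open>Prime powers among the real polynomials\<close>

lemma poly_bar: "poly (bar p) (x ^ q) = poly p x ^ q"
  by (simp add: poly_altdef frob_sum frob_mult flip: power_mult) (simp add: mult.commute)

lemma bar_0_iff [simp]: "bar p = 0 \<longleftrightarrow> p = 0"
  by (simp add: poly_eq_iff)

lemma bar_dvd: "p dvd r \<Longrightarrow> bar p dvd bar r"
  unfolding dvd_def by (auto simp: bar_mult)

lemma monic_unit: "is_unit p \<Longrightarrow> lead_coeff p = 1 \<Longrightarrow> p = (1 :: 'a poly)"
  using is_unit_iff_degree[of p] by (cases "p = 0") (auto elim!: degree_eq_zeroE simp: one_pCons)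

lemma tilde_degree: "coeff (p :: 'a poly) 0 \<noteq> 0 \<Longrightarrow> degree (tilde q p) = degree p"
  using degree_reflect_poly_eq[of "bar p"] by (simp add: tilde_def flip: bar_def)

text \<open>A real divisor of \<open>F ^ Suc j\<close> either has a factor \<open>F\<close>, which
  is peeled off, or is coprime to \<open>F\<close> and so divides \<open>F ^ j\<close>.\<close>

lemma prime_power_realI:
  assumes F: "lead_coeff F = 1" "bar F = F" "0 < degree F"
    and alt: "\<And>\<gamma>. bar \<gamma> = \<gamma> \<Longrightarrow> F dvd \<gamma> \<or> comaximal F \<gamma>"
  shows "prime_power_real F"
proof -
  have F0: "F \<noteq> 0" using F by auto
  have "\<exists>i\<le>j. \<gamma> = F ^ i" if "lead_coeff \<gamma> = 1" "bar \<gamma> = \<gamma>" "\<gamma> dvd F ^ j" for \<gamma> j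
    using that
  proof (induction j arbitrary: \<gamma>)
    case 0
    then have "\<gamma> = 1" by (intro monic_unit) simp_all
    then show ?case by simp
  next
    case (Suc j)
    show ?case
    proof (cases "F dvd \<gamma>")
      case True
      then obtain \<gamma>' where g: "\<gamma> = F * \<gamma>'" by (rule dvdE)
      have "lead_coeff \<gamma>' = 1" using Suc.prems(1) F(1) unfolding g by (simp add: lead_coeff_mult)
      moreover have "F * bar \<gamma>' = F * \<gamma>'" using Suc.prems(2) F(2) unfolding g by (simp add: bar_mult)
      then have "bar \<gamma>' = \<gamma>'" using F0 by (metis mult_left_cancel)
      moreover have "\<gamma>' dvd F ^ j" using Suc.prems(3) F0 unfolding g by simp
      ultimately obtain i where "i \<le> j" "\<gamma>' = F ^ i" using Suc.IH by blast
      then show ?thesis unfolding g by (intro exI[of _ "Suc i"]) simp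
    next
      case False
      then have "comaximal F \<gamma>" using alt Suc.prems(2) by blast
      then have "comaximal \<gamma> F" by (rule comaximal_sym)
      moreover have "\<gamma> dvd F * F ^ j" using Suc.prems(3) by simp
      ultimately have "\<gamma> dvd F ^ j" by (rule comaximal_dvd)
      then show ?thesis using Suc.IH Suc.prems by (meson le_SucI)
    qed
  qed
  then show ?thesis using F unfolding prime_power_real_def by blast
qed

lemma irreducible_degree_pos: "Factorial_Ring.irreducible (p :: 'a poly) \<Longrightarrow> 0 < degree p"
  using is_unit_iff_degree[of p] by (auto simp: Factorial_Ring.irreducible_def)

lemma prime_power_real_irreducible:
  assumes "lead_coeff F = 1" "bar F = F" "Factorial_Ring.irreducible F"
  shows "prime_power_real F"
  using assms irreducible_comaximal irreducible_degree_pos by (intro prime_power_realI) auto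

lemma irreducible_bar: "Factorial_Ring.irreducible G \<Longrightarrow> Factorial_Ring.irreducible (bar G)"
proof (rule Factorial_Ring.irreducibleI)
  assume G: "Factorial_Ring.irreducible G"
  show "bar G \<noteq> 0" "\<not> is_unit (bar G)"
    using irreducible_degree_pos[OF G] is_unit_iff_degree[of "bar G"] degree_bar[of G] by auto
  fix a b assume "bar G = a * b"
  then have "G = bar a * bar b" by (metis bar_bar bar_mult)
  then have "is_unit (bar a) \<or> is_unit (bar b)" using Factorial_Ring.irreducibleD[OF G] by blast
  then show "is_unit a \<or> is_unit b" using bar_dvd[of "bar a" 1] bar_dvd[of "bar b" 1] by auto
qed

lemma irreducible_monic_comaximal:
  assumes "lead_coeff (p :: 'a poly) = 1" "lead_coeff r = 1" "Factorial_Ring.irreducible p" "Factorial_Ring.irreducible r" "p \<noteq> r"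
  shows "comaximal p r"
proof (rule irreducible_comaximal[OF assms(3)])
  show "\<not> p dvd r"
  proof
    assume "p dvd r"
    then obtain e where e: "r = p * e" by (rule dvdE)
    have "is_unit e" using Factorial_Ring.irreducibleD[OF assms(4) e] assms(3) by (auto simp: Factorial_Ring.irreducible_def)
    moreover have "lead_coeff e = 1" using assms(1,2) unfolding e by (simp add: lead_coeff_mult)
    ultimately have "e = 1" by (rule monic_unit)
    then show False using assms(5) e by simp
  qed
qed

text \<open>A real polynomial divisible by \<open>G\<close> is also divisible by
  \<open>bar G\<close>, and these two are coprime. So it is divisible by the product or coprime to
  both factors.\<close>

lemma prime_power_real_pair:
  assumes G: "lead_coeff G = 1" "Factorial_Ring.irreducible G" and ne: "bar G \<noteq> G"
  shows "prime_power_real (G * bar G)"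
proof (rule prime_power_realI)
  note irr = irreducible_bar[OF G(2)]
  have lb: "lead_coeff (bar G) = 1" using G(1) by simp
  show "lead_coeff (G * bar G) = 1" using G(1) lb by (simp add: lead_coeff_mult del: coeff_bar degree_bar)
  show "bar (G * bar G) = G * bar G" by (simp add: bar_mult mult.commute)
  show "0 < degree (G * bar G)"
    using irreducible_degree_pos[OF G(2)] irreducible_degree_pos[OF irr] by (subst degree_mult_eq) auto
  fix \<gamma> assume \<gamma>: "bar \<gamma> = \<gamma>"
  show "G * bar G dvd \<gamma> \<or> comaximal (G * bar G) \<gamma>"
  proof (cases "G dvd \<gamma>")
    case True
    then obtain \<gamma>' where g: "\<gamma> = G * \<gamma>'" by (rule dvdE)
    have "bar G dvd G * \<gamma>'" using bar_dvd[OF True] \<gamma> g by simp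
    moreover have "comaximal (bar G) G" by (rule irreducible_monic_comaximal[OF lb G(1) irr G(2) ne])
    ultimately have "bar G dvd \<gamma>'" using comaximal_dvd by blast
    then show ?thesis unfolding g by (simp add: mult_dvd_mono)
  next
    case False
    then have "\<not> bar G dvd \<gamma>" using bar_dvd[of "bar G" \<gamma>] \<gamma> by auto
    then show ?thesis using False irreducible_comaximal[OF G(2)] irreducible_comaximal[OF irr] comaximal_mult by blast
  qed
qed

end

subsection \<open>The Cayley transform\<close>

text \<open>In the Moebius map \<open>x -> z (x - c^q) / (x - c)\<close>, \<open>z\<close> is the
  image of infinity and \<open>c\<close> is sent to infinity. It maps the real elements to elements
  of norm one.\<close>

locale cayley_transform = finite_hermitian_field where q = q and ty = ty
  for q :: nat and ty :: "'a::field itself" +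
  fixes z c :: 'a
  assumes z_norm: "z ^ q * z = 1" and c_nonreal: "c ^ q \<noteq> c"
begin

text \<open>Up to sign the determinant of the Moebius map, nonzero because \<open>c\<close> is not
  real.\<close>

definition \<delta> :: 'a where "\<delta> = z * (c - c ^ q)"

lemma z_nonzero: "z \<noteq> 0"
  using z_norm by auto

lemma \<delta>_nonzero: "\<delta> \<noteq> 0"
  using z_nonzero c_nonreal by (simp add: \<delta>_def)

text \<open>Moves the roots along the Moebius map, by substituting the inverse map
  \<open>x -> (c x - z c^q) / (x - z)\<close>; the scalar makes the result monic.\<close>

definition cay :: "'a poly \<Rightarrow> 'a poly" where
  "cay p = smult (1 / poly p c) (hsubst (degree p) p [:- (z * c ^ q), c:] [:- z, 1:])"

definition icay :: "'a poly \<Rightarrow> 'a poly" where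
  "icay p = smult (1 / poly p z) (hsubst (degree p) p [:- (z * c ^ q), z:] [:- c, 1:])"

lemma degree_monicI: "degree p \<le> n \<Longrightarrow> coeff p n = 1 \<Longrightarrow> degree p = n \<and> lead_coeff p = (1::'a)"
  by (metis le_antisym le_degree zero_neq_one)

lemma cay_degree: assumes "poly p c \<noteq> 0" shows "degree (cay p) = degree p" "lead_coeff (cay p) = 1"
proof -
  have "degree (cay p) \<le> degree p" unfolding cay_def
    by (rule order_trans[OF degree_smult_le degree_hsubst]) auto
  moreover have "coeff (cay p) (degree p) = 1" using assms by (simp add: cay_def coeff_hsubst)
  ultimately show "degree (cay p) = degree p" "lead_coeff (cay p) = 1" using degree_monicI by blast+
qed

lemma icay_degree: assumes "poly p z \<noteq> 0" shows "degree (icay p) = degree p" "lead_coeff (icay p) = 1"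
proof -
  have "degree (icay p) \<le> degree p" unfolding icay_def
    by (rule order_trans[OF degree_smult_le degree_hsubst]) auto
  moreover have "coeff (icay p) (degree p) = 1" using assms by (simp add: icay_def coeff_hsubst)
  ultimately show "degree (icay p) = degree p" "lead_coeff (icay p) = 1" using degree_monicI by blast+
qed

lemma cay_pole: "poly p c \<noteq> 0 \<Longrightarrow> lead_coeff p = 1 \<Longrightarrow> poly (cay p) z \<noteq> 0"
  using z_nonzero c_nonreal by (simp add: cay_def poly_hsubst_pole algebra_simps)

lemma icay_pole: "poly p z \<noteq> 0 \<Longrightarrow> lead_coeff p = 1 \<Longrightarrow> poly (icay p) c \<noteq> 0"
  using z_nonzero c_nonreal by (simp add: icay_def poly_hsubst_pole algebra_simps)

lemma monic_smult_eq: "lead_coeff (smult k p) = 1 \<Longrightarrow> lead_coeff (smult l p) = (1::'a) \<Longrightarrow> smult k p = smult l p"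
proof -
  assume "lead_coeff (smult k p) = 1" "lead_coeff (smult l p) = 1"
  then have "k * lead_coeff p = 1" "l * lead_coeff p = 1" by (auto split: if_splits)
  then have "k = l" by (metis mult_right_cancel mult_zero_right zero_neq_one)
  then show ?thesis by simp
qed

text \<open>The two substitutions compose to multiplication by a power of \<delta>. The scalars need
  not be followed, as both sides are monic.\<close>

lemma icay_cay:
  assumes "poly p c \<noteq> 0" "lead_coeff p = 1"
  shows "icay (cay p) = p"
proof -
  have "[: z * c * c ^ q - c * (z * c ^ q), c * z - z * c ^ q:] = [:0, \<delta>:]" by (simp add: \<delta>_def algebra_simps)
  then have "hsubst (degree p) (hsubst (degree p) p [:- (z * c ^ q), c:] [:- z, 1:]) [:- (z * c ^ q), z:] [:- c, 1:] = smult (\<delta> ^ degree p) p"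
    unfolding hsubst_hsubst hsubst_scale[OF order_refl, symmetric] by (simp add: \<delta>_def algebra_simps)
  then obtain k where k: "icay (cay p) = smult k p"
    unfolding icay_def cay_degree(1)[OF assms(1)] unfolding cay_def hsubst_smult by auto
  have "lead_coeff (icay (cay p)) = 1" by (rule icay_degree(2)[OF cay_pole[OF assms]])
  then show ?thesis using monic_smult_eq[of k p 1] assms(2) unfolding k by simp
qed

lemma cay_icay:
  assumes "poly p z \<noteq> 0" "lead_coeff p = 1"
  shows "cay (icay p) = p"
proof -
  have "hsubst (degree p) (hsubst (degree p) p [:- (z * c ^ q), z:] [:- c, 1:]) [:- (z * c ^ q), c:] [:- z, 1:] = smult (\<delta> ^ degree p) p"
    unfolding hsubst_hsubst hsubst_scale[OF order_refl, symmetric] by (simp add: \<delta>_def algebra_simps)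
  then obtain k where k: "cay (icay p) = smult k p"
    unfolding cay_def icay_degree(1)[OF assms(1)] unfolding icay_def hsubst_smult by auto
  have "lead_coeff (cay (icay p)) = 1" by (rule cay_degree(2)[OF icay_pole[OF assms]])
  then show ?thesis using monic_smult_eq[of k p 1] assms(2) unfolding k by simp
qed

lemma cay_mult: "p \<noteq> 0 \<Longrightarrow> r \<noteq> 0 \<Longrightarrow> cay (p * r) = cay p * cay r"
  by (simp add: cay_def degree_mult_eq hsubst_mult mult.commute[of "poly r c"])

lemma icay_mult: "p \<noteq> 0 \<Longrightarrow> r \<noteq> 0 \<Longrightarrow> icay (p * r) = icay p * icay r"
  by (simp add: icay_def degree_mult_eq hsubst_mult mult.commute[of "poly r z"])

lemma icay_1 [simp]: "icay 1 = 1"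
  by (simp add: icay_def hsubst_def)

lemma icay_power: "p \<noteq> 0 \<Longrightarrow> icay (p ^ k) = icay p ^ k"
  by (induction k) (simp_all add: icay_mult)

text \<open>A factorisation of \<open>icay f\<close> is transformed back into one of
  \<open>f\<close>; no factor vanishes at \<open>c\<close>, so the degrees are preserved.\<close>

lemma icay_irreducible:
  assumes f: "lead_coeff f = 1" "Factorial_Ring.irreducible f" "poly f z \<noteq> 0"
  shows "Factorial_Ring.irreducible (icay f)"
proof (rule Factorial_Ring.irreducibleI)
  have d: "0 < degree (icay f)" using irreducible_degree_pos[OF f(2)] icay_degree(1)[OF f(3)] by simp
  then show nz: "icay f \<noteq> 0" and "\<not> is_unit (icay f)" using is_unit_iff_degree[of "icay f"] by auto
  fix a b assume ab: "icay f = a * b"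
  have pole: "poly a c \<noteq> 0" "poly b c \<noteq> 0" using icay_pole[OF f(3,1)] unfolding ab by auto
  have nz': "a \<noteq> 0" "b \<noteq> 0" using nz ab by auto
  have "f = cay a * cay b" using cay_icay[OF f(3,1)] cay_mult[OF nz'] unfolding ab by simp
  from Factorial_Ring.irreducibleD[OF f(2) this]
  have "degree (cay a) = 0 \<or> degree (cay b) = 0" by (metis is_unit_iff_degree not_is_unit_0)
  then have "degree a = 0 \<or> degree b = 0" using cay_degree(1) pole by simp
  then show "is_unit a \<or> is_unit b" using is_unit_iff_degree nz' by blast
qed

lemma bar_hsubst: "bar (hsubst n p b a) = hsubst n (bar p) (bar b) (bar a)"
proof -
  have "bar (\<Sum>i\<in>I. h i) = (\<Sum>i\<in>I. bar (h i))" if "finite I" for I and h :: "nat \<Rightarrow> 'a poly"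
    by (rule poly_eqI) (simp add: coeff_sum frob_sum)
  moreover have "bar (smult k p) = smult (k ^ q) (bar p)" for k p
    by (rule poly_eqI) (simp add: frob_mult)
  ultimately show ?thesis by (simp add: hsubst_def bar_mult bar_power)
qed

lemma hsubst_smult_both: "hsubst n p (smult k b) (smult k a) = smult (k ^ n) (hsubst n p b a)"
proof -
  have "smult k b ^ i * smult k a ^ (n - i) = smult (k ^ n) (b ^ i * a ^ (n - i))" if "i \<le> n" for i
    using that by (simp add: smult_power mult_smult_left mult_smult_right flip: power_add)
  then show ?thesis unfolding hsubst_def smult_sum2 by (intro sum.cong refl) (simp add: mult.commute)
qed

text \<open>Since \<open>1 / z = z ^ q\<close>, the reversed conjugate polynomial takes at
  \<open>z\<close> the conjugate of \<open>poly p z\<close>, up to a power of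
  \<open>z\<close>.\<close>

lemma tilde_pole: "coeff p 0 \<noteq> 0 \<Longrightarrow> poly p z \<noteq> 0 \<Longrightarrow> poly (tilde q p) z \<noteq> 0"
proof -
  assume p: "coeff p 0 \<noteq> 0" "poly p z \<noteq> 0"
  have "inverse z = z ^ q" using z_norm z_nonzero by (simp add: field_simps)
  then have "poly (reflect_poly (bar p)) z = z ^ degree p * poly p z ^ q"
    using poly_reflect_poly_nz[OF z_nonzero, of "bar p"] by (simp add: poly_bar)
  then show ?thesis using p z_nonzero by (simp add: tilde_def flip: bar_def)
qed

text \<open>Conjugation exchanges the linear forms \<open>?b\<close> and \<open>?a\<close> up to the
  factor \<open>z ^ q\<close>, and exchanging the arguments of a homogeneous substitution amounts to
  reversing the polynomial. Thus self-dual polynomials become real ones.\<close>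

lemma bar_icay:
  assumes p: "lead_coeff p = 1" "coeff p 0 \<noteq> 0" "poly p z \<noteq> 0"
  shows "bar (icay p) = icay (tilde q p)"
proof -
  let ?b = "[:- (z * c ^ q), z:]" and ?a = "[:- c, 1:]"
  let ?n = "degree p"
  let ?h = "hsubst ?n (reflect_poly (bar p)) ?b ?a"
  have bb: "bar ?b = smult (z ^ q) ?a"
    by (rule poly_eqI) (auto simp: coeff_pCons frob_uminus frob_mult split: nat.splits)
  have ba: "bar ?a = smult (z ^ q) ?b"
    using z_norm by (intro poly_eqI) (auto simp: coeff_pCons frob_uminus frob_mult split: nat.splits simp flip: mult.assoc)
  have "bar (hsubst ?n p ?b ?a) = smult ((z ^ q) ^ ?n) ?h"
    unfolding bar_hsubst bb ba hsubst_smult_both hsubst_reflect[OF degree_bar] ..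
  moreover have "bar (smult k r) = smult (k ^ q) (bar r)" for k r
    by (rule poly_eqI) (simp add: frob_mult)
  ultimately obtain k where k: "bar (icay p) = smult k ?h" unfolding icay_def by auto
  obtain l where l: "icay (tilde q p) = smult l ?h"
    unfolding icay_def tilde_degree[OF p(2)] unfolding tilde_def hsubst_smult by (auto simp flip: bar_def)
  have "lead_coeff (bar (icay p)) = 1" using icay_degree[OF p(3)] by simp
  moreover have "lead_coeff (icay (tilde q p)) = 1" by (rule icay_degree(2)[OF tilde_pole[OF p(2,3)]])
  ultimately show ?thesis unfolding k l by (rule monic_smult_eq)
qed

end

section \<open>Inverse matrices and the Cayley transform of matrices\<close>

definition minv :: "'a::field mat \<Rightarrow> 'a mat" where
  "minv M = (SOME B. B \<in> carrier_mat (dim_row M) (dim_row M) \<and> M * B = 1\<^sub>m (dim_row M) \<and> B * M = 1\<^sub>m (dim_row M))"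

lemma scalar_mat_mult:
  assumes "(W :: 'a::field mat) \<in> carrier_mat n m"
  shows "k \<cdot>\<^sub>m 1\<^sub>m n * W = k \<cdot>\<^sub>m W"
  unfolding mult_smult_assoc_mat[OF one_carrier_mat assms] left_mult_one_mat[OF assms] ..

context finite_hermitian_field
begin

lemma minv:
  assumes "(M :: 'a mat) \<in> carrier_mat n n" "det M \<noteq> 0"
  shows "minv M \<in> carrier_mat n n" "M * minv M = 1\<^sub>m n" "minv M * M = 1\<^sub>m n"
proof -
  obtain B where "B \<in> carrier_mat n n" "M * B = 1\<^sub>m n" "B * M = 1\<^sub>m n" using inverse_ex[OF assms] .
  then have "\<exists>B. B \<in> carrier_mat (dim_row M) (dim_row M) \<and> M * B = 1\<^sub>m (dim_row M) \<and> B * M = 1\<^sub>m (dim_row M)"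
    using assms(1) by auto
  from someI_ex[OF this] show "minv M \<in> carrier_mat n n" "M * minv M = 1\<^sub>m n" "minv M * M = 1\<^sub>m n"
    using assms(1) unfolding minv_def[symmetric] by auto
qed

lemma det_nonzeroI:
  assumes "(M :: 'a mat) \<in> carrier_mat n n" "B \<in> carrier_mat n n" "M * B = 1\<^sub>m n"
  shows "det M \<noteq> 0"
  using det_mult[OF assms(1,2)] assms(3) by auto

lemma minv_unique:
  assumes M: "(M :: 'a mat) \<in> carrier_mat n n" and B: "B \<in> carrier_mat n n" "M * B = 1\<^sub>m n"
  shows "minv M = B"
proof -
  note m = minv[OF M det_nonzeroI[OF assms]]
  have "minv M = minv M * (M * B)" unfolding B(2) using m(1) by simp
  also have "\<dots> = minv M * M * B" by (rule assoc_mult_mat[symmetric, OF m(1) M B(1)])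
  also have "\<dots> = B" unfolding m(3) using B(1) by simp
  finally show ?thesis .
qed

text \<open>Both transforms are a scalar matrix minus \<delta> times an inverse, and
  \<open>M -> k M^(-1)\<close> is an involution; this is what makes them inverse to each
  other.\<close>

lemma minv_smult_minv:
  assumes M: "(M :: 'a mat) \<in> carrier_mat n n" "det M \<noteq> 0" and k: "k \<noteq> 0"
  shows "k \<cdot>\<^sub>m minv (k \<cdot>\<^sub>m minv M) = M" "det (k \<cdot>\<^sub>m minv M) \<noteq> 0"
proof -
  note m = minv[OF M]
  have "(k \<cdot>\<^sub>m minv M) * (inverse k \<cdot>\<^sub>m M) = k \<cdot>\<^sub>m (inverse k \<cdot>\<^sub>m (minv M * M))"
    using mult_smult_assoc_mat[OF m(1), of "inverse k \<cdot>\<^sub>m M" n k] mult_smult_distrib[OF m(1) M(1), of "inverse k"] M(1) by simp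
  also have "\<dots> = 1\<^sub>m n" unfolding m(3) using k by (intro eq_matI) auto
  finally have e: "(k \<cdot>\<^sub>m minv M) * (inverse k \<cdot>\<^sub>m M) = 1\<^sub>m n" .
  have c: "k \<cdot>\<^sub>m minv M \<in> carrier_mat n n" "inverse k \<cdot>\<^sub>m M \<in> carrier_mat n n" using m(1) M(1) by auto
  show "k \<cdot>\<^sub>m minv (k \<cdot>\<^sub>m minv M) = M"
    unfolding minv_unique[OF c e] using k by (intro eq_matI) auto
  show "det (k \<cdot>\<^sub>m minv M) \<noteq> 0" by (rule det_nonzeroI[OF c e])
qed

end

context cayley_transform
begin

text \<open>Equal to \<open>z (c^q - H) (c - H)^(-1)\<close>. In the partial fraction form
  \<open>H\<close> occurs once, which gives the inverse transform the same shape.\<close>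

definition cayley :: "nat \<Rightarrow> 'a mat \<Rightarrow> 'a mat" where
  "cayley n H = z \<cdot>\<^sub>m 1\<^sub>m n - \<delta> \<cdot>\<^sub>m minv (c \<cdot>\<^sub>m 1\<^sub>m n - H)"

definition icayley :: "nat \<Rightarrow> 'a mat \<Rightarrow> 'a mat" where
  "icayley n A = c \<cdot>\<^sub>m 1\<^sub>m n - \<delta> \<cdot>\<^sub>m minv (z \<cdot>\<^sub>m 1\<^sub>m n - A)"

text \<open>With \<open>M = c - H\<close> one has \<open>A M = z M\<^sup>\<star>\<close>. As
  \<open>M\<close> and its adjoint are polynomials in \<open>H\<close>, they commute; so
  \<open>M\<^sup>\<star> M^(-1)\<close> is unitary, and so is its multiple by \<open>z\<close> of
  norm one.\<close>

lemma
  assumes H: "H \<in> Herm n" and nz: "poly (char_poly H) c \<noteq> 0"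
  shows cayley_U: "cayley n H \<in> U n"
    and char_poly_cayley: "char_poly (cayley n H) = cay (char_poly H)"
    and icayley_cayley: "icayley n (cayley n H) = H"
proof -
  note HD = HermD[OF H]
  define M where "M = c \<cdot>\<^sub>m 1\<^sub>m n - H"
  define R where "R = minv M"
  define A where "A = z \<cdot>\<^sub>m 1\<^sub>m n - \<delta> \<cdot>\<^sub>m R"
  have A: "cayley n H = A" by (simp add: A_def R_def M_def cayley_def)
  have M: "M \<in> carrier_mat n n" unfolding M_def using HD(1) by (rule minus_carrier_mat)
  have dM: "poly (char_poly H) c = det M" unfolding M_def by (rule poly_char_poly[OF HD(1)])
  then have "det M \<noteq> 0" using nz by simp
  note R = minv[OF M this, folded R_def]
  have Ac: "A \<in> carrier_mat n n" unfolding A_def by (intro minus_carrier_mat smult_carrier_mat R(1))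
  have Ms: "M\<^sup>\<star> \<in> carrier_mat n n" and Rs: "R\<^sup>\<star> \<in> carrier_mat n n" using M R by auto
  have Hij: "H $$ (j, i) ^ q = H $$ (i, j)" if "i < n" "j < n" for i j
    using Herm_index[OF H that(2,1)] by simp
  have AM: "A * M = z \<cdot>\<^sub>m M\<^sup>\<star>"
  proof -
    have "A * M = z \<cdot>\<^sub>m 1\<^sub>m n * M - \<delta> \<cdot>\<^sub>m R * M"
      unfolding A_def by (rule minus_mult_distrib_mat[of _ n n]) (use M R in auto)
    also have "z \<cdot>\<^sub>m 1\<^sub>m n * M = z \<cdot>\<^sub>m M" by (rule scalar_mat_mult[OF M])
    also have "\<delta> \<cdot>\<^sub>m R * M = \<delta> \<cdot>\<^sub>m 1\<^sub>m n" using mult_smult_assoc_mat[of R n n M n \<delta>] M R by simp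
    also have "z \<cdot>\<^sub>m M - \<delta> \<cdot>\<^sub>m 1\<^sub>m n = z \<cdot>\<^sub>m M\<^sup>\<star>"
      using M HD Hij by (intro eq_matI) (auto simp: M_def \<delta>_def algebra_simps frob_diff)
    finally show ?thesis .
  qed
  have comm: "M * M\<^sup>\<star> = M\<^sup>\<star> * M"
  proof -
    have lin: "pm [:x, - 1:] H = x \<cdot>\<^sub>m 1\<^sub>m n - H" for x
      using HD(1) by (simp add: pm_pCons) (intro eq_matI, auto)
    have "M = pm [:c, - 1:] H" by (simp add: M_def lin)
    moreover have "M\<^sup>\<star> = pm [:c ^ q, - 1:] H"
      unfolding lin using HD Hij by (intro eq_matI) (auto simp: M_def frob_diff)
    ultimately show ?thesis using pm_commute[OF HD(1)] by simp
  qed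
  define Y where "Y = M\<^sup>\<star> * R"
  have Yc: "Y \<in> carrier_mat n n" using Ms R by (simp add: Y_def)
  have AY: "A = z \<cdot>\<^sub>m Y"
  proof -
    have "A = A * (M * R)" unfolding R(2) using Ac by simp
    also have "\<dots> = A * M * R" by (rule assoc_mult_mat[symmetric, OF Ac M R(1)])
    also have "\<dots> = z \<cdot>\<^sub>m Y" unfolding AM Y_def by (rule mult_smult_assoc_mat[OF Ms R(1)])
    finally show ?thesis .
  qed
  have "Y\<^sup>\<star> * Y = 1\<^sub>m n"
  proof -
    have "Y\<^sup>\<star> = R\<^sup>\<star> * M" unfolding Y_def using star_mult[OF Ms R(1)] by simp
    then have "Y\<^sup>\<star> * Y = R\<^sup>\<star> * (M * (M\<^sup>\<star> * R))"
      unfolding Y_def using assoc_mult_mat[OF Rs M, of "M\<^sup>\<star> * R" n] Ms R by simp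
    also have "M * (M\<^sup>\<star> * R) = M\<^sup>\<star> * (M * R)"
      using assoc_mult_mat[OF M Ms R(1)] assoc_mult_mat[OF Ms M R(1)] comm by simp
    also have "\<dots> = M\<^sup>\<star>" unfolding R(2) using Ms by simp
    also have "R\<^sup>\<star> * M\<^sup>\<star> = 1\<^sub>m n" using star_mult[OF M R(1)] unfolding R(2) by simp
    finally show ?thesis .
  qed
  then have "A\<^sup>\<star> * A = (z ^ q * z) \<cdot>\<^sub>m 1\<^sub>m n"
    unfolding AY star_smult using Yc
    by (simp add: mult_smult_assoc_mat[of _ n n _ n] mult_smult_distrib[of _ n n _ n]) (intro eq_matI, auto)
  also have "\<dots> = 1\<^sub>m n" unfolding z_norm by (intro eq_matI) auto
  finally show "cayley n H \<in> U n" unfolding A by (rule U_I[OF Ac])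
  have deg: "degree (char_poly H) = n" using degree_monic_char_poly[OF HD(1)] by simp
  have cc: "cmat A \<in> carrier_mat n n" "cmat M \<in> carrier_mat n n" using Ac M by auto
  \<comment> \<open>Multiplication of \<open>x - A\<close> by \<open>c - H\<close> produces the
    linear pencil \<open>(c x - z c^q) - (x - z) H\<close>, whose determinant is a homogeneous
    substitution into \<open>char_poly H\<close>.\<close>
  have "char_poly_matrix A * cmat M = [:0, 1:] \<cdot>\<^sub>m 1\<^sub>m n * cmat M - cmat A * cmat M"
    unfolding char_poly_matrix_eq[OF Ac] by (rule minus_mult_distrib_mat[of _ n n]) (use cc in auto)
  also have "[:0, 1:] \<cdot>\<^sub>m 1\<^sub>m n * cmat M = [:0, 1:] \<cdot>\<^sub>m cmat M"
    using mult_smult_assoc_mat[OF one_carrier_mat cc(2)] left_mult_one_mat[OF cc(2)] by simp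
  also have "cmat A * cmat M = cmat (z \<cdot>\<^sub>m M\<^sup>\<star>)"
    unfolding AM[symmetric] by (rule cmat_mult[OF Ac M, symmetric])
  also have "[:0, 1:] \<cdot>\<^sub>m cmat M - cmat (z \<cdot>\<^sub>m M\<^sup>\<star>) = [:- (z * c ^ q), c:] \<cdot>\<^sub>m 1\<^sub>m n - [:- z, 1:] \<cdot>\<^sub>m cmat H"
    using M HD Hij by (intro eq_matI) (auto simp: M_def algebra_simps frob_diff)
  finally have "det (char_poly_matrix A * cmat M) = hsubst n (char_poly H) [:- (z * c ^ q), c:] [:- z, 1:]"
    using det_pencil_hsubst[OF HD(1), of "[:- z, 1:]"] by simp
  moreover have "det (char_poly_matrix A * cmat M) = char_poly A * det (cmat M)"
    unfolding char_poly_def by (rule det_mult[OF char_poly_matrix_closed[OF Ac] cc(2)])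
  moreover have "det (cmat M) = [:det M:]"
  proof -
    have "comm_ring_hom (\<lambda>x::'a. [:x:])" by unfold_locales (auto simp: one_pCons)
    then show ?thesis by (rule comm_ring_hom.hom_det)
  qed
  ultimately have "smult (det M) (char_poly A) = hsubst n (char_poly H) [:- (z * c ^ q), c:] [:- z, 1:]"
    by (simp add: mult.commute[of "char_poly A"])
  then have "smult (1 / det M) (smult (det M) (char_poly A)) = cay (char_poly H)"
    unfolding cay_def deg dM by simp
  then show "char_poly (cayley n H) = cay (char_poly H)"
    unfolding A using \<open>det M \<noteq> 0\<close> by simp
  have "z \<cdot>\<^sub>m 1\<^sub>m n - A = \<delta> \<cdot>\<^sub>m R" using R(1) by (intro eq_matI) (auto simp: A_def)
  then show "icayley n (cayley n H) = H"
    unfolding A icayley_def using minv_smult_minv(1)[OF M \<open>det M \<noteq> 0\<close> \<delta>_nonzero] HD(1)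
    by (simp add: R_def) (intro eq_matI, auto simp: M_def)
qed

text \<open>Symmetry is checked on \<open>N\<^sup>\<star> H N\<close> with \<open>N = z - A\<close>,
  where no inverse occurs; congruence by the inverse of \<open>N\<close> carries it over to
  \<open>H\<close>.\<close>

lemma
  assumes A: "A \<in> U n" and nz: "poly (char_poly A) z \<noteq> 0"
  shows icayley_Herm: "icayley n A \<in> Herm n"
    and cayley_icayley: "cayley n (icayley n A) = A"
    and icayley_pole: "poly (char_poly (icayley n A)) c \<noteq> 0"
proof -
  note AD = U_D[OF A]
  define N where "N = z \<cdot>\<^sub>m 1\<^sub>m n - A"
  define Q where "Q = minv N"
  define H where "H = c \<cdot>\<^sub>m 1\<^sub>m n - \<delta> \<cdot>\<^sub>m Q"
  have H: "icayley n A = H" by (simp add: H_def Q_def N_def icayley_def)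
  have N: "N \<in> carrier_mat n n" unfolding N_def using AD(2) by (rule minus_carrier_mat)
  have "det N \<noteq> 0" unfolding N_def using nz poly_char_poly[OF AD(2)] by simp
  note Q = minv[OF N this, folded Q_def]
  have Hc: "H \<in> carrier_mat n n" unfolding H_def by (intro minus_carrier_mat smult_carrier_mat Q(1))
  have Ns: "N\<^sup>\<star> \<in> carrier_mat n n" and Qs: "Q\<^sup>\<star> \<in> carrier_mat n n" using N Q by auto
  let ?W = "(z * c ^ q) \<cdot>\<^sub>m 1\<^sub>m n - c \<cdot>\<^sub>m A"
  have HN: "H * N = ?W"
  proof -
    have "H * N = c \<cdot>\<^sub>m 1\<^sub>m n * N - \<delta> \<cdot>\<^sub>m Q * N"
      unfolding H_def by (rule minus_mult_distrib_mat[of _ n n]) (use N Q in auto)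
    also have "c \<cdot>\<^sub>m 1\<^sub>m n * N = c \<cdot>\<^sub>m N" by (rule scalar_mat_mult[OF N])
    also have "\<delta> \<cdot>\<^sub>m Q * N = \<delta> \<cdot>\<^sub>m 1\<^sub>m n" using mult_smult_assoc_mat[of Q n n N n \<delta>] N Q by simp
    also have "c \<cdot>\<^sub>m N - \<delta> \<cdot>\<^sub>m 1\<^sub>m n = ?W"
      using AD by (intro eq_matI) (auto simp: N_def \<delta>_def algebra_simps)
    finally show ?thesis .
  qed
  define S where "S = N\<^sup>\<star> * (H * N)"
  have Wc: "?W \<in> carrier_mat n n" by (intro minus_carrier_mat smult_carrier_mat AD(2))
  have "N\<^sup>\<star> * ?W = z ^ q \<cdot>\<^sub>m ?W - ((z * c ^ q) \<cdot>\<^sub>m A\<^sup>\<star> - c \<cdot>\<^sub>m 1\<^sub>m n)"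
  proof -
    have "N\<^sup>\<star> = z ^ q \<cdot>\<^sub>m 1\<^sub>m n - A\<^sup>\<star>"
      using AD by (intro eq_matI) (auto simp: N_def frob_diff)
    then have "N\<^sup>\<star> * ?W = (z ^ q \<cdot>\<^sub>m 1\<^sub>m n - A\<^sup>\<star>) * ?W" by simp
    also have "\<dots> = z ^ q \<cdot>\<^sub>m 1\<^sub>m n * ?W - A\<^sup>\<star> * ?W"
      by (rule minus_mult_distrib_mat[of _ n n]) (use AD Wc in auto)
    also have "z ^ q \<cdot>\<^sub>m 1\<^sub>m n * ?W = z ^ q \<cdot>\<^sub>m ?W" by (rule scalar_mat_mult[OF Wc])
    also have "A\<^sup>\<star> * ?W = A\<^sup>\<star> * ((z * c ^ q) \<cdot>\<^sub>m 1\<^sub>m n) - A\<^sup>\<star> * (c \<cdot>\<^sub>m A)"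
      by (rule mult_minus_distrib_mat[of _ n n]) (use AD in auto)
    also have "A\<^sup>\<star> * ((z * c ^ q) \<cdot>\<^sub>m 1\<^sub>m n) = (z * c ^ q) \<cdot>\<^sub>m A\<^sup>\<star>"
      using mult_smult_distrib[OF AD(5) one_carrier_mat, of "z * c ^ q"] AD(5) by simp
    also have "A\<^sup>\<star> * (c \<cdot>\<^sub>m A) = c \<cdot>\<^sub>m 1\<^sub>m n"
      using mult_smult_distrib[OF AD(5,2), of c] AD(3) by simp
    finally show ?thesis .
  qed
  then have SE: "S = z ^ q \<cdot>\<^sub>m ?W - ((z * c ^ q) \<cdot>\<^sub>m A\<^sup>\<star> - c \<cdot>\<^sub>m 1\<^sub>m n)" unfolding S_def HN .
  have Sc: "S \<in> carrier_mat n n" unfolding SE by (intro minus_carrier_mat smult_carrier_mat one_carrier_mat)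
  have "S\<^sup>\<star> = S"
  proof (rule eq_matI)
    fix i j assume "i < dim_row S" "j < dim_col S"
    then have ij: "i < n" "j < n" using Sc by auto
    have e: "S $$ (k, l) = (if k = l then c ^ q + c else 0) - (z ^ q * c * A $$ (k, l) + z * c ^ q * A $$ (l, k) ^ q)"
      if "k < n" "l < n" for k l
    proof -
      have "z ^ q * (z * c ^ q) = c ^ q" using z_norm by (simp flip: mult.assoc)
      then show ?thesis using that AD unfolding SE by (auto simp: algebra_simps)
    qed
    show "S\<^sup>\<star> $$ (i, j) = S $$ (i, j)"
      using ij Sc by (simp add: e frob_diff frob_add frob_mult)
  qed (use Sc in auto)
  then have "S \<in> Herm n" using Sc by (simp add: Herm_def)
  from Herm_conj[OF this Q(1)] have "Q\<^sup>\<star> * S * Q \<in> Herm n" .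
  also have "Q\<^sup>\<star> * S * Q = H"
  proof -
    have HNc: "H * N \<in> carrier_mat n n" using Hc N by simp
    have "Q\<^sup>\<star> * S = Q\<^sup>\<star> * N\<^sup>\<star> * (H * N)" unfolding S_def by (rule assoc_mult_mat[symmetric, OF Qs Ns HNc])
    also have "Q\<^sup>\<star> * N\<^sup>\<star> = 1\<^sub>m n" using star_mult[OF N Q(1)] unfolding Q(2) by simp
    also have "1\<^sub>m n * (H * N) = H * N" by (rule left_mult_one_mat[OF HNc])
    finally have "Q\<^sup>\<star> * S * Q = H * N * Q" by simp
    also have "\<dots> = H * (N * Q)" by (rule assoc_mult_mat[OF Hc N Q(1)])
    finally show ?thesis unfolding Q(2) using Hc by simp
  qed
  finally show "icayley n A \<in> Herm n" unfolding H .
  have e: "c \<cdot>\<^sub>m 1\<^sub>m n - H = \<delta> \<cdot>\<^sub>m Q" using Q(1) by (intro eq_matI) (auto simp: H_def)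
  show "cayley n (icayley n A) = A"
    unfolding H cayley_def e using minv_smult_minv(1)[OF N \<open>det N \<noteq> 0\<close> \<delta>_nonzero] AD(2)
    by (simp add: Q_def) (intro eq_matI, auto simp: N_def)
  show "poly (char_poly (icayley n A)) c \<noteq> 0"
    unfolding H poly_char_poly[OF Hc] e using minv_smult_minv(2)[OF N \<open>det N \<noteq> 0\<close> \<delta>_nonzero] by (simp add: Q_def)
qed

lemma card_unitary_char_poly:
  assumes \<phi>: "lead_coeff \<phi> = 1" "poly \<phi> z \<noteq> 0"
  shows "card {A \<in> U n. char_poly A = \<phi>} = card (herm_with_char n (icay \<phi>))"
proof -
  have "bij_betw (cayley n) (herm_with_char n (icay \<phi>)) {A \<in> U n. char_poly A = \<phi>}"
  proof (rule bij_betw_byWitness[where f' = "icayley n"])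
    note pole = icay_pole[OF \<phi>(2,1)]
    show "\<forall>H\<in>herm_with_char n (icay \<phi>). icayley n (cayley n H) = H"
      using icayley_cayley pole by (simp add: herm_with_char_def)
    show "\<forall>A\<in>{A \<in> U n. char_poly A = \<phi>}. cayley n (icayley n A) = A"
      using cayley_icayley \<phi> by simp
    show "cayley n ` herm_with_char n (icay \<phi>) \<subseteq> {A \<in> U n. char_poly A = \<phi>}"
      using cayley_U char_poly_cayley pole cay_icay[OF \<phi>(2,1)] by (auto simp: herm_with_char_def)
    show "icayley n ` {A \<in> U n. char_poly A = \<phi>} \<subseteq> herm_with_char n (icay \<phi>)"
    proof (rule image_subsetI)
      fix A assume "A \<in> {A \<in> U n. char_poly A = \<phi>}"
      then have A: "A \<in> U n" "char_poly A = \<phi>" by auto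
      have nz: "poly (char_poly A) z \<noteq> 0" using A(2) \<phi>(2) by simp
      let ?H = "icayley n A"
      note H = icayley_Herm[OF A(1) nz]
      note p = icayley_pole[OF A(1) nz]
      have "\<phi> = cay (char_poly ?H)"
        using char_poly_cayley[OF H p] cayley_icayley[OF A(1) nz] A(2) by simp
      moreover have "lead_coeff (char_poly ?H) = 1" using degree_monic_char_poly[OF HermD(1)[OF H]] by simp
      ultimately have "icay \<phi> = char_poly ?H" using icay_cay[OF p] by simp
      then show "?H \<in> herm_with_char n (icay \<phi>)" using H by (simp add: herm_with_char_def)
    qed
  qed
  then show ?thesis by (simp add: bij_betw_same_card)
qed

end

lemma blk_zero: "blk (0\<^sub>m m m) (0\<^sub>m n n) = 0\<^sub>m (m + n) (m + n)"
  by (simp add: blk_def)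

lemma blk_index:
  assumes "A \<in> carrier_mat m m" "D \<in> carrier_mat n n" "i < m + n" "j < m + n"
  shows "blk A D $$ (i, j) = (if i < m then if j < m then A $$ (i, j) else 0
    else if j < m then 0 else D $$ (i - m, j - m))"
  using assms by (auto simp: blk_def)

lemma blk_assoc:
  assumes "A \<in> carrier_mat l l" "B \<in> carrier_mat m m" "D \<in> carrier_mat n n"
  shows "blk A (blk B D) = blk (blk A B) D"
proof (rule eq_matI)
  have c: "blk B D \<in> carrier_mat (m + n) (m + n)" "blk A B \<in> carrier_mat (l + m) (l + m)"
    using assms by (auto intro: blk_carrier)
  have c': "blk A (blk B D) \<in> carrier_mat (l + (m + n)) (l + (m + n))" "blk (blk A B) D \<in> carrier_mat (l + m + n) (l + m + n)"
    using blk_carrier[OF assms(1) c(1)] blk_carrier[OF c(2) assms(3)] by auto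
  show "dim_row (blk A (blk B D)) = dim_row (blk (blk A B) D)" "dim_col (blk A (blk B D)) = dim_col (blk (blk A B) D)"
    using c' by auto
  fix i j assume "i < dim_row (blk (blk A B) D)" "j < dim_col (blk (blk A B) D)"
  then have ij: "i < l + m + n" "j < l + m + n" using c' by auto
  then show "blk A (blk B D) $$ (i, j) = blk (blk A B) D $$ (i, j)"
    by (simp add: blk_index[OF assms(1) c(1)] blk_index[OF assms(2,3)] blk_index[OF assms(1,2)]
      blk_index[OF c(2) assms(3)] not_less) linarith
qed

definition proj :: "nat \<Rightarrow> nat \<Rightarrow> 'a::field mat" where
  "proj r s = blk (1\<^sub>m r) (0\<^sub>m s s)"

lemma proj_carrier [simp]: "proj r s \<in> carrier_mat (r + s) (r + s)"
  by (simp add: proj_def blk_carrier)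

lemma proj_dim [simp]: "dim_row (proj r s) = r + s" "dim_col (proj r s) = r + s"
  by (simp_all add: proj_def blk_def)

lemma proj_index: "i < r + s \<Longrightarrow> j < r + s \<Longrightarrow> proj r s $$ (i, j) = (if i = j \<and> j < r then 1 else 0)"
  by (auto simp: proj_def blk_def)

lemma mult_proj_index:
  assumes B: "(B :: 'a::field mat) \<in> carrier_mat (r + s) (r + s)" and ij: "i < r + s" "j < r + s"
  shows "(B * proj r s) $$ (i, j) = (if j < r then B $$ (i, j) else 0)"
    "(proj r s * B) $$ (i, j) = (if i < r then B $$ (i, j) else 0)"
proof -
  have "(B * proj r s) $$ (i, j) = (\<Sum>l = 0..<r + s. if l = j then (if j < r then B $$ (i, j) else 0) else 0)"
    unfolding mat_mult_index[OF B proj_carrier ij] by (intro sum.cong refl) (use ij in \<open>auto simp: proj_index\<close>)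
  then show "(B * proj r s) $$ (i, j) = (if j < r then B $$ (i, j) else 0)" using ij by simp
  have "(proj r s * B) $$ (i, j) = (\<Sum>l = 0..<r + s. if l = i then (if i < r then B $$ (i, j) else 0) else 0)"
    unfolding mat_mult_index[OF proj_carrier B ij] by (intro sum.cong refl) (use ij in \<open>auto simp: proj_index\<close>)
  then show "(proj r s * B) $$ (i, j) = (if i < r then B $$ (i, j) else 0)" using ij by simp
qed

lemma commute_proj:
  assumes B: "(B :: 'a::field mat) \<in> carrier_mat (r + s) (r + s)" and comm: "B * proj r s = proj r s * B"
  obtains B1 B2 where "B1 \<in> carrier_mat r r" "B2 \<in> carrier_mat s s" "B = blk B1 B2"
proof -
  let ?B1 = "mat r r (\<lambda>ij. B $$ ij)" and ?B2 = "mat s s (\<lambda>(i, j). B $$ (r + i, r + j))"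
  have z: "B $$ (i, j) = 0" if ij: "i < r + s" "j < r + s" and d: "(i < r) \<noteq> (j < r)" for i j
    using mult_proj_index[OF B ij] d unfolding comm by (auto split: if_splits)
  have "B = blk ?B1 ?B2"
  proof (rule eq_matI)
    fix i j assume "i < dim_row (blk ?B1 ?B2)" "j < dim_col (blk ?B1 ?B2)"
    then have ij: "i < r + s" "j < r + s" by (auto simp: blk_def)
    then show "B $$ (i, j) = blk ?B1 ?B2 $$ (i, j)" using z[OF ij] by (auto simp: blk_def)
  qed (use B in \<open>auto simp: blk_def\<close>)
  then show thesis using that[of ?B1 ?B2] by simp
qed

context finite_hermitian_field
begin

subsection \<open>Orthogonal projections\<close>

lemma star_proj: "(proj r s)\<^sup>\<star> = proj r s"
  by (rule eq_matI) (auto simp: proj_index)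

lemma proj_Suc: "proj (Suc r) s = blk (1\<^sub>m 1) (proj r s)"
  unfolding proj_def by (subst blk_assoc[of _ 1 _ r _ s]) (simp_all add: One_nat_def)

lemma blk_U: "A \<in> U m \<Longrightarrow> D \<in> U n \<Longrightarrow> blk A D \<in> U (m + n)"
  using blk_U_iff[of A m D n] U_D(2) by simp

text \<open>The image of a nonzero orthogonal projection contains a vector of norm one. A unitary
  matrix moves it to the first coordinate, and the projection splits into 1 and a projection in one
  dimension less.\<close>

lemma orthogonal_projection_diagonal:
  assumes "E \<in> Herm n" "E * E = E"
  shows "\<exists>r s. \<exists>g\<in>U n. n = r + s \<and> E * g = g * proj r s"
  using assms
proof (induction n arbitrary: E)
  case 0
  note ED = HermD[OF "0.prems"(1)]
  have "E * 1\<^sub>m 0 = 1\<^sub>m 0 * proj 0 0" using ED(1) by (intro eq_matI) auto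
  then show ?case using one_U[of 0] by (intro exI[of _ 0] bexI[of _ "1\<^sub>m 0"]) auto
next
  case (Suc m)
  let ?n = "Suc m"
  note ED = HermD[OF Suc.prems(1)]
  show ?case
  proof (cases "E = 0\<^sub>m ?n ?n")
    case True
    have p: "proj 0 ?n = (0\<^sub>m ?n ?n :: 'a mat)"
      by (rule eq_matI) (auto simp: proj_index)
    have "E * 1\<^sub>m ?n = 1\<^sub>m ?n * proj 0 ?n" unfolding p True by simp
    then show ?thesis using one_U[of ?n] by (intro exI[of _ 0] exI[of _ ?n] bexI[of _ "1\<^sub>m ?n"]) auto
  next
    case False
    from ex_unit_vector[OF Suc.prems(1) False] obtain v where v: "v \<in> carrier_mat ?n 1" "ip v (E * v) = 1" by blast
    \<comment> \<open>As \<open>E\<close> is idempotent and its own adjoint, the norm of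
      \<open>E v\<close> is \<open>ip v (E * v) = 1\<close>.\<close>
    define w where "w = E * v"
    have w: "w \<in> carrier_mat ?n 1" using ED v by (simp add: w_def)
    have Ew: "E * w = w" unfolding w_def using assoc_mult_mat[OF ED(1,1) v(1)] Suc.prems(2) by simp
    have "nrm q w = ip (E * v) w" using ip_self[OF w] by (simp add: w_def)
    also have "\<dots> = ip v (E * w)" using ip_mult_left[OF ED(1) v(1) w] ED(2) by simp
    also have "\<dots> = 1" unfolding Ew using v(2) by (simp add: w_def)
    finally obtain g where g: "g \<in> U ?n" "\<And>i. i < ?n \<Longrightarrow> g $$ (i, 0) = w $$ (i, 0)"
      using unitary_first_col[of w m] w by auto
    note gD = U_D[OF g(1)]
    define P where "P = (proj 1 m :: 'a mat)"
    have P: "P \<in> carrier_mat ?n ?n" unfolding P_def by (rule carrier_matI) (simp_all add: One_nat_def)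
    have n1: "1 + m = ?n" by (simp add: One_nat_def)
    have EgP: "E * (g * P) = g * P"
    proof (rule mat_eq_cl[of _ ?n ?n])
      have gP: "g * P \<in> carrier_mat ?n ?n" using gD P by simp
      then show "E * (g * P) \<in> carrier_mat ?n ?n" "g * P \<in> carrier_mat ?n ?n" using ED by auto
      fix j assume j: "j < ?n"
      have "cl (E * (g * P)) j = E * cl (g * P) j" by (rule cl_mult[OF ED(1) gP j])
      also have "cl (g * P) j = (if j = 0 then w else 0\<^sub>m ?n 1)"
      proof (rule eq_matI)
        fix i l assume "i < dim_row (if j = 0 then w else 0\<^sub>m ?n 1)" "l < dim_col (if j = 0 then w else 0\<^sub>m ?n 1)"
        then have il: "i < ?n" "l = 0" using w by (auto split: if_splits)
        show "cl (g * P) j $$ (i, l) = (if j = 0 then w else 0\<^sub>m ?n 1) $$ (i, l)"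
          using mult_proj_index(1)[of g 1 m i j, unfolded n1] gD(2) il j g(2) cl_index[OF gP il(1)]
          by (auto simp: P_def[symmetric])
      qed (use w gP in \<open>auto simp: cl_def\<close>)
      finally show "cl (E * (g * P)) j = cl (g * P) j"
        using \<open>cl (g * P) j = _\<close> Ew ED(1) by auto
    qed
    define E' where "E' = g\<^sup>\<star> * E * g"
    have E': "E' \<in> Herm ?n" unfolding E'_def by (rule Herm_conj[OF Suc.prems(1) gD(2)])
    note E'D = HermD[OF E']
    have gE: "g * E' = E * g"
    proof -
      have "E' = g\<^sup>\<star> * (E * g)" unfolding E'_def by (rule assoc_mult_mat[OF gD(5) ED(1) gD(2)])
      then show ?thesis using U_cancel(2)[OF g(1), of "E * g" ?n] ED gD by simp
    qed
    have E'E': "E' * E' = E'"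
    proof -
      have "g * (E' * E') = g * E' * E'" by (rule assoc_mult_mat[symmetric, OF gD(2) E'D(1) E'D(1)])
      also have "\<dots> = E * (g * E')" using assoc_mult_mat[OF ED(1) gD(2) E'D(1)] unfolding gE .
      also have "\<dots> = E * E * g" unfolding gE by (rule assoc_mult_mat[symmetric, OF ED(1) ED(1) gD(2)])
      also have "\<dots> = g * E'" unfolding Suc.prems(2) gE ..
      finally have "g\<^sup>\<star> * (g * (E' * E')) = g\<^sup>\<star> * (g * E')" by simp
      then show ?thesis using U_cancel(1)[OF g(1), of "E' * E'" ?n] U_cancel(1)[OF g(1) E'D(1)] E'D by simp
    qed
    have E'P: "E' * P = P"
    proof -
      have "g * (E' * P) = E * (g * P)"
        using assoc_mult_mat[OF gD(2) E'D(1) P] assoc_mult_mat[OF ED(1) gD(2) P] gE by simp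
      then have "g\<^sup>\<star> * (g * (E' * P)) = g\<^sup>\<star> * (g * P)" unfolding EgP by simp
      then show ?thesis using U_cancel(1)[OF g(1), of "E' * P" ?n] U_cancel(1)[OF g(1) P] E'D P by simp
    qed
    \<comment> \<open>The adjoint of the preceding identity. Together they say that
      \<open>E'\<close> commutes with \<open>P\<close>, hence is block-diagonal.\<close>
    have PE': "P * E' = P"
      using star_mult[OF E'D(1) P] E'P E'D(2) star_proj[of 1 m] by (simp add: P_def)
    obtain a E'' where aE: "a \<in> carrier_mat 1 1" "E'' \<in> carrier_mat m m" "E' = blk a E''"
      using commute_proj[of E' 1 m, unfolded n1] E'D(1) E'P PE' unfolding P_def by metis
    have "blk (a * 1\<^sub>m 1) (E'' * 0\<^sub>m m m) = blk (1\<^sub>m 1) (0\<^sub>m m m)"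
      using E'P aE by (simp add: P_def proj_def blk_mult[of a 1 E'' m "1\<^sub>m 1" "0\<^sub>m m m"])
    from blk_inj(1)[OF _ _ _ _ this, of 1 m] have a1: "a = 1\<^sub>m 1" using aE by simp
    have "blk (a\<^sup>\<star>) (E''\<^sup>\<star>) = blk a E''" using E'D(2) aE star_blk[of a 1 E'' m] by simp
    from blk_inj(2)[OF _ _ _ _ this, of 1 m] have "E''\<^sup>\<star> = E''" using aE by simp
    then have H'': "E'' \<in> Herm m" using aE by (simp add: Herm_def)
    have "blk (a * a) (E'' * E'') = blk a E''" using E'E' aE blk_mult[of a 1 E'' m a E''] by simp
    from blk_inj(2)[OF _ _ _ _ this, of 1 m] have "E'' * E'' = E''" using aE by simp
    from Suc.IH[OF H'' this] obtain r s h where h: "h \<in> U m" "m = r + s" "E'' * h = h * proj r s" by blast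
    note hD = U_D[OF h(1)]
    define k where "k = blk (1\<^sub>m 1) h"
    have k: "k \<in> U ?n" using blk_U[OF one_U[of 1] h(1)] unfolding k_def n1 .
    note kD = U_D[OF k]
    have ps: "(proj r s :: 'a mat) \<in> carrier_mat m m" using proj_carrier[of r s] h(2) by simp
    have pS: "(proj (Suc r) s :: 'a mat) \<in> carrier_mat ?n ?n" using proj_carrier[of "Suc r" s] h(2) by simp
    have E'k: "E' * k = k * proj (Suc r) s"
      unfolding aE(3) a1 k_def proj_Suc
      using aE(2) hD ps h(3) by (simp add: blk_mult[of "1\<^sub>m 1" 1 _ m "1\<^sub>m 1"])
    have "E * (g * k) = g * k * proj (Suc r) s"
    proof -
      have "E * (g * k) = g * E' * k" unfolding gE by (rule assoc_mult_mat[symmetric, OF ED(1) gD(2) kD(2)])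
      also have "\<dots> = g * (k * proj (Suc r) s)" unfolding E'k[symmetric] by (rule assoc_mult_mat[OF gD(2) E'D(1) kD(2)])
      also have "\<dots> = g * k * proj (Suc r) s" by (rule assoc_mult_mat[symmetric, OF gD(2) kD(2) pS])
      finally show ?thesis .
    qed
    then show ?thesis using mult_U[OF g(1) k] h(2) by (intro exI[of _ "Suc r"] exI[of _ s] bexI[of _ "g * k"]) auto
  qed
qed

lemma pow_mat_Suc_left: "(A :: 'a mat) \<in> carrier_mat n n \<Longrightarrow> A ^\<^sub>m Suc k = A * A ^\<^sub>m k"
proof (induction k)
  case (Suc k)
  have "A ^\<^sub>m Suc (Suc k) = A * A ^\<^sub>m k * A" using Suc by simp
  also have "\<dots> = A * (A ^\<^sub>m k * A)" using Suc.prems by (intro assoc_mult_mat) (auto intro: pow_carrier_mat)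
  finally show ?case by simp
qed simp

lemma pow_mat_U: "A \<in> U n \<Longrightarrow> A\<^sup>\<star> ^\<^sub>m k \<in> carrier_mat n n"
  using U_D(5) by (rule pow_carrier_mat)

text \<open>The adjoint of \<open>A\<close> is its inverse, so the adjoint of \<open>p(A)\<close> is
  \<open>bar p\<close> at \<open>A^(-1)\<close>; extracting \<open>A^(-k)\<close> reverses the
  polynomial. The exponent is left free, as an upper bound of the degree, for the induction.\<close>

lemma star_pm_U:
  assumes A: "A \<in> U n"
  shows "degree p \<le> k \<Longrightarrow> (pm p A)\<^sup>\<star> = (A\<^sup>\<star> ^\<^sub>m k) * pm (hsubst k (bar p) 1 [:0, 1:]) A"
proof (induction p arbitrary: k)
  case 0
  then show ?case using U_D(2)[OF A] right_mult_zero_mat[OF pow_mat_U[OF A], of k n] by (simp add: bar_def)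
next
  case (pCons a p)
  note AD = U_D[OF A]
  note c = pm_carrier[OF AD(2)]
  have bp: "bar (pCons a p) = pCons (a ^ q) (bar p)" by (rule poly_eqI) (simp add: coeff_pCons split: nat.splits)
  show ?case
  proof (cases k)
    case 0
    then have p0: "p = 0" using pCons.prems by (simp split: if_splits)
    have "bar [:a:] = [:a ^ q:]" by (rule poly_eqI) (simp add: coeff_pCons split: nat.splits)
    then have "hsubst 0 (bar [:a:]) 1 [:0, 1:] = [:a ^ q:]" by (simp add: hsubst_def)
    then show ?thesis unfolding 0 p0 using AD by (simp add: star_smult)
  next
    case (Suc k)
    then have "degree p \<le> k" using pCons.prems by (cases "p = 0") auto
    note IH = pCons.IH[OF this]
    let ?h = "hsubst k (bar p) 1 [:0, 1:]"
    let ?Y = "A\<^sup>\<star> ^\<^sub>m k"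
    note Y = pow_mat_U[OF A, of k]
    have YS: "A\<^sup>\<star> ^\<^sub>m Suc k = A\<^sup>\<star> * ?Y" by (rule pow_mat_Suc_left[OF AD(5)])
    have inv: "A\<^sup>\<star> ^\<^sub>m i * A ^\<^sub>m i = 1\<^sub>m n" for i
    proof (induction i)
      case 0
      then show ?case using AD by simp
    next
      case (Suc i)
      have ci: "A ^\<^sub>m i \<in> carrier_mat n n" by (rule pow_carrier_mat[OF AD(2)])
      note yi = pow_mat_U[OF A, of i]
      have "A\<^sup>\<star> ^\<^sub>m Suc i * A ^\<^sub>m Suc i = A\<^sup>\<star> ^\<^sub>m i * (A\<^sup>\<star> * (A * A ^\<^sub>m i))"
        unfolding pow_mat_Suc_left[OF AD(2)] pow_mat.simps(2)[of "A\<^sup>\<star>" i]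
        by (rule assoc_mult_mat[OF yi AD(5) mult_carrier_mat[OF AD(2) ci]])
      then show ?case using U_cancel(1)[OF A ci] Suc by simp
    qed
    have "(pm (pCons a p) A)\<^sup>\<star> = (a \<cdot>\<^sub>m 1\<^sub>m n + pm p A * A)\<^sup>\<star>"
      unfolding pm_pCons[OF AD(2)] using pm_commute[OF AD(2), of "[:0, 1:]" p] AD(2) by simp
    also have "\<dots> = (a \<cdot>\<^sub>m 1\<^sub>m n)\<^sup>\<star> + (pm p A * A)\<^sup>\<star>"
      by (rule star_add[of _ n n]) (use c AD in auto)
    also have "(a \<cdot>\<^sub>m 1\<^sub>m n)\<^sup>\<star> = a ^ q \<cdot>\<^sub>m 1\<^sub>m n" by (simp add: star_smult)
    also have "(pm p A * A)\<^sup>\<star> = A\<^sup>\<star> ^\<^sub>m Suc k * pm ?h A"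
      unfolding star_mult[OF c AD(2)] IH YS by (rule assoc_mult_mat[symmetric, OF AD(5) Y c])
    also have "a ^ q \<cdot>\<^sub>m 1\<^sub>m n = A\<^sup>\<star> ^\<^sub>m Suc k * pm (smult (a ^ q) (monom 1 (Suc k))) A"
    proof -
      have "A\<^sup>\<star> ^\<^sub>m Suc k * pm (smult (a ^ q) (monom 1 (Suc k))) A = a ^ q \<cdot>\<^sub>m (A\<^sup>\<star> ^\<^sub>m Suc k * A ^\<^sub>m Suc k)"
        unfolding pm_smult[OF AD(2)] pm_power_mat[OF AD(2)]
        by (rule mult_smult_distrib[OF pow_mat_U[OF A] pow_carrier_mat[OF AD(2)]])
      then show ?thesis unfolding inv by simp
    qed
    also have "\<dots> + A\<^sup>\<star> ^\<^sub>m Suc k * pm ?h A = A\<^sup>\<star> ^\<^sub>m Suc k * (pm (smult (a ^ q) (monom 1 (Suc k))) A + pm ?h A)"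
      by (rule mult_add_distrib_mat[symmetric, OF pow_mat_U[OF A] c c])
    also have "pm (smult (a ^ q) (monom 1 (Suc k))) A + pm ?h A = pm (hsubst (Suc k) (bar (pCons a p)) 1 [:0, 1:]) A"
      unfolding bp hsubst_pCons pm_add[OF AD(2), symmetric] by (simp add: monom_altdef)
    finally show ?thesis unfolding Suc .
  qed
qed

text \<open>A self-dual polynomial is its reversed conjugate up to a scalar, so the adjoint of
  \<open>p(A)\<close> vanishes wherever \<open>p(A)\<close> does.\<close>

lemma star_pm_self_dual:
  assumes A: "A \<in> U n" and p: "tilde q p = p" "coeff p 0 \<noteq> 0"
  obtains Y where "Y \<in> carrier_mat n n" "(pm p A)\<^sup>\<star> = Y * pm p A"
proof -
  note AD = U_D[OF A]
  let ?k = "degree p"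
  let ?r = "reflect_poly (bar p)"
  have "hsubst ?k (bar p) 1 [:0, 1:] = hsubst ?k ?r [:0, 1:] 1"
    by (rule hsubst_reflect[OF degree_bar, symmetric])
  also have "\<dots> = smult (1 ^ ?k) ?r"
    unfolding one_pCons by (rule hsubst_scale) (use degree_reflect_poly_le[of "bar p"] in simp)
  finally have h: "hsubst ?k (bar p) 1 [:0, 1:] = ?r" by simp
  have "?r = smult (coeff p 0 ^ q) (tilde q p)" using p(2) by (simp add: tilde_def bar_def)
  then have r: "?r = smult (coeff p 0 ^ q) p" unfolding p(1) .
  note Y = pow_mat_U[OF A, of ?k]
  note c = pm_carrier[OF AD(2)]
  have "(pm p A)\<^sup>\<star> = (coeff p 0 ^ q \<cdot>\<^sub>m (A\<^sup>\<star> ^\<^sub>m ?k)) * pm p A"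
    unfolding star_pm_U[OF A order_refl] h r pm_smult[OF AD(2)]
    using mult_smult_distrib[OF Y c] mult_smult_assoc_mat[OF Y c] by simp
  then show thesis using that[OF smult_carrier_mat[OF Y]] by blast
qed

subsection \<open>Splitting off coprime factors\<close>

lemma commuting_star_pm:
  assumes A: "A \<in> U n" and M: "M \<in> carrier_mat n n" and p: "tilde q p = p" "coeff p 0 \<noteq> 0" and z: "pm p A * M = 0\<^sub>m n n"
  shows "(pm p A)\<^sup>\<star> * M = 0\<^sub>m n n"
proof -
  obtain Y where Y: "Y \<in> carrier_mat n n" "(pm p A)\<^sup>\<star> = Y * pm p A" using star_pm_self_dual[OF A p] .
  show ?thesis unfolding Y(2) assoc_mult_mat[OF Y(1) pm_carrier[OF U_D(2)[OF A]] M] z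
    by (rule right_mult_zero_mat[OF Y(1)])
qed

lemma monic_dvd_eq:
  assumes "u dvd p" "lead_coeff u = 1" "lead_coeff p = (1::'a)" "degree p \<le> degree u"
  shows "u = p"
proof -
  obtain w where w: "p = u * w" using assms(1) by (rule dvdE)
  have nz: "u \<noteq> 0" "w \<noteq> 0" using assms(3) w by auto
  have "degree w = 0" using assms(4) nz unfolding w by (simp add: degree_mult_eq)
  moreover have "lead_coeff w = 1" using assms(2,3) unfolding w by (simp add: lead_coeff_mult)
  ultimately have "w = 1" using nz by (intro monic_unit) (simp_all add: is_unit_iff_degree)
  then show ?thesis using w by simp
qed

definition unitary_with_char :: "nat \<Rightarrow> 'a poly \<Rightarrow> 'a mat set" where
  "unitary_with_char n \<phi> = {A \<in> U n. char_poly A = \<phi>}"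

lemma finite_unitary_with_char [simp]: "finite (unitary_with_char n \<phi>)"
  by (simp add: unitary_with_char_def)

lemma unitary_with_charD: "A \<in> unitary_with_char n \<phi> \<Longrightarrow> A \<in> U n" "A \<in> unitary_with_char n \<phi> \<Longrightarrow> char_poly A = \<phi>"
  by (auto simp: unitary_with_char_def)

context
  fixes \<phi>1 \<phi>2 :: "'a poly" and n1 n2 :: nat
  assumes monic: "lead_coeff \<phi>1 = 1" "lead_coeff \<phi>2 = 1"
    and deg: "degree \<phi>1 = n1" "degree \<phi>2 = n2"
    and nz: "coeff \<phi>1 0 \<noteq> 0" "coeff \<phi>2 0 \<noteq> 0"
    and dual: "tilde q \<phi>1 = \<phi>1" "tilde q \<phi>2 = \<phi>2"
    and cop: "comaximal \<phi>1 \<phi>2"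
begin

text \<open>One fixed Bezout pair, so that \<open>e1\<close> and \<open>e2\<close> are the same
  polynomials for all matrices and conjugation of a matrix conjugates the value of
  \<open>e2\<close>.\<close>

private definition "bez = (SOME ab. fst ab * \<phi>1 + snd ab * \<phi>2 = 1)"
private definition "e1 = fst bez * \<phi>1"
private definition "e2 = snd bez * \<phi>2"

private lemma e_sum: "e1 + e2 = 1"
proof -
  obtain a b where "a * \<phi>1 + b * \<phi>2 = 1" using cop by (auto simp: comaximal_def)
  then have "\<exists>ab. fst ab * \<phi>1 + snd ab * \<phi>2 = 1" by (intro exI[of _ "(a, b)"]) simp
  from someI_ex[OF this] show ?thesis by (simp add: bez_def e1_def e2_def)
qed

private lemma pm_e_sum: "B \<in> carrier_mat m m \<Longrightarrow> pm e1 B + pm e2 B = 1\<^sub>m m"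
  by (simp add: e_sum flip: pm_add)

private lemma pm_dvd_zero:
  assumes "B \<in> carrier_mat m m" "p dvd r" "pm p B = 0\<^sub>m m m"
  shows "pm r B = 0\<^sub>m m m"
proof -
  obtain w where w: "r = p * w" using assms(2) by (rule dvdE)
  show ?thesis unfolding w pm_mult[OF assms(1)] assms(3) by (rule left_mult_zero_mat[OF pm_carrier[OF assms(1)]])
qed

private lemma pm_e2_blk:
  assumes "A1 \<in> carrier_mat n1 n1" "A2 \<in> carrier_mat n2 n2" "char_poly A1 = \<phi>1" "char_poly A2 = \<phi>2"
  shows "pm e2 (blk A1 A2) = proj n1 n2"
proof -
  have CH: "pm \<phi>1 A1 = 0\<^sub>m n1 n1" "pm \<phi>2 A2 = 0\<^sub>m n2 n2"
    using Cayley_Hamilton[OF assms(1)] Cayley_Hamilton[OF assms(2)] unfolding assms(3,4) .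
  have "pm e1 A1 = 0\<^sub>m n1 n1"
    by (rule pm_dvd_zero[OF assms(1) _ CH(1)]) (simp add: e1_def)
  then have "pm e2 A1 = 1\<^sub>m n1" using pm_e_sum[OF assms(1)] pm_carrier[OF assms(1), of e2] by simp
  moreover have "pm e2 A2 = 0\<^sub>m n2 n2"
    by (rule pm_dvd_zero[OF assms(2) _ CH(2)]) (simp add: e2_def)
  ultimately show ?thesis unfolding pm_blk[OF assms(1,2)] by (simp add: proj_def)
qed

text \<open>Idempotency is the Cayley-Hamilton theorem, as \<open>\<phi>1 * \<phi>2\<close> divides
  \<open>e1 * e2\<close>. For symmetry: \<phi>2 at \<open>A\<close> kills the value of
  \<open>e1\<close>, hence by self-duality so does its adjoint. Thus
  \<open>E\<^sup>\<star> (1 - E) = 0\<close>, and \<open>E\<^sup>\<star> = E\<^sup>\<star> E\<close>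
  is its own adjoint.\<close>

private lemma e2_projection:
  assumes A: "A \<in> unitary_with_char (n1 + n2) (\<phi>1 * \<phi>2)"
  shows "pm e2 A \<in> Herm (n1 + n2)" "pm e2 A * pm e2 A = pm e2 A"
proof -
  let ?n = "n1 + n2"
  note AU = unitary_with_charD(1)[OF A]
  note AD = U_D[OF AU]
  note c = pm_carrier[OF AD(2)]
  let ?E = "pm e2 A" and ?E1 = "pm e1 A"
  have CH: "pm (\<phi>1 * \<phi>2) A = 0\<^sub>m ?n ?n" using Cayley_Hamilton[OF AD(2)] unitary_with_charD(2)[OF A] by simp
  have sum: "?E = 1\<^sub>m ?n - ?E1"
  proof -
    have "pm e2 A = pm (1 - e1) A" using e_sum by (metis add_diff_cancel_left')
    then show ?thesis using pm_diff[OF AD(2), of 1 e1] AD(2) by simp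
  qed
  have E1: "?E1 = 1\<^sub>m ?n - ?E"
  proof -
    have "pm e1 A = pm (1 - e2) A" using e_sum by (metis add_diff_cancel_right')
    then show ?thesis using pm_diff[OF AD(2), of 1 e2] AD(2) by simp
  qed
  have "e2 * e2 = e2 - e2 * e1" using e_sum by (metis add_diff_cancel_left' mult_1_right right_diff_distrib)
  moreover have "pm (e2 * e1) A = 0\<^sub>m ?n ?n"
    by (rule pm_dvd_zero[OF AD(2) _ CH]) (simp add: e1_def e2_def mult_dvd_mono mult.commute)
  ultimately have "?E * ?E = ?E - 0\<^sub>m ?n ?n" using pm_mult[OF AD(2), of e2 e2] pm_diff[OF AD(2), of e2 "e2 * e1"] by simp
  then show "?E * ?E = ?E" using c[of e2] by simp (intro eq_matI, auto)
  define b where "b = snd bez"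
  have z1: "pm \<phi>2 A * ?E1 = 0\<^sub>m ?n ?n"
    unfolding pm_mult[OF AD(2), symmetric] by (rule pm_dvd_zero[OF AD(2) _ CH]) (simp add: e1_def mult.commute mult_dvd_mono)
  have z2: "(pm \<phi>2 A)\<^sup>\<star> * ?E1 = 0\<^sub>m ?n ?n" by (rule commuting_star_pm[OF AU c dual(2) nz(2) z1])
  have bs: "(pm b A)\<^sup>\<star> \<in> carrier_mat ?n ?n" "(pm \<phi>2 A)\<^sup>\<star> \<in> carrier_mat ?n ?n" "?E\<^sup>\<star> \<in> carrier_mat ?n ?n"
    using c[of b] c[of \<phi>2] c[of e2] by auto
  have "?E = pm \<phi>2 A * pm b A" unfolding pm_mult[OF AD(2), symmetric] by (simp add: e2_def b_def mult.commute)
  then have Es: "?E\<^sup>\<star> = (pm b A)\<^sup>\<star> * (pm \<phi>2 A)\<^sup>\<star>" using star_mult[OF c c, of \<phi>2 b] by simp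
  have "?E\<^sup>\<star> * ?E1 = 0\<^sub>m ?n ?n"
    unfolding Es assoc_mult_mat[OF bs(1,2) c] z2 by (rule right_mult_zero_mat[OF bs(1)])
  then have "?E\<^sup>\<star> * (1\<^sub>m ?n - ?E) = 0\<^sub>m ?n ?n" unfolding E1 .
  then have "?E\<^sup>\<star> * 1\<^sub>m ?n - ?E\<^sup>\<star> * ?E = 0\<^sub>m ?n ?n"
    using mult_minus_distrib_mat[OF bs(3) one_carrier_mat c[of e2]] by simp
  then have d: "?E\<^sup>\<star> - ?E\<^sup>\<star> * ?E = 0\<^sub>m ?n ?n" using right_mult_one_mat[OF bs(3)] by simp
  have "?E\<^sup>\<star> = ?E\<^sup>\<star> * ?E"
  proof (rule eq_matI)
    have cc: "?E\<^sup>\<star> * ?E \<in> carrier_mat ?n ?n" using bs(3) c by (rule mult_carrier_mat)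
    fix i j assume "i < dim_row (?E\<^sup>\<star> * ?E)" "j < dim_col (?E\<^sup>\<star> * ?E)"
    then have ij: "i < ?n" "j < ?n" using carrier_matD[OF cc] by simp_all
    have "(?E\<^sup>\<star> - ?E\<^sup>\<star> * ?E) $$ (i, j) = ?E\<^sup>\<star> $$ (i, j) - (?E\<^sup>\<star> * ?E) $$ (i, j)"
      by (rule index_minus_mat(1)) (use ij carrier_matD[OF cc] in simp_all)
    then show "?E\<^sup>\<star> $$ (i, j) = (?E\<^sup>\<star> * ?E) $$ (i, j)" unfolding d using ij by simp
  qed (use bs(3) c[of e2] AD(2) in simp_all)
  moreover have "(?E\<^sup>\<star> * ?E)\<^sup>\<star> = ?E\<^sup>\<star> * ?E" using star_mult[OF bs(3) c[of e2]] by simp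
  ultimately have "?E = ?E\<^sup>\<star>" by (metis star_star_id)
  then show "?E \<in> Herm ?n" using c[of e2] by (simp add: Herm_def)
qed

text \<open>\<open>A\<close> commutes with the orthogonal projection that is its value under
  \<open>e2\<close>, so it is block-diagonal in an orthonormal basis adapted to that
  projection.\<close>

private lemma split_surj:
  assumes A: "A \<in> unitary_with_char (n1 + n2) (\<phi>1 * \<phi>2)"
  shows "\<exists>g\<in>U (n1 + n2). \<exists>A1\<in>unitary_with_char n1 \<phi>1. \<exists>A2\<in>unitary_with_char n2 \<phi>2. g * blk A1 A2 * g\<^sup>\<star> = A"
proof -
  let ?n = "n1 + n2"
  note AU = unitary_with_charD(1)[OF A]
  note AD = U_D[OF AU]
  let ?E = "pm e2 A"
  have Ec: "?E \<in> carrier_mat ?n ?n" by (rule pm_carrier[OF AD(2)])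
  obtain r s g where g: "g \<in> U ?n" "?n = r + s" "?E * g = g * proj r s"
    using orthogonal_projection_diagonal[OF e2_projection[OF A]] by blast
  note gD = U_D[OF g(1)]
  have gs: "g\<^sup>\<star> \<in> U ?n" by (rule star_U[OF g(1)])
  define B where "B = g\<^sup>\<star> * A * g"
  have BU: "B \<in> U ?n" unfolding B_def by (intro mult_U gs AU g(1))
  note BD = U_D[OF BU]
  have P: "(proj r s :: 'a mat) \<in> carrier_mat ?n ?n" using g(2) by simp
  have pB: "pm e2 B = proj r s"
  proof -
    have "pm e2 B = g\<^sup>\<star> * ?E * g" unfolding B_def by (rule pm_similar[OF AD(2) gD(5,2,4,3)])
    also have "\<dots> = g\<^sup>\<star> * (?E * g)" by (rule assoc_mult_mat[OF gD(5) Ec gD(2)])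
    also have "\<dots> = proj r s" unfolding g(3) by (rule U_cancel(1)[OF g(1) P])
    finally show ?thesis .
  qed
  have "B * pm e2 B = pm e2 B * B" using pm_commute[OF BD(2), of "[:0, 1:]" e2] BD(2) by simp
  then obtain B1 B2 where B: "B1 \<in> carrier_mat r r" "B2 \<in> carrier_mat s s" "B = blk B1 B2"
    using commute_proj[of B r s] BD(2) unfolding pB g(2) by metis
  have cB: "char_poly B = \<phi>1 * \<phi>2"
    using char_poly_conj_U[OF gs AD(2)] unitary_with_charD(2)[OF A] by (simp add: B_def)
  have cB12: "char_poly B1 * char_poly B2 = \<phi>1 * \<phi>2" using char_poly_blk[OF B(1,2)] cB B(3) by simp
  have e2B: "pm e2 B1 = 1\<^sub>m r" "pm e2 B2 = 0\<^sub>m s s"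
  proof -
    have e: "blk (pm e2 B1) (pm e2 B2) = blk (1\<^sub>m r) (0\<^sub>m s s)"
      using pB unfolding B(3) pm_blk[OF B(1,2)] proj_def .
    show "pm e2 B1 = 1\<^sub>m r" "pm e2 B2 = 0\<^sub>m s s"
      using blk_inj[OF pm_carrier[OF B(1)] pm_carrier[OF B(2)] one_carrier_mat zero_carrier_mat e] by auto
  qed
  have CH: "pm (\<phi>1 * \<phi>2) B1 = 0\<^sub>m r r" "pm (\<phi>1 * \<phi>2) B2 = 0\<^sub>m s s"
  proof -
    have "blk (pm (\<phi>1 * \<phi>2) B1) (pm (\<phi>1 * \<phi>2) B2) = blk (0\<^sub>m r r) (0\<^sub>m s s)"
      using Cayley_Hamilton[OF BD(2)] unfolding cB unfolding B(3) pm_blk[OF B(1,2)] blk_zero g(2) .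
    from blk_inj[OF pm_carrier[OF B(1)] pm_carrier[OF B(2)] zero_carrier_mat zero_carrier_mat this]
    show "pm (\<phi>1 * \<phi>2) B1 = 0\<^sub>m r r" "pm (\<phi>1 * \<phi>2) B2 = 0\<^sub>m s s" by auto
  qed
  \<comment> \<open>On the first block \<open>e2\<close> is the identity, and
    \<open>e2 * \<phi>1\<close> is a multiple of the characteristic polynomial of
    \<open>B\<close>.\<close>
  have "pm \<phi>1 B1 = pm e2 B1 * pm \<phi>1 B1" unfolding e2B(1) by (rule left_mult_one_mat[symmetric, OF pm_carrier[OF B(1)]])
  also have "\<dots> = 0\<^sub>m r r" unfolding pm_mult[OF B(1), symmetric]
    by (rule pm_dvd_zero[OF B(1) _ CH(1)]) (simp add: e2_def mult.commute mult_dvd_mono)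
  finally have z1: "pm \<phi>1 B1 = 0\<^sub>m r r" .
  have e1B: "pm e1 B2 = 1\<^sub>m s"
    using pm_e_sum[OF B(2)] e2B(2) pm_carrier[OF B(2), of e1] by simp
  have "pm \<phi>2 B2 = pm e1 B2 * pm \<phi>2 B2" unfolding e1B by (rule left_mult_one_mat[symmetric, OF pm_carrier[OF B(2)]])
  also have "\<dots> = 0\<^sub>m s s" unfolding pm_mult[OF B(2), symmetric]
    by (rule pm_dvd_zero[OF B(2) _ CH(2)]) (simp add: e1_def mult_dvd_mono)
  finally have z2: "pm \<phi>2 B2 = 0\<^sub>m s s" .
  note mB = degree_monic_char_poly[OF B(1)] degree_monic_char_poly[OF B(2)]
  \<comment> \<open>Dividing a power of \<phi>1, \<open>char_poly B1\<close> is coprime to \<phi>2;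
    as it divides \<open>\<phi>1 * \<phi>2\<close>, it divides \<phi>1.\<close>
  have d1: "char_poly B1 dvd \<phi>1"
  proof -
    have d: "char_poly B1 dvd \<phi>1 ^ r" by (rule char_poly_dvd_power[OF B(1) z1])
    obtain w where w: "\<phi>1 ^ r = char_poly B1 * w" using d by (rule dvdE)
    have "comaximal (\<phi>1 ^ r) \<phi>2" by (rule comaximal_power[OF cop])
    then obtain a b where "a * (\<phi>1 ^ r) + b * \<phi>2 = 1" by (auto simp: comaximal_def)
    then have "(a * w) * char_poly B1 + b * \<phi>2 = 1" unfolding w by (simp add: mult_ac)
    then have "comaximal (char_poly B1) \<phi>2" unfolding comaximal_def by blast
    moreover have "char_poly B1 dvd \<phi>2 * \<phi>1" using cB12 by (metis dvd_triv_left mult.commute)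
    ultimately show ?thesis by (rule comaximal_dvd)
  qed
  have d2: "char_poly B2 dvd \<phi>2"
  proof -
    have d: "char_poly B2 dvd \<phi>2 ^ s" by (rule char_poly_dvd_power[OF B(2) z2])
    obtain w where w: "\<phi>2 ^ s = char_poly B2 * w" using d by (rule dvdE)
    have "comaximal (\<phi>2 ^ s) \<phi>1" by (rule comaximal_power[OF comaximal_sym[OF cop]])
    then obtain a b where "a * (\<phi>2 ^ s) + b * \<phi>1 = 1" by (auto simp: comaximal_def)
    then have "(a * w) * char_poly B2 + b * \<phi>1 = 1" unfolding w by (simp add: mult_ac)
    then have "comaximal (char_poly B2) \<phi>1" unfolding comaximal_def by blast
    moreover have "char_poly B2 dvd \<phi>1 * \<phi>2" using cB12 by (metis dvd_triv_right)
    ultimately show ?thesis by (rule comaximal_dvd)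
  qed
  have nz12: "\<phi>1 \<noteq> 0" "\<phi>2 \<noteq> 0" using monic by auto
  \<comment> \<open>Divisibility only bounds the block sizes by the degrees; the common sum turns
    both bounds into equalities.\<close>
  have "r \<le> n1" using dvd_imp_degree_le[OF d1 nz12(1)] mB(1) deg(1) by simp
  moreover have "s \<le> n2" using dvd_imp_degree_le[OF d2 nz12(2)] mB(2) deg(2) by simp
  ultimately have rs: "r = n1" "s = n2" using g(2) by auto
  have c1: "char_poly B1 = \<phi>1" by (rule monic_dvd_eq[OF d1]) (use mB monic deg rs in auto)
  have c2: "char_poly B2 = \<phi>2" by (rule monic_dvd_eq[OF d2]) (use mB monic deg rs in auto)
  have "B1 \<in> U r \<and> B2 \<in> U s" using blk_U_iff[of B1 r B2 s] B BU unfolding g(2) by simp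
  then have "B1 \<in> unitary_with_char n1 \<phi>1" "B2 \<in> unitary_with_char n2 \<phi>2"
    using c1 c2 rs by (auto simp: unitary_with_char_def)
  moreover have "g * blk B1 B2 * g\<^sup>\<star> = A"
    unfolding B(3)[symmetric] B_def by (rule conj_U_cancel(2)[OF g(1) AD(2)])
  ultimately show ?thesis using g(1) by blast
qed

private lemma conj_in_U:
  assumes "A \<in> unitary_with_char n \<phi>" "h \<in> U n"
  shows "h\<^sup>\<star> * A * h \<in> unitary_with_char n \<phi>"
proof -
  note A = unitary_with_charD[OF assms(1)]
  have "h\<^sup>\<star> * A * h \<in> U n" by (intro mult_U star_U assms(2) A(1))
  moreover have "char_poly (h\<^sup>\<star> * A * h) = \<phi>" using char_poly_conj_U[OF star_U[OF assms(2)] U_D(2)[OF A(1)]] A(2) by simp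
  ultimately show ?thesis by (simp add: unitary_with_char_def)
qed

text \<open>Two representations differ by a unitary \<open>h\<close> that conjugates one
  block-diagonal matrix into the other. At both of them \<open>e2\<close> has the value
  \<open>proj n1 n2\<close>, so \<open>h\<close> commutes with this projection and is itself
  block-diagonal.\<close>

private lemma split_fiber:
  assumes g: "g \<in> U (n1 + n2)" and A: "A1 \<in> unitary_with_char n1 \<phi>1" "A2 \<in> unitary_with_char n2 \<phi>2"
  shows "card {(g', A'). g' \<in> U (n1 + n2) \<and> A' \<in> unitary_with_char n1 \<phi>1 \<times> unitary_with_char n2 \<phi>2
      \<and> g' * blk (fst A') (snd A') * g'\<^sup>\<star> = g * blk A1 A2 * g\<^sup>\<star>} = card (U n1) * card (U n2)"
proof -
  let ?n = "n1 + n2"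
  let ?S = "{(g', A'). g' \<in> U ?n \<and> A' \<in> unitary_with_char n1 \<phi>1 \<times> unitary_with_char n2 \<phi>2
      \<and> g' * blk (fst A') (snd A') * g'\<^sup>\<star> = g * blk A1 A2 * g\<^sup>\<star>}"
  note AU = unitary_with_charD[OF A(1)] unitary_with_charD[OF A(2)]
  note A1 = U_D[OF AU(1)] and A2 = U_D[OF AU(3)]
  note gD = U_D[OF g]
  let ?B = "blk A1 A2"
  have BU: "?B \<in> U ?n" by (rule blk_U[OF AU(1,3)])
  note BD = U_D[OF BU]
  let ?f = "\<lambda>(h1, h2). (g * blk h1 h2, (h1\<^sup>\<star> * A1 * h1, h2\<^sup>\<star> * A2 * h2))"
  have "bij_betw ?f (U n1 \<times> U n2) ?S"
  proof (rule bij_betw_imageI)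
    show "inj_on ?f (U n1 \<times> U n2)"
    proof (rule inj_onI, clarify)
      fix h1 h2 k1 k2 assume h: "h1 \<in> U n1" "h2 \<in> U n2" "k1 \<in> U n1" "k2 \<in> U n2" and eq: "g * blk h1 h2 = g * blk k1 k2"
      have "g\<^sup>\<star> * (g * blk h1 h2) = g\<^sup>\<star> * (g * blk k1 k2)" by (simp only: eq)
      then have "blk h1 h2 = blk k1 k2"
        unfolding U_cancel(1)[OF g U_D(2)[OF blk_U[OF h(1,2)]]] U_cancel(1)[OF g U_D(2)[OF blk_U[OF h(3,4)]]] .
      from blk_inj[OF U_D(2)[OF h(1)] U_D(2)[OF h(2)] U_D(2)[OF h(3)] U_D(2)[OF h(4)] this]
      show "h1 = k1 \<and> h2 = k2" by simp
    qed
    show "?f ` (U n1 \<times> U n2) = ?S"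
    proof
      show "?f ` (U n1 \<times> U n2) \<subseteq> ?S"
      proof (rule image_subsetI, clarify, intro conjI)
        fix h1 h2 assume h: "h1 \<in> U n1" "h2 \<in> U n2"
        note h1 = U_D[OF h(1)] and h2 = U_D[OF h(2)]
        let ?h = "blk h1 h2"
        have hU: "?h \<in> U ?n" by (rule blk_U[OF h])
        note hD = U_D[OF hU]
        show "g * ?h \<in> U ?n" by (rule mult_U[OF g hU])
        show "(h1\<^sup>\<star> * A1 * h1, h2\<^sup>\<star> * A2 * h2) \<in> unitary_with_char n1 \<phi>1 \<times> unitary_with_char n2 \<phi>2"
          using conj_in_U[OF A(1) h(1)] conj_in_U[OF A(2) h(2)] by simp
        have "blk (h1\<^sup>\<star> * A1 * h1) (h2\<^sup>\<star> * A2 * h2) = ?h\<^sup>\<star> * ?B * ?h"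
        proof -
          have c: "h1\<^sup>\<star> * A1 \<in> carrier_mat n1 n1" "h2\<^sup>\<star> * A2 \<in> carrier_mat n2 n2"
            by (rule mult_carrier_mat[OF h1(5) A1(2)], rule mult_carrier_mat[OF h2(5) A2(2)])
          show ?thesis
            unfolding star_blk[OF h1(2) h2(2)] blk_mult[OF h1(5) h2(5) A1(2) A2(2)] blk_mult[OF c h1(2) h2(2)] ..
        qed
        moreover have "(g * ?h) * (?h\<^sup>\<star> * ?B * ?h) * (g * ?h)\<^sup>\<star> = g * ?B * g\<^sup>\<star>"
        proof -
          have c: "?h\<^sup>\<star> * ?B * ?h \<in> carrier_mat ?n ?n" by (intro mult_carrier_mat[of _ ?n ?n] hD(5,2) BD(2))
          have hgs: "?h\<^sup>\<star> * g\<^sup>\<star> \<in> carrier_mat ?n ?n" by (rule mult_carrier_mat[OF hD(5) gD(5)])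
          have "(g * ?h) * (?h\<^sup>\<star> * ?B * ?h) * (g * ?h)\<^sup>\<star> = g * (?h * (?h\<^sup>\<star> * ?B * ?h)) * (?h\<^sup>\<star> * g\<^sup>\<star>)"
            unfolding star_mult[OF gD(2) hD(2)] assoc_mult_mat[OF gD(2) hD(2) c] ..
          also have "\<dots> = g * (?h * (?h\<^sup>\<star> * ?B * ?h) * ?h\<^sup>\<star>) * g\<^sup>\<star>"
            using assoc_mult_mat[OF gD(2) mult_carrier_mat[OF hD(2) c] hgs]
              assoc_mult_mat[OF mult_carrier_mat[OF hD(2) c] hD(5) gD(5)]
              assoc_mult_mat[OF gD(2) mult_carrier_mat[OF mult_carrier_mat[OF hD(2) c] hD(5)] gD(5)] by simp
          finally show ?thesis unfolding conj_U_cancel(2)[OF hU BD(2)] .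
        qed
        ultimately show "g * ?h * blk (fst (h1\<^sup>\<star> * A1 * h1, h2\<^sup>\<star> * A2 * h2)) (snd (h1\<^sup>\<star> * A1 * h1, h2\<^sup>\<star> * A2 * h2)) * (g * ?h)\<^sup>\<star> = g * ?B * g\<^sup>\<star>"
          by simp
      qed
      show "?S \<subseteq> ?f ` (U n1 \<times> U n2)"
      proof clarify
        fix g' C1 C2 assume g': "g' \<in> U ?n" and C: "C1 \<in> unitary_with_char n1 \<phi>1" "C2 \<in> unitary_with_char n2 \<phi>2"
          and eq: "g' * blk (fst (C1, C2)) (snd (C1, C2)) * g'\<^sup>\<star> = g * ?B * g\<^sup>\<star>"
        note CU = unitary_with_charD[OF C(1)] unitary_with_charD[OF C(2)]
        note C1 = U_D[OF CU(1)] and C2 = U_D[OF CU(3)]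
        note g'D = U_D[OF g']
        let ?C = "blk C1 C2"
        have CU': "?C \<in> U ?n" by (rule blk_U[OF CU(1,3)])
        note CD = U_D[OF CU']
        define h where "h = g\<^sup>\<star> * g'"
        have hU: "h \<in> U ?n" unfolding h_def by (intro mult_U star_U g g')
        note hD = U_D[OF hU]
        have gh: "g' = g * h" unfolding h_def by (rule U_cancel(2)[symmetric, OF g g'D(2)])
        have hC: "h * ?C = ?B * h"
        proof -
          have gB: "g * ?B \<in> carrier_mat ?n ?n" by (rule mult_carrier_mat[OF gD(2) BD(2)])
          have "g' * ?C = g' * ?C * (g'\<^sup>\<star> * g')" unfolding g'D(3) using g'D CD by simp
          also have "\<dots> = g' * ?C * g'\<^sup>\<star> * g'"
            by (rule assoc_mult_mat[symmetric, OF mult_carrier_mat[OF g'D(2) CD(2)] g'D(5,2)])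
          also have "\<dots> = g * ?B * g\<^sup>\<star> * g'" using eq by simp
          also have "\<dots> = g * ?B * h" unfolding h_def by (rule assoc_mult_mat[OF gB gD(5) g'D(2)])
          also have "\<dots> = g * (?B * h)" by (rule assoc_mult_mat[OF gD(2) BD(2) hD(2)])
          finally have "g\<^sup>\<star> * (g' * ?C) = g\<^sup>\<star> * (g * (?B * h))" by simp
          then have "g\<^sup>\<star> * (g' * ?C) = ?B * h"
            unfolding U_cancel(1)[OF g mult_carrier_mat[OF BD(2) hD(2)]] .
          moreover have "h * ?C = g\<^sup>\<star> * (g' * ?C)" unfolding h_def by (rule assoc_mult_mat[OF gD(5) g'D(2) CD(2)])
          ultimately show ?thesis by simp
        qed
        have C_eq: "?C = h\<^sup>\<star> * ?B * h"
        proof -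
          have "?C = h\<^sup>\<star> * (h * ?C)" by (rule U_cancel(1)[symmetric, OF hU CD(2)])
          then show ?thesis unfolding hC using assoc_mult_mat[OF hD(5) BD(2) hD(2)] by simp
        qed
        have P: "(proj n1 n2 :: 'a mat) \<in> carrier_mat ?n ?n" by simp
        have "proj n1 n2 = h\<^sup>\<star> * proj n1 n2 * h"
          using pm_similar[OF BD(2) hD(5,2,4,3), of e2] unfolding C_eq[symmetric]
            pm_e2_blk[OF C1(2) C2(2) CU(2,4)] pm_e2_blk[OF A1(2) A2(2) AU(2,4)] .
        then have "h * proj n1 n2 = h * (h\<^sup>\<star> * (proj n1 n2 * h))"
          using assoc_mult_mat[OF hD(5) P hD(2)] by simp
        then have "h * proj n1 n2 = proj n1 n2 * h" unfolding U_cancel(2)[OF hU mult_carrier_mat[OF P hD(2)]] .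
        from commute_proj[OF hD(2) this] obtain h1 h2 where
          h: "h1 \<in> carrier_mat n1 n1" "h2 \<in> carrier_mat n2 n2" "h = blk h1 h2" .
        have hU12: "h1 \<in> U n1" "h2 \<in> U n2" using blk_U_iff[of h1 n1 h2 n2] h hU by auto
        have "blk (h1 * C1) (h2 * C2) = blk (A1 * h1) (A2 * h2)"
          using hC unfolding h(3) blk_mult[OF h(1,2) C1(2) C2(2)] blk_mult[OF A1(2) A2(2) h(1,2)] .
        from blk_inj[OF mult_carrier_mat[OF h(1) C1(2)] mult_carrier_mat[OF h(2) C2(2)]
            mult_carrier_mat[OF A1(2) h(1)] mult_carrier_mat[OF A2(2) h(2)] this]
        have e: "h1 * C1 = A1 * h1" "h2 * C2 = A2 * h2" by auto
        have "C1 = h1\<^sup>\<star> * A1 * h1"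
          using U_cancel(1)[OF hU12(1) C1(2)] assoc_mult_mat[OF U_D(5)[OF hU12(1)] A1(2) h(1)] unfolding e(1) by simp
        moreover have "C2 = h2\<^sup>\<star> * A2 * h2"
          using U_cancel(1)[OF hU12(2) C2(2)] assoc_mult_mat[OF U_D(5)[OF hU12(2)] A2(2) h(2)] unfolding e(2) by simp
        ultimately have "(g', C1, C2) = ?f (h1, h2)" using gh h(3) by simp
        then show "(g', C1, C2) \<in> ?f ` (U n1 \<times> U n2)" using hU12 by (intro image_eqI[of _ _ "(h1, h2)"]) auto
      qed
    qed
  qed
  from bij_betw_same_card[OF this] show ?thesis by (simp add: card_cartesian_product)
qed

lemma card_unitary_split:
  "card (U (n1 + n2)) * (card (unitary_with_char n1 \<phi>1) * card (unitary_with_char n2 \<phi>2))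
    = card (U n1) * card (U n2) * card (unitary_with_char (n1 + n2) (\<phi>1 * \<phi>2))"
proof -
  have "card (U (n1 + n2)) * card (unitary_with_char n1 \<phi>1 \<times> unitary_with_char n2 \<phi>2)
    = card (U n1) * card (U n2) * card (unitary_with_char (n1 + n2) (\<phi>1 * \<phi>2))"
  proof (rule card_product_fibers[where f = "\<lambda>g A. g * blk (fst A) (snd A) * g\<^sup>\<star>"])
    fix g :: "'a mat" and A assume g: "g \<in> U (n1 + n2)" and A: "A \<in> unitary_with_char n1 \<phi>1 \<times> unitary_with_char n2 \<phi>2"
    obtain A1 A2 where A12: "A = (A1, A2)" "A1 \<in> unitary_with_char n1 \<phi>1" "A2 \<in> unitary_with_char n2 \<phi>2" using A by auto
    note A1 = unitary_with_charD[OF A12(2)] and A2 = unitary_with_charD[OF A12(3)]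
    have bU: "blk A1 A2 \<in> U (n1 + n2)" by (rule blk_U[OF A1(1) A2(1)])
    have "char_poly (g * blk A1 A2 * g\<^sup>\<star>) = \<phi>1 * \<phi>2"
      using char_poly_conj_U[OF g U_D(2)[OF bU]] char_poly_blk[OF U_D(2)[OF A1(1)] U_D(2)[OF A2(1)]] A1(2) A2(2) by simp
    moreover have "g * blk A1 A2 * g\<^sup>\<star> \<in> U (n1 + n2)" by (intro mult_U star_U g bU)
    ultimately show "g * blk (fst A) (snd A) * g\<^sup>\<star> \<in> unitary_with_char (n1 + n2) (\<phi>1 * \<phi>2)"
      by (simp add: A12(1) unitary_with_char_def)
    show "card {(a', b'). a' \<in> U (n1 + n2) \<and> b' \<in> unitary_with_char n1 \<phi>1 \<times> unitary_with_char n2 \<phi>2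
        \<and> a' * blk (fst b') (snd b') * a'\<^sup>\<star> = g * blk (fst A) (snd A) * g\<^sup>\<star>} = card (U n1) * card (U n2)"
      using split_fiber[OF g A12(2,3)] by (simp add: A12(1))
  next
    fix C assume "C \<in> unitary_with_char (n1 + n2) (\<phi>1 * \<phi>2)"
    from split_surj[OF this] obtain g A1 A2 where "g \<in> U (n1 + n2)" "A1 \<in> unitary_with_char n1 \<phi>1"
      "A2 \<in> unitary_with_char n2 \<phi>2" "g * blk A1 A2 * g\<^sup>\<star> = C" by blast
    then show "\<exists>a\<in>U (n1 + n2). \<exists>b\<in>unitary_with_char n1 \<phi>1 \<times> unitary_with_char n2 \<phi>2. a * blk (fst b) (snd b) * a\<^sup>\<star> = C"
      by (intro bexI[of _ g] bexI[of _ "(A1, A2)"]) auto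
  qed auto
  then show ?thesis by (simp add: card_cartesian_product)
qed

end

subsection \<open>Dual polynomials\<close>

lemma tilde_bar: "tilde q p = smult (1 / coeff p 0 ^ q) (reflect_poly (bar p))"
  by (simp add: tilde_def bar_def)

lemma tilde_1 [simp]: "tilde q 1 = (1 :: 'a poly)"
  by (simp add: tilde_bar)

lemma tilde_mult: "tilde q (p * r) = tilde q p * tilde q (r :: 'a poly)"
  by (simp add: tilde_bar coeff_mult_0 reflect_poly_mult bar_mult frob_mult mult.commute)

lemma coeff_0_tilde: "coeff (tilde q p) 0 = lead_coeff p ^ q / coeff (p :: 'a poly) 0 ^ q"
  by (simp add: tilde_bar)

lemma tilde_tilde:
  assumes "lead_coeff (p :: 'a poly) = 1" "coeff p 0 \<noteq> 0"
  shows "tilde q (tilde q p) = p"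
proof -
  have b: "bar (smult k r) = smult (k ^ q) (bar r)" "bar (reflect_poly r) = reflect_poly (bar r)" for k r
    by (rule poly_eqI, simp add: frob_mult) (rule poly_eqI, simp add: coeff_reflect_poly)
  have "tilde q (tilde q p) = smult (1 / coeff (tilde q p) 0 ^ q) (reflect_poly (bar (tilde q p)))"
    by (rule tilde_bar)
  also have "bar (tilde q p) = smult (1 / coeff p 0) (reflect_poly p)"
    unfolding tilde_bar b by (simp add: power_divide)
  also have "coeff (tilde q p) 0 ^ q = 1 / coeff p 0"
    unfolding coeff_0_tilde using assms(1) by (simp add: power_divide)
  finally show ?thesis using assms(2) by (simp add: reflect_poly_smult)
qed

lemma tilde_eq_0: "coeff p 0 = 0 \<Longrightarrow> tilde q p = (0 :: 'a poly)"
  by (simp add: tilde_bar zero_power[OF q_pos])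

lemma tilde_self_nonzero: "tilde q p = p \<Longrightarrow> p \<noteq> 0 \<Longrightarrow> coeff (p :: 'a poly) 0 \<noteq> 0"
  using tilde_eq_0[of p] by auto

definition self_dual :: "'a poly \<Rightarrow> bool" where
  "self_dual p \<longleftrightarrow> lead_coeff p = 1 \<and> coeff p 0 \<noteq> 0 \<and> tilde q p = p"

lemma self_dual_1: "self_dual 1"
  by (simp add: self_dual_def)

lemma self_dual_mult: "self_dual p \<Longrightarrow> self_dual r \<Longrightarrow> self_dual (p * r)"
  by (simp add: self_dual_def tilde_mult coeff_mult_0 lead_coeff_mult)

lemma self_dual_power: "self_dual p \<Longrightarrow> self_dual (p ^ k)"
  by (induction k) (auto intro: self_dual_mult self_dual_1)

lemma self_dual_prod: "(\<And>i. i \<in> I \<Longrightarrow> self_dual (h i)) \<Longrightarrow> self_dual (\<Prod>i\<in>I. h i)"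
  by (induction I rule: infinite_finite_induct) (auto intro: self_dual_mult self_dual_1)

subsection \<open>The proportion of unitary matrices with a given characteristic polynomial\<close>

text \<open>Dividing by the group order makes the count multiplicative over coprime self-dual
  factors.\<close>

definition ratio :: "'a poly \<Rightarrow> real" where
  "ratio \<phi> = real (card (unitary_with_char (degree \<phi>) \<phi>)) / real (card (U (degree \<phi>)))"

lemma real_card_U_nonzero: "real (card (U n)) \<noteq> 0"
  using card_U_pos[of n] by (metis less_numeral_extra(3) of_nat_eq_0_iff)

lemma ratio_1: "ratio 1 = 1"
proof -
  have "unitary_with_char 0 1 = U 0"
  proof -
    have "char_poly A = 1" if "A \<in> U 0" for A
      using degree_monic_char_poly[OF U_D(2)[OF that]]
      by (intro monic_unit) (auto simp: is_unit_iff_degree)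
    then show ?thesis by (auto simp: unitary_with_char_def)
  qed
  then show ?thesis unfolding ratio_def degree_1 by (simp only: divide_self[OF real_card_U_nonzero])
qed

lemma ratio_mult:
  assumes "self_dual p" "self_dual r" "comaximal p r"
  shows "ratio (p * r) = ratio p * ratio r"
proof -
  have nz: "p \<noteq> 0" "r \<noteq> 0" using assms by (auto simp: self_dual_def)
  let ?u = "\<lambda>n. real (card (U n))" and ?c = "\<lambda>n p. real (card (unitary_with_char n p))"
  have "card (U (degree p + degree r)) * (card (unitary_with_char (degree p) p) * card (unitary_with_char (degree r) r))
    = card (U (degree p)) * card (U (degree r)) * card (unitary_with_char (degree p + degree r) (p * r))"
    by (rule card_unitary_split) (use assms in \<open>auto simp: self_dual_def\<close>)
  from arg_cong[OF this, of real]
  have "?u (degree p + degree r) * (?c (degree p) p * ?c (degree r) r)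
    = ?u (degree p) * ?u (degree r) * ?c (degree p + degree r) (p * r)" by (simp only: of_nat_mult)
  moreover have "c / C = a / A * (b / B)" if "C * (a * b) = A * B * c" "A \<noteq> 0" "B \<noteq> 0" "C \<noteq> 0" for a b c A B C :: real
    using that by (simp add: field_simps)
  ultimately show ?thesis unfolding ratio_def degree_mult_eq[OF nz] using real_card_U_nonzero by blast
qed

lemma ratio_prod:
  assumes "finite I" "\<And>i. i \<in> I \<Longrightarrow> self_dual (h i)"
    and "\<And>i k. i \<in> I \<Longrightarrow> k \<in> I \<Longrightarrow> i \<noteq> k \<Longrightarrow> comaximal (h i) (h k)"
  shows "ratio (\<Prod>i\<in>I. h i) = (\<Prod>i\<in>I. ratio (h i))"
  using assms
proof (induction I rule: finite_induct)
  case empty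
  then show ?case by (simp add: ratio_1)
next
  case (insert i I)
  have "comaximal (\<Prod>k\<in>I. h k) (h i)"
    by (rule comaximal_prod) (use insert.prems(2) insert.hyps in blast)
  then have "ratio (h i * (\<Prod>k\<in>I. h k)) = ratio (h i) * ratio (\<Prod>k\<in>I. h k)"
    using insert.prems(1) by (intro ratio_mult self_dual_prod comaximal_sym[of _ "h i"]) auto
  then show ?case using insert by simp
qed

text \<open>A monic irreducible polynomial with a root is linear and has no second root, but there
  are at least two elements of norm one.\<close>

lemma ex_norm_one_not_root:
  assumes "lead_coeff (p :: 'a poly) = 1" "Factorial_Ring.irreducible p"
  shows "\<exists>z. z ^ q * z = 1 \<and> poly p z \<noteq> 0"
proof -
  obtain z where z: "z ^ (q + 1) = (1::'a)" using ex_norm_one_neq[of 0] by blast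
  obtain y where y: "y ^ (q + 1) = (1::'a)" "y \<noteq> z" using ex_norm_one_neq[of z] by blast
  have "poly p z \<noteq> 0 \<or> poly p y \<noteq> 0"
  proof (cases "poly p z = 0")
    case True
    then obtain w where w: "p = [:- z, 1:] * w" by (auto simp: poly_eq_0_iff_dvd)
    have "\<not> is_unit [:- z, 1:]" by (simp add: is_unit_iff_degree)
    then have "is_unit w" using Factorial_Ring.irreducibleD[OF assms(2) w] by blast
    moreover have "lead_coeff w = 1" using assms(1) unfolding w by (simp only: lead_coeff_mult) simp
    ultimately have "p = [:- z, 1:]" using monic_unit[of w] w by simp
    then show ?thesis using y(2) by simp
  qed simp
  moreover have "x ^ q * x = x ^ (q + 1)" for x :: 'a by (simp only: power_add power_one_right)
  ultimately show ?thesis using z y(1) by metis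
qed

end

context cayley_transform
begin

lemma ratio_power:
  assumes p: "lead_coeff p = 1" "poly p z \<noteq> 0"
  shows "ratio (p ^ j) = real (card (herm_with_char (degree p * j) (icay p ^ j))) / real (card (U (degree p * j)))"
proof -
  have "p \<noteq> 0" using p(1) by auto
  then have "degree (p ^ j) = degree p * j" by (simp add: degree_power_eq mult.commute)
  moreover have "icay (p ^ j) = icay p ^ j" using \<open>p \<noteq> 0\<close> by (rule icay_power)
  moreover have "card {A \<in> U (degree p * j). char_poly A = p ^ j} = card (herm_with_char (degree p * j) (icay (p ^ j)))"
    by (rule card_unitary_char_poly) (use p in \<open>simp_all add: lead_coeff_power\<close>)
  ultimately show ?thesis by (simp only: ratio_def unitary_with_char_def)
qed

end

context finite_hermitian_field
begin

text \<open>\<open>icay f\<close> is real and irreducible, hence of odd degree, which turns the sign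
  \<open>(-1) ^ (d * Suc j)\<close> into \<open>(-1) ^ Suc j\<close>.\<close>

lemma ratio_power_self_dual:
  assumes f: "lead_coeff f = 1" "Factorial_Ring.irreducible f" "tilde q f = f"
  shows "ratio (f ^ Suc j) = ratio (f ^ j) * (real (q ^ degree f) ^ j / (real (q ^ degree f) ^ Suc j - (-1) ^ Suc j))"
proof -
  obtain z where z: "z ^ q * z = 1" "poly f z \<noteq> 0" using ex_norm_one_not_root[OF f(1,2)] by blast
  obtain c :: 'a where "c ^ q \<noteq> c" using ex_nonreal by blast
  then interpret cayley_transform q ty z c by unfold_locales (use z in auto)
  have c0: "coeff f 0 \<noteq> 0" using f by (intro tilde_self_nonzero) auto
  have irr: "Factorial_Ring.irreducible (icay f)" by (rule icay_irreducible[OF f(1,2) z(2)])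
  have "bar (icay f) = icay f" using bar_icay[OF f(1) c0 z(2)] f(3) by simp
  then have F: "prime_power_real (icay f)"
    using irr icay_degree(2)[OF z(2)] by (intro prime_power_real_irreducible)
  have odd: "odd (degree f)" using irreducible_real_odd[OF F irr] icay_degree(1)[OF z(2)] by simp
  show ?thesis
    unfolding ratio_power[OF f(1) z(2)] herm_ratio[OF F icay_degree(1)[OF z(2)]] power_mult
    using odd by simp
qed

text \<open>The transforms of \<open>g\<close> and of its dual are conjugate, and distinct because
  \<open>cay\<close> recovers both polynomials. Their product has even degree
  \<open>2 * degree g\<close>, so the sign is 1.\<close>

lemma ratio_power_pair:
  assumes g: "lead_coeff g = 1" "Factorial_Ring.irreducible g" "coeff g 0 \<noteq> 0" "tilde q g \<noteq> g" "lead_coeff (tilde q g) = 1"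
  shows "ratio ((g * tilde q g) ^ Suc j)
    = ratio ((g * tilde q g) ^ j) * (real (q ^ (2 * degree g)) ^ j / (real (q ^ (2 * degree g)) ^ Suc j - 1))"
proof -
  obtain z where z: "z ^ q * z = 1" "poly g z \<noteq> 0" using ex_norm_one_not_root[OF g(1,2)] by blast
  obtain c :: 'a where "c ^ q \<noteq> c" using ex_nonreal by blast
  then interpret cayley_transform q ty z c by unfold_locales (use z in auto)
  have zt: "poly (tilde q g) z \<noteq> 0" by (rule tilde_pole[OF g(3) z(2)])
  have nz: "g \<noteq> 0" "tilde q g \<noteq> 0" using z(2) zt by auto
  have zz: "poly (g * tilde q g) z \<noteq> 0" using z(2) zt by simp
  have l: "lead_coeff (g * tilde q g) = 1" using g(1,5) by (simp only: lead_coeff_mult) simp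
  have b: "bar (icay g) = icay (tilde q g)" by (rule bar_icay[OF g(1,3) z(2)])
  have e: "icay (g * tilde q g) = icay g * bar (icay g)" unfolding b by (rule icay_mult[OF nz])
  have "bar (icay g) \<noteq> icay g" unfolding b using cay_icay[OF z(2) g(1)] cay_icay[OF zt g(5)] g(4) by metis
  then have F: "prime_power_real (icay (g * tilde q g))"
    unfolding e using icay_degree(2)[OF z(2)] icay_irreducible[OF g(1,2) z(2)] by (intro prime_power_real_pair)
  have d: "degree (g * tilde q g) = 2 * degree g" using nz tilde_degree[OF g(3)] by (simp add: degree_mult_eq)
  show ?thesis
    unfolding ratio_power[OF l zz] herm_ratio[OF F icay_degree(1)[OF zz]] unfolding d power_mult[of _ "2 * _" "Suc j"]
    by (simp add: power_mult)
qed

end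

section \<open>Assembling the factors over all irreducible polynomials\<close>

theorem theorem18:
  fixes q n :: nat
    and \<phi> :: "'a::field poly"
    and I :: "'i set" and f :: "'i \<Rightarrow> 'a poly" and j :: "'i \<Rightarrow> nat"
    and I' :: "'k set" and g :: "'k \<Rightarrow> 'a poly" and j' :: "'k \<Rightarrow> nat"
  assumes q: "primepow q" "CARD('a) = q ^ 2"
    and \<phi>: "lead_coeff \<phi> = 1" "degree \<phi> = n" "coeff \<phi> 0 \<noteq> 0"
    and fin: "finite I" "finite I'"
    and factorization:
      "\<phi> = (\<Prod>i\<in>I. f i ^ j i) * (\<Prod>i\<in>I'. (g i * tilde q (g i)) ^ j' i)"
    and f: "\<And>i. i \<in> I \<Longrightarrow> lead_coeff (f i) = 1 \<and> Factorial_Ring.irreducible (f i)"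
    and g: "\<And>i. i \<in> I' \<Longrightarrow> lead_coeff (g i) = 1 \<and> Factorial_Ring.irreducible (g i)"
    and tilde_g: "\<And>i. i \<in> I' \<Longrightarrow> lead_coeff (tilde q (g i)) = 1 \<and> Factorial_Ring.irreducible (tilde q (g i))"
    and self_dual: "\<And>i. i \<in> I \<Longrightarrow> f i = tilde q (f i)"
    and not_self_dual: "\<And>i. i \<in> I' \<Longrightarrow> g i \<noteq> tilde q (g i)"
    and distinct:
      "inj_on f I" "inj_on g I'" "inj_on (\<lambda>i. tilde q (g i)) I'"
      "f ` I \<inter> g ` I' = {}"
      "f ` I \<inter> (\<lambda>i. tilde q (g i)) ` I' = {}"
      "g ` I' \<inter> (\<lambda>i. tilde q (g i)) ` I' = {}"
  shows "real (card {A \<in> (U_mats n q :: 'a mat set). char_poly A = \<phi>}) =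
    real (card (U_mats n q :: 'a mat set))
    * (\<Prod>i\<in>I. real (q ^ (degree (f i) * j i * (j i - 1)))
         / real (card (U_mats (j i) (q ^ degree (f i)) :: 'a alg_closure mat set)))
    * (\<Prod>i\<in>I'. real (q ^ (2 * degree (g i) * j' i * (j' i - 1)))
         / real (card (GL_mats (j' i) (q ^ (2 * degree (g i))) :: 'a alg_closure mat set)))"
proof -
  interpret hermitian_field q "TYPE('a)" by (rule hermitian_field_finite[OF q])
  interpret finite_hermitian_field q "TYPE('a)"
  proof unfold_locales
    have "CARD('a) \<noteq> 0" using q(2) q_gt_1 by simp
    then have "finite (UNIV :: 'a set)" by (metis card.infinite)
    from power_card_field[OF this] show "(GF (q\<^sup>2) :: 'a set) = UNIV" by (simp add: GF_def q(2))
  qed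
  \<comment> \<open>Division by zero makes \<open>tilde\<close> return 0 for a polynomial without
    constant term, whereas the dual of \<open>g i\<close> is monic.\<close>
  have g0: "coeff (g i) 0 \<noteq> 0" if "i \<in> I'" for i
  proof
    assume "coeff (g i) 0 = 0"
    then have "tilde q (g i) = 0" by (rule tilde_eq_0)
    then show False using tilde_g[OF that] by simp
  qed
  have df: "self_dual (f i)" if "i \<in> I" for i
    using f[OF that] self_dual[OF that] tilde_self_nonzero[of "f i"] by (auto simp: self_dual_def)
  have dg: "self_dual (g i * tilde q (g i))" if "i \<in> I'" for i
    using g[OF that] tilde_g[OF that] g0[OF that] tilde_tilde[of "g i"] coeff_0_tilde[of "g i"]
    by (auto simp: self_dual_def tilde_mult coeff_mult_0 lead_coeff_mult mult.commute)
  have ff: "comaximal (f i) (f k)" if "i \<in> I" "k \<in> I" "i \<noteq> k" for i k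
    using f[OF that(1)] f[OF that(2)] distinct(1) that by (intro irreducible_monic_comaximal) (auto dest: inj_onD)
  have fg: "comaximal (f i) (g k * tilde q (g k))" if "i \<in> I" "k \<in> I'" for i k
  proof -
    have "comaximal (g k) (f i)" "comaximal (tilde q (g k)) (f i)"
      using f[OF that(1)] g[OF that(2)] tilde_g[OF that(2)] distinct(4,5) that
      by (auto intro!: irreducible_monic_comaximal)
    then show ?thesis by (intro comaximal_sym[OF comaximal_mult])
  qed
  have gg: "comaximal (g i * tilde q (g i)) (g k * tilde q (g k))" if "i \<in> I'" "k \<in> I'" "i \<noteq> k" for i k
  proof -
    have "comaximal (g k) (g i)" "comaximal (tilde q (g k)) (g i)" "comaximal (g k) (tilde q (g i))"
      "comaximal (tilde q (g k)) (tilde q (g i))"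
      using g[OF that(1)] g[OF that(2)] tilde_g[OF that(1)] tilde_g[OF that(2)] distinct(2,3,6) that
      by (auto intro!: irreducible_monic_comaximal dest: inj_onD)
    then show ?thesis by (intro comaximal_mult comaximal_sym[OF comaximal_mult])
  qed
  \<comment> \<open>Both sides are 1 at \<open>k = 0\<close> and change by the same factor from
    \<open>k\<close> to \<open>Suc k\<close>. The group on the right lives over the extension of
    degree \<open>degree (f i)\<close> inside the algebraic closure.\<close>
  have rf: "ratio (f i ^ k) = real (q ^ (degree (f i) * k * (k - 1)))
         / real (card (U_mats k (q ^ degree (f i)) :: 'a alg_closure mat set))" if i: "i \<in> I" for i k
  proof -
    have d: "0 < degree (f i)" using f[OF i] irreducible_degree_pos by blast
    interpret E: hermitian_field "q ^ degree (f i)" "TYPE('a alg_closure)"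
      by (rule hermitian_field_alg_closure[OF q d])
    have "ratio (f i ^ k) = real ((q ^ degree (f i)) ^ (k * (k - 1))) / real (card (E.U k))"
    proof (induction k)
      case 0
      then show ?case by (simp add: ratio_1 E.card_dim_0)
    next
      case (Suc k)
      have "ratio (f i ^ Suc k) = ratio (f i ^ k) * (real (q ^ degree (f i)) ^ k / (real (q ^ degree (f i)) ^ Suc k - (-1) ^ Suc k))"
        using ratio_power_self_dual[of "f i" k] f[OF i] self_dual[OF i] by simp
      then show ?case unfolding E.quotient_U_Suc Suc by simp
    qed
    then show ?thesis by (simp only: E.U_mats_eq power_mult mult.assoc)
  qed
  have rg: "ratio ((g i * tilde q (g i)) ^ k) = real (q ^ (2 * degree (g i) * k * (k - 1)))
         / real (card (GL_mats k (q ^ (2 * degree (g i))) :: 'a alg_closure mat set))" if i: "i \<in> I'" for i k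
  proof -
    have d: "0 < degree (g i)" using g[OF i] irreducible_degree_pos by blast
    \<comment> \<open>Interpreted at \<open>q ^ degree (g i)\<close>, because its square is the
      field size \<open>q ^ (2 * degree (g i))\<close> of the general linear group.\<close>
    interpret E: hermitian_field "q ^ degree (g i)" "TYPE('a alg_closure)"
      by (rule hermitian_field_alg_closure[OF q d])
    have Q: "q ^ (2 * degree (g i)) = (q ^ degree (g i))\<^sup>2" by (simp add: mult.commute flip: power_mult)
    have "ratio ((g i * tilde q (g i)) ^ k) = real (((q ^ degree (g i))\<^sup>2) ^ (k * (k - 1))) / real (card (E.GL k))"
    proof (induction k)
      case 0
      then show ?case by (simp add: ratio_1 E.card_dim_0)
    next
      case (Suc k)
      have "ratio ((g i * tilde q (g i)) ^ Suc k)
        = ratio ((g i * tilde q (g i)) ^ k) * (real ((q ^ degree (g i))\<^sup>2) ^ k / (real ((q ^ degree (g i))\<^sup>2) ^ Suc k - 1))"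
        using ratio_power_pair[of "g i" k] g[OF i] g0[OF i] tilde_g[OF i] not_self_dual[OF i] unfolding Q by simp
      then show ?case unfolding E.quotient_GL_Suc Suc .
    qed
    moreover have "q ^ (2 * degree (g i) * k * (k - 1)) = ((q ^ degree (g i))\<^sup>2) ^ (k * (k - 1))"
      unfolding Q[symmetric] by (simp only: mult.assoc flip: power_mult)
    ultimately show ?thesis unfolding Q E.GL_mats_eq by simp
  qed
  have "ratio \<phi> = ratio (\<Prod>i\<in>I. f i ^ j i) * ratio (\<Prod>i\<in>I'. (g i * tilde q (g i)) ^ j' i)"
    unfolding factorization
  proof (rule ratio_mult)
    show "self_dual (\<Prod>i\<in>I. f i ^ j i)" by (intro self_dual_prod self_dual_power df)
    show "self_dual (\<Prod>i\<in>I'. (g i * tilde q (g i)) ^ j' i)" by (intro self_dual_prod self_dual_power dg)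
    show "comaximal (\<Prod>i\<in>I. f i ^ j i) (\<Prod>i\<in>I'. (g i * tilde q (g i)) ^ j' i)"
      by (intro comaximal_prod comaximal_sym[OF comaximal_prod] comaximal_power2 comaximal_sym[OF fg])
  qed
  also have "ratio (\<Prod>i\<in>I. f i ^ j i) = (\<Prod>i\<in>I. ratio (f i ^ j i))"
    by (intro ratio_prod fin self_dual_power df comaximal_power2 ff)
  also have "ratio (\<Prod>i\<in>I'. (g i * tilde q (g i)) ^ j' i) = (\<Prod>i\<in>I'. ratio ((g i * tilde q (g i)) ^ j' i))"
    by (intro ratio_prod fin self_dual_power dg comaximal_power2 gg)
  finally have "ratio \<phi> = (\<Prod>i\<in>I. real (q ^ (degree (f i) * j i * (j i - 1)))
         / real (card (U_mats (j i) (q ^ degree (f i)) :: 'a alg_closure mat set)))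
    * (\<Prod>i\<in>I'. real (q ^ (2 * degree (g i) * j' i * (j' i - 1)))
         / real (card (GL_mats (j' i) (q ^ (2 * degree (g i))) :: 'a alg_closure mat set)))"
    by (simp add: rf rg)
  moreover have "real (card {A \<in> U_mats n q. char_poly A = \<phi>}) = real (card (U_mats n q :: 'a mat set)) * ratio \<phi>"
    unfolding ratio_def \<phi>(2) U_mats_eq unitary_with_char_def by simp
  ultimately show ?thesis by (simp only: mult.assoc)
qed
end
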